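(* Let $1\le r<\min\{m,n\}$ and $G,\widetilde G=G+E\in\mathbb{C}^{m\times n}$. Let $U=[U_1,U_2]\in\mathbb{C}^{m\times m}$ and $V=[V_1,V_2]\in\mathbb{C}^{n\times n}$ be unitary, with $U_1\in\mathbb{C}^{m\times r}$, $V_1\in\mathbb{C}^{n\times r}$, such that $$U^{H}GV=\begin{bmatrix} G_1 & 0 \\ 0 & G_2 \end{bmatrix},\qquad U^{H}\widetilde GV=\begin{bmatrix} G_1+E_{11} & E_{12} \\ E_{21} & G_2+E_{22} \end{bmatrix},$$ where $G_1,E_{11}\in\mathbb{C}^{r\times r}$, $E_{12}\in\mathbb{C}^{r\times(n-r)}$, $E_{21}\in\mathbb{C}^{(m-r)\times r}$, $G_2,E_{22}\in\mathbb{C}^{(m-r)\times(n-r)}$. Let $$\delta=\min_{\mu\in\mathrm{sv}(G_1),\,\nu\in\mathrm{sv}_{\mathrm{ext}}(G_2)}|\mu-\nu|,\quad \underline\delta=\delta-\|E_{11}\|_2-\|E_{22}\|_2,\quad \varepsilon=\max\{\|E_{12}\|_2,\|E_{21}\|_2\}.$$ Let $\|\cdot\|_{\mathrm{ui}}$ be a unitarily invariant norm, and let $\|(\cdot,\cdot)\|$ be one of the following two norms on $\mathbb{C}^{(m-r)\times r}\times\mathbb{C}^{(n-r)\times r}$, with the corresponding constant $c$: (N1) $\|(X,Y)\|=\left\|\begin{bmatrix} X & 0 \\ 0 & Y \end{bmatrix}\right\|_{\mathrm{ui}}$, with $c=1$ if $\sigma_{\min}(G_1)>\sigma_{\max}(G_2)$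 or $\|\cdot\|_{\mathrm{ui}}=\|\cdot\|_{F}$, and $c=\pi/2$ otherwise; (N2) $\|(X,Y)\|=\max\{\|X\|_{\mathrm{ui}},\|Y\|_{\mathrm{ui}}\}$, with $c=1$ if $\sigma_{\min}(G_1)>\sigma_{\max}(G_2)$, and $c=\pi$ otherwise. Suppose $$\underline\delta>0\quad\text{and}\quad \kappa_2:=\frac{c^2\varepsilon}{\underline\delta^2}\,\|(E_{21},E_{12}^{H})\|<\frac14 .$$ Then: (a) There exists $(\Gamma,\Omega)\in\mathbb{C}^{(m-r)\times r}\times\mathbb{C}^{(n-r)\times r}$ solving $$\Gamma(G_1+E_{11})-(G_2+E_{22})\Omega=E_{21}-\Gamma E_{12}\Omega,\qquad \Omega(G_1+E_{11})^{H}-(G_2+E_{22})^{H}\Gamma=E_{12}^{H}-\Omega E_{21}^{H}\Gamma,$$ and satisfying $$\|(\Gamma,\Omega)\|\le\frac{1+\sqrt{1-4\kappa_2}}{1-2\kappa_2+\sqrt{1-4\kappa_2}}\,\frac{c\,\|(E_{21},E_{12}^{H})\|}{\underline\delta}<2\,\frac{c\,\|(E_{21},E_{12}^{H})\|}{\underline\delta}.$$ Moreover, with this $(\Gamma,\Omega)$ and with the unitary matrices $$\check U=[\check U_1,\check U_2]=[U_1,U_2]\begin{bmatrix} I_r & -\Gamma^{H} \\ \Gamma & I_{m-r} \end{bmatrix}\begin{bmatrix} (I+\Gamma^{H}\Gamma)^{-1/2} & 0 \\ 0 & (I+\Gamma\Gamma^{H})^{-1/2} \end{bmatrix},$$ $$\check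 V=[\check V_1,\check V_2]=[V_1,V_2]\begin{bmatrix} I_r & -\Omega^{H} \\ \Omega & I_{n-r} \end{bmatrix}\begin{bmatrix} (I+\Omega^{H}\Omega)^{-1/2} & 0 \\ 0 & (I+\Omega\Omega^{H})^{-1/2} \end{bmatrix}$$ ($\check U_1\in\mathbb{C}^{m\times r}$, $\check V_1\in\mathbb{C}^{n\times r}$): (b) $\check U^{H}\widetilde G\check V=\begin{bmatrix} \check G_1 & 0 \\ 0 & \check G_2 \end{bmatrix}$, and the singular values of $\widetilde G$ form the multiset union of those of $$\check G_1=\check U_1^{H}\widetilde G\check V_1=(I+\Gamma^{H}\Gamma)^{1/2}(G_1+E_{11}+E_{12}\Omega)(I+\Omega^{H}\Omega)^{-1/2}=(I+\Gamma^{H}\Gamma)^{-1/2}(G_1+E_{11}+\Gamma^{H}E_{21})(I+\Omega^{H}\Omega)^{1/2}$$ and $$\check G_2=\check U_2^{H}\widetilde G\check V_2=(I+\Gamma\Gamma^{H})^{1/2}(G_2+E_{22}-E_{21}\Omega^{H})(I+\Omega\Omega^{H})^{-1/2}=(I+\Gamma\Gamma^{H})^{-1/2}(G_2+E_{22}-\Gamma E_{12})(I+\Omega\Omega^{H})^{1/2}.$$ (c) $$\sigma_{\min}(\check G_1)\ge\sigma_{\min}(G_1)-\|E_{11}\|_2-2c\,\frac{\varepsilon\,\|(E_{21},E_{12}^{H})\|}{\underline\delta},\qquad \sigma_{\max}(\check G_2)\le\sigma_{\max}(G_2)+\|E_{22}\|_2+2c\,\frac{\varepsilon\,\|(E_{21},E_{12}^{H})\|}{\underline\delta}.$$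 (d) The left and right singular subspaces of $\widetilde G$ associated with the part $\mathrm{sv}(\check G_1)$ of its singular values are spanned by the columns of $$\check U_1=(U_1+U_2\Gamma)(I+\Gamma^{H}\Gamma)^{-1/2},\qquad \check V_1=(V_1+V_2\Omega)(I+\Omega^{H}\Omega)^{-1/2},$$ respectively, and in particular $$\|\check U_1-U_1\|_{\mathrm{ui}}\le\|\Gamma\|_{\mathrm{ui}}\le\|(\Gamma,\Omega)\|\le 2\,\frac{c\,\|(E_{21},E_{12}^{H})\|}{\underline\delta},\qquad \|\check V_1-V_1\|_{\mathrm{ui}}\le\|\Omega\|_{\mathrm{ui}}\le\|(\Gamma,\Omega)\|\le 2\,\frac{c\,\|(E_{21},E_{12}^{H})\|}{\underline\delta}.$$
   Context: $X^H$ is the conjugate transpose; $\|\cdot\|_2$ and $\|\cdot\|_F$ are the spectral and Frobenius norms. A matrix $B\in\mathbb{C}^{p\times q}$ has $\min\{p,q\}$ singular values $\sigma_1(B)\ge\dots\ge\sigma_{\min\{p,q\}}(B)$; $\sigma_{\max}(B)=\sigma_1(B)$, $\sigma_{\min}(B)=\sigma_{\min\{p,q\}}(B)$; $\mathrm{sv}(B)$ is the multiset of these singular values and $\mathrm{sv}_{\mathrm{ext}}(B)$ is $\mathrm{sv}(B)$ together with $|p-q|$ additional copies of $0$. A unitarily invariant norm $\|\cdot\|_{\mathrm{ui}}$ is a norm defined on complex matrices of all sizes such that $\|P^HBQ\|_{\mathrm{ui}}=\|B\|_{\mathrm{ui}}$ for all unitary $P,Q$ of fitting sizes, $\|B\|_{\mathrm{ui}}=\|B\|_2$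 whenever $\mathrm{rank}(B)=1$, and appending zero rows or columns to $B$ does not change $\|B\|_{\mathrm{ui}}$. Such norms satisfy $\|XYZ\|_{\mathrm{ui}}\le\|X\|_2\|Y\|_{\mathrm{ui}}\|Z\|_2$. That the column spaces of $\check U_1$ and $\check V_1$ are left and right singular subspaces of $\widetilde G$ associated with $\mathrm{sv}(\check G_1)$ means $\widetilde G\check V_1=\check U_1\check G_1$ and $\widetilde G^H\check U_1=\check V_1\check G_1^H$, where $\check U_1,\check V_1$ have orthonormal columns.
   Formalization: The strict inequality "< 2c‖(E21,E12^H)‖/δ" in (a) is claimed only when E12 or E21 is nonzero; if both vanish it would read 0 < 0, which is false. All other bounds hold without this condition. *)

theory Defs
  imports
    "HOL-Library.Multiset"
    "HOL-Analysis.L2_Norm"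
    "HOL-Computational_Algebra.Fundamental_Theorem_Algebra"
    "Jordan_Normal_Form.Schur_Decomposition"
    "Jordan_Normal_Form.Gauss_Jordan_Elimination"
    "Jordan_Normal_Form.DL_Rank"
begin

abbreviation conj_transpose :: "complex mat \<Rightarrow> complex mat" ("_\<^sup>H" [1000] 999)
  where "A\<^sup>H \<equiv> mat_adjoint A"

definition unitary_mat :: "nat \<Rightarrow> complex mat \<Rightarrow> bool" where
  "unitary_mat n P \<longleftrightarrow> P \<in> carrier_mat n n \<and> P\<^sup>H * P = 1\<^sub>m n \<and> P * P\<^sup>H = 1\<^sub>m n"

text \<open>For a matrix \<open>A = [A1, A2]\<close> where \<open>A1\<close> has \<open>r\<close> columns, these are \<open>A1\<close> and \<open>A2\<close>.\<close>

definition left_cols :: "nat \<Rightarrow> complex mat \<Rightarrow> complex mat" where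
  "left_cols r A = mat_of_cols (dim_row A) (take r (cols A))"

definition right_cols :: "nat \<Rightarrow> complex mat \<Rightarrow> complex mat" where
  "right_cols r A = mat_of_cols (dim_row A) (drop r (cols A))"

text \<open>The singular values of \<open>B\<close> are the square roots of the eigenvalues of the smaller of the two
  Gram matrices of \<open>B\<close>, counted with multiplicity. That matrix has order
  \<open>min (dim_row B) (dim_col B)\<close> and real nonnegative eigenvalues.\<close>

definition sing_vals :: "complex mat \<Rightarrow> real multiset" where
  "sing_vals B = image_mset (\<lambda>z. sqrt (Re z))
     (proots (char_poly (if dim_row B \<le> dim_col B then B * B\<^sup>H else B\<^sup>H * B)))"

definition sing_vals_ext :: "complex mat \<Rightarrow> real multiset" where
  "sing_vals_ext B = sing_vals B +
     replicate_mset (max (dim_row B) (dim_col B) - min (dim_row B) (dim_col B)) 0"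

text \<open>The \<open>j\<close>-th largest singular value, where \<open>j\<close> counts from 1.\<close>

definition sing_val :: "complex mat \<Rightarrow> nat \<Rightarrow> real" where
  "sing_val B j = rev (sorted_list_of_multiset (sing_vals B)) ! (j - 1)"

definition sing_val_max :: "complex mat \<Rightarrow> real" where
  "sing_val_max B = sing_val B 1"

definition sing_val_min :: "complex mat \<Rightarrow> real" where
  "sing_val_min B = sing_val B (min (dim_row B) (dim_col B))"

lemma size_sing_vals: "size (sing_vals B) = min (dim_row B) (dim_col B)"
proof (cases "dim_row B \<le> dim_col B")
  case True
  have "B * B\<^sup>H \<in> carrier_mat (dim_row B) (dim_row B)"
    by (auto simp: mat_adjoint_def)
  from degree_monic_char_poly[OF this] True show ?thesis
    by (simp add: sing_vals_def size_proots_complex)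
next
  case False
  have "B\<^sup>H * B \<in> carrier_mat (dim_col B) (dim_col B)"
    by (auto simp: mat_adjoint_def)
  from degree_monic_char_poly[OF this] False show ?thesis
    by (simp add: sing_vals_def size_proots_complex)
qed

definition vec_norm2 :: "complex vec \<Rightarrow> real" where
  "vec_norm2 x = L2_set (\<lambda>i. cmod (x $ i)) {..<dim_vec x}"

definition spectral_norm :: "complex mat \<Rightarrow> real" where
  "spectral_norm B = Sup {vec_norm2 (B *\<^sub>v x) | x. x \<in> carrier_vec (dim_col B) \<and> vec_norm2 x \<le> 1}"

definition frobenius_norm :: "complex mat \<Rightarrow> real" where
  "frobenius_norm B = L2_set (\<lambda>ij. cmod (B $$ ij)) ({..<dim_row B} \<times> {..<dim_col B})"

text \<open>In the last clause \<open>k\<close> zero rows and \<open>l\<close> zero columns are appended.\<close>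

definition unitarily_invariant_norm :: "(complex mat \<Rightarrow> real) \<Rightarrow> bool" where
  "unitarily_invariant_norm N \<longleftrightarrow>
     (\<forall>p q. \<forall>A \<in> carrier_mat p q. 0 \<le> N A \<and> (N A = 0 \<longleftrightarrow> A = 0\<^sub>m p q)) \<and>
     (\<forall>A a. N (a \<cdot>\<^sub>m A) = cmod a * N A) \<and>
     (\<forall>p q. \<forall>A \<in> carrier_mat p q. \<forall>B \<in> carrier_mat p q. N (A + B) \<le> N A + N B) \<and>
     (\<forall>p q. \<forall>B \<in> carrier_mat p q. \<forall>P Q. unitary_mat p P \<longrightarrow> unitary_mat q Q \<longrightarrow>
        N (P\<^sup>H * B * Q) = N B) \<and>
     (\<forall>B. vec_space.rank (dim_row B) B = 1 \<longrightarrow> N B = spectral_norm B) \<and>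
     (\<forall>p q k l. \<forall>B \<in> carrier_mat p q.
        N (four_block_mat B (0\<^sub>m p l) (0\<^sub>m k q) (0\<^sub>m k l)) = N B)"

definition psd_mat :: "nat \<Rightarrow> complex mat \<Rightarrow> bool" where
  "psd_mat n A \<longleftrightarrow> A \<in> carrier_mat n n \<and> A\<^sup>H = A \<and>
     (\<forall>x \<in> carrier_vec n. 0 \<le> Re ((A *\<^sub>v x) \<bullet>c x))"

text \<open>The powers \<open>1/2\<close> and \<open>-1/2\<close>, for a Hermitian positive definite matrix \<open>A\<close>; they are
  only meaningful for such \<open>A\<close>.\<close>

definition mat_sqrt :: "complex mat \<Rightarrow> complex mat" where
  "mat_sqrt A = (THE S. psd_mat (dim_row A) S \<and> S * S = A)"

definition mat_inv_sqrt :: "complex mat \<Rightarrow> complex mat" where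
  "mat_inv_sqrt A = the (mat_inverse (mat_sqrt A))"

text \<open>The orthonormal columns of \<open>P\<close> and \<open>Q\<close> span left and right singular subspaces of \<open>A\<close>
  associated with \<open>sing_vals B\<close>, where \<open>B\<close> has order \<open>r\<close>.\<close>

definition singular_subspaces ::
    "nat \<Rightarrow> complex mat \<Rightarrow> complex mat \<Rightarrow> complex mat \<Rightarrow> complex mat \<Rightarrow> bool" where
  "singular_subspaces r A B P Q \<longleftrightarrow>
     B \<in> carrier_mat r r \<and> P \<in> carrier_mat (dim_row A) r \<and> Q \<in> carrier_mat (dim_col A) r \<and>
     P\<^sup>H * P = 1\<^sub>m r \<and> Q\<^sup>H * Q = 1\<^sub>m r \<and>
     A * Q = P * B \<and> A\<^sup>H * P = Q * B\<^sup>H"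

end

theory Submission
  imports Defs
begin

text \<open>The linear part of the pair of equations for \<open>(\<Gamma>, \<Omega>)\<close> is a Sylvester equation \<open>Z * A - B * Z = W\<close> whose
  coefficients \<open>A\<close> and \<open>B\<close> are the Hermitian dilations \<open>[[0, X], [X\<^sup>H, 0]]\<close> of the perturbed diagonal blocks. By
  Weyl's inequality their spectra are at distance at least \<open>\<delta>'\<close>. In eigenbases the solution multiplies the
  entries of the right-hand side by \<open>1 / (a j - b i)\<close>, and such a Schur multiplier is bounded by
  \<open>pi / (2 * \<delta>')\<close> in every unitarily invariant norm, because \<open>1 / s\<close> agrees for \<open>\<bar>s\<bar> \<ge> 1\<close>, up to a small error
  on bounded sets, with a combination of functions \<open>sin (\<theta> * s)\<close> with absolute coefficient sum at most
  \<open>pi / 2\<close> (Sz.-Nagy). For the Frobenius norm and for separated singular values direct estimates give the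
  constant 1. The full quadratic equation is then solved by a contracting fixed point iteration, and its
  solution block diagonalizes the matrix.\<close>

subsection \<open>Matrix algebra with side conditions on dimensions\<close>

text \<open>Coupling is the reason for the dilation: the linear parts mix \<open>\<Gamma>\<close>
  with \<open>\<Omega>\<close> and \<open>A1\<close>, \<open>A2\<close> with their adjoints, and
  only the combined coefficients are Hermitian, so that solving becomes entrywise division in two
  unitary bases. The price is a spectrum with both signs and with the zeros that a rectangular block
  forces, hence \<open>sing_vals_ext\<close> in the gap. Without separation the function
  \<open>1 / s\<close> is needed on both sides of the origin, and \<open>pi / 2\<close> is the
  constant of Sz.-Nagy's extremal problem for it. Integrals are avoided by rounding the scaled
  eigenvalues to a grid, on which the representation is a finite trigonometric sum with one large
  period, and then refining the grid. For the maximum norm the constant doubles, since a block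
  diagonal matrix is bounded only by the sum of the norms of its blocks. The iteration is governed
  by \<open>\<epsilon> * x\<^sup>2 - \<tau> * x + g = 0\<close> with
  \<open>\<tau> = \<delta>' / c\<close> and \<open>g\<close> the norm of the right-hand side:
  \<open>\<kappa> < 1 / 4\<close> makes the discriminant positive, and the smaller root is the
  radius of an invariant ball.\<close>

lemma assoc_mm: "dim_col A = dim_row B \<Longrightarrow> dim_col B = dim_row C \<Longrightarrow> A * B * C = A * (B * C)"
  for A B C :: "complex mat"
  by (rule assoc_mult_mat[of _ "dim_row A" "dim_col A" _ "dim_col B" _ "dim_col C"]) auto

lemma assoc_mv: "dim_col A = dim_row B \<Longrightarrow> dim_col B = dim_vec x \<Longrightarrow> A * B *\<^sub>v x = A *\<^sub>v (B *\<^sub>v x)"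
  for A B :: "complex mat"
  by (rule assoc_mult_mat_vec[of _ "dim_row A" "dim_col A" _ "dim_col B"]) auto

lemma add_mm: "dim_row A = dim_row B \<Longrightarrow> dim_col A = dim_col B \<Longrightarrow> dim_col A = dim_row C \<Longrightarrow>
    (A + B) * C = A * C + B * C"
  for A B C :: "complex mat"
  by (rule add_mult_distrib_mat[of _ "dim_row A" "dim_col A" _ _ "dim_col C"]) auto

lemma mm_add: "dim_row B = dim_row C \<Longrightarrow> dim_col B = dim_col C \<Longrightarrow> dim_col A = dim_row B \<Longrightarrow>
    A * (B + C) = A * B + A * C"
  for A B C :: "complex mat"
  by (rule mult_add_distrib_mat[of _ "dim_row A" "dim_col A" _ "dim_col B" ]) auto

lemma minus_mm: "dim_row A = dim_row B \<Longrightarrow> dim_col A = dim_col B \<Longrightarrow> dim_col A = dim_row C \<Longrightarrow>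
    (A - B) * C = A * C - B * C"
  for A B C :: "complex mat"
  by (rule minus_mult_distrib_mat[of _ "dim_row A" "dim_col A" _ _ "dim_col C"]) auto

lemma mm_minus: "dim_row B = dim_row C \<Longrightarrow> dim_col B = dim_col C \<Longrightarrow> dim_col A = dim_row B \<Longrightarrow>
    A * (B - C) = A * B - A * C"
  for A B C :: "complex mat"
  by (rule mult_minus_distrib_mat[of _ "dim_row A" "dim_col A" _ "dim_col B" ]) auto

lemma add_zero_m: "dim_row A = m \<Longrightarrow> dim_col A = n \<Longrightarrow> A + 0\<^sub>m m n = A"
  and zero_add_m: "dim_row A = m \<Longrightarrow> dim_col A = n \<Longrightarrow> 0\<^sub>m m n + A = A"
  for A :: "complex mat"
  by (auto intro!: eq_matI)

lemma four_block_mm: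
  fixes A1 :: "complex mat"
  assumes "dim_row B1 = dim_row A1" "dim_col C1 = dim_col A1" "dim_row C1 = dim_row D1" "dim_col B1 = dim_col D1"
    "dim_row B2 = dim_row A2" "dim_col C2 = dim_col A2" "dim_row C2 = dim_row D2" "dim_col B2 = dim_col D2"
    "dim_row A2 = dim_col A1" "dim_row D2 = dim_col D1"
  shows "four_block_mat A1 B1 C1 D1 * four_block_mat A2 B2 C2 D2 =
    four_block_mat (A1 * A2 + B1 * C2) (A1 * B2 + B1 * D2) (C1 * A2 + D1 * C2) (C1 * B2 + D1 * D2)"
proof -
  have c: "A1 \<in> carrier_mat (dim_row A1) (dim_col A1)" "B1 \<in> carrier_mat (dim_row A1) (dim_col D1)"
    "C1 \<in> carrier_mat (dim_row D1) (dim_col A1)" "D1 \<in> carrier_mat (dim_row D1) (dim_col D1)"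
    "A2 \<in> carrier_mat (dim_col A1) (dim_col A2)" "B2 \<in> carrier_mat (dim_col A1) (dim_col D2)"
    "C2 \<in> carrier_mat (dim_col D1) (dim_col A2)" "D2 \<in> carrier_mat (dim_col D1) (dim_col D2)"
    using assms by (auto intro!: carrier_matI)
  show ?thesis by (rule mult_four_block_mat[OF c])
qed

lemma four_block_add:
  fixes A1 :: "complex mat"
  assumes "dim_row A1 = dim_row A2" "dim_col A1 = dim_col A2" "dim_row D1 = dim_row D2" "dim_col D1 = dim_col D2"
    "dim_row B1 = dim_row A1" "dim_col C1 = dim_col A1" "dim_row C1 = dim_row D1" "dim_col B1 = dim_col D1"
    "dim_row B2 = dim_row A2" "dim_col C2 = dim_col A2" "dim_row C2 = dim_row D2" "dim_col B2 = dim_col D2"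
  shows "four_block_mat A1 B1 C1 D1 + four_block_mat A2 B2 C2 D2 =
    four_block_mat (A1 + A2) (B1 + B2) (C1 + C2) (D1 + D2)"
  by (rule add_four_block_mat[of _ "dim_row A1" "dim_col A1" _ "dim_col D1" _ "dim_row D1"])
    (use assms in \<open>auto intro!: carrier_matI\<close>)

lemma four_block_uminus_carrier:
  fixes A B C D :: "complex mat"
  assumes "A \<in> carrier_mat p k" "B \<in> carrier_mat p l" "C \<in> carrier_mat q k" "D \<in> carrier_mat q l"
  shows "- four_block_mat A B C D = four_block_mat (- A) (- B) (- C) (- D)"
  by (rule eq_matI) (use assms in auto)

lemma four_block_uminus:
  fixes A :: "complex mat"
  assumes "dim_row B = dim_row A" "dim_col C = dim_col A" "dim_row C = dim_row D" "dim_col B = dim_col D"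
  shows "- four_block_mat A B C D = four_block_mat (- A) (- B) (- C) (- D)"
proof -
  have c: "A \<in> carrier_mat (dim_row A) (dim_col A)" "B \<in> carrier_mat (dim_row A) (dim_col D)" "C \<in> carrier_mat (dim_row D) (dim_col A)" "D \<in> carrier_mat (dim_row D) (dim_col D)"
    using assms by (auto intro!: carrier_matI)
  show ?thesis by (rule four_block_uminus_carrier[OF c])
qed

lemma four_block_minus_carrier:
  fixes A1 B1 C1 D1 :: "complex mat"
  assumes "A1 \<in> carrier_mat p k" "B1 \<in> carrier_mat p l" "C1 \<in> carrier_mat q k" "D1 \<in> carrier_mat q l"
    "A2 \<in> carrier_mat p k" "B2 \<in> carrier_mat p l" "C2 \<in> carrier_mat q k" "D2 \<in> carrier_mat q l"
  shows "four_block_mat A1 B1 C1 D1 - four_block_mat A2 B2 C2 D2 =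
    four_block_mat (A1 - A2) (B1 - B2) (C1 - C2) (D1 - D2)"
  by (rule eq_matI) (use assms in auto)

lemma four_block_minus:
  fixes A1 :: "complex mat"
  assumes "dim_row A1 = dim_row A2" "dim_col A1 = dim_col A2" "dim_row D1 = dim_row D2" "dim_col D1 = dim_col D2"
    "dim_row B1 = dim_row A1" "dim_col C1 = dim_col A1" "dim_row C1 = dim_row D1" "dim_col B1 = dim_col D1"
    "dim_row B2 = dim_row A2" "dim_col C2 = dim_col A2" "dim_row C2 = dim_row D2" "dim_col B2 = dim_col D2"
  shows "four_block_mat A1 B1 C1 D1 - four_block_mat A2 B2 C2 D2 =
    four_block_mat (A1 - A2) (B1 - B2) (C1 - C2) (D1 - D2)"
proof -
  have c: "A1 \<in> carrier_mat (dim_row A1) (dim_col A1)" "B1 \<in> carrier_mat (dim_row A1) (dim_col D1)" "C1 \<in> carrier_mat (dim_row D1) (dim_col A1)" "D1 \<in> carrier_mat (dim_row D1) (dim_col D1)"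
    "A2 \<in> carrier_mat (dim_row A1) (dim_col A1)" "B2 \<in> carrier_mat (dim_row A1) (dim_col D1)" "C2 \<in> carrier_mat (dim_row D1) (dim_col A1)" "D2 \<in> carrier_mat (dim_row D1) (dim_col D1)"
    using assms by (auto intro!: carrier_matI)
  show ?thesis by (rule four_block_minus_carrier[OF c])
qed

lemma four_block_inject_carrier:
  fixes A :: "complex mat"
  assumes c: "A \<in> carrier_mat p k" "B \<in> carrier_mat p l" "C \<in> carrier_mat q k" "D \<in> carrier_mat q l"
    "A' \<in> carrier_mat p k" "B' \<in> carrier_mat p l" "C' \<in> carrier_mat q k" "D' \<in> carrier_mat q l"
  shows "four_block_mat A B C D = four_block_mat A' B' C' D' \<longleftrightarrow> A = A' \<and> B = B' \<and> C = C' \<and> D = D'"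
    (is "?L = ?R \<longleftrightarrow> ?S")
proof
  assume e: "?L = ?R"
  have *: "?L $$ (i, j) = ?R $$ (i, j)" for i j by (simp add: e)
  have "A $$ (i, j) = A' $$ (i, j)" if "i < p" "j < k" for i j
    using *[of i j] that c by auto
  moreover have "B $$ (i, j) = B' $$ (i, j)" if "i < p" "j < l" for i j
    using *[of i "j + k"] that c by auto
  moreover have "C $$ (i, j) = C' $$ (i, j)" if "i < q" "j < k" for i j
    using *[of "i + p" j] that c by auto
  moreover have "D $$ (i, j) = D' $$ (i, j)" if "i < q" "j < l" for i j
    using *[of "i + p" "j + k"] that c by auto
  ultimately show ?S using c by (auto intro!: eq_matI)
qed simp

lemma four_block_exhaust:
  fixes A :: "complex mat"
  assumes "A \<in> carrier_mat (p + q) (k + l)"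
  obtains A1 A2 A3 A4 where "A = four_block_mat A1 A2 A3 A4"
    "A1 \<in> carrier_mat p k" "A2 \<in> carrier_mat p l" "A3 \<in> carrier_mat q k" "A4 \<in> carrier_mat q l"
proof -
  obtain A1 A2 A3 A4 where s: "split_block A p k = (A1, A2, A3, A4)"
    by (cases "split_block A p k") auto
  show thesis
    by (rule that[of A1 A2 A3 A4]) (use split_block[OF s, of q l] assms in auto)
qed

subsection \<open>The conjugate transpose\<close>

lemma dim_adjoint [simp]: "dim_row (A\<^sup>H) = dim_col A" "dim_col (A\<^sup>H) = dim_row A"
  by (auto simp: mat_adjoint_def)

lemma adjoint_index [simp]: "i < dim_col A \<Longrightarrow> j < dim_row A \<Longrightarrow> A\<^sup>H $$ (i, j) = cnj (A $$ (j, i))"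
  by (auto simp: mat_adjoint_def mat_of_rows_def)

lemma adjoint_carrier [simp]: "A\<^sup>H \<in> carrier_mat m n \<longleftrightarrow> A \<in> carrier_mat n m"
  unfolding carrier_mat_def by auto

lemma adjoint_adjoint [simp]: "(A\<^sup>H)\<^sup>H = A"
  by (rule eq_matI) auto

lemma adjoint_mm: "dim_col A = dim_row B \<Longrightarrow> (A * B)\<^sup>H = B\<^sup>H * A\<^sup>H"
  by (rule eq_matI) (auto simp: scalar_prod_def intro!: sum.cong)

lemma adjoint_add: "dim_row A = dim_row B \<Longrightarrow> dim_col A = dim_col B \<Longrightarrow> (A + B)\<^sup>H = A\<^sup>H + B\<^sup>H"
  by (rule eq_matI) auto

lemma adjoint_minus: "dim_row A = dim_row B \<Longrightarrow> dim_col A = dim_col B \<Longrightarrow> (A - B)\<^sup>H = A\<^sup>H - B\<^sup>H"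
  by (rule eq_matI) auto

lemma adjoint_uminus [simp]: "(- A)\<^sup>H = - (A\<^sup>H)"
  by (rule eq_matI) auto

lemma adjoint_one [simp]: "(1\<^sub>m n)\<^sup>H = 1\<^sub>m n"
  by (rule eq_matI) auto

lemma adjoint_zero [simp]: "(0\<^sub>m m n)\<^sup>H = 0\<^sub>m n m"
  by (rule eq_matI) auto

lemma adjoint_four_block_carrier:
  fixes A B C D :: "complex mat"
  assumes "A \<in> carrier_mat p k" "B \<in> carrier_mat p l" "C \<in> carrier_mat q k" "D \<in> carrier_mat q l"
  shows "(four_block_mat A B C D)\<^sup>H = four_block_mat (A\<^sup>H) (C\<^sup>H) (B\<^sup>H) (D\<^sup>H)"
  by (rule eq_matI) (use assms in auto)

lemma adjoint_four_block:
  assumes "dim_row B = dim_row A" "dim_col C = dim_col A" "dim_row C = dim_row D" "dim_col B = dim_col D"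
  shows "(four_block_mat A B C D)\<^sup>H = four_block_mat (A\<^sup>H) (C\<^sup>H) (B\<^sup>H) (D\<^sup>H)"
proof -
  have c: "A \<in> carrier_mat (dim_row A) (dim_col A)" "B \<in> carrier_mat (dim_row A) (dim_col D)" "C \<in> carrier_mat (dim_row D) (dim_col A)" "D \<in> carrier_mat (dim_row D) (dim_col D)"
    using assms by (auto intro!: carrier_matI)
  show ?thesis by (rule adjoint_four_block_carrier[OF c])
qed

text \<open>Premises on dimensions instead of \<open>carrier_mat\<close> facts make these usable as
  simplification rules: every variable occurs on the left-hand side, so the side conditions reduce
  to known dimensions.\<close>

lemmas mat_dist = add_mm mm_add minus_mm mm_minus assoc_mm
  add_zero_m zero_add_m adjoint_mm adjoint_add adjoint_minus

lemmas block_simps = four_block_mm four_block_add four_block_minus four_block_uminus adjoint_four_block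

section \<open>Diagonal matrices given by a function of the index\<close>

definition diag_of :: "nat \<Rightarrow> (nat \<Rightarrow> complex) \<Rightarrow> complex mat" where
  "diag_of n d = mat n n (\<lambda>(i, j). if i = j then d i else 0)"

lemma diag_of_dim [simp]: "dim_row (diag_of n d) = n" "dim_col (diag_of n d) = n"
  "diag_of n d \<in> carrier_mat n n"
  by (auto simp: diag_of_def)

lemma diag_of_index [simp]: "i < n \<Longrightarrow> j < n \<Longrightarrow> diag_of n d $$ (i, j) = (if i = j then d i else 0)"
  by (auto simp: diag_of_def)

lemma diag_of_mm_index [simp]:
  assumes "dim_row A = n" "i < n" "j < dim_col A"
  shows "(diag_of n d * A) $$ (i, j) = d i * A $$ (i, j)"
proof -
  have "(diag_of n d * A) $$ (i, j) = (\<Sum>k = 0..<n. (if i = k then d i else 0) * A $$ (k, j))"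
    using assms by (auto simp: scalar_prod_def intro!: sum.cong)
  also have "\<dots> = (\<Sum>k = 0..<n. if i = k then d i * A $$ (k, j) else 0)"
    by (rule sum.cong) auto
  finally show ?thesis using assms by simp
qed

lemma mm_diag_of_index [simp]:
  assumes "dim_col A = n" "i < dim_row A" "j < n"
  shows "(A * diag_of n d) $$ (i, j) = A $$ (i, j) * d j"
proof -
  have "(A * diag_of n d) $$ (i, j) = (\<Sum>k = 0..<n. A $$ (i, k) * (if k = j then d k else 0))"
    using assms by (auto simp: scalar_prod_def intro!: sum.cong)
  also have "\<dots> = (\<Sum>k = 0..<n. if k = j then A $$ (i, k) * d k else 0)"
    by (rule sum.cong) auto
  finally show ?thesis using assms by simp
qed

lemma diag_of_mult: "diag_of n d * diag_of n e = diag_of n (\<lambda>i. d i * e i)"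
  by (rule eq_matI) (auto simp del: index_mult_mat(1))

lemma diag_of_add: "diag_of n d + diag_of n e = diag_of n (\<lambda>i. d i + e i)"
  by (rule eq_matI) auto

lemma diag_of_adjoint: "(diag_of n d)\<^sup>H = diag_of n (\<lambda>i. cnj (d i))"
  by (rule eq_matI) auto

lemma diag_of_one: "diag_of n (\<lambda>i. 1) = 1\<^sub>m n"
  by (rule eq_matI) auto

lemma diag_of_cong: "(\<And>i. i < n \<Longrightarrow> d i = e i) \<Longrightarrow> diag_of n d = diag_of n e"
  by (rule eq_matI) auto

lemma diag_of_mv_index [simp]:
  assumes "dim_vec x = n" "i < n"
  shows "(diag_of n d *\<^sub>v x) $ i = d i * x $ i"
proof -
  have "(diag_of n d *\<^sub>v x) $ i = (\<Sum>k = 0..<n. (if i = k then d i else 0) * x $ k)"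
    using assms by (auto simp: scalar_prod_def intro!: sum.cong)
  also have "\<dots> = (\<Sum>k = 0..<n. if i = k then d i * x $ k else 0)"
    by (rule sum.cong) auto
  finally show ?thesis using assms by simp
qed

subsection \<open>Euclidean norm and spectral norm\<close>

lemma vec_norm2_nonneg [simp]: "0 \<le> vec_norm2 x"
  by (simp add: vec_norm2_def)

lemma vec_norm2_sq: "(vec_norm2 x)\<^sup>2 = (\<Sum>i<dim_vec x. (cmod (x $ i))\<^sup>2)"
  by (simp add: vec_norm2_def L2_set_def sum_nonneg)

lemma cinner_self: "x \<bullet>c x = of_real ((vec_norm2 x)\<^sup>2)"
  unfolding vec_norm2_sq scalar_prod_def
  by (auto simp: lessThan_atLeast0 complex_norm_square simp del: of_real_power intro!: sum.cong)

lemma vec_norm2_eq_0 [simp]: "vec_norm2 x = 0 \<longleftrightarrow> x = 0\<^sub>v (dim_vec x)"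
proof -
  have "vec_norm2 x = 0 \<longleftrightarrow> (vec_norm2 x)\<^sup>2 = 0" by simp
  also have "\<dots> \<longleftrightarrow> (\<forall>i<dim_vec x. x $ i = 0)"
    unfolding vec_norm2_sq by (subst sum_nonneg_eq_0_iff) auto
  also have "\<dots> \<longleftrightarrow> x = 0\<^sub>v (dim_vec x)"
    by (metis eq_vecI index_zero_vec)
  finally show ?thesis .
qed

lemma vec_norm2_zero [simp]: "vec_norm2 (0\<^sub>v n) = 0"
  by simp

lemma vec_norm2_smult [simp]: "vec_norm2 (c \<cdot>\<^sub>v x) = cmod c * vec_norm2 x"
  unfolding vec_norm2_def by (auto simp: norm_mult L2_set_right_distrib intro!: L2_set_cong)

lemma vec_norm2_uminus [simp]: "vec_norm2 (- x) = vec_norm2 x"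
  unfolding vec_norm2_def by (auto intro!: L2_set_cong)

lemma vec_norm2_conjugate [simp]: "vec_norm2 (conjugate x) = vec_norm2 x"
  unfolding vec_norm2_def by (auto intro!: L2_set_cong)

lemma vec_norm2_triangle: "dim_vec x = dim_vec y \<Longrightarrow> vec_norm2 (x + y) \<le> vec_norm2 x + vec_norm2 y"
proof -
  assume d: "dim_vec x = dim_vec y"
  have "vec_norm2 (x + y) \<le> L2_set (\<lambda>i. cmod (x $ i) + cmod (y $ i)) {..<dim_vec y}"
    unfolding vec_norm2_def using d by (auto intro!: L2_set_mono norm_triangle_ineq)
  also have "\<dots> \<le> vec_norm2 x + vec_norm2 y"
    unfolding vec_norm2_def using d by (simp add: L2_set_triangle_ineq)
  finally show ?thesis .
qed

lemma vec_norm2_triangle_minus: "dim_vec x = dim_vec y \<Longrightarrow> vec_norm2 x - vec_norm2 y \<le> vec_norm2 (x + y)"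
proof -
  assume d: "dim_vec x = dim_vec y"
  have "vec_norm2 ((x + y) + (- y)) \<le> vec_norm2 (x + y) + vec_norm2 (- y)"
    by (rule vec_norm2_triangle) (use d in auto)
  moreover have "(x + y) + (- y) = x" by (rule eq_vecI) (use d in auto)
  ultimately show ?thesis by simp
qed

lemma cinner_le: "dim_vec x = dim_vec y \<Longrightarrow> cmod (x \<bullet>c y) \<le> vec_norm2 x * vec_norm2 y"
proof -
  assume d: "dim_vec x = dim_vec y"
  have "cmod (x \<bullet>c y) \<le> (\<Sum>i<dim_vec x. cmod (x $ i * cnj (y $ i)))"
    unfolding scalar_prod_def using d by (auto simp: lessThan_atLeast0 intro!: order_trans[OF norm_sum] sum_mono)
  also have "\<dots> = (\<Sum>i<dim_vec x. \<bar>cmod (x $ i)\<bar> * \<bar>cmod (y $ i)\<bar>)"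
    by (simp add: norm_mult)
  also have "\<dots> \<le> vec_norm2 x * vec_norm2 y"
    unfolding vec_norm2_def using d L2_set_mult_ineq[of "\<lambda>i. cmod (x $ i)" "\<lambda>i. cmod (y $ i)" "{..<dim_vec x}"] by simp
  finally show ?thesis .
qed

lemma cinner_adjoint:
  assumes "dim_vec x = dim_col A" "dim_vec y = dim_row A"
  shows "(A *\<^sub>v x) \<bullet>c y = x \<bullet>c (A\<^sup>H *\<^sub>v y)"
proof -
  have "(A *\<^sub>v x) \<bullet>c y = (\<Sum>i = 0..<dim_row A. \<Sum>j = 0..<dim_col A. A $$ (i, j) * x $ j * cnj (y $ i))"
    using assms by (auto simp: scalar_prod_def sum_distrib_right intro!: sum.cong)
  also have "\<dots> = (\<Sum>j = 0..<dim_col A. \<Sum>i = 0..<dim_row A. A $$ (i, j) * x $ j * cnj (y $ i))"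
    by (rule sum.swap)
  also have "\<dots> = x \<bullet>c (A\<^sup>H *\<^sub>v y)"
    using assms by (auto simp: scalar_prod_def sum_distrib_left mult_ac intro!: sum.cong)
  finally show ?thesis .
qed

lemma vec_norm2_mv_sq:
  assumes "dim_vec x = dim_col A"
  shows "(vec_norm2 (A *\<^sub>v x))\<^sup>2 = Re (x \<bullet>c ((A\<^sup>H * A) *\<^sub>v x))"
proof -
  have "of_real ((vec_norm2 (A *\<^sub>v x))\<^sup>2) = (A *\<^sub>v x) \<bullet>c (A *\<^sub>v x)" by (simp only: cinner_self)
  also have "\<dots> = x \<bullet>c (A\<^sup>H *\<^sub>v (A *\<^sub>v x))" using assms by (subst cinner_adjoint) auto
  also have "A\<^sup>H *\<^sub>v (A *\<^sub>v x) = (A\<^sup>H * A) *\<^sub>v x" using assms by (simp add: assoc_mv)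
  finally show ?thesis by (metis Re_complex_of_real)
qed

lemma vec_norm2_isometry:
  assumes "A\<^sup>H * A = 1\<^sub>m n" "dim_vec x = n"
  shows "vec_norm2 (A *\<^sub>v x) = vec_norm2 x"
proof -
  have "dim_col A = n" using arg_cong[OF assms(1), of dim_col] by simp
  then have "(vec_norm2 (A *\<^sub>v x))\<^sup>2 = Re (x \<bullet>c (1\<^sub>m n *\<^sub>v x))"
    using vec_norm2_mv_sq[of x A] assms by simp
  also have "1\<^sub>m n *\<^sub>v x = x" by (rule one_mult_mat_vec) (rule carrier_vecI[OF assms(2)])
  also have "Re (x \<bullet>c x) = (vec_norm2 x)\<^sup>2" by (simp add: cinner_self del: of_real_power)
  finally show ?thesis by simp
qed

text \<open>Cauchy-Schwarz against each row gives a crude constant, the sum of the row norms. Its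
  task is to show that the set whose \<open>Sup\<close> is the spectral norm is bounded
  above.\<close>

lemma mv_bounded: "\<exists>K. 0 \<le> K \<and> (\<forall>x :: complex vec. dim_vec x = dim_col A \<longrightarrow> vec_norm2 (A *\<^sub>v x) \<le> K * vec_norm2 x)"
proof (intro exI conjI allI impI)
  let ?K = "(\<Sum>i<dim_row A. vec_norm2 (row A i))"
  show "0 \<le> ?K" by (intro sum_nonneg) auto
  fix x :: "complex vec" assume d: "dim_vec x = dim_col A"
  have *: "cmod ((A *\<^sub>v x) $ i) \<le> vec_norm2 (row A i) * vec_norm2 x" if "i < dim_row A" for i
  proof -
    have "(A *\<^sub>v x) $ i = row A i \<bullet>c conjugate x" using that by simp
    then show ?thesis using cinner_le[of "row A i" "conjugate x"] d by simp
  qed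
  have "vec_norm2 (A *\<^sub>v x) \<le> (\<Sum>i<dim_row A. cmod ((A *\<^sub>v x) $ i))"
    unfolding vec_norm2_def by (rule order_trans[OF L2_set_le_sum]) auto
  also have "\<dots> \<le> (\<Sum>i<dim_row A. vec_norm2 (row A i) * vec_norm2 x)"
    by (rule sum_mono) (use * in auto)
  finally show "vec_norm2 (A *\<^sub>v x) \<le> ?K * vec_norm2 x" by (simp add: sum_distrib_right)
qed

lemma spectral_norm_bdd: "bdd_above {vec_norm2 (B *\<^sub>v x) | x. x \<in> carrier_vec (dim_col B) \<and> vec_norm2 x \<le> 1}"
proof -
  obtain K where K: "0 \<le> K" "\<And>x. dim_vec x = dim_col B \<Longrightarrow> vec_norm2 (B *\<^sub>v x) \<le> K * vec_norm2 x"
    using mv_bounded by blast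
  show ?thesis
  proof (rule bdd_aboveI)
    fix t assume "t \<in> {vec_norm2 (B *\<^sub>v x) | x. x \<in> carrier_vec (dim_col B) \<and> vec_norm2 x \<le> 1}"
    then obtain x where x: "t = vec_norm2 (B *\<^sub>v x)" "dim_vec x = dim_col B" "vec_norm2 x \<le> 1" by auto
    show "t \<le> K" using K(2)[OF x(2)] x(1,3) K(1) mult_left_mono[of "vec_norm2 x" 1 K] by simp
  qed
qed

lemma spectral_norm_nonneg [simp]: "0 \<le> spectral_norm B"
  unfolding spectral_norm_def
  by (rule cSup_upper2[OF _ _ spectral_norm_bdd, of "vec_norm2 (B *\<^sub>v 0\<^sub>v (dim_col B))"])
    (auto intro!: exI[of _ "0\<^sub>v (dim_col B)"])

lemma spectral_norm_bound:
  assumes d: "dim_vec x = dim_col B"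
  shows "vec_norm2 (B *\<^sub>v x) \<le> spectral_norm B * vec_norm2 x"
proof (cases "vec_norm2 x = 0")
  case True
  then have "x = 0\<^sub>v (dim_col B)" using d by simp
  then have "B *\<^sub>v x = 0\<^sub>v (dim_row B)" by (auto intro!: eq_vecI)
  then show ?thesis using True by simp
next
  case False
  then have pos: "vec_norm2 x > 0" by (metis less_eq_real_def vec_norm2_nonneg)
  let ?y = "complex_of_real (1 / vec_norm2 x) \<cdot>\<^sub>v x"
  have n: "vec_norm2 ?y = 1" using pos by (simp add: norm_divide del: vec_norm2_eq_0)
  have By: "B *\<^sub>v ?y = complex_of_real (1 / vec_norm2 x) \<cdot>\<^sub>v (B *\<^sub>v x)"
    by (rule mult_mat_vec[of _ "dim_row B" "dim_col B"]) (use d in \<open>auto intro!: carrier_vecI\<close>)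
  have "vec_norm2 (B *\<^sub>v ?y) \<le> spectral_norm B"
    unfolding spectral_norm_def
    by (rule cSup_upper[OF _ spectral_norm_bdd]) (use d n in \<open>auto intro!: exI[of _ ?y] carrier_vecI\<close>)
  then show ?thesis using pos unfolding By by (simp add: norm_divide field_simps del: vec_norm2_eq_0)
qed

lemma spectral_norm_le:
  assumes "0 \<le> K" "\<And>x. dim_vec x = dim_col B \<Longrightarrow> vec_norm2 (B *\<^sub>v x) \<le> K * vec_norm2 x"
  shows "spectral_norm B \<le> K"
  unfolding spectral_norm_def
proof (rule cSup_least)
  show "{vec_norm2 (B *\<^sub>v x) | x. x \<in> carrier_vec (dim_col B) \<and> vec_norm2 x \<le> 1} \<noteq> {}"
    by (auto intro!: exI[of _ "0\<^sub>v (dim_col B)"])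
  fix t assume "t \<in> {vec_norm2 (B *\<^sub>v x) | x. x \<in> carrier_vec (dim_col B) \<and> vec_norm2 x \<le> 1}"
  then obtain x where x: "t = vec_norm2 (B *\<^sub>v x)" "dim_vec x = dim_col B" "vec_norm2 x \<le> 1" by auto
  show "t \<le> K" using assms(2)[OF x(2)] x(1,3) assms(1) mult_left_mono[of "vec_norm2 x" 1 K] by simp
qed

text \<open>The squared length of \<open>y = B\<^sup>H *\<^sub>v x\<close> is the inner product of
  \<open>x\<close> with \<open>B *\<^sub>v y\<close>; Cauchy-Schwarz and cancelling one factor
  \<open>vec_norm2 y\<close> finish. Equality then follows by applying the inequality to
  \<open>B\<^sup>H\<close> as well.\<close>

lemma spectral_norm_adjoint_le: "spectral_norm (B\<^sup>H) \<le> spectral_norm B"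
proof (rule spectral_norm_le)
  fix x :: "complex vec" assume d: "dim_vec x = dim_col (B\<^sup>H)"
  let ?y = "B\<^sup>H *\<^sub>v x"
  have "(vec_norm2 ?y)\<^sup>2 = Re (x \<bullet>c (B *\<^sub>v ?y))"
    using d by (subst vec_norm2_mv_sq) (simp_all add: assoc_mv)
  also have "\<dots> \<le> cmod (x \<bullet>c (B *\<^sub>v ?y))" by (rule complex_Re_le_cmod)
  also have "\<dots> \<le> vec_norm2 x * vec_norm2 (B *\<^sub>v ?y)" using d by (intro cinner_le) auto
  also have "\<dots> \<le> vec_norm2 x * (spectral_norm B * vec_norm2 ?y)"
    by (intro mult_left_mono spectral_norm_bound) auto
  finally have *: "vec_norm2 ?y * vec_norm2 ?y \<le> (spectral_norm B * vec_norm2 x) * vec_norm2 ?y"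
    by (simp add: power2_eq_square mult_ac)
  show "vec_norm2 ?y \<le> spectral_norm B * vec_norm2 x"
  proof (cases "vec_norm2 ?y = 0")
    case False
    then have "vec_norm2 ?y > 0" by (metis less_eq_real_def vec_norm2_nonneg)
    with * show ?thesis by (simp only: mult_le_cancel_right_pos)
  qed (simp del: vec_norm2_eq_0)
qed simp

lemma spectral_norm_adjoint [simp]: "spectral_norm (B\<^sup>H) = spectral_norm B"
  using spectral_norm_adjoint_le[of B] spectral_norm_adjoint_le[of "B\<^sup>H"] by simp

lemma add_mv: "dim_row A = dim_row B \<Longrightarrow> dim_col A = dim_vec x \<Longrightarrow> dim_col B = dim_vec x \<Longrightarrow>
    (A + B) *\<^sub>v x = A *\<^sub>v x + B *\<^sub>v x" for A B :: "complex mat"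
  by (rule add_mult_distrib_mat_vec[of _ "dim_row A" "dim_col A"]) (auto intro: carrier_vecI)

lemma mv_smult: "dim_col A = dim_vec x \<Longrightarrow> A *\<^sub>v (c \<cdot>\<^sub>v x) = c \<cdot>\<^sub>v (A *\<^sub>v x)" for A :: "complex mat"
  by (rule mult_mat_vec[of _ "dim_row A" "dim_col A"]) (auto intro: carrier_vecI)

lemma spectral_norm_add:
  assumes "dim_row A = dim_row B" "dim_col A = dim_col B"
  shows "spectral_norm (A + B) \<le> spectral_norm A + spectral_norm B"
proof (rule spectral_norm_le)
  fix x :: "complex vec" assume "dim_vec x = dim_col (A + B)"
  then have d: "dim_vec x = dim_col A" "dim_vec x = dim_col B" using assms by auto
  have "vec_norm2 ((A + B) *\<^sub>v x) \<le> vec_norm2 (A *\<^sub>v x) + vec_norm2 (B *\<^sub>v x)"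
    using assms d by (simp add: add_mv vec_norm2_triangle)
  also have "\<dots> \<le> spectral_norm A * vec_norm2 x + spectral_norm B * vec_norm2 x"
    by (intro add_mono spectral_norm_bound d)
  finally show "vec_norm2 ((A + B) *\<^sub>v x) \<le> (spectral_norm A + spectral_norm B) * vec_norm2 x"
    by (simp add: algebra_simps)
qed simp

lemma spectral_norm_mm:
  assumes "dim_col A = dim_row B"
  shows "spectral_norm (A * B) \<le> spectral_norm A * spectral_norm B"
proof (rule spectral_norm_le)
  fix x :: "complex vec" assume "dim_vec x = dim_col (A * B)"
  then have d: "dim_vec x = dim_col B" by auto
  have "vec_norm2 (A *\<^sub>v (B *\<^sub>v x)) \<le> spectral_norm A * vec_norm2 (B *\<^sub>v x)"
    using assms by (intro spectral_norm_bound) auto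
  also have "\<dots> \<le> spectral_norm A * (spectral_norm B * vec_norm2 x)"
    by (intro mult_left_mono spectral_norm_bound d) auto
  finally show "vec_norm2 (A * B *\<^sub>v x) \<le> spectral_norm A * spectral_norm B * vec_norm2 x"
    using assms d by (simp add: assoc_mv mult.assoc)
qed simp

lemma spectral_norm_smult: "spectral_norm (c \<cdot>\<^sub>m A) \<le> cmod c * spectral_norm A"
proof (rule spectral_norm_le)
  fix x :: "complex vec" assume "dim_vec x = dim_col (c \<cdot>\<^sub>m A)"
  then have d: "dim_vec x = dim_col A" by auto
  have "(c \<cdot>\<^sub>m A) *\<^sub>v x = c \<cdot>\<^sub>v (A *\<^sub>v x)"
    using d by (auto intro!: eq_vecI)
  then show "vec_norm2 ((c \<cdot>\<^sub>m A) *\<^sub>v x) \<le> cmod c * spectral_norm A * vec_norm2 x"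
    using spectral_norm_bound[OF d] by (simp add: mult_left_mono mult.assoc)
qed simp

lemma spectral_norm_isometry:
  assumes "A\<^sup>H * A = 1\<^sub>m n"
  shows "spectral_norm A \<le> 1"
proof (rule spectral_norm_le)
  fix x :: "complex vec" assume "dim_vec x = dim_col A"
  moreover have "dim_col A = n" using arg_cong[OF assms, of dim_col] by simp
  ultimately show "vec_norm2 (A *\<^sub>v x) \<le> 1 * vec_norm2 x"
    using vec_norm2_isometry[OF assms] by simp
qed simp

subsection \<open>Unitary matrices and the spectral theorem\<close>

lemma unitary_matD:
  assumes "unitary_mat n P"
  shows "dim_row P = n" "dim_col P = n" "P\<^sup>H * P = 1\<^sub>m n" "P * P\<^sup>H = 1\<^sub>m n" "P \<in> carrier_mat n n"
  using assms by (auto simp: unitary_mat_def)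

lemma unitary_matI: "P \<in> carrier_mat n n \<Longrightarrow> P\<^sup>H * P = 1\<^sub>m n \<Longrightarrow> unitary_mat n P"
  unfolding unitary_mat_def by (auto intro: mat_mult_left_right_inverse[of "P\<^sup>H" n P])

lemma unitary_mat_adjoint: "unitary_mat n P \<Longrightarrow> unitary_mat n (P\<^sup>H)"
  by (auto simp: unitary_mat_def)

lemma unitary_mat_one: "unitary_mat n (1\<^sub>m n)"
  by (auto simp: unitary_mat_def)

lemma unitary_cancel:
  assumes "unitary_mat n P" "dim_row X = n"
  shows "P\<^sup>H * (P * X) = X" "P * (P\<^sup>H * X) = X"
proof -
  note P = unitary_matD[OF assms(1)]
  have "P\<^sup>H * (P * X) = (P\<^sup>H * P) * X" "P * (P\<^sup>H * X) = (P * P\<^sup>H) * X"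
    using P(1,2) assms(2) by (simp_all add: assoc_mm)
  then show "P\<^sup>H * (P * X) = X" "P * (P\<^sup>H * X) = X" using assms(2) by (simp_all add: P(3,4))
qed

lemma unitary_cancel_right:
  assumes "unitary_mat n P" "dim_col X = n"
  shows "X * P * P\<^sup>H = X"
  using assms unitary_matD[OF assms(1)] by (simp_all add: assoc_mm)

lemma unitary_mat_mult:
  assumes "unitary_mat n P" "unitary_mat n Q"
  shows "unitary_mat n (P * Q)"
proof (rule unitary_matI)
  note P = unitary_matD[OF assms(1)] and Q = unitary_matD[OF assms(2)]
  show "P * Q \<in> carrier_mat n n" using P Q by auto
  have "(P * Q)\<^sup>H * (P * Q) = Q\<^sup>H * (P\<^sup>H * (P * Q))"
    using P(1,2) Q(1,2) by (simp add: adjoint_mm assoc_mm)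
  then show "(P * Q)\<^sup>H * (P * Q) = 1\<^sub>m n" using unitary_cancel(1)[OF assms(1) Q(1)] Q(3) by simp
qed

lemma unitary_diag:
  assumes "\<And>i. i < n \<Longrightarrow> cmod (d i) = 1"
  shows "unitary_mat n (diag_of n d)"
proof (rule unitary_matI)
  have "cnj (d i) * d i = 1" if "i < n" for i
    using assms[OF that] complex_norm_square[of "d i"] by (simp add: mult.commute)
  then show "(diag_of n d)\<^sup>H * diag_of n d = 1\<^sub>m n"
    unfolding diag_of_adjoint diag_of_mult by (intro eq_matI) auto
qed simp

lemma unitary_block:
  assumes "unitary_mat p A" "unitary_mat q D"
  shows "unitary_mat (p + q) (four_block_mat A (0\<^sub>m p q) (0\<^sub>m q p) D)"
proof (rule unitary_matI)
  note A = unitary_matD[OF assms(1)] and D = unitary_matD[OF assms(2)]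
  show "four_block_mat A (0\<^sub>m p q) (0\<^sub>m q p) D \<in> carrier_mat (p + q) (p + q)" using A D by auto
  show "(four_block_mat A (0\<^sub>m p q) (0\<^sub>m q p) D)\<^sup>H * four_block_mat A (0\<^sub>m p q) (0\<^sub>m q p) D = 1\<^sub>m (p + q)"
    using A(1-3) D(1-3) by (simp add: block_simps mat_dist)
qed

lemma unitary_mv_norm: "unitary_mat n P \<Longrightarrow> dim_vec x = n \<Longrightarrow> vec_norm2 (P *\<^sub>v x) = vec_norm2 x"
  using vec_norm2_isometry[of P n x] by (auto simp: unitary_mat_def)

lemma unitary_mv_cancel:
  assumes "unitary_mat n P" "dim_vec x = n"
  shows "P\<^sup>H *\<^sub>v (P *\<^sub>v x) = x" "P *\<^sub>v (P\<^sup>H *\<^sub>v x) = x"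
proof -
  note P = unitary_matD[OF assms(1)]
  have x: "x \<in> carrier_vec n" using assms(2) by (rule carrier_vecI)
  have "P\<^sup>H *\<^sub>v (P *\<^sub>v x) = (P\<^sup>H * P) *\<^sub>v x" "P *\<^sub>v (P\<^sup>H *\<^sub>v x) = (P * P\<^sup>H) *\<^sub>v x"
    using P(1,2) assms(2) by (simp_all add: assoc_mv)
  then show "P\<^sup>H *\<^sub>v (P *\<^sub>v x) = x" "P *\<^sub>v (P\<^sup>H *\<^sub>v x) = x" using x by (simp_all add: P(3,4))
qed

text \<open>Gram-Schmidt on a basis that starts with \<open>v\<close> leaves \<open>v\<close> in
  first place, and dividing by the lengths makes the columns orthonormal. The scalar
  \<open>c\<close> stays unspecified because deflation uses only the direction of an
  eigenvector.\<close>

lemma unitary_first_col: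
  fixes v :: "complex vec"
  assumes v: "v \<in> carrier_vec n" "v \<noteq> 0\<^sub>v n"
  obtains W c where "unitary_mat n W" "col W 0 = c \<cdot>\<^sub>v v"
proof -
  interpret cof_vec_space n "TYPE(complex)" .
  define ws where "ws = gram_schmidt n (basis_completion v)"
  note bc = basis_completion[OF v]
  note gs = gram_schmidt_result[OF bc(2,4,5) ws_def]
  have len: "length ws = n" using gs(4) bc(6) by simp
  have cws: "ws ! i \<in> carrier_vec n" if "i < n" for i using gs(3) len that nth_mem by blast
  have n0: "0 < n"
  proof (rule ccontr)
    assume "\<not> 0 < n"
    then have "v = 0\<^sub>v n" using v by (intro eq_vecI) auto
    with v show False by simp
  qed
  have "basis_completion v = v # tl (basis_completion v)"
    using bc(6,7) n0 by (cases "basis_completion v") auto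
  then have hd: "hd ws = v" unfolding ws_def using gram_schmidt_hd[OF v(1), of "tl (basis_completion v)"] by simp
  then have w0: "ws ! 0 = v" using len n0 by (cases ws) auto
  define nm where "nm i = vec_norm2 (ws ! i)" for i
  have orth: "ws ! i \<bullet>c ws ! j = 0 \<longleftrightarrow> i \<noteq> j" if "i < n" "j < n" for i j
    using corthogonalD[OF gs(2)] that len by auto
  have nm: "nm i \<noteq> 0" if "i < n" for i
    using orth[OF that that] unfolding cinner_self nm_def by auto
  define W where "W = mat n n (\<lambda>(k, j). ws ! j $ k / complex_of_real (nm j))"
  have "(W\<^sup>H * W) $$ (i, j) = (ws ! j \<bullet>c ws ! i) / (nm i * nm j)" if "i < n" "j < n" for i j
    using that cws[OF that(1)] cws[OF that(2)]
    by (auto simp: W_def scalar_prod_def sum_divide_distrib intro!: sum.cong)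
  then have "W\<^sup>H * W = 1\<^sub>m n"
    by (intro eq_matI)
      (auto simp: orth cinner_self nm nm_def[symmetric] power2_eq_square W_def simp del: index_mult_mat(1))
  then have "unitary_mat n W" by (intro unitary_matI) (auto simp: W_def)
  moreover have "col W 0 = (1 / nm 0) \<cdot>\<^sub>v v"
    using n0 v(1) by (intro eq_vecI) (auto simp: W_def w0)
  ultimately show thesis by (rule that)
qed

text \<open>Deflation: in a unitary basis whose first vector is an eigenvector, the first column
  vanishes below the diagonal. Being Hermitian, the matrix then has a vanishing rest of the first
  row and a real eigenvalue, and the induction hypothesis diagonalizes the remaining block.\<close>

theorem hermitian_spectral:
  assumes "A \<in> carrier_mat n n" "A\<^sup>H = A"
  shows "\<exists>P d. unitary_mat n P \<and> A = P * diag_of n (\<lambda>i. complex_of_real (d i)) * P\<^sup>H"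
  using assms
proof (induction n arbitrary: A)
  case 0
  then have "A = 1\<^sub>m 0 * diag_of 0 (\<lambda>i. complex_of_real 0) * (1\<^sub>m 0)\<^sup>H" by (intro eq_matI) auto
  then show ?case by (intro exI[of _ "1\<^sub>m 0"] exI[of _ "\<lambda>i. 0"] conjI unitary_mat_one)
next
  case (Suc n)
  note A = Suc.prems
  have dA: "dim_row A = Suc n" "dim_col A = Suc n" using A by auto
  obtain as where as: "char_poly A = (\<Prod>a\<leftarrow>as. [:- a, 1:])" "length as = Suc n"
    using char_poly_factorized[OF A(1)] by blast
  then obtain e as' where "as = e # as'" by (cases as) auto
  then have "poly (char_poly A) e = 0" using as by (simp add: poly_prod_list)
  then have "eigenvalue A e" using eigenvalue_root_char_poly[OF A(1)] by simp
  then obtain v where v: "v \<in> carrier_vec (Suc n)" "v \<noteq> 0\<^sub>v (Suc n)" "A *\<^sub>v v = e \<cdot>\<^sub>v v"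
    unfolding eigenvalue_def eigenvector_def using dA by auto
  obtain W c where W: "unitary_mat (Suc n) W" "col W 0 = c \<cdot>\<^sub>v v"
    using unitary_first_col[OF v(1,2)] by blast
  note dW = unitary_matD[OF W(1)]
  define B where "B = W\<^sup>H * A * W"
  have cB: "B \<in> carrier_mat (1 + n) (1 + n)" using dW dA by (auto simp: B_def)
  have hB: "B\<^sup>H = B" using dW dA A(2) by (simp add: B_def adjoint_mm assoc_mm)
  have A_eq: "A = W * B * W\<^sup>H"
    using dW(1,2) dA unitary_cancel(2)[OF W(1), of "A"] unitary_cancel_right[OF W(1), of A]
    by (simp add: B_def assoc_mm)
  have "col (A * W) 0 = A *\<^sub>v col W 0"
    by (rule col_mult2[OF A(1) dW(5)]) simp
  also have "\<dots> = e \<cdot>\<^sub>v col W 0"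
    using v dA unfolding W(2) by (simp add: mv_smult smult_smult_assoc mult.commute)
  finally have colAW: "col (A * W) 0 = e \<cdot>\<^sub>v col W 0" .
  have B0: "B $$ (i, 0) = (if i = 0 then e else 0)" if i: "i < Suc n" for i
  proof -
    have "B = W\<^sup>H * (A * W)" using dW dA by (simp add: B_def assoc_mm)
    then have "B $$ (i, 0) = row (W\<^sup>H) i \<bullet> col (A * W) 0" using i dW dA by simp
    also have "\<dots> = e * (row (W\<^sup>H) i \<bullet> col W 0)"
      unfolding colAW by (rule scalar_prod_smult_distrib[of _ "Suc n"]) (use i dW(1,2) in \<open>auto intro!: carrier_vecI\<close>)
    also have "row (W\<^sup>H) i \<bullet> col W 0 = (W\<^sup>H * W) $$ (i, 0)" using i dW(1,2) by simp
    also have "\<dots> = (if i = 0 then 1 else 0)" using i unfolding dW(3) by simp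
    finally show ?thesis by simp
  qed
  have er: "e = of_real (Re e)"
  proof -
    have "B\<^sup>H $$ (0, 0) = cnj (B $$ (0, 0))" using cB by simp
    then have "e = cnj e" using B0[of 0] hB by simp
    then show ?thesis by (simp add: complex_eq_iff)
  qed
  obtain B1 B2 B3 B4 where B: "B = four_block_mat B1 B2 B3 B4" "B1 \<in> carrier_mat 1 1" "B2 \<in> carrier_mat 1 n"
    "B3 \<in> carrier_mat n 1" "B4 \<in> carrier_mat n n"
    using four_block_exhaust[OF cB] by metis
  have b3: "B3 $$ (i, j) = 0" if "i < n" "j < 1" for i j
    using B0[of "i + 1"] that B by (simp add: B(1))
  then have B3: "B3 = 0\<^sub>m n 1" using B by (intro eq_matI) auto
  have "B1 $$ (0, 0) = e" using B0[of 0] B by (simp add: B(1))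
  then have b1: "B1 $$ (i, j) = of_real (Re e)" if "i < 1" "j < 1" for i j
    using that er by simp
  have "four_block_mat (B1\<^sup>H) (B3\<^sup>H) (B2\<^sup>H) (B4\<^sup>H) = four_block_mat B1 B2 B3 B4"
    using hB B(2-5) unfolding B(1) by (subst (asm) adjoint_four_block) auto
  then have "B3\<^sup>H = B2" "B4\<^sup>H = B4"
    using B(2-5) four_block_inject_carrier[of "B1\<^sup>H" 1 1 "B3\<^sup>H" n "B2\<^sup>H" n "B4\<^sup>H" B1 B2 B3 B4] by auto
  then have B2: "B2 = 0\<^sub>m 1 n" using B3 by simp
  obtain P d where P: "unitary_mat n P" "B4 = P * diag_of n (\<lambda>i. complex_of_real (d i)) * P\<^sup>H"
    using Suc.IH[OF B(5) \<open>B4\<^sup>H = B4\<close>] by blast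
  note dP = unitary_matD[OF P(1)]
  let ?D = "diag_of n (\<lambda>i. complex_of_real (d i))"
  let ?d = "\<lambda>i. case i of 0 \<Rightarrow> Re e | Suc k \<Rightarrow> d k"
  define R where "R = four_block_mat (1\<^sub>m 1) (0\<^sub>m 1 n) (0\<^sub>m n 1) P"
  have R: "unitary_mat (Suc n) R"
    unfolding R_def using unitary_block[OF unitary_mat_one[of 1] P(1)] by simp
  have D: "four_block_mat B1 (0\<^sub>m 1 n) (0\<^sub>m n 1) ?D = diag_of (Suc n) (\<lambda>i. complex_of_real (?d i))"
    using b1 B by (intro eq_matI) (auto split: nat.split)
  have e: "R * four_block_mat B1 (0\<^sub>m 1 n) (0\<^sub>m n 1) ?D * R\<^sup>H = B"
    unfolding R_def B(1) B2 B3 P(2) using B(2) dP(1,2) by (simp add: block_simps mat_dist)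
  have "A = W * R * diag_of (Suc n) (\<lambda>i. complex_of_real (?d i)) * (W * R)\<^sup>H"
    unfolding A_eq e[unfolded D, symmetric] using dW(1,2) unitary_matD(1,2)[OF R] by (simp add: adjoint_mm assoc_mm)
  moreover have "unitary_mat (Suc n) (W * R)" by (rule unitary_mat_mult[OF W(1) R])
  ultimately show ?case by blast
qed

lemma diag_quad_form:
  assumes P: "unitary_mat n P" and x: "dim_vec x = n"
  shows "(P * diag_of n d * P\<^sup>H *\<^sub>v x) \<bullet>c x = (\<Sum>i<n. d i * of_real ((cmod ((P\<^sup>H *\<^sub>v x) $ i))\<^sup>2))"
proof -
  note dP = unitary_matD[OF P]
  let ?y = "P\<^sup>H *\<^sub>v x"
  have "P * diag_of n d * P\<^sup>H *\<^sub>v x = P *\<^sub>v (diag_of n d *\<^sub>v ?y)"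
    using dP(1,2) x by (simp add: assoc_mv)
  then have "(P * diag_of n d * P\<^sup>H *\<^sub>v x) \<bullet>c x = (diag_of n d *\<^sub>v ?y) \<bullet>c ?y"
    using dP(1,2) x by (simp add: cinner_adjoint)
  also have "\<dots> = (\<Sum>i<n. d i * of_real ((cmod (?y $ i))\<^sup>2))"
    using dP(1,2) x unfolding scalar_prod_def complex_norm_square
    by (auto simp: lessThan_atLeast0 mult.assoc simp del: index_mult_mat_vec intro!: sum.cong)
  finally show ?thesis .
qed

lemma diag_mv_norm_sq:
  assumes P: "unitary_mat n P" and x: "dim_vec x = n"
  shows "(vec_norm2 (P * diag_of n d * P\<^sup>H *\<^sub>v x))\<^sup>2 = (\<Sum>i<n. (cmod (d i))\<^sup>2 * (cmod ((P\<^sup>H *\<^sub>v x) $ i))\<^sup>2)"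
proof -
  note dP = unitary_matD[OF P]
  let ?y = "P\<^sup>H *\<^sub>v x"
  have "P * diag_of n d * P\<^sup>H *\<^sub>v x = P *\<^sub>v (diag_of n d *\<^sub>v ?y)"
    using dP(1,2) x by (simp add: assoc_mv)
  then have "vec_norm2 (P * diag_of n d * P\<^sup>H *\<^sub>v x) = vec_norm2 (diag_of n d *\<^sub>v ?y)"
    using dP(1,2) by (simp add: unitary_mv_norm[OF P])
  moreover have "(vec_norm2 (diag_of n d *\<^sub>v ?y))\<^sup>2 = (\<Sum>i<n. (cmod (d i))\<^sup>2 * (cmod (?y $ i))\<^sup>2)"
    unfolding vec_norm2_sq using dP(1,2)
    by (auto simp: norm_mult power_mult_distrib simp del: index_mult_mat_vec intro!: sum.cong)
  ultimately show ?thesis by simp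
qed

lemma unitary_coords_norm_sq:
  assumes P: "unitary_mat n P" and x: "dim_vec x = n"
  shows "(\<Sum>i<n. (cmod ((P\<^sup>H *\<^sub>v x) $ i))\<^sup>2) = (vec_norm2 x)\<^sup>2"
  using vec_norm2_sq[of "P\<^sup>H *\<^sub>v x"] unitary_mv_norm[OF unitary_mat_adjoint[OF P] x] unitary_matD(1,2)[OF P]
  by (simp del: index_mult_mat_vec)

subsection \<open>Square roots\<close>

lemma psd_spectral:
  assumes "psd_mat n A"
  obtains P d where "unitary_mat n P" "\<And>i. i < n \<Longrightarrow> 0 \<le> d i" "A = P * diag_of n (\<lambda>i. complex_of_real (d i)) * P\<^sup>H"
proof -
  have A: "A \<in> carrier_mat n n" "A\<^sup>H = A" using assms by (auto simp: psd_mat_def)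
  obtain P d where P: "unitary_mat n P" "A = P * diag_of n (\<lambda>i. complex_of_real (d i)) * P\<^sup>H"
    using hermitian_spectral[OF A] by blast
  note dP = unitary_matD[OF P(1)]
  have "0 \<le> d k" if k: "k < n" for k
  proof -
    \<comment> \<open>The quadratic form takes the value \<open>d k\<close> at the
      \<open>k\<close>-th column of \<open>P\<close>.\<close>
    let ?e = "unit_vec n k :: complex vec"
    let ?x = "P *\<^sub>v ?e"
    have x: "dim_vec ?x = n" using dP by simp
    have Px: "P\<^sup>H *\<^sub>v ?x = ?e" by (rule unitary_mv_cancel(1)[OF P(1)]) simp
    have "0 \<le> Re ((A *\<^sub>v ?x) \<bullet>c ?x)" using assms x by (auto simp: psd_mat_def simp del: dim_mult_mat_vec intro: carrier_vecI)
    also have "(A *\<^sub>v ?x) \<bullet>c ?x = (\<Sum>i<n. complex_of_real (d i) * of_real ((cmod (?e $ i))\<^sup>2))"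
      unfolding P(2) diag_quad_form[OF P(1) x] Px ..
    also have "\<dots> = (\<Sum>i<n. if i = k then complex_of_real (d k) else 0)"
      using k by (intro sum.cong) auto
    also have "\<dots> = complex_of_real (d k)" using k by simp
    finally show ?thesis by simp
  qed
  then show thesis using that P by blast
qed

lemma psd_of_diag:
  assumes P: "unitary_mat n P" and d: "\<And>i. i < n \<Longrightarrow> 0 \<le> d i"
  shows "psd_mat n (P * diag_of n (\<lambda>i. complex_of_real (d i)) * P\<^sup>H)"
  unfolding psd_mat_def
proof (intro conjI ballI)
  note dP = unitary_matD[OF P]
  show "P * diag_of n (\<lambda>i. complex_of_real (d i)) * P\<^sup>H \<in> carrier_mat n n" using dP(1,2) by auto
  show "(P * diag_of n (\<lambda>i. complex_of_real (d i)) * P\<^sup>H)\<^sup>H = P * diag_of n (\<lambda>i. complex_of_real (d i)) * P\<^sup>H"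
    using dP(1,2) by (simp add: adjoint_mm assoc_mm diag_of_adjoint)
  fix x :: "complex vec" assume "x \<in> carrier_vec n"
  then have x: "dim_vec x = n" by simp
  show "0 \<le> Re ((P * diag_of n (\<lambda>i. complex_of_real (d i)) * P\<^sup>H *\<^sub>v x) \<bullet>c x)"
    unfolding diag_quad_form[OF P x] using d by (auto simp del: index_mult_mat_vec intro!: sum_nonneg mult_nonneg_nonneg)
qed

lemma psd_gram: "psd_mat (dim_col X) (X\<^sup>H * X)"
  unfolding psd_mat_def
proof (intro conjI ballI)
  show "X\<^sup>H * X \<in> carrier_mat (dim_col X) (dim_col X)" by auto
  show "(X\<^sup>H * X)\<^sup>H = X\<^sup>H * X" by (simp add: adjoint_mm)
  fix x :: "complex vec" assume "x \<in> carrier_vec (dim_col X)"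
  then have x: "dim_vec x = dim_col X" by simp
  have "(X\<^sup>H * X *\<^sub>v x) \<bullet>c x = (X *\<^sub>v x) \<bullet>c (X *\<^sub>v x)"
    using x by (simp add: assoc_mv cinner_adjoint)
  then show "0 \<le> Re ((X\<^sup>H * X *\<^sub>v x) \<bullet>c x)" by (simp add: cinner_self del: of_real_power)
qed

lemma psd_gram': "psd_mat (dim_row X) (X * X\<^sup>H)"
  using psd_gram[of "X\<^sup>H"] by simp

lemma psd_carrier: "psd_mat n A \<Longrightarrow> A \<in> carrier_mat n n"
  and psd_adjoint: "psd_mat n A \<Longrightarrow> A\<^sup>H = A"
  and psd_dim: "psd_mat n A \<Longrightarrow> dim_row A = n" "psd_mat n A \<Longrightarrow> dim_col A = n"
  by (auto simp: psd_mat_def)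

text \<open>In eigenbases the hypothesis reads
  \<open>((s i)\<^sup>2 - (t j)\<^sup>2) * M i j = 0\<close>, and nonnegativity turns
  \<open>(s i)\<^sup>2 = (t j)\<^sup>2\<close> into \<open>s i = t j\<close>. This replaces a
  functional calculus: it yields uniqueness of square roots and moves square roots across
  rectangular matrices.\<close>

lemma psd_intertwine:
  assumes S: "psd_mat m S" and T: "psd_mat n T" and X: "X \<in> carrier_mat m n"
    and eq: "S * S * X = X * (T * T)"
  shows "S * X = X * T"
proof -
  obtain P s where P: "unitary_mat m P" "\<And>i. i < m \<Longrightarrow> 0 \<le> s i" "S = P * diag_of m (\<lambda>i. complex_of_real (s i)) * P\<^sup>H"
    using psd_spectral[OF S] by metis
  obtain Q t where Q: "unitary_mat n Q" "\<And>i. i < n \<Longrightarrow> 0 \<le> t i" "T = Q * diag_of n (\<lambda>i. complex_of_real (t i)) * Q\<^sup>H"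
    using psd_spectral[OF T] by metis
  note dP = unitary_matD(1,2)[OF P(1)] and dQ = unitary_matD(1,2)[OF Q(1)]
  have dX: "dim_row X = m" "dim_col X = n" using X by auto
  let ?D = "diag_of m (\<lambda>i. complex_of_real (s i))" and ?E = "diag_of n (\<lambda>i. complex_of_real (t i))"
  let ?M = "P\<^sup>H * X * Q"
  have X_eq: "X = P * ?M * Q\<^sup>H"
    using dP dQ dX unitary_cancel(2)[OF P(1), of "X * Q * Q\<^sup>H"] unitary_cancel_right[OF Q(1), of X]
    by (simp add: assoc_mm)
  have "P\<^sup>H * (S * S * X) * Q = ?D * (?D * ?M)"
    unfolding P(3) using dP dQ dX by (simp add: assoc_mm unitary_cancel[OF P(1)])
  moreover have "P\<^sup>H * (X * (T * T)) * Q = ?M * ?E * ?E"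
    unfolding Q(3) using dP dQ dX
    by (simp add: assoc_mm unitary_cancel[OF Q(1)] unitary_matD(3)[OF Q(1)])
  ultimately have e: "?D * (?D * ?M) = ?M * ?E * ?E" using eq by simp
  have "?D * ?M = ?M * ?E"
  proof (rule eq_matI)
    fix i j assume "i < dim_row (?M * ?E)" "j < dim_col (?M * ?E)"
    then have ij: "i < m" "j < n" using dP dQ by auto
    have "(?D * (?D * ?M)) $$ (i, j) = (?M * ?E * ?E) $$ (i, j)" unfolding e ..
    then have z: "of_real ((s i)\<^sup>2 - (t j)\<^sup>2) * ?M $$ (i, j) = 0"
      using ij dP dQ dX by (simp del: index_mult_mat(1) add: power2_eq_square algebra_simps)
    show "(?D * ?M) $$ (i, j) = (?M * ?E) $$ (i, j)"
    proof (cases "?M $$ (i, j) = 0")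
      case False
      then have "(s i)\<^sup>2 = (t j)\<^sup>2" using z by (simp del: index_mult_mat(1) of_real_diff of_real_power)
      then have "s i = t j" using P(2)[OF ij(1)] Q(2)[OF ij(2)] by (simp add: power2_eq_iff_nonneg)
      then show ?thesis using ij dP dQ dX by (simp del: index_mult_mat(1))
    next
      case True
      have "(?D * ?M) $$ (i, j) = s i * ?M $$ (i, j)" "(?M * ?E) $$ (i, j) = ?M $$ (i, j) * t j"
        using ij dP dQ dX by (simp_all del: index_mult_mat(1))
      then show ?thesis unfolding True by simp
    qed
  qed (use dP dQ dX in auto)
  moreover have "S * X = P * (?D * ?M) * Q\<^sup>H"
  proof -
    have "S * X = S * (P * ?M * Q\<^sup>H)" using X_eq by simp
    also have "\<dots> = P * (?D * ?M) * Q\<^sup>H"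
      unfolding P(3) using dP dQ dX by (simp add: assoc_mm unitary_cancel[OF P(1)])
    finally show ?thesis .
  qed
  moreover have "X * T = P * (?M * ?E) * Q\<^sup>H"
  proof -
    have "X * T = (P * ?M * Q\<^sup>H) * T" using X_eq by simp
    also have "\<dots> = P * (?M * ?E) * Q\<^sup>H"
      unfolding Q(3) using dP dQ dX by (simp add: assoc_mm unitary_cancel[OF Q(1)])
    finally show ?thesis .
  qed
  ultimately show ?thesis by simp
qed

lemma psd_sqrt_unique:
  assumes "psd_mat n S" "psd_mat n T" "S * S = T * T"
  shows "S = T"
proof -
  have "S * 1\<^sub>m n = 1\<^sub>m n * T"
    by (rule psd_intertwine[OF assms(1,2)]) (use assms psd_dim in auto)
  then show ?thesis using psd_dim[OF assms(1)] psd_dim[OF assms(2)] by simp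
qed

lemma psd_sqrt_diag:
  assumes P: "unitary_mat n P"
  shows "(P * diag_of n d * P\<^sup>H) * (P * diag_of n e * P\<^sup>H) = P * diag_of n (\<lambda>i. d i * e i) * P\<^sup>H"
  using unitary_matD(1,2)[OF P]
  by (simp add: assoc_mm unitary_cancel[OF P] flip: diag_of_mult)

lemma mat_sqrt_eqI:
  assumes "psd_mat n S" "S * S = A"
  shows "mat_sqrt A = S"
proof -
  have "dim_row A = n" using assms psd_dim[of n S] by auto
  then show ?thesis unfolding mat_sqrt_def
    by (intro the_equality) (use assms psd_sqrt_unique in auto)
qed

lemma mat_sqrt:
  assumes "psd_mat n A"
  shows "psd_mat n (mat_sqrt A)" "mat_sqrt A * mat_sqrt A = A"
proof -
  obtain P d where P: "unitary_mat n P" "\<And>i. i < n \<Longrightarrow> 0 \<le> d i" "A = P * diag_of n (\<lambda>i. complex_of_real (d i)) * P\<^sup>H"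
    using psd_spectral[OF assms] by metis
  let ?S = "P * diag_of n (\<lambda>i. complex_of_real (sqrt (d i))) * P\<^sup>H"
  have S: "psd_mat n ?S" by (rule psd_of_diag[OF P(1)]) (use P(2) in auto)
  have D: "diag_of n (\<lambda>i. complex_of_real (sqrt (d i)) * complex_of_real (sqrt (d i))) = diag_of n (\<lambda>i. complex_of_real (d i))"
    by (rule diag_of_cong) (use P(2) in \<open>simp flip: of_real_mult\<close>)
  have "?S * ?S = A" unfolding psd_sqrt_diag[OF P(1)] D P(3) ..
  then have "mat_sqrt A = ?S" "?S * ?S = A" using mat_sqrt_eqI[OF S] by auto
  then show "psd_mat n (mat_sqrt A)" "mat_sqrt A * mat_sqrt A = A" using S by auto
qed

text \<open>A two-sided inverse excludes the value \<open>None\<close> of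
  \<open>mat_inverse\<close>, and uniqueness of inverses identifies the result.\<close>

lemma mat_inv_sqrt_eqI:
  assumes "mat_sqrt A \<in> carrier_mat n n" "R \<in> carrier_mat n n" "mat_sqrt A * R = 1\<^sub>m n" "R * mat_sqrt A = 1\<^sub>m n"
  shows "mat_inv_sqrt A = R"
proof -
  have U: "mat_sqrt A \<in> Units (ring_mat TYPE(complex) n ())"
    using assms by (auto simp: Units_def ring_mat_def)
  then obtain B where B: "mat_inverse (mat_sqrt A) = Some B"
    using mat_inverse(1)[OF assms(1), of "()"] by (cases "mat_inverse (mat_sqrt A)") auto
  have "B * mat_sqrt A = 1\<^sub>m n" "B \<in> carrier_mat n n" using mat_inverse(2)[OF assms(1) B] by auto
  then have "B = B * (mat_sqrt A * R)" using assms(3) by simp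
  also have "\<dots> = (B * mat_sqrt A) * R" using \<open>B \<in> _\<close> assms by (subst assoc_mm) auto
  also have "\<dots> = R" using \<open>B * mat_sqrt A = 1\<^sub>m n\<close> assms by simp
  finally show ?thesis using B by (simp add: mat_inv_sqrt_def)
qed

text \<open>One eigenbasis serves \<open>1 + B\<close> and both of its powers, so identities between
  them become scalar identities in \<open>x i = sqrt (1 + d i)\<close>. The bound
  \<open>1 \<le> x i\<close> makes the inverse square root a contraction.\<close>

lemma sqrt_one_plus:
  assumes "psd_mat n B"
  obtains P x where "unitary_mat n P" "\<And>i. i < n \<Longrightarrow> 1 \<le> x i"
    "1\<^sub>m n + B = P * diag_of n (\<lambda>i. complex_of_real ((x i)\<^sup>2)) * P\<^sup>H"
    "mat_sqrt (1\<^sub>m n + B) = P * diag_of n (\<lambda>i. complex_of_real (x i)) * P\<^sup>H"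
    "mat_inv_sqrt (1\<^sub>m n + B) = P * diag_of n (\<lambda>i. complex_of_real (1 / x i)) * P\<^sup>H"
proof -
  obtain P d where P: "unitary_mat n P" "\<And>i. i < n \<Longrightarrow> 0 \<le> d i" "B = P * diag_of n (\<lambda>i. complex_of_real (d i)) * P\<^sup>H"
    using psd_spectral[OF assms] by metis
  note dP = unitary_matD[OF P(1)]
  define x where "x i = sqrt (1 + d i)" for i
  have x: "1 \<le> x i" if "i < n" for i using P(2)[OF that] by (simp add: x_def)
  have D: "diag_of n (\<lambda>i. complex_of_real ((x i)\<^sup>2)) = 1\<^sub>m n + diag_of n (\<lambda>i. complex_of_real (d i))"
    using P(2) by (intro eq_matI) (auto simp: x_def simp del: of_real_power)
  have e1: "1\<^sub>m n + B = P * diag_of n (\<lambda>i. complex_of_real ((x i)\<^sup>2)) * P\<^sup>H"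
    unfolding D P(3) using dP by (simp add: mat_dist)
  let ?S = "P * diag_of n (\<lambda>i. complex_of_real (x i)) * P\<^sup>H"
  let ?R = "P * diag_of n (\<lambda>i. complex_of_real (1 / x i)) * P\<^sup>H"
  have S: "psd_mat n ?S" by (rule psd_of_diag[OF P(1)]) (use x in force)
  have e2: "mat_sqrt (1\<^sub>m n + B) = ?S"
    by (rule mat_sqrt_eqI[OF S]) (unfold psd_sqrt_diag[OF P(1)] e1, simp add: power2_eq_square)
  have i1: "diag_of n (\<lambda>i. complex_of_real (x i) * complex_of_real (1 / x i)) = 1\<^sub>m n"
    "diag_of n (\<lambda>i. complex_of_real (1 / x i) * complex_of_real (x i)) = 1\<^sub>m n"
    using x by (auto intro!: eq_matI simp flip: of_real_mult) (metis not_one_le_zero)+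
  have one: "P * 1\<^sub>m n * P\<^sup>H = 1\<^sub>m n" using dP by simp
  have "mat_inv_sqrt (1\<^sub>m n + B) = ?R"
    by (rule mat_inv_sqrt_eqI[of _ n], unfold e2 psd_sqrt_diag[OF P(1)] i1 one)
      (use dP(1,2) in auto)
  then show thesis using that[OF P(1) x e1 e2] by blast
qed

lemma sqrt_one_plus_props:
  assumes "psd_mat n B"
  defines "A \<equiv> 1\<^sub>m n + B"
  shows "psd_mat n (mat_sqrt A)" "psd_mat n (mat_inv_sqrt A)" "mat_sqrt A * mat_sqrt A = A"
    "mat_sqrt A * mat_inv_sqrt A = 1\<^sub>m n" "mat_inv_sqrt A * mat_sqrt A = 1\<^sub>m n"
    "mat_inv_sqrt A * A = mat_sqrt A" "A * mat_inv_sqrt A = mat_sqrt A"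
    "spectral_norm (mat_inv_sqrt A) \<le> 1"
proof -
  obtain P x where P: "unitary_mat n P" "\<And>i. i < n \<Longrightarrow> 1 \<le> x i"
    and e: "A = P * diag_of n (\<lambda>i. complex_of_real ((x i)\<^sup>2)) * P\<^sup>H"
    and s: "mat_sqrt A = P * diag_of n (\<lambda>i. complex_of_real (x i)) * P\<^sup>H"
    and i: "mat_inv_sqrt A = P * diag_of n (\<lambda>i. complex_of_real (1 / x i)) * P\<^sup>H"
    using sqrt_one_plus[OF assms(1)] unfolding A_def by metis
  note dP = unitary_matD[OF P(1)]
  have x0: "x i \<noteq> 0" "0 \<le> x i" if "i < n" for i using P(2)[OF that] by auto
  have one: "P * diag_of n (\<lambda>i. 1) * P\<^sup>H = 1\<^sub>m n" using dP by (simp add: diag_of_one)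
  show ps: "psd_mat n (mat_sqrt A)" unfolding s by (rule psd_of_diag[OF P(1)]) (use x0 in auto)
  show pi: "psd_mat n (mat_inv_sqrt A)" unfolding i by (rule psd_of_diag[OF P(1)]) (use x0 in auto)
  show ss: "mat_sqrt A * mat_sqrt A = A"
    unfolding s psd_sqrt_diag[OF P(1)] unfolding e by (simp add: power2_eq_square)
  have "diag_of n (\<lambda>i. complex_of_real (x i) * complex_of_real (1 / x i)) = diag_of n (\<lambda>i. 1)"
    "diag_of n (\<lambda>i. complex_of_real (1 / x i) * complex_of_real (x i)) = diag_of n (\<lambda>i. 1)"
    by (auto intro!: diag_of_cong simp: x0)
  then show sr: "mat_sqrt A * mat_inv_sqrt A = 1\<^sub>m n" and rs: "mat_inv_sqrt A * mat_sqrt A = 1\<^sub>m n"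
    unfolding s i psd_sqrt_diag[OF P(1)] using one by simp_all
  note d = psd_dim[OF ps] psd_dim[OF pi]
  have "mat_inv_sqrt A * (mat_sqrt A * mat_sqrt A) = (mat_inv_sqrt A * mat_sqrt A) * mat_sqrt A"
    using d by (simp add: assoc_mm)
  then show "mat_inv_sqrt A * A = mat_sqrt A" unfolding ss rs using d by simp
  have "(mat_sqrt A * mat_sqrt A) * mat_inv_sqrt A = mat_sqrt A * (mat_sqrt A * mat_inv_sqrt A)"
    using d by (simp add: assoc_mm)
  then show "A * mat_inv_sqrt A = mat_sqrt A" unfolding ss sr using d by simp
  show "spectral_norm (mat_inv_sqrt A) \<le> 1"
  proof (rule spectral_norm_le)
    fix v :: "complex vec" assume "dim_vec v = dim_col (mat_inv_sqrt A)"
    then have v: "dim_vec v = n" using d by simp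
    have "(vec_norm2 (mat_inv_sqrt A *\<^sub>v v))\<^sup>2 \<le> (\<Sum>i<n. (cmod ((P\<^sup>H *\<^sub>v v) $ i))\<^sup>2)"
      unfolding i diag_mv_norm_sq[OF P(1) v]
    proof (rule sum_mono)
      fix k assume "k \<in> {..<n}"
      then have "1 \<le> x k" using P(2) by simp
      then have "(cmod (complex_of_real (1 / x k)))\<^sup>2 \<le> 1"
        by (simp add: norm_divide power_le_one)
      then show "(cmod (complex_of_real (1 / x k)))\<^sup>2 * (cmod ((P\<^sup>H *\<^sub>v v) $ k))\<^sup>2 \<le> (cmod ((P\<^sup>H *\<^sub>v v) $ k))\<^sup>2"
        by (rule mult_left_le_one_le[rotated 2]) auto
    qed
    also have "\<dots> = (vec_norm2 v)\<^sup>2" by (rule unitary_coords_norm_sq[OF P(1) v])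
    finally show "vec_norm2 (mat_inv_sqrt A *\<^sub>v v) \<le> 1 * vec_norm2 v"
      using power2_le_imp_le[OF _ vec_norm2_nonneg] by simp
  qed simp
qed

subsection \<open>Contractions and unitarily invariant norms\<close>

lemma uminus_zero_m [simp]: "- 0\<^sub>m m n = (0\<^sub>m m n :: complex mat)"
  by (auto intro: eq_matI)

text \<open>Halmos: \<open>S\<close> and \<open>T\<close> are the square roots of \<open>1 - X\<^sup>H * X\<close> and \<open>1 - X * X\<^sup>H\<close>.\<close>

lemma unitary_dilation:
  assumes X: "X \<in> carrier_mat p q" and le: "spectral_norm X \<le> 1"
  obtains S T where "S \<in> carrier_mat q q" "T \<in> carrier_mat p p"
    "unitary_mat (p + q) (four_block_mat X T S (- (X\<^sup>H)))"
proof -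
  \<comment> \<open>A contraction does not increase \<open>x \<bullet>c x\<close>, so the gap matrix
    is positive semidefinite. It is formulated for general \<open>Y\<close> because it is applied to
    \<open>X\<close> and to \<open>X\<^sup>H\<close>.\<close>
  have gap: "psd_mat k (1\<^sub>m k - Y\<^sup>H * Y)" if Y: "Y \<in> carrier_mat l k" "spectral_norm Y \<le> 1" for Y k l
    unfolding psd_mat_def
  proof (intro conjI ballI)
    have dY: "dim_row Y = l" "dim_col Y = k" using Y by auto
    show "1\<^sub>m k - Y\<^sup>H * Y \<in> carrier_mat k k" using dY by auto
    show "(1\<^sub>m k - Y\<^sup>H * Y)\<^sup>H = 1\<^sub>m k - Y\<^sup>H * Y" using dY by (simp add: adjoint_minus adjoint_mm)
    fix x :: "complex vec" assume x: "x \<in> carrier_vec k"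
    have "vec_norm2 (Y *\<^sub>v x) \<le> spectral_norm Y * vec_norm2 x" using x dY by (intro spectral_norm_bound) auto
    also have "\<dots> \<le> 1 * vec_norm2 x" using Y(2) by (intro mult_right_mono) auto
    finally have "(vec_norm2 (Y *\<^sub>v x))\<^sup>2 \<le> (vec_norm2 x)\<^sup>2" by (intro power_mono) auto
    moreover have "((1\<^sub>m k - Y\<^sup>H * Y) *\<^sub>v x) \<bullet>c x = x \<bullet>c x - (Y *\<^sub>v x) \<bullet>c (Y *\<^sub>v x)"
    proof -
      have "(1\<^sub>m k - Y\<^sup>H * Y) *\<^sub>v x = x - Y\<^sup>H *\<^sub>v (Y *\<^sub>v x)"
        using x dY by (subst minus_mult_distrib_mat_vec[of _ k k]) (auto simp: assoc_mv)
      then have "((1\<^sub>m k - Y\<^sup>H * Y) *\<^sub>v x) \<bullet>c x = x \<bullet>c x - (Y\<^sup>H *\<^sub>v (Y *\<^sub>v x)) \<bullet>c x"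
        by (simp only:) (rule minus_scalar_prod_distrib[of _ k], use x dY in \<open>auto intro!: carrier_vecI\<close>)
      also have "(Y\<^sup>H *\<^sub>v (Y *\<^sub>v x)) \<bullet>c x = (Y *\<^sub>v x) \<bullet>c (Y *\<^sub>v x)"
        using x dY by (simp add: cinner_adjoint)
      finally show ?thesis .
    qed
    ultimately show "0 \<le> Re (((1\<^sub>m k - Y\<^sup>H * Y) *\<^sub>v x) \<bullet>c x)"
      by (simp add: cinner_self del: of_real_power)
  qed
  have dX: "dim_row X = p" "dim_col X = q" using X by auto
  have g1: "psd_mat q (1\<^sub>m q - X\<^sup>H * X)" by (rule gap[OF X le])
  have g2: "psd_mat p (1\<^sub>m p - X * X\<^sup>H)" using gap[of "X\<^sup>H" q p] X le by simp
  define S where "S = mat_sqrt (1\<^sub>m q - X\<^sup>H * X)"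
  define T where "T = mat_sqrt (1\<^sub>m p - X * X\<^sup>H)"
  note S = mat_sqrt[OF g1, folded S_def] and T = mat_sqrt[OF g2, folded T_def]
  note dS = psd_dim[OF S(1)] and dT = psd_dim[OF T(1)]
  \<comment> \<open>\<open>T * T * X = X * (S * S)\<close> since both sides are
    \<open>X - X * X\<^sup>H * X\<close>, so the square roots intertwine too. This cancels the
    off-diagonal blocks of \<open>?U\<^sup>H * ?U\<close>.\<close>
  have TX: "T * X = X * S"
    by (rule psd_intertwine[OF T(1) S(1) X]) (unfold S(2) T(2), use dX in \<open>simp add: mat_dist\<close>)
  have TX': "X\<^sup>H * T = S * X\<^sup>H"
    using arg_cong[OF TX, of mat_adjoint] dX dS dT psd_adjoint[OF S(1)] psd_adjoint[OF T(1)] by (simp add: adjoint_mm)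
  have c1: "X\<^sup>H * X + (1\<^sub>m q - X\<^sup>H * X) = 1\<^sub>m q" "(1\<^sub>m p - X * X\<^sup>H) + X * X\<^sup>H = 1\<^sub>m p"
    using dX by (auto intro!: eq_matI simp del: index_mult_mat(1))
  have c2: "S * X\<^sup>H - S * X\<^sup>H = 0\<^sub>m q p" "X * S - X * S = 0\<^sub>m p q"
    using dX dS by (auto intro!: eq_matI simp del: index_mult_mat(1))
  have c3: "S * X\<^sup>H + - (S * X\<^sup>H) = 0\<^sub>m q p" "X * S + - (X * S) = 0\<^sub>m p q"
    using dX dS by (auto intro!: eq_matI simp del: index_mult_mat(1))
  let ?U = "four_block_mat X T S (- (X\<^sup>H))"
  have "?U\<^sup>H * ?U = four_block_mat (X\<^sup>H * X + S * S) (X\<^sup>H * T + - (S * X\<^sup>H)) (T * X + - (X * S)) (T * T + X * X\<^sup>H)"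
    using dX dS dT psd_adjoint[OF S(1)] psd_adjoint[OF T(1)] by (simp add: block_simps)
  also have "\<dots> = 1\<^sub>m (p + q)"
    unfolding TX TX' S(2) T(2) c1 c3 by (simp add: add.commute)
  finally have "unitary_mat (p + q) ?U"
    using dX dS dT by (intro unitary_matI) (auto intro!: carrier_matI)
  then show thesis using that psd_carrier[OF S(1)] psd_carrier[OF T(1)] by blast
qed

section \<open>Submultiplicativity of unitarily invariant norms\<close>

context
  fixes N :: "complex mat \<Rightarrow> real"
  assumes N: "unitarily_invariant_norm N"
begin

lemma ui_norm_nonneg: "0 \<le> N A"
  using N unfolding unitarily_invariant_norm_def by (metis carrier_matI)

lemma ui_norm_eq_0: "N A = 0 \<longleftrightarrow> A = 0\<^sub>m (dim_row A) (dim_col A)"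
  using N unfolding unitarily_invariant_norm_def by (metis carrier_matI)

lemma ui_norm_zero: "N (0\<^sub>m p q) = 0"
  by (simp add: ui_norm_eq_0)

lemma ui_norm_smult: "N (a \<cdot>\<^sub>m A) = cmod a * N A"
  using N unfolding unitarily_invariant_norm_def by blast

lemma ui_norm_triangle: "dim_row A = dim_row B \<Longrightarrow> dim_col A = dim_col B \<Longrightarrow> N (A + B) \<le> N A + N B"
  using N unfolding unitarily_invariant_norm_def by (metis carrier_matI)

lemma ui_norm_uminus: "N (- A) = N A"
proof -
  have "- A = (-1) \<cdot>\<^sub>m A" by (auto intro: eq_matI)
  then show ?thesis by (simp add: ui_norm_smult)
qed

lemma ui_norm_triangle_minus: "dim_row A = dim_row B \<Longrightarrow> dim_col A = dim_col B \<Longrightarrow> N (A - B) \<le> N A + N B"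
proof -
  assume d: "dim_row A = dim_row B" "dim_col A = dim_col B"
  have "A - B = A + - B" using d by (auto intro: eq_matI)
  then show ?thesis using ui_norm_triangle[of A "- B"] d by (simp add: ui_norm_uminus)
qed

lemma ui_norm_unitary:
  assumes "unitary_mat p P" "unitary_mat q Q" "A \<in> carrier_mat p q"
  shows "N (P * A * Q) = N A"
proof -
  have "N ((P\<^sup>H)\<^sup>H * A * Q) = N A"
    using N assms unitary_mat_adjoint[OF assms(1)] unfolding unitarily_invariant_norm_def by blast
  then show ?thesis by simp
qed

lemma ui_norm_unitary_left:
  assumes "unitary_mat p P" "dim_row A = p"
  shows "N (P * A) = N A"
proof -
  have "A \<in> carrier_mat p (dim_col A)" using assms by (intro carrier_matI) auto
  from ui_norm_unitary[OF assms(1) unitary_mat_one this]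
  show ?thesis by simp
qed

lemma ui_norm_unitary_right:
  assumes "unitary_mat q Q" "dim_col A = q"
  shows "N (A * Q) = N A"
proof -
  have "A \<in> carrier_mat (dim_row A) q" using assms by (intro carrier_matI) auto
  from ui_norm_unitary[OF unitary_mat_one assms(1) this]
  show ?thesis by simp
qed

lemma ui_norm_pad: "B \<in> carrier_mat p q \<Longrightarrow> N (four_block_mat B (0\<^sub>m p l) (0\<^sub>m k q) (0\<^sub>m k l)) = N B"
  using N unfolding unitarily_invariant_norm_def by blast

text \<open>Averaging with the reflections that negate the discarded rows and columns.\<close>

lemma ui_norm_block_le:
  assumes c: "A \<in> carrier_mat p q" "B \<in> carrier_mat p l" "C \<in> carrier_mat k q" "D \<in> carrier_mat k l"
  shows "N A \<le> N (four_block_mat A B C D)"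
proof -
  note d = c[THEN carrier_matD(1)] c[THEN carrier_matD(2)]
  have um: "unitary_mat j (- 1\<^sub>m j)" for j
    by (rule unitary_matI) auto
  let ?Z = "four_block_mat A B C D" and ?Z1 = "four_block_mat A B (0\<^sub>m k q) (0\<^sub>m k l)"
    and ?Z2 = "four_block_mat A (0\<^sub>m p l) (0\<^sub>m k q) (0\<^sub>m k l)"
  let ?J = "four_block_mat (1\<^sub>m p) (0\<^sub>m p k) (0\<^sub>m k p) (- 1\<^sub>m k)"
  let ?K = "four_block_mat (1\<^sub>m q) (0\<^sub>m q l) (0\<^sub>m l q) (- 1\<^sub>m l)"
  have J: "unitary_mat (p + k) ?J" by (rule unitary_block[OF unitary_mat_one um])
  have K: "unitary_mat (q + l) ?K" by (rule unitary_block[OF unitary_mat_one um])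
  have eJ: "?J * ?Z = four_block_mat A B (- C) (- D)" using d by (simp add: block_simps mat_dist)
  have eK: "?Z1 * ?K = four_block_mat A (- B) (0\<^sub>m k q) (0\<^sub>m k l)" using d by (simp add: block_simps mat_dist)
  have half: "N X \<le> N Y" if "2 \<cdot>\<^sub>m X = Y + Y'" "N Y' = N Y" "dim_row Y' = dim_row Y" "dim_col Y' = dim_col Y" for X Y Y'
  proof -
    have "2 * N X = N (Y + Y')" unfolding that(1)[symmetric] ui_norm_smult by simp
    also have "\<dots> \<le> N Y + N Y'" using that by (intro ui_norm_triangle) auto
    finally show ?thesis using that by simp
  qed
  have "N ?Z1 \<le> N ?Z"
  proof (rule half)
    show "2 \<cdot>\<^sub>m ?Z1 = ?Z + ?J * ?Z" unfolding eJ by (intro eq_matI) (use c in auto)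
    show "N (?J * ?Z) = N ?Z" by (rule ui_norm_unitary_left[OF J]) (use d in auto)
  qed (use d in auto)
  moreover have "N ?Z2 \<le> N ?Z1"
  proof (rule half)
    show "2 \<cdot>\<^sub>m ?Z2 = ?Z1 + ?Z1 * ?K" unfolding eK by (intro eq_matI) (use c in auto)
    show "N (?Z1 * ?K) = N ?Z1" by (rule ui_norm_unitary_right[OF K]) (use d in auto)
  qed (use d in auto)
  ultimately show ?thesis using ui_norm_pad[OF c(1), of l k] by simp
qed

text \<open>Extend \<open>X\<close> to a unitary matrix and \<open>Y\<close> by zero rows:
  \<open>X * Y\<close> is the upper block of the product, whose norm is that of \<open>Y\<close>,
  and discarding the lower block does not increase the norm.\<close>

lemma ui_norm_contraction_left:
  assumes X: "X \<in> carrier_mat p q" and le: "spectral_norm X \<le> 1" and Y: "Y \<in> carrier_mat q k"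
  shows "N (X * Y) \<le> N Y"
proof -
  obtain S T where ST: "S \<in> carrier_mat q q" "T \<in> carrier_mat p p"
    and U: "unitary_mat (p + q) (four_block_mat X T S (- (X\<^sup>H)))"
    using unitary_dilation[OF X le] by blast
  let ?U = "four_block_mat X T S (- (X\<^sup>H))"
  let ?Y = "four_block_mat Y (0\<^sub>m q 0) (0\<^sub>m p k) (0\<^sub>m p 0)"
  note d = X[THEN carrier_matD(1)] X[THEN carrier_matD(2)] Y[THEN carrier_matD(1)] Y[THEN carrier_matD(2)]
    ST[THEN carrier_matD(1)] ST[THEN carrier_matD(2)]
  have "?U * ?Y = four_block_mat (X * Y) (0\<^sub>m p 0) (S * Y) (0\<^sub>m q 0)"
    using d by (simp add: block_simps mat_dist)
  then have "N (X * Y) \<le> N (?U * ?Y)"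
    using ui_norm_block_le[OF mult_carrier_mat[OF X Y] zero_carrier_mat mult_carrier_mat[OF ST(1) Y] zero_carrier_mat, of 0]
    by simp
  also have "\<dots> = N ?Y" by (rule ui_norm_unitary_left[OF U]) (use d in auto)
  also have "\<dots> = N Y" by (rule ui_norm_pad[OF Y])
  finally show ?thesis .
qed

lemma ui_norm_contraction_right:
  assumes X: "X \<in> carrier_mat p q" and le: "spectral_norm X \<le> 1" and Y: "Y \<in> carrier_mat k p"
  shows "N (Y * X) \<le> N Y"
proof -
  obtain S T where ST: "S \<in> carrier_mat q q" "T \<in> carrier_mat p p"
    and U: "unitary_mat (p + q) (four_block_mat X T S (- (X\<^sup>H)))"
    using unitary_dilation[OF X le] by blast
  let ?U = "four_block_mat X T S (- (X\<^sup>H))"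
  let ?Y = "four_block_mat Y (0\<^sub>m k q) (0\<^sub>m 0 p) (0\<^sub>m 0 q)"
  note d = X[THEN carrier_matD(1)] X[THEN carrier_matD(2)] Y[THEN carrier_matD(1)] Y[THEN carrier_matD(2)]
    ST[THEN carrier_matD(1)] ST[THEN carrier_matD(2)]
  have "?Y * ?U = four_block_mat (Y * X) (Y * T) (0\<^sub>m 0 q) (0\<^sub>m 0 p)"
    using d by (simp add: block_simps mat_dist)
  then have "N (Y * X) \<le> N (?Y * ?U)"
    using ui_norm_block_le[OF mult_carrier_mat[OF Y X] mult_carrier_mat[OF Y ST(2)] zero_carrier_mat zero_carrier_mat, of 0]
    by simp
  also have "\<dots> = N ?Y" by (rule ui_norm_unitary_right[OF U]) (use d in auto)
  also have "\<dots> = N Y" by (rule ui_norm_pad[OF Y])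
  finally show ?thesis .
qed

text \<open>The strict bound keeps \<open>t\<close> positive even for \<open>X = 0\<close>, where
  division by the norm itself would fail. The two product estimates are proved for every such
  \<open>t\<close> and then for the limit at the spectral norm.\<close>

lemma scaled_contraction:
  assumes "spectral_norm X < t"
  shows "spectral_norm (complex_of_real (1 / t) \<cdot>\<^sub>m X) \<le> 1" "X = complex_of_real t \<cdot>\<^sub>m (complex_of_real (1 / t) \<cdot>\<^sub>m X)" "0 < t"
proof -
  show t: "0 < t" using assms spectral_norm_nonneg[of X] by linarith
  have "spectral_norm (complex_of_real (1 / t) \<cdot>\<^sub>m X) \<le> cmod (complex_of_real (1 / t)) * spectral_norm X"
    by (rule spectral_norm_smult)
  also have "cmod (complex_of_real (1 / t)) = 1 / t" using t by (simp add: norm_divide)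
  also have "1 / t * spectral_norm X \<le> 1" using t assms by simp
  finally show "spectral_norm (complex_of_real (1 / t) \<cdot>\<^sub>m X) \<le> 1" .
  show "X = complex_of_real t \<cdot>\<^sub>m (complex_of_real (1 / t) \<cdot>\<^sub>m X)" using t by (intro eq_matI) auto
qed

lemma ui_norm_mult_left:
  assumes "dim_col X = dim_row Y"
  shows "N (X * Y) \<le> spectral_norm X * N Y"
proof -
  have "N (X * Y) \<le> t * N Y" if t: "spectral_norm X < t" for t
  proof -
    let ?X = "complex_of_real (1 / t) \<cdot>\<^sub>m X"
    note s = scaled_contraction[OF t]
    have "X * Y = complex_of_real t \<cdot>\<^sub>m (?X * Y)"
    proof -
      have "X * Y = (complex_of_real t \<cdot>\<^sub>m ?X) * Y" using s(2) by simp
      also have "\<dots> = complex_of_real t \<cdot>\<^sub>m (?X * Y)"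
        by (rule mult_smult_assoc_mat[of _ "dim_row X" "dim_col X" _ "dim_col Y"]) (use assms in \<open>auto intro!: carrier_matI\<close>)
      finally show ?thesis .
    qed
    then have "N (X * Y) = t * N (?X * Y)" using s(3) by (simp add: ui_norm_smult)
    also have "\<dots> \<le> t * N Y"
      by (intro mult_left_mono ui_norm_contraction_left[of _ "dim_row X" "dim_col X" _ "dim_col Y"])
        (use s assms in \<open>auto intro!: carrier_matI\<close>)
    finally show ?thesis .
  qed
  then have "N (X * Y) \<le> (spectral_norm X + e) * N Y" if "e > 0" for e using that by simp
  moreover have "((\<lambda>e. (spectral_norm X + e) * N Y) \<longlongrightarrow> (spectral_norm X + 0) * N Y) (at_right 0)"
    by (intro tendsto_intros)
  ultimately have "N (X * Y) \<le> (spectral_norm X + 0) * N Y"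
    by (intro tendsto_lowerbound[where F = "at_right (0::real)"]) (auto simp: eventually_at_right_less intro: eventually_mono[OF eventually_at_right_less])
  then show ?thesis by simp
qed

lemma ui_norm_mult_right:
  assumes "dim_col Y = dim_row X"
  shows "N (Y * X) \<le> N Y * spectral_norm X"
proof -
  have "N (Y * X) \<le> N Y * t" if t: "spectral_norm X < t" for t
  proof -
    let ?X = "complex_of_real (1 / t) \<cdot>\<^sub>m X"
    note s = scaled_contraction[OF t]
    have "Y * X = complex_of_real t \<cdot>\<^sub>m (Y * ?X)"
    proof -
      have "Y * X = Y * (complex_of_real t \<cdot>\<^sub>m ?X)" using s(2) by simp
      also have "\<dots> = complex_of_real t \<cdot>\<^sub>m (Y * ?X)"
        by (rule mult_smult_distrib[of _ "dim_row Y" "dim_col Y" _ "dim_col X"]) (use assms in \<open>auto intro!: carrier_matI\<close>)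
      finally show ?thesis .
    qed
    then have "N (Y * X) = t * N (Y * ?X)" using s(3) by (simp add: ui_norm_smult)
    also have "\<dots> \<le> t * N Y"
      by (intro mult_left_mono ui_norm_contraction_right[of _ "dim_row X" "dim_col X" _ "dim_row Y"])
        (use s assms in \<open>auto intro!: carrier_matI\<close>)
    finally show ?thesis by (simp add: mult.commute)
  qed
  then have "N (Y * X) \<le> N Y * (spectral_norm X + e)" if "e > 0" for e using that by simp
  moreover have "((\<lambda>e. N Y * (spectral_norm X + e)) \<longlongrightarrow> N Y * (spectral_norm X + 0)) (at_right 0)"
    by (intro tendsto_intros)
  ultimately have "N (Y * X) \<le> N Y * (spectral_norm X + 0)"
    by (intro tendsto_lowerbound[where F = "at_right (0::real)"]) (auto intro: eventually_mono[OF eventually_at_right_less])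
  then show ?thesis by simp
qed

end

section \<open>Comparison with the spectral norm and with the entries\<close>

lemma rank_col_mat:
  fixes y :: "complex vec"
  assumes "y \<noteq> 0\<^sub>v (dim_vec y)"
  shows "vec_space.rank (dim_vec y) (mat_of_cols (dim_vec y) [y]) = 1"
proof -
  interpret vec_space "TYPE(complex)" "dim_vec y" .
  have y: "y \<in> carrier_vec (dim_vec y)" by simp
  note bc = basis_completion[OF y assms]
  have "0 < dim_vec y"
  proof (rule ccontr)
    assume "\<not> 0 < dim_vec y"
    then have "y = 0\<^sub>v (dim_vec y)" by (intro eq_vecI) auto
    with assms show False by simp
  qed
  then have "basis_completion y \<noteq> []" using bc(6) by (metis length_greater_0_conv)
  then have "y \<in> set (basis_completion y)" using bc(7) by (metis list.set_sel(1))
  then have li: "lin_indpt {y}" using bc(5) subset_li_is_li[of "set (basis_completion y)" "{y}"] by auto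
  have cols: "cols (mat_of_cols (dim_vec y) [y]) = [y]" by (rule cols_mat_of_cols) simp
  show ?thesis
    by (rule lin_indpt_full_rank[of _ 1]) (use li in \<open>auto simp: cols\<close>)
qed

lemma spectral_norm_col_mat: "spectral_norm (mat_of_cols (dim_vec y) [y]) = vec_norm2 y"
proof -
  let ?M = "mat_of_cols (dim_vec y) [y]"
  have e: "?M *\<^sub>v z = z $ 0 \<cdot>\<^sub>v y" "vec_norm2 z = cmod (z $ 0)" if "dim_vec z = 1" for z
  proof -
    show "?M *\<^sub>v z = z $ 0 \<cdot>\<^sub>v y"
      using that by (intro eq_vecI) (auto simp: scalar_prod_def mat_of_cols_def)
    have "(vec_norm2 z)\<^sup>2 = (cmod (z $ 0))\<^sup>2" unfolding vec_norm2_sq that by simp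
    then show "vec_norm2 z = cmod (z $ 0)" by simp
  qed
  show ?thesis
  proof (rule antisym)
    show "spectral_norm ?M \<le> vec_norm2 y" by (rule spectral_norm_le) (auto simp: e)
    have "vec_norm2 (?M *\<^sub>v vec 1 (\<lambda>_. 1)) \<le> spectral_norm ?M * vec_norm2 (vec 1 (\<lambda>_. 1) :: complex vec)"
      by (rule spectral_norm_bound) simp
    then show "vec_norm2 y \<le> spectral_norm ?M" by (simp add: e)
  qed
qed

text \<open>Apply \<open>X\<close> to the one-column matrix of \<open>x\<close>. Unless the result
  is zero it has rank one, so the normalization of the norm on such matrices identifies its norm
  with its Euclidean length; submultiplicativity does the rest.\<close>

lemma spectral_norm_le_ui_norm:
  assumes N: "unitarily_invariant_norm N"
  shows "spectral_norm X \<le> N X"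
proof (rule spectral_norm_le)
  show "0 \<le> N X" by (rule ui_norm_nonneg[OF N])
  fix x :: "complex vec" assume x: "dim_vec x = dim_col X"
  let ?y = "X *\<^sub>v x"
  let ?C = "mat_of_cols (dim_vec x) [x]"
  have c: "mat_of_cols (dim_vec ?y) [?y] = X * ?C"
    using x by (intro eq_matI) (auto simp: mat_of_cols_def scalar_prod_def)
  show "vec_norm2 ?y \<le> N X * vec_norm2 x"
  proof (cases "?y = 0\<^sub>v (dim_vec ?y)")
    case True
    then have "vec_norm2 ?y = 0" by simp
    then show ?thesis using ui_norm_nonneg[OF N] by simp
  next
    case False
    have "vec_norm2 ?y = spectral_norm (mat_of_cols (dim_vec ?y) [?y])" by (simp only: spectral_norm_col_mat)
    also have "\<dots> = N (mat_of_cols (dim_vec ?y) [?y])"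
      using N rank_col_mat[OF False] unfolding unitarily_invariant_norm_def by (metis mat_of_cols_carrier(2))
    also have "\<dots> \<le> N X * spectral_norm ?C" unfolding c using x by (intro ui_norm_mult_right[OF N]) auto
    finally show ?thesis by (simp only: spectral_norm_col_mat)
  qed
qed

lemma entry_le_spectral_norm:
  assumes "i < dim_row A" "j < dim_col A"
  shows "cmod (A $$ (i, j)) \<le> spectral_norm A"
proof -
  let ?e = "unit_vec (dim_col A) j :: complex vec"
  have n: "vec_norm2 ?e = 1"
  proof -
    have "(vec_norm2 ?e)\<^sup>2 = (\<Sum>k<dim_col A. if k = j then 1 else 0)"
      unfolding vec_norm2_sq using assms(2) by (intro sum.cong) auto
    also have "\<dots> = 1" using assms by simp
    finally show ?thesis using real_sqrt_unique[OF _ vec_norm2_nonneg, of ?e 1] by simp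
  qed
  have "A $$ (i, j) = (A *\<^sub>v ?e) $ i" using assms by simp
  also have "cmod \<dots> \<le> vec_norm2 (A *\<^sub>v ?e)"
    unfolding vec_norm2_def by (rule order_trans[OF _ member_le_L2_set[of _ i]]) (use assms in auto)
  also have "\<dots> \<le> spectral_norm A * vec_norm2 ?e" by (rule spectral_norm_bound) simp
  finally show ?thesis by (simp add: n)
qed

text \<open>Expansion in the matrix units \<open>E ij\<close>, with \<open>K\<close> the sum of
  their norms. Hence entrywise convergence implies convergence in every unitarily invariant
  norm.\<close>

lemma ui_norm_le_sum_entries:
  assumes N: "unitarily_invariant_norm N"
  shows "\<exists>K \<ge> 0. \<forall>A \<in> carrier_mat p q. N A \<le> K * (\<Sum>i<p. \<Sum>j<q. cmod (A $$ (i, j)))"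
proof -
  define E where "E ij = mat p q (\<lambda>kl. if kl = ij then 1 else 0 :: complex)" for ij
  define K where "K = (\<Sum>ij\<in>{..<p} \<times> {..<q}. N (E ij))"
  have K: "0 \<le> K" "\<And>ij. ij \<in> {..<p} \<times> {..<q} \<Longrightarrow> N (E ij) \<le> K"
    unfolding K_def by (auto intro!: sum_nonneg member_le_sum[where f = "\<lambda>ij. N (E ij)"] ui_norm_nonneg[OF N])
  have "N A \<le> K * (\<Sum>i<p. \<Sum>j<q. cmod (A $$ (i, j)))" if A: "A \<in> carrier_mat p q" for A
  proof -
    define R where "R F = mat p q (\<lambda>ij. if ij \<in> F then A $$ ij else 0)" for F
    have "N (R F) \<le> (\<Sum>ij\<in>F. K * cmod (A $$ ij))" if "finite F" "F \<subseteq> {..<p} \<times> {..<q}" for F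
      using that
    proof (induction F rule: finite_induct)
      case empty
      have "R {} = 0\<^sub>m p q" by (auto simp: R_def intro!: eq_matI)
      then show ?case by (simp add: ui_norm_zero[OF N])
    next
      case (insert ij F)
      have "R (insert ij F) = A $$ ij \<cdot>\<^sub>m E ij + R F"
        using insert.hyps by (intro eq_matI) (auto simp: R_def E_def)
      then have "N (R (insert ij F)) \<le> N (A $$ ij \<cdot>\<^sub>m E ij) + N (R F)"
        using ui_norm_triangle[OF N, of "A $$ ij \<cdot>\<^sub>m E ij" "R F"] by (simp add: E_def R_def)
      also have "\<dots> \<le> cmod (A $$ ij) * K + (\<Sum>ij\<in>F. K * cmod (A $$ ij))"
        unfolding ui_norm_smult[OF N] using insert by (intro add_mono mult_left_mono K(2)) auto
      finally show ?case using insert.hyps by (simp add: mult.commute)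
    qed
    from this[of "{..<p} \<times> {..<q}"]
    have "N (R ({..<p} \<times> {..<q})) \<le> K * (\<Sum>ij\<in>{..<p} \<times> {..<q}. cmod (A $$ ij))"
      by (simp add: sum_distrib_left)
    moreover have "R ({..<p} \<times> {..<q}) = A" using A by (intro eq_matI) (auto simp: R_def)
    moreover have "(\<Sum>ij\<in>{..<p} \<times> {..<q}. cmod (A $$ ij)) = (\<Sum>i<p. \<Sum>j<q. cmod (A $$ (i, j)))"
      by (simp add: sum.cartesian_product)
    ultimately show ?thesis by simp
  qed
  with K(1) show ?thesis by blast
qed

lemma ui_norm_tendsto_0:
  assumes N: "unitarily_invariant_norm N" and X: "\<And>k. X k \<in> carrier_mat p q" and L: "L \<in> carrier_mat p q"
    and lim: "\<And>i j. i < p \<Longrightarrow> j < q \<Longrightarrow> (\<lambda>k. X k $$ (i, j)) \<longlonglongrightarrow> L $$ (i, j)"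
  shows "(\<lambda>k. N (X k - L)) \<longlonglongrightarrow> 0"
proof -
  obtain K where K: "\<And>A. A \<in> carrier_mat p q \<Longrightarrow> N A \<le> K * (\<Sum>i<p. \<Sum>j<q. cmod (A $$ (i, j)))"
    using ui_norm_le_sum_entries[OF N] by metis
  have "(\<lambda>k. K * (\<Sum>i<p. \<Sum>j<q. cmod (X k $$ (i, j) - L $$ (i, j)))) \<longlonglongrightarrow> K * (\<Sum>i<p. \<Sum>j<q. 0)"
    by (intro tendsto_intros tendsto_norm_zero LIM_zero lim) auto
  then have lim0: "(\<lambda>k. K * (\<Sum>i<p. \<Sum>j<q. cmod (X k $$ (i, j) - L $$ (i, j)))) \<longlonglongrightarrow> 0" by simp
  have le: "N (X k - L) \<le> K * (\<Sum>i<p. \<Sum>j<q. cmod (X k $$ (i, j) - L $$ (i, j)))" for k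
    using K[OF minus_carrier_mat[OF L, of "X k"]] X[of k] L by auto
  show ?thesis
  proof (rule tendsto_0_le[OF lim0, where K = 1], intro always_eventually allI)
    fix k
    show "norm (N (X k - L)) \<le> norm (K * (\<Sum>i<p. \<Sum>j<q. cmod (X k $$ (i, j) - L $$ (i, j)))) * 1"
      unfolding real_norm_def using le[of k] ui_norm_nonneg[OF N, of "X k - L"] by linarith
  qed
qed

subsection \<open>A discrete version of Sz.-Nagy's extremal problem\<close>

lemma sum_int_shift:
  fixes f :: "int \<Rightarrow> real"
  assumes "\<And>j. f (j + int K) = f j"
  shows "(\<Sum>j<K. f (int j + 1)) = (\<Sum>j<K. f (int j))"
proof -
  have "(\<Sum>j<Suc K. f (int j)) = f 0 + (\<Sum>j<K. f (int (Suc j)))"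
    by (subst sum.lessThan_Suc_shift) simp
  then show ?thesis using assms[of 0] by (simp add: add.commute)
qed

text \<open>Orthogonality of the characters modulo \<open>K\<close>, in real form. Off the multiples
  of \<open>K\<close> the factor \<open>sin y\<close> is nonzero, and multiplication by
  \<open>2 * sin y\<close> makes the sum telescope.\<close>

lemma sum_cos_period:
  fixes a :: int
  assumes K: "0 < K"
  shows "(\<Sum>l<K. cos (2 * pi * real_of_int a / real K * real l)) = (if int K dvd a then real K else 0)"
proof (cases "int K dvd a")
  case True
  then obtain b where b: "a = int K * b" by (elim dvdE)
  have "cos (2 * pi * real_of_int a / real K * real l) = 1" for l
  proof -
    have "2 * pi * real_of_int a / real K * real l = real_of_int (b * int l) * (2 * pi)"
      using K by (simp add: b field_simps)
    then show ?thesis unfolding cos_one_2pi_int by (intro exI[of _ "b * int l"]) simp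
  qed
  then show ?thesis using True by simp
next
  case False
  define y where "y = pi * real_of_int a / real K"
  have arg: "2 * pi * real_of_int a / real K * real l = 2 * y * real l" for l
    by (simp add: y_def)
  have s0: "sin y \<noteq> 0"
  proof
    assume "sin y = 0"
    then obtain i where "y = real_of_int i * pi" by (auto simp: sin_zero_iff_int2)
    then have "real_of_int a = real_of_int (i * int K)" using K by (simp add: y_def field_simps)
    then have "a = i * int K" by (simp only: of_int_eq_iff)
    with False show False by simp
  qed
  have "2 * sin y * (\<Sum>l<k. cos (2 * y * real l)) = sin ((2 * real k - 1) * y) + sin y" for k
  proof (induction k)
    case (Suc k)
    have "2 * sin y * cos (2 * y * real k) = sin ((2 * real k + 1) * y) - sin ((2 * real k - 1) * y)"
      using sin_diff[of "2 * y * real k" y] sin_add[of "2 * y * real k" y]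
      by (simp add: algebra_simps)
    then show ?case using Suc by (simp add: algebra_simps)
  qed simp
  from this[of K] have "2 * sin y * (\<Sum>l<K. cos (2 * y * real l)) = sin (2 * pi * real_of_int a - y) + sin y"
    using K by (simp add: y_def algebra_simps)
  also have "\<dots> = 0" by (simp add: sin_diff sin_int_2pin cos_int_2pin)
  finally show ?thesis using False s0 unfolding arg by simp
qed

text \<open>The terms \<open>p\<close> and \<open>p + L\<close> belong to angles that differ by
  \<open>pi / 2\<close>, and \<open>1 / (sin y)\<^sup>2 + 1 / (cos y)\<^sup>2 = 4 / (sin (2 *
  y))\<^sup>2\<close>; so doubling the number of terms multiplies the sum by 4. This is why
  \<open>sz_nagy_discrete\<close> works with a power of two.\<close>

lemma sum_cosec_sq:
  "(\<Sum>p<2 ^ k. 1 / (sin (pi * (2 * real p + 1) / (2 * 2 ^ k)))\<^sup>2) = (2 ^ k)\<^sup>2"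
proof (induction k)
  case (Suc k)
  define L :: nat where "L = 2 ^ k"
  have L: "0 < L" by (simp add: L_def)
  have Lr: "real L = 2 ^ k" by (simp add: L_def)
  define y where "y p = pi * (2 * real p + 1) / (4 * real L)" for p :: nat
  define f where "f p = 1 / (sin (y p))\<^sup>2" for p
  have step: "f p + f (p + L) = 4 / (sin (pi * (2 * real p + 1) / (2 * 2 ^ k)))\<^sup>2" if "p < L" for p
  proof -
    have yL: "y (p + L) = y p + pi / 2" using L by (simp add: y_def field_simps)
    have "2 * real p + 1 < 2 * real L" using that by linarith
    from mult_strict_left_mono[OF this pi_gt_zero]
    have y: "0 < y p" "y p < pi / 2" using L by (auto simp: y_def field_simps intro!: add_pos_nonneg)
    then have s: "sin (y p) \<noteq> 0" "cos (y p) \<noteq> 0"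
      using sin_gt_zero2[of "y p"] cos_gt_zero[of "y p"] by auto
    have s2: "pi * (2 * real p + 1) / (2 * 2 ^ k) = 2 * y p" using L by (simp add: y_def Lr[symmetric] field_simps)
    have "f p + f (p + L) = 1 / (sin (y p))\<^sup>2 + 1 / (cos (y p))\<^sup>2"
      unfolding f_def yL by (simp add: sin_add)
    also have "\<dots> = ((sin (y p))\<^sup>2 + (cos (y p))\<^sup>2) / ((sin (y p))\<^sup>2 * (cos (y p))\<^sup>2)"
      using s by (simp add: field_simps)
    also have "\<dots> = 4 / (2 * sin (y p) * cos (y p))\<^sup>2" by (simp add: power_mult_distrib)
    finally show ?thesis unfolding s2 sin_double .
  qed
  have split: "(\<Sum>p<L + b. f p) = (\<Sum>p<L. f p) + (\<Sum>p<b. f (p + L))" for b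
    by (induction b) (auto simp: add_ac)
  have "(\<Sum>p<2 ^ Suc k. 1 / (sin (pi * (2 * real p + 1) / (2 * 2 ^ Suc k)))\<^sup>2) = (\<Sum>p<L + L. f p)"
    by (rule sum.cong) (auto simp: L_def f_def y_def)
  also have "\<dots> = (\<Sum>p<L. f p) + (\<Sum>p<L. f (p + L))"
    by (rule split)
  also have "\<dots> = (\<Sum>p<L. 4 / (sin (pi * (2 * real p + 1) / (2 * 2 ^ k)))\<^sup>2)"
    by (simp add: sum.distrib[symmetric] step)
  also have "\<dots> = 4 * (2 ^ k)\<^sup>2"
    unfolding Suc[symmetric] by (simp add: L_def sum_distrib_left)
  finally show ?case by (simp add: power_mult_distrib)
qed simp

text \<open>The increments in \<open>l\<close> of the cotangent sum are sums of cosines that vanish for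
  \<open>0 < l\<close> and \<open>l + 1 < L\<close>, so the sum is constant in that range.\<close>

lemma square_wave:
  assumes L: "0 < L"
  defines "x p \<equiv> pi * (2 * real p + 1) / (2 * real L)"
  shows "(\<Sum>p<L. cot (x p) * sin (2 * x p * real l)) * sin (pi * real l / real L) = real L * \<bar>sin (pi * real l / real L)\<bar>"
proof -
  define S where "S l = (\<Sum>p<L. cot (x p) * sin (2 * x p * real l))" for l :: nat
  define C where "C l = (\<Sum>p<L. cos (2 * x p * real l))" for l :: nat
  have sx: "sin (x p) \<noteq> 0" if "p < L" for p
  proof -
    have "2 * real p + 1 < 2 * real L" using that by linarith
    from mult_strict_left_mono[OF this pi_gt_zero]
    have "0 < x p" "x p < pi" using L by (auto simp: x_def field_simps intro!: add_pos_nonneg)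
    then show ?thesis using sin_gt_zero[of "x p"] by simp
  qed
  have C: "C l = 0" if "1 \<le> l" "l < L" for l
  proof -
    define y where "y = pi * real l / real L"
    have "0 < y" "y < pi" using that by (auto simp: y_def field_simps)
    then have s0: "sin y \<noteq> 0" using sin_gt_zero[of y] by simp
    have arg: "2 * x p * real l = (2 * real p + 1) * y" for p using L by (simp add: x_def y_def field_simps)
    \<comment> \<open>Another telescoping sum; for \<open>k = L\<close> its end value
      \<open>sin (2 * pi * l)\<close> vanishes.\<close>
    have "2 * sin y * (\<Sum>p<k. cos ((2 * real p + 1) * y)) = sin (2 * real k * y)" for k
    proof (induction k)
      case (Suc k)
      have "2 * sin y * cos ((2 * real k + 1) * y) = sin ((2 * real k + 2) * y) - sin (2 * real k * y)"
        using sin_diff[of "(2 * real k + 1) * y" y] sin_add[of "(2 * real k + 1) * y" y]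
        by (simp add: algebra_simps)
      then show ?case using Suc by (simp add: algebra_simps)
    qed simp
    from this[of L] have "2 * sin y * C l = sin (2 * real L * y)" by (simp only: C_def arg)
    also have "2 * real L * y = 2 * pi * real l" using L by (simp add: y_def)
    also have "sin (2 * pi * real l) = 0" using sin_npi2[of "2 * l"] by (simp add: mult_ac)
    finally show ?thesis using s0 by simp
  qed
  have S: "S l = real L" if "1 \<le> l" "l < L" for l
    using that
  proof (induction l rule: nat_induct_at_least)
    case base
    have "S 1 = (\<Sum>p<L. 1 + cos (2 * x p))"
      unfolding S_def
    proof (rule sum.cong)
      fix p assume "p \<in> {..<L}"
      then have "sin (x p) \<noteq> 0" using sx by simp
      then have "cot (x p) * sin (2 * x p) = 2 * (cos (x p))\<^sup>2"
        by (simp add: cot_def sin_double power2_eq_square)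
      also have "\<dots> = 1 + cos (2 * x p)" by (simp add: cos_double_cos)
      finally show "cot (x p) * sin (2 * x p * real 1) = 1 + cos (2 * x p)" by simp
    qed simp
    also have "\<dots> = real L + C 1" by (simp add: sum.distrib C_def)
    finally show ?case using C[of 1] base by simp
  next
    case (Suc l)
    have "S (Suc l) - S l = (\<Sum>p<L. cos (2 * x p * real (Suc l)) + cos (2 * x p * real l))"
      unfolding S_def sum_subtractf[symmetric]
    proof (rule sum.cong)
      fix p assume "p \<in> {..<L}"
      then have s: "sin (x p) \<noteq> 0" using sx by simp
      define u where "u = x p * (2 * real l + 1)"
      have u: "2 * x p * real (Suc l) = u + x p" "2 * x p * real l = u - x p"
        by (simp_all add: u_def algebra_simps)
      show "cot (x p) * sin (2 * x p * real (Suc l)) - cot (x p) * sin (2 * x p * real l)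
        = cos (2 * x p * real (Suc l)) + cos (2 * x p * real l)"
        unfolding u using s by (simp add: sin_add sin_diff cos_add cos_diff cot_def field_simps)
    qed simp
    also have "\<dots> = C (Suc l) + C l" by (simp add: sum.distrib C_def)
    finally show ?case using Suc C[of l] C[of "Suc l"] by simp
  qed
  \<comment> \<open>Both factors have period \<open>2 * L\<close> in \<open>l\<close>: raising
    \<open>l\<close> by \<open>2 * L\<close> changes \<open>2 * x p * l\<close> by an odd multiple
    of \<open>2 * pi\<close>.\<close>
  define t where "t = l mod (2 * L)"
  define q where "q = l div (2 * L)"
  have l: "l = 2 * L * q + t" by (simp add: t_def q_def)
  have t: "t < 2 * L" using L by (simp add: t_def)
  have per: "sin (u + 2 * pi * real k) = sin u" for u k
    using sin_npi2[of "2 * k"] cos_npi2[of "2 * k"] by (simp add: sin_add mult_ac)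
  have St: "S l = S t"
    unfolding S_def
  proof (intro sum.cong refl)
    fix p
    have "2 * x p * real l = 2 * x p * real t + 2 * pi * real ((2 * p + 1) * q)"
      using L by (simp add: x_def l field_simps)
    then show "cot (x p) * sin (2 * x p * real l) = cot (x p) * sin (2 * x p * real t)" by (simp only: per)
  qed
  have "pi * real l / real L = pi * real t / real L + 2 * pi * real q"
    using L by (simp add: l field_simps)
  then have st: "sin (pi * real l / real L) = sin (pi * real t / real L)" by (simp only: per)
  \<comment> \<open>At \<open>t = 0\<close> and \<open>t = L\<close> the sine factor vanishes.
    Beyond \<open>L\<close> the reflection \<open>u = 2 * L - t\<close> changes the sign of both
    factors.\<close>
  consider "t = 0" | "1 \<le> t" "t < L" | "t = L" | "L < t" by linarith
  then have "S t * sin (pi * real t / real L) = real L * \<bar>sin (pi * real t / real L)\<bar>"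
  proof cases
    case 2
    then have "0 \<le> sin (pi * real t / real L)" by (intro sin_ge_zero) (auto simp: field_simps)
    then show ?thesis using S[OF 2] by simp
  next
    case 4
    define u where "u = 2 * L - t"
    have u: "1 \<le> u" "u < L" using 4 t by (auto simp: u_def)
    have tu: "real t = 2 * real L - real u" using t 4 by (simp add: u_def)
    have neg: "sin (2 * pi * real k - v) = - sin v" for v k
      using sin_npi2[of "2 * k"] cos_npi2[of "2 * k"] by (simp add: sin_diff mult_ac)
    have "S t = - S u"
      unfolding S_def sum_negf[symmetric]
    proof (intro sum.cong refl)
      fix p
      have "2 * x p * real t = 2 * pi * real (2 * p + 1) - 2 * x p * real u"
        using L by (simp add: x_def tu field_simps)
      then have "sin (2 * x p * real t) = - sin (2 * x p * real u)" by (simp only: neg)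
      then show "cot (x p) * sin (2 * x p * real t) = - (cot (x p) * sin (2 * x p * real u))" by simp
    qed
    moreover have "pi * real t / real L = 2 * pi * real (1 :: nat) - pi * real u / real L"
      using L by (simp add: tu field_simps)
    then have "sin (pi * real t / real L) = - sin (pi * real u / real L)" by (simp only: neg)
    moreover have "0 \<le> sin (pi * real u / real L)" using u by (intro sin_ge_zero) (auto simp: field_simps)
    ultimately show ?thesis using S[OF u] by simp
  qed (use L in auto)
  then show ?thesis unfolding st St[symmetric] by (simp add: S_def)
qed

text \<open>The second difference of \<open>h\<close> has sum zero over a period and is nonnegative off the origin, so
  its cosine coefficients are at most zero. They are those of \<open>h\<close> times \<open>2 * cos \<theta> - 2\<close>.\<close>

lemma cosine_coeff_nonneg:
  fixes h :: "int \<Rightarrow> real"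
  assumes per: "\<And>j. h (j + int K) = h j" and even: "\<And>j. h (- j) = h j"
    and conv: "\<And>j. 0 < j \<Longrightarrow> j < int K \<Longrightarrow> 2 * h j \<le> h (j + 1) + h (j - 1)"
    and l: "0 < l" "l < K"
  shows "0 \<le> (\<Sum>j<K. h (int j) * cos (2 * pi * real l / real K * real j))"
proof -
  define \<theta> where "\<theta> = 2 * pi * real l / real K"
  have K: "0 < K" using l by simp
  define c where "c j = cos (\<theta> * real_of_int j)" for j
  have perc: "c (j + int K) = c j" for j
  proof -
    have "\<theta> * real_of_int (j + int K) = \<theta> * real_of_int j + 2 * pi * real_of_int (int l)"
      using K by (simp add: \<theta>_def field_simps)
    then show ?thesis using sin_int_2pin[of "int l"] cos_int_2pin[of "int l"] by (simp add: c_def cos_add)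
  qed
  define d where "d j = h (j + 1) + h (j - 1) - 2 * h j" for j
  have c2: "c (j + 1) + c (j - 1) = 2 * cos \<theta> * c j" for j
    by (simp add: c_def algebra_simps cos_add cos_diff)
  have sh1: "(\<Sum>j<K. h (int j + 1) * c (int j)) = (\<Sum>j<K. h (int j) * c (int j - 1))"
    using sum_int_shift[of "\<lambda>j. h j * c (j - 1)" K] per perc[of "_ - 1"] by (simp add: algebra_simps)
  have sh2: "(\<Sum>j<K. h (int j) * c (int j + 1)) = (\<Sum>j<K. h (int j - 1) * c (int j))"
    using sum_int_shift[of "\<lambda>j. h (j - 1) * c j" K] per[of "_ - 1"] perc by (simp add: algebra_simps)
  have "(\<Sum>j<K. d (int j) * c (int j)) = (\<Sum>j<K. h (int j + 1) * c (int j)) + (\<Sum>j<K. h (int j - 1) * c (int j)) - 2 * (\<Sum>j<K. h (int j) * c (int j))"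
    by (simp add: d_def algebra_simps sum.distrib sum_subtractf sum_distrib_left)
  also have "\<dots> = (\<Sum>j<K. h (int j) * (c (int j + 1) + c (int j - 1))) - 2 * (\<Sum>j<K. h (int j) * c (int j))"
    unfolding sh1 sh2[symmetric] by (simp add: algebra_simps sum.distrib)
  also have "\<dots> = - (2 - 2 * cos \<theta>) * (\<Sum>j<K. h (int j) * c (int j))"
    unfolding c2 by (simp add: algebra_simps sum_distrib_left sum_subtractf)
  finally have e1: "(2 - 2 * cos \<theta>) * (\<Sum>j<K. h (int j) * c (int j)) = - (\<Sum>j<K. d (int j) * c (int j))"
    by (simp add: algebra_simps)
  have "(\<Sum>j<K. d (int j)) = (\<Sum>j<K. h (int j + 1)) + (\<Sum>j<K. h (int j - 1)) - 2 * (\<Sum>j<K. h (int j))"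
    by (simp add: d_def sum.distrib sum_subtractf sum_distrib_left)
  also have "\<dots> = 0"
    using sum_int_shift[of h K] sum_int_shift[of "\<lambda>j. h (j - 1)" K] per per[of "_ - 1"] by (simp add: algebra_simps)
  finally have d0: "(\<Sum>j<K. d (int j)) = 0" .
  \<comment> \<open>At the origin, where the second difference may be negative,
    \<open>c 0 = 1\<close> gives equality; elsewhere it is nonnegative and
    \<open>c j \<le> 1\<close>.\<close>
  have "d (int j) * c (int j) \<le> d (int j)" if "j < K" for j
  proof (cases "j = 0")
    case False
    then have "0 \<le> d (int j)" using conv[of "int j"] that by (simp add: d_def)
    then show ?thesis using mult_left_mono[of "c (int j)" 1 "d (int j)"] by (simp add: c_def)
  qed (simp add: c_def)
  then have "(\<Sum>j<K. d (int j) * c (int j)) \<le> (\<Sum>j<K. d (int j))" by (intro sum_mono) auto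
  then have "0 \<le> (2 - 2 * cos \<theta>) * (\<Sum>j<K. h (int j) * c (int j))" using e1 d0 by simp
  \<comment> \<open>By \<open>0 < l < K\<close> the angle is no multiple of \<open>2 * pi\<close>,
    so the factor \<open>2 - 2 * cos \<theta>\<close> is positive and can be cancelled.\<close>
  moreover have "cos \<theta> < 1"
  proof -
    have "cos \<theta> \<noteq> 1"
    proof
      assume "cos \<theta> = 1"
      then obtain i :: int where "\<theta> = real_of_int i * (2 * pi)" by (auto simp: cos_one_2pi_int)
      then have "real l = real_of_int i * real K" using K by (simp add: \<theta>_def field_simps)
      then have "real_of_int (int l) = real_of_int (i * int K)" by simp
      then have "int l = i * int K" by (simp only: of_int_eq_iff)
      then have "int K dvd int l" by simp
      then show False using l by (auto dest: zdvd_imp_le)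
    qed
    then show ?thesis using cos_le_one[of \<theta>] by linarith
  qed
  ultimately have "0 \<le> (\<Sum>j<K. h (int j) * c (int j))" by (simp add: zero_le_mult_iff)
  then show ?thesis by (simp add: c_def \<theta>_def)
qed

text \<open>Finite Fourier inversion: the product of two cosines splits into the frequencies
  \<open>i - j\<close> and \<open>i + j\<close>, each of which selects one residue class with weight
  \<open>K / 2\<close>. Evenness merges the contributions \<open>h i / 2\<close> and
  \<open>h (- i) / 2\<close>.\<close>

lemma cosine_inversion:
  fixes h :: "int \<Rightarrow> real"
  assumes per: "\<And>j. h (j + int K) = h j" and even: "\<And>j. h (- j) = h j" and K: "0 < K"
  shows "(\<Sum>l<K. (\<Sum>j<K. h (int j) * cos (2 * pi * real l / real K * real j)) / real K * cos (2 * pi * real l / real K * real_of_int i)) = h i"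
proof -
  have permult: "h (j + int K * int b) = h j" for j b
  proof (induction b)
    case (Suc b)
    have "h (j + int K * int (Suc b)) = h ((j + int K * int b) + int K)" by (simp add: algebra_simps)
    then show ?case using per Suc by simp
  qed simp
  have permult': "h (j + int K * b) = h j" for j b
  proof (cases "0 \<le> b")
    case True then show ?thesis using permult[of j "nat b"] by simp
  next
    case False then show ?thesis using permult[of "j + int K * b" "nat (- b)"] by simp
  qed
  have cosum: "(\<Sum>l<K. cos (2 * pi * real l / real K * real j) * cos (2 * pi * real l / real K * real_of_int i))
     = (if int K dvd i - int j then real K / 2 else 0) + (if int K dvd i + int j then real K / 2 else 0)" for j
  proof -
    have "cos (2 * pi * real l / real K * real j) * cos (2 * pi * real l / real K * real_of_int i)
      = cos (2 * pi * real_of_int (i - int j) / real K * real l) / 2 + cos (2 * pi * real_of_int (i + int j) / real K * real l) / 2" for l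
    proof -
      have "2 * pi * real_of_int (i - int j) / real K * real l = 2 * pi * real l / real K * real_of_int i - 2 * pi * real l / real K * real j"
        "2 * pi * real_of_int (i + int j) / real K * real l = 2 * pi * real l / real K * real_of_int i + 2 * pi * real l / real K * real j"
        using K by (simp_all add: field_simps)
      then show ?thesis by (simp only: cos_add cos_diff) (simp add: field_simps)
    qed
    then show ?thesis
      using sum_cos_period[OF K, of "i - int j"] sum_cos_period[OF K, of "i + int j"]
      by (simp add: sum.distrib flip: sum_divide_distrib)
  qed
  have pick: "(\<Sum>j<K. if int K dvd a - int j then h (int j) * (real K / 2) else 0) = h a * (real K / 2)" for a
  proof -
    define j0 where "j0 = nat (a mod int K)"
    have j0: "int j0 = a mod int K" "j0 < K" using K by (auto simp: j0_def nat_less_iff)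
    have "int K dvd a - int j \<longleftrightarrow> j = j0" if "j < K" for j
    proof
      assume "int K dvd a - int j"
      then have "a mod int K = int j mod int K" by (simp add: mod_eq_dvd_iff)
      then show "j = j0" using that j0 by simp
    next
      assume "j = j0" then show "int K dvd a - int j" using j0 by (simp add: minus_mod_eq_div_mult)
    qed
    then have "(\<Sum>j<K. if int K dvd a - int j then h (int j) * (real K / 2) else 0) = (\<Sum>j<K. if j = j0 then h (int j) * (real K / 2) else 0)"
      by (intro sum.cong) auto
    also have "\<dots> = h (int j0) * (real K / 2)" using j0 by simp
    also have "h (int j0) = h a"
      using permult'[of "int j0" "a div int K"] j0 by simp
    finally show ?thesis .
  qed
  have "(\<Sum>l<K. (\<Sum>j<K. h (int j) * cos (2 * pi * real l / real K * real j)) / real K * cos (2 * pi * real l / real K * real_of_int i))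
    = (\<Sum>l<K. \<Sum>j<K. h (int j) / real K * (cos (2 * pi * real l / real K * real j) * cos (2 * pi * real l / real K * real_of_int i)))"
    by (simp add: sum_divide_distrib sum_distrib_right sum_distrib_left mult_ac)
  also have "\<dots> = (\<Sum>j<K. h (int j) / real K * (\<Sum>l<K. cos (2 * pi * real l / real K * real j) * cos (2 * pi * real l / real K * real_of_int i)))"
    by (subst sum.swap) (simp add: sum_distrib_left)
  also have "\<dots> = (\<Sum>j<K. (if int K dvd i - int j then h (int j) * (real K / 2) else 0) / real K) + (\<Sum>j<K. (if int K dvd (- i) - int j then h (int j) * (real K / 2) else 0) / real K)"
  proof -
    have dv: "int K dvd i + int j \<longleftrightarrow> int K dvd (- i) - int j" for j
      using dvd_minus_iff[of "int K" "i + int j"] by (simp add: algebra_simps)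
    show ?thesis unfolding cosum dv sum.distrib[symmetric] by (intro sum.cong) (auto simp: field_simps)
  qed
  also have "\<dots> = h i" unfolding sum_divide_distrib[symmetric] pick using even[of i] K by simp
  finally show ?thesis .
qed

text \<open>With \<open>x = j / M\<close>, the right-hand side is half the difference of \<open>f (x - 1)\<close> and \<open>f (x + 1)\<close> for the
  convex function \<open>f x = (\<Sum>i\<le>n. 2 / (2 * i + 1 + \<bar>x\<bar>))\<close>. Since the cosine coefficients of the periodic
  extension of \<open>f\<close> are nonnegative, the square wave evaluates the absolute sum of the weights, up to
  a sum of squared cosecants.\<close>

lemma sz_nagy_discrete:
  fixes M R n :: nat
  assumes M: "1 \<le> M"
  obtains K :: nat and \<theta> :: real and w :: "nat \<Rightarrow> real"
  where "(\<Sum>l<K. \<bar>w l\<bar>) \<le> pi / 2"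
    "\<And>j :: int. int M \<le> j \<Longrightarrow> j \<le> int R \<Longrightarrow>
      (\<Sum>l<K. w l * sin (\<theta> * real l * real_of_int j)) = real M / j - 1 / (j / real M + 2 * real n + 2)"
proof -
  \<comment> \<open>\<open>L = 2 ^ k\<close> is at least \<open>R + 2\<close>, so
    \<open>j + M\<close> stays within the half period \<open>M * L\<close> for all
    \<open>j \<le> R\<close>. The power of two serves \<open>sum_cosec_sq\<close>; evenness excludes
    \<open>2 * p + 1 = L\<close>.\<close>
  define k where "k = Suc R + 1"
  define L :: nat where "L = 2 ^ k"
  have evL: "even L" by (simp add: L_def k_def)
  have L: "0 < L" "R + 2 \<le> L"
  proof -
    show "0 < L" by (simp add: L_def)
    have "k < 2 ^ k" by (rule less_exp)
    then show "R + 2 \<le> L" by (simp add: L_def k_def)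
  qed
  \<comment> \<open>With period \<open>2 * M * L\<close>, a shift by \<open>M\<close> is a phase of
    \<open>pi * l / L\<close>, the angle in \<open>square_wave\<close>.\<close>
  define K where "K = 2 * M * L"
  have K: "0 < K" using M L by (simp add: K_def)
  \<comment> \<open>The distance from \<open>j\<close> to the nearest multiple of \<open>K\<close>;
    composition with it extends \<open>H\<close> evenly and periodically.\<close>
  define T where "T j = min (j mod int K) (int K - j mod int K)" for j :: int
  \<comment> \<open>\<open>H t = f (t / M)\<close> for the convex \<open>f\<close>. The cut of the
    series at \<open>n\<close> produces the error term \<open>1 / (j / M + 2 * n + 2)\<close> after
    telescoping.\<close>
  define H where "H t = (\<Sum>i\<le>n. 2 * real M / ((2 * real i + 1) * real M + real_of_int t))" for t :: int
  define h where "h j = H (T j)" for j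
  have per: "h (j + int K) = h j" for j by (simp add: h_def T_def)
  have even: "h (- j) = h j" for j
  proof -
    have "T (- j) = T j"
      using K by (auto simp: T_def zmod_zminus1_eq_if min_def)
    then show ?thesis by (simp add: h_def)
  qed
  have K2: "int K = 2 * int (M * L)" "0 < int (M * L)" using M L by (simp_all add: K_def)
  have T1: "T j = j" if "0 \<le> j" "j \<le> int (M * L)" for j
  proof -
    have e: "j mod int K = j" using that K2 by (intro mod_pos_pos_trivial) linarith+
    show ?thesis unfolding T_def e by (rule min_absorb1) (use that K2 in linarith)
  qed
  have T2: "T j = int K - j" if "int (M * L) \<le> j" "j \<le> int K" for j
  proof (cases "j = int K")
    case True then show ?thesis using K by (simp add: T_def)
  next
    case False
    then have e: "j mod int K = j" using that K2 by (intro mod_pos_pos_trivial) linarith+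
    show ?thesis unfolding T_def e by (rule min_absorb2) (use that K2 in linarith)
  qed
  have Hconv: "2 * H t \<le> H (t + 1) + H (t - 1)" if "1 \<le> t" for t
  proof -
    have "2 * (2 * real M / ((2 * real i + 1) * real M + real_of_int t))
      \<le> 2 * real M / ((2 * real i + 1) * real M + real_of_int (t + 1)) + 2 * real M / ((2 * real i + 1) * real M + real_of_int (t - 1))" for i
    proof -
      define x where "x = (2 * real i + 1) * real M + real_of_int t"
      have "1 * 1 \<le> (2 * real i + 1) * real M" using M by (intro mult_mono) auto
      then have x: "1 < x" using that by (simp add: x_def)
      have "2 / x \<le> 1 / (x + 1) + 1 / (x - 1)"
      proof -
        have "2 / x = 2 * x / (x * x)" using x by simp
        also have "\<dots> \<le> 2 * x / ((x + 1) * (x - 1))"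
          using x by (intro divide_left_mono mult_pos_pos) (auto simp: algebra_simps)
        also have "\<dots> = (1 * (x - 1) + 1 * (x + 1)) / ((x + 1) * (x - 1))" by simp
        also have "\<dots> = 1 / (x + 1) + 1 / (x - 1)" by (rule add_frac_eq[symmetric]) (use x in auto)
        finally show ?thesis .
      qed
      then have "2 * real M * (2 / x) \<le> 2 * real M * (1 / (x + 1) + 1 / (x - 1))" by (intro mult_left_mono) auto
      moreover have "(2 * real i + 1) * real M + real_of_int (t + 1) = x + 1" "(2 * real i + 1) * real M + real_of_int (t - 1) = x - 1"
        by (simp_all add: x_def)
      ultimately show ?thesis unfolding x_def[symmetric] by (simp add: algebra_simps)
    qed
    then show ?thesis unfolding H_def sum_distrib_left sum.distrib[symmetric] by (intro sum_mono) auto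
  qed
  have Hmono: "H (t + 1) \<le> H t" if "0 \<le> t" for t
    unfolding H_def
  proof (rule sum_mono)
    fix i
    have "0 < (2 * real i + 1) * real M" using M by simp
    then show "2 * real M / ((2 * real i + 1) * real M + real_of_int (t + 1)) \<le> 2 * real M / ((2 * real i + 1) * real M + real_of_int t)"
      using that by (intro divide_left_mono mult_pos_pos) auto
  qed
  have conv: "2 * h j \<le> h (j + 1) + h (j - 1)" if j: "0 < j" "j < int K" for j
  proof -
    consider "j < int (M * L)" | "j = int (M * L)" | "int (M * L) < j" by linarith
    then show ?thesis
    proof cases
      case 1
      then show ?thesis using j T1[of j] T1[of "j + 1"] T1[of "j - 1"] Hconv[of j] by (simp add: h_def)
    next
      \<comment> \<open>At the half period both neighbours fold to \<open>j - 1\<close>, and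
        convexity reduces to \<open>H\<close> being decreasing.\<close>
      case 2
      have "T j = j" "T (j - 1) = j - 1" using T1[of j] T1[of "j - 1"] 2 j by linarith+
      moreover have "T (j + 1) = j - 1" using T2[of "j + 1"] 2 j K2 by linarith
      moreover have "0 \<le> j - 1" using j by simp
      from Hmono[OF this] have "H j \<le> H (j - 1)" by simp
      ultimately show ?thesis by (simp add: h_def)
    next
      case 3
      have "1 \<le> int K - j" using j by simp
      from Hconv[OF this] have "2 * H (int K - j) \<le> H (int K - (j - 1)) + H (int K - (j + 1))"
        by (simp add: algebra_simps)
      then show ?thesis using 3 j T2[of j] T2[of "j + 1"] T2[of "j - 1"] by (simp add: h_def)
    qed
  qed
  define c where "c l = (\<Sum>j<K. h (int j) * cos (2 * pi * real l / real K * real j)) / real K" for l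
  have c0: "0 \<le> c l" if "0 < l" "l < K" for l
    unfolding c_def using cosine_coeff_nonneg[OF per even conv that] by simp
  define \<theta> where "\<theta> = 2 * pi / real K"
  have inv: "(\<Sum>l<K. c l * cos (\<theta> * real l * real_of_int i)) = h i" for i
    using cosine_inversion[OF per even K, of i] by (simp add: c_def \<theta>_def field_simps)
  \<comment> \<open>The difference of the shifts by \<open>M\<close> in both directions turns each
    cosine into a sine with the factor \<open>sin (pi * l / L)\<close>. As
    \<open>c l \<ge> 0\<close> for \<open>l > 0\<close> and \<open>w 0 = 0\<close>, the number
    \<open>\<bar>w l\<bar>\<close> is \<open>c l\<close> times the absolute value of this factor,
    which \<open>square_wave\<close> computes.\<close>
  define w where "w l = c l * sin (pi * real l / real L)" for l
  define \<phi> where "\<phi> j = (h (j - int M) - h (j + int M)) / 2" for j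
  have thM: "\<theta> * real l * real M = pi * real l / real L" for l
    using M by (simp add: \<theta>_def K_def field_simps)
  have wsum: "(\<Sum>l<K. w l * sin (\<theta> * real l * real_of_int j)) = \<phi> j" for j
  proof -
    have "\<phi> j = (\<Sum>l<K. c l * (cos (\<theta> * real l * real_of_int (j - int M)) - cos (\<theta> * real l * real_of_int (j + int M))) / 2)"
      unfolding \<phi>_def inv[symmetric] by (simp add: sum_subtractf right_diff_distrib sum_divide_distrib diff_divide_distrib)
    also have "\<dots> = (\<Sum>l<K. w l * sin (\<theta> * real l * real_of_int j))"
    proof (rule sum.cong)
      fix l
      have "\<theta> * real l * real_of_int (j - int M) = \<theta> * real l * real_of_int j - pi * real l / real L"
        "\<theta> * real l * real_of_int (j + int M) = \<theta> * real l * real_of_int j + pi * real l / real L"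
        unfolding thM[symmetric] by (simp_all add: algebra_simps)
      then show "c l * (cos (\<theta> * real l * real_of_int (j - int M)) - cos (\<theta> * real l * real_of_int (j + int M))) / 2
        = w l * sin (\<theta> * real l * real_of_int j)"
        by (simp only: cos_add cos_diff w_def) simp
    qed simp
    finally show ?thesis by simp
  qed
  have val: "\<phi> j = real M / j - 1 / (j / real M + 2 * real n + 2)" if "int M \<le> j" "j + int M \<le> int (M * L)" for j
  proof -
    have Mr: "0 < real M" using M by simp
    define s where "s = real_of_int j / real M"
    have "real M \<le> real_of_int j" using that by linarith
    then have s: "1 \<le> s" using Mr by (simp add: s_def field_simps)
    have js: "real_of_int j = s * real M" using Mr by (simp add: s_def)
    have den: "2 * real M / ((2 * real i + 1) * real M + real_of_int (j - int M)) = 2 / (2 * real i + s)"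
      "2 * real M / ((2 * real i + 1) * real M + real_of_int (j + int M)) = 2 / (2 * real (Suc i) + s)" for i
    proof -
      have "(2 * real i + 1) * real M + real_of_int (j - int M) = real M * (2 * real i + s)"
        "(2 * real i + 1) * real M + real_of_int (j + int M) = real M * (2 * real (Suc i) + s)"
        by (simp_all add: js algebra_simps)
      then show "2 * real M / ((2 * real i + 1) * real M + real_of_int (j - int M)) = 2 / (2 * real i + s)"
        "2 * real M / ((2 * real i + 1) * real M + real_of_int (j + int M)) = 2 / (2 * real (Suc i) + s)"
        using Mr by simp_all
    qed
    have "T (j - int M) = j - int M" "T (j + int M) = j + int M" using that by (auto intro!: T1)
    then have h1: "h (j - int M) = (\<Sum>i\<le>n. 2 / (2 * real i + s))"
      and h2: "h (j + int M) = (\<Sum>i\<le>n. 2 / (2 * real (Suc i) + s))"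
      by (simp_all only: h_def H_def den)
    have half: "(2 / a - 2 / b) / 2 = 1 / a - 1 / b" for a b :: real
      by (simp add: diff_divide_distrib)
    have "\<phi> j = (\<Sum>i\<le>n. 1 / (2 * real i + s) - 1 / (2 * real (Suc i) + s))"
      unfolding \<phi>_def h1 h2 sum_subtractf[symmetric] sum_divide_distrib half ..
    also have "\<dots> = 1 / s - 1 / (2 * real (Suc n) + s)"
      by (induction n) auto
    finally show ?thesis using Mr by (simp add: js algebra_simps)
  qed
  have podd: "\<phi> (int K - j) = - \<phi> j" for j
  proof -
    have "h (int K - j - int M) = h (j + int M)" using per[of "- (j + int M)"] even[of "j + int M"] by (simp add: algebra_simps)
    moreover have "h (int K - j + int M) = h (j - int M)" using per[of "- (j - int M)"] even[of "j - int M"] by (simp add: algebra_simps)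
    ultimately show ?thesis by (simp only: \<phi>_def minus_divide_left minus_diff_eq)
  qed
  define x where "x p = pi * (2 * real p + 1) / (2 * real L)" for p :: nat
  \<comment> \<open>Dropping the subtracted term leaves
    \<open>\<phi> \<le> 1 / (2 * p + 1) = pi / (2 * L * x p)\<close> at this node, and for
    \<open>x\<close> in the first quadrant \<open>cot x / x \<le> 1 / (sin x)\<^sup>2\<close>
    amounts to \<open>cos x * sin x \<le> x\<close>.\<close>
  have term_le: "cot (x p) * \<phi> (int (M * (2 * p + 1))) \<le> pi / (2 * real L) * (1 / (sin (x p))\<^sup>2)" if p: "2 * p + 1 < L" for p
  proof -
    have "2 * real p + 1 < real L" using p by linarith
    from mult_strict_left_mono[OF this pi_gt_zero]
    have x: "0 < x p" "x p < pi / 2" using L by (auto simp: x_def field_simps intro!: add_pos_nonneg)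
    then have sc: "0 < sin (x p)" "0 < cos (x p)" using sin_gt_zero2[of "x p"] cos_gt_zero[of "x p"] by auto
    have "M * (2 * p + 1) + M \<le> M * L" using p by (metis Suc_eq_plus1 Suc_leI mult_Suc_right add.commute mult_le_mono2)
    then have "\<phi> (int (M * (2 * p + 1))) = real M / real_of_int (int (M * (2 * p + 1))) - 1 / (real_of_int (int (M * (2 * p + 1))) / real M + 2 * real n + 2)"
      by (intro val) (auto simp del: mult_Suc_right simp flip: of_nat_add of_nat_mult)
    also have "\<dots> \<le> real M / real_of_int (int (M * (2 * p + 1)))" by simp
    also have "real_of_int (int (M * (2 * p + 1))) = real M * (2 * real p + 1)" by (simp add: algebra_simps)
    also have "real M / (real M * (2 * real p + 1)) = 1 / (2 * real p + 1)" using M by simp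
    also have "\<dots> = pi / (2 * real L) * (1 / x p)" using L by (simp add: x_def)
    finally have "cot (x p) * \<phi> (int (M * (2 * p + 1))) \<le> cot (x p) * (pi / (2 * real L) * (1 / x p))"
      using sc by (intro mult_left_mono) (auto simp: cot_def)
    also have "\<dots> = pi / (2 * real L) * (cos (x p) / (sin (x p) * x p))" by (simp add: cot_def mult_ac)
    also have "\<dots> \<le> pi / (2 * real L) * (1 / (sin (x p))\<^sup>2)"
    proof (intro mult_left_mono)
      have "cos (x p) * sin (x p) \<le> 1 * x p" using sc x sin_x_le_x[of "x p"] by (intro mult_mono) auto
      then have "cos (x p) * sin (x p) * sin (x p) \<le> x p * sin (x p)" using sc by (intro mult_right_mono) auto
      then show "cos (x p) / (sin (x p) * x p) \<le> 1 / (sin (x p))\<^sup>2"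
        using sc x by (simp add: field_simps power2_eq_square)
    qed simp
    finally show ?thesis .
  qed
  \<comment> \<open>For \<open>2 * p + 1 > L\<close> reflect \<open>p\<close> to
    \<open>L - 1 - p\<close>: the cotangent and \<open>\<phi>\<close> both change sign, and the
    squared sine stays the same.\<close>
  have term_le2: "cot (x p) * \<phi> (int (M * (2 * p + 1))) \<le> pi / (2 * real L) * (1 / (sin (x p))\<^sup>2)" if p: "p < L" for p
  proof (cases "2 * p + 1 < L")
    case False
    then have "L < 2 * p + 1" using evL by (metis dvd_triv_left even_Suc nat_neq_iff Suc_eq_plus1)
    define p' where "p' = L - 1 - p"
    have p': "2 * p' + 1 < L" "real p' = real L - 1 - real p" using p \<open>L < 2 * p + 1\<close> by (auto simp: p'_def)
    have "x p' = pi - x p" using L by (simp add: x_def p'(2) field_simps)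
    then have cs: "cot (x p') = - cot (x p)" "sin (x p') = sin (x p)" by (simp_all add: cot_def)
    have idx: "int (M * (2 * p' + 1)) = int K - int (M * (2 * p + 1))"
    proof -
      have "(2 * p' + 1) + (2 * p + 1) = 2 * L" using p by (simp add: p'_def)
      then have "M * (2 * p' + 1) + M * (2 * p + 1) = M * (2 * L)" by (simp only: distrib_left[symmetric])
      also have "\<dots> = K" by (simp add: K_def)
      finally have "M * (2 * p' + 1) + M * (2 * p + 1) = K" .
      then show ?thesis by linarith
    qed
    show ?thesis using term_le[OF p'(1)] unfolding idx podd cs by simp
  qed (rule term_le)
  \<comment> \<open>The absolute value becomes linear in the weight, so after exchanging the sums
    only the values of \<open>\<phi>\<close> at odd multiples of \<open>M\<close> remain. Each term
    is at most \<open>pi / (2 * L)\<close> times a squared cosecant, and these bounds add up to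
    \<open>L * pi / 2\<close>.\<close>
  have "real L * \<bar>w l\<bar> = (\<Sum>p<L. cot (x p) * (w l * sin (\<theta> * real l * real_of_int (int (M * (2 * p + 1))))))" if l: "l < K" for l
  proof -
    have "real L * \<bar>w l\<bar> = c l * (real L * \<bar>sin (pi * real l / real L)\<bar>)"
    proof (cases "l = 0")
      case False
      then show ?thesis using c0[of l] l by (simp add: w_def abs_mult)
    qed (simp add: w_def)
    also have "\<dots> = c l * ((\<Sum>p<L. cot (x p) * sin (2 * x p * real l)) * sin (pi * real l / real L))"
      unfolding x_def square_wave[OF L(1)] ..
    also have "\<dots> = (\<Sum>p<L. cot (x p) * (w l * sin (2 * x p * real l)))"
      by (simp add: w_def sum_distrib_left sum_distrib_right mult_ac)
    finally have *: "real L * \<bar>w l\<bar> = (\<Sum>p<L. cot (x p) * (w l * sin (2 * x p * real l)))" .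
    have "2 * x p * real l = \<theta> * real l * real_of_int (int (M * (2 * p + 1)))" for p
    proof -
      have "\<theta> * real l * real_of_int (int (M * (2 * p + 1))) = (\<theta> * real l * real M) * (2 * real p + 1)" by (simp add: algebra_simps)
      also have "\<dots> = 2 * x p * real l" unfolding thM using L by (simp add: x_def)
      finally show ?thesis by (rule sym)
    qed
    then show ?thesis unfolding * by (simp only:)
  qed
  then have "(\<Sum>l<K. real L * \<bar>w l\<bar>) = (\<Sum>l<K. \<Sum>p<L. cot (x p) * (w l * sin (\<theta> * real l * real_of_int (int (M * (2 * p + 1))))))"
    by (intro sum.cong) auto
  also have "\<dots> = (\<Sum>p<L. cot (x p) * \<phi> (int (M * (2 * p + 1))))"
    unfolding wsum[symmetric] by (subst sum.swap) (simp only: sum_distrib_left)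
  also have "\<dots> \<le> (\<Sum>p<L. pi / (2 * real L) * (1 / (sin (x p))\<^sup>2))" by (rule sum_mono) (use term_le2 in auto)
  also have "\<dots> = pi / (2 * real L) * (real L)\<^sup>2"
    unfolding sum_distrib_left[symmetric] using sum_cosec_sq[of k] by (simp add: x_def L_def)
  also have "\<dots> = real L * (pi / 2)" using L by (simp add: power2_eq_square)
  finally have "(\<Sum>l<K. \<bar>w l\<bar>) \<le> pi / 2" using L by (simp flip: sum_distrib_left)
  moreover have "(\<Sum>l<K. w l * sin (\<theta> * real l * real_of_int j)) = real M / j - 1 / (j / real M + 2 * real n + 2)"
    if j: "int M \<le> j" "j \<le> int R" for j
  proof -
    have "R + M \<le> M * L"
    proof -
      have "R + M \<le> M * (R + 1)" using M by (simp add: algebra_simps)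
      also have "\<dots> \<le> M * L" using L by (intro mult_le_mono2) simp
      finally show ?thesis .
    qed
    then have "j + int M \<le> int (M * L)" using j by linarith
    then show ?thesis using wsum val j by simp
  qed
  ultimately show thesis by (rule that)
qed

subsection \<open>Schur multipliers with entries \<open>1 / (a j - b i)\<close>\<close>

lemma ui_norm_limit_le:
  assumes N: "unitarily_invariant_norm N" and X: "\<And>k. X k \<in> carrier_mat p q" and L: "L \<in> carrier_mat p q"
    and lim: "\<And>i j. i < p \<Longrightarrow> j < q \<Longrightarrow> (\<lambda>k. X k $$ (i, j)) \<longlonglongrightarrow> L $$ (i, j)"
    and le: "\<And>k. N (X k) \<le> B"
  shows "N L \<le> B"
proof -
  have "N L \<le> B + N (X k - L)" for k
  proof -
    have "L = X k - (X k - L)" using X[of k] L by (intro eq_matI) auto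
    then have "N L \<le> N (X k) + N (X k - L)"
      using ui_norm_triangle_minus[OF N, of "X k" "X k - L"] X[of k] L by auto
    then show ?thesis using le[of k] by simp
  qed
  moreover have "(\<lambda>k. B + N (X k - L)) \<longlonglongrightarrow> B + 0"
    by (intro tendsto_intros ui_norm_tendsto_0[OF N X L lim])
  ultimately show ?thesis by (intro tendsto_lowerbound[of _ "B" sequentially]) auto
qed

text \<open>By Euler's formula the multiplier is half the difference of two exponentials, up to the
  factor \<open>\<i>\<close>. Each exponential splits into a row part and a column part, that is,
  acts by unitary diagonal matrices on both sides, so the constant is 1.\<close>

lemma ui_norm_sin_multiplier:
  assumes N: "unitarily_invariant_norm N" and W: "W \<in> carrier_mat p q"
  shows "N (mat p q (\<lambda>(i, j). complex_of_real (sin (v j - u i)) * W $$ (i, j))) \<le> N W"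
proof -
  let ?A = "diag_of p (\<lambda>i. cis (- u i)) * W * diag_of q (\<lambda>j. cis (v j))"
  let ?B = "diag_of p (\<lambda>i. cis (u i)) * W * diag_of q (\<lambda>j. cis (- v j))"
  note d = carrier_matD[OF W]
  have nA: "N ?A = N W" "N ?B = N W"
    using W by (intro ui_norm_unitary[OF N unitary_diag unitary_diag]; simp)+
  have sincis: "complex_of_real (sin x) = - \<i> / 2 * cis x + \<i> / 2 * cis (- x)" for x
    by (simp add: complex_eq_iff)
  have e: "mat p q (\<lambda>(i, j). complex_of_real (sin (v j - u i)) * W $$ (i, j)) = (- \<i> / 2) \<cdot>\<^sub>m ?A + (\<i> / 2) \<cdot>\<^sub>m ?B"
  proof (rule eq_matI)
    fix i j assume "i < dim_row ((- \<i> / 2) \<cdot>\<^sub>m ?A + (\<i> / 2) \<cdot>\<^sub>m ?B)" "j < dim_col ((- \<i> / 2) \<cdot>\<^sub>m ?A + (\<i> / 2) \<cdot>\<^sub>m ?B)"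
    then have ij: "i < p" "j < q" by auto
    have "cis (v j - u i) = cis (- u i) * cis (v j)" "cis (- (v j - u i)) = cis (u i) * cis (- v j)"
      by (simp_all add: cis_mult)
    then show "mat p q (\<lambda>(i, j). complex_of_real (sin (v j - u i)) * W $$ (i, j)) $$ (i, j)
      = ((- \<i> / 2) \<cdot>\<^sub>m ?A + (\<i> / 2) \<cdot>\<^sub>m ?B) $$ (i, j)"
      using ij d unfolding sincis by (simp add: algebra_simps del: index_mult_mat(1))
  qed (use d in auto)
  have "N ((- \<i> / 2) \<cdot>\<^sub>m ?A + (\<i> / 2) \<cdot>\<^sub>m ?B) \<le> N ((- \<i> / 2) \<cdot>\<^sub>m ?A) + N ((\<i> / 2) \<cdot>\<^sub>m ?B)"
    using d by (intro ui_norm_triangle[OF N]) auto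
  also have "\<dots> = N W" unfolding ui_norm_smult[OF N] nA by (simp add: norm_divide)
  finally show ?thesis unfolding e .
qed

lemma ui_norm_sin_sum_multiplier:
  fixes w :: "nat \<Rightarrow> real"
  assumes N: "unitarily_invariant_norm N" and W: "W \<in> carrier_mat p q"
  shows "N (mat p q (\<lambda>(i, j). complex_of_real (\<Sum>l<K. w l * sin (\<theta> l * (v j - u i))) * W $$ (i, j))) \<le> (\<Sum>l<K. \<bar>w l\<bar>) * N W"
proof (induction K)
  case 0
  have "mat p q (\<lambda>(i, j). complex_of_real (\<Sum>l<0. w l * sin (\<theta> l * (v j - u i))) * W $$ (i, j)) = 0\<^sub>m p q"
    by (intro eq_matI) auto
  then show ?case by (simp only: ui_norm_zero[OF N]) simp
next
  case (Suc K)
  let ?X = "\<lambda>K. mat p q (\<lambda>(i, j). complex_of_real (\<Sum>l<K. w l * sin (\<theta> l * (v j - u i))) * W $$ (i, j))"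
  let ?Y = "mat p q (\<lambda>(i, j). complex_of_real (sin (\<theta> K * v j - \<theta> K * u i)) * W $$ (i, j))"
  have "?X (Suc K) = ?X K + complex_of_real (w K) \<cdot>\<^sub>m ?Y"
    by (intro eq_matI) (auto simp: algebra_simps)
  then have "N (?X (Suc K)) \<le> N (?X K) + N (complex_of_real (w K) \<cdot>\<^sub>m ?Y)"
    using ui_norm_triangle[OF N, of "?X K" "complex_of_real (w K) \<cdot>\<^sub>m ?Y"] by simp
  also have "\<dots> \<le> (\<Sum>l<K. \<bar>w l\<bar>) * N W + \<bar>w K\<bar> * N W"
    unfolding ui_norm_smult[OF N] norm_of_real
    by (intro add_mono Suc mult_left_mono ui_norm_sin_multiplier[OF N W]) auto
  finally show ?case by (simp add: algebra_simps)
qed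

lemma floor_scaled_tendsto:
  "(\<lambda>m. real_of_int \<lfloor>real (Suc m) * t\<rfloor> / real (Suc m)) \<longlonglongrightarrow> t"
proof (rule tendsto_sandwich)
  have "(\<lambda>m. t - inverse (real (Suc m))) \<longlonglongrightarrow> t - 0"
    by (intro tendsto_intros LIMSEQ_inverse_real_of_nat)
  then show "(\<lambda>m. t - inverse (real (Suc m))) \<longlonglongrightarrow> t" by simp
  have "t - inverse (real (Suc m)) \<le> real_of_int \<lfloor>real (Suc m) * t\<rfloor> / real (Suc m)" for m
  proof -
    have "real (Suc m) * t - 1 \<le> real_of_int \<lfloor>real (Suc m) * t\<rfloor>" by linarith
    then have "(real (Suc m) * t - 1) / real (Suc m) \<le> real_of_int \<lfloor>real (Suc m) * t\<rfloor> / real (Suc m)"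
      by (intro divide_right_mono) auto
    then show ?thesis by (simp add: diff_divide_distrib inverse_eq_divide del: of_nat_Suc)
  qed
  then show "\<forall>\<^sub>F m in sequentially. t - inverse (real (Suc m)) \<le> real_of_int \<lfloor>real (Suc m) * t\<rfloor> / real (Suc m)"
    by (intro always_eventually allI)
  have "real_of_int \<lfloor>real (Suc m) * t\<rfloor> / real (Suc m) \<le> t" for m
  proof -
    have "real_of_int \<lfloor>real (Suc m) * t\<rfloor> / real (Suc m) \<le> real (Suc m) * t / real (Suc m)"
      by (intro divide_right_mono) auto
    then show ?thesis by (simp del: of_nat_Suc)
  qed
  then show "\<forall>\<^sub>F m in sequentially. real_of_int \<lfloor>real (Suc m) * t\<rfloor> / real (Suc m) \<le> t"
    by (intro always_eventually allI)
qed simp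

text \<open>Divided by \<open>\<delta>\<close>, the two families have gap at least 1. They are
  rounded down to the grid of mesh \<open>1 / Suc m\<close>, where the reciprocal is, up to a
  vanishing term, a finite sine sum with absolute weight at most \<open>pi / 2\<close>. The bound is
  uniform in \<open>m\<close>, so it survives the entrywise limit.\<close>

theorem ui_norm_schur_multiplier:
  assumes N: "unitarily_invariant_norm N" and W: "W \<in> carrier_mat p q" and \<delta>: "0 < \<delta>"
    and gap: "\<And>i j. i < p \<Longrightarrow> j < q \<Longrightarrow> \<delta> \<le> \<bar>a j - b i\<bar>"
  shows "N (mat p q (\<lambda>(i, j). W $$ (i, j) / complex_of_real (a j - b i))) \<le> pi / (2 * \<delta>) * N W"
proof -
  define y where "y m j = \<lfloor>real (Suc m) * (a j / \<delta>)\<rfloor>" for m j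
  define x where "x m i = \<lfloor>real (Suc m) * (b i / \<delta>)\<rfloor>" for m i
  define d where "d m i j = y m j - x m i" for m i j
  \<comment> \<open>The values from \<open>sz_nagy_discrete\<close> with \<open>M = Suc m\<close>
    and \<open>n = m\<close>, continued to negative arguments as an odd function. Tying
    \<open>n\<close> to the mesh lets a single limit remove both the rounding and the error
    term.\<close>
  define v where "v m z = real (Suc m) / real_of_int z - real_of_int (sgn z) / (\<bar>real_of_int z\<bar> / real (Suc m) + 2 * real m + 2)" for m z
  define X where "X m = mat p q (\<lambda>(i, j). complex_of_real (v m (d m i j)) * W $$ (i, j))" for m
  define L where "L = mat p q (\<lambda>(i, j). complex_of_real (\<delta> / (a j - b i)) * W $$ (i, j))"
  have dgap: "int (Suc m) \<le> \<bar>d m i j\<bar>" if "i < p" "j < q" for m i j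
  proof -
    \<comment> \<open>Rounding cannot push the integer gap below \<open>Suc m\<close>, because
      adding the integer \<open>Suc m\<close> commutes with the floor.\<close>
    have fl: "int (Suc m) \<le> \<lfloor>real (Suc m) * (s / \<delta>)\<rfloor> - \<lfloor>real (Suc m) * (t / \<delta>)\<rfloor>" if "\<delta> \<le> s - t" for s t
    proof -
      have "1 \<le> s / \<delta> - t / \<delta>" using that \<delta> by (simp add: diff_divide_distrib[symmetric])
      from mult_left_mono[OF this, of "real (Suc m)"]
      have "real (Suc m) * (t / \<delta>) + real (Suc m) \<le> real (Suc m) * (s / \<delta>)" by (simp add: algebra_simps)
      then have "\<lfloor>real (Suc m) * (t / \<delta>) + real_of_int (int (Suc m))\<rfloor> \<le> \<lfloor>real (Suc m) * (s / \<delta>)\<rfloor>"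
        by (intro floor_mono) simp
      then show ?thesis unfolding floor_add_int[symmetric] by linarith
    qed
    show ?thesis
    proof (cases "b i \<le> a j")
      case True
      then have "\<delta> \<le> a j - b i" using gap[OF that] by simp
      from fl[OF this] show ?thesis by (simp add: d_def x_def y_def)
    next
      case False
      then have "\<delta> \<le> b i - a j" using gap[OF that] by simp
      from fl[OF this] show ?thesis by (simp add: d_def x_def y_def)
    qed
  qed
  have "N (X m) \<le> pi / 2 * N W" for m
  proof -
    \<comment> \<open>Only finitely many integers \<open>d m i j\<close> occur, so a representation
      on a bounded range suffices. Its frequencies and weights depend on \<open>m\<close>, the bound
      \<open>pi / 2\<close> does not.\<close>
    define R where "R = (\<Sum>i<p. \<Sum>j<q. nat \<bar>d m i j\<bar>)"
    have R: "\<bar>d m i j\<bar> \<le> int R" if "i < p" "j < q" for i j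
    proof -
      have "nat \<bar>d m i j\<bar> \<le> (\<Sum>j<q. nat \<bar>d m i j\<bar>)"
        using that by (intro member_le_sum[where f = "\<lambda>j. nat \<bar>d m i j\<bar>"]) auto
      also have "\<dots> \<le> R" unfolding R_def
        using that by (intro member_le_sum[where f = "\<lambda>i. \<Sum>j<q. nat \<bar>d m i j\<bar>"]) auto
      finally show ?thesis by linarith
    qed
    obtain K \<theta> w where w: "(\<Sum>l<K. \<bar>w l\<bar>) \<le> pi / 2"
      and rep: "\<And>z :: int. int (Suc m) \<le> z \<Longrightarrow> z \<le> int R \<Longrightarrow>
        (\<Sum>l<K. w l * sin (\<theta> * real l * real_of_int z)) = real (Suc m) / z - 1 / (z / real (Suc m) + 2 * real m + 2)"
      by (rule sz_nagy_discrete[where M = "Suc m" and R = R and n = m]) (simp, blast)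
    have rep': "(\<Sum>l<K. w l * sin (\<theta> * real l * real_of_int z)) = v m z" if z: "int (Suc m) \<le> \<bar>z\<bar>" "\<bar>z\<bar> \<le> int R" for z
    proof (cases "0 < z")
      case True
      then show ?thesis using rep[of z] z by (simp add: v_def)
    next
      case False
      then have "z < 0" using z by linarith
      moreover have "(\<Sum>l<K. w l * sin (\<theta> * real l * real_of_int z)) = - (\<Sum>l<K. w l * sin (\<theta> * real l * real_of_int (- z)))"
        by (simp add: sum_negf)
      ultimately show ?thesis using rep[of "- z"] z by (simp add: v_def)
    qed
    have "X m = mat p q (\<lambda>(i, j). complex_of_real (\<Sum>l<K. w l * sin (\<theta> * real l * (real_of_int (y m j) - real_of_int (x m i)))) * W $$ (i, j))"
      unfolding X_def
    proof (intro cong_mat refl)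
      fix i j assume ij: "i < p" "j < q"
      have "v m (d m i j) = (\<Sum>l<K. w l * sin (\<theta> * real l * (real_of_int (y m j) - real_of_int (x m i))))"
        using rep'[OF dgap[OF ij] R[OF ij]] by (simp add: d_def)
      then show "(case (i, j) of (i, j) \<Rightarrow> complex_of_real (v m (d m i j)) * W $$ (i, j))
        = (case (i, j) of (i, j) \<Rightarrow> complex_of_real (\<Sum>l<K. w l * sin (\<theta> * real l * (real_of_int (y m j) - real_of_int (x m i)))) * W $$ (i, j))"
        by simp
    qed
    then have "N (X m) \<le> (\<Sum>l<K. \<bar>w l\<bar>) * N W"
      using ui_norm_sin_sum_multiplier[OF N W, where K = K and w = w and \<theta> = "\<lambda>l. \<theta> * real l"
          and v = "\<lambda>j. real_of_int (y m j)" and u = "\<lambda>i. real_of_int (x m i)"] by simp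
    also have "\<dots> \<le> pi / 2 * N W" using w ui_norm_nonneg[OF N] by (intro mult_right_mono) auto
    finally show ?thesis .
  qed
  moreover have "(\<lambda>m. X m $$ (i, j)) \<longlonglongrightarrow> L $$ (i, j)" if ij: "i < p" "j < q" for i j
  proof -
    have ne: "a j / \<delta> - b i / \<delta> \<noteq> 0" using gap[OF ij] \<delta> by auto
    have "(\<lambda>m. real_of_int (y m j) / real (Suc m) - real_of_int (x m i) / real (Suc m)) \<longlonglongrightarrow> a j / \<delta> - b i / \<delta>"
      unfolding x_def y_def by (intro tendsto_diff floor_scaled_tendsto)
    then have "(\<lambda>m. real_of_int (d m i j) / real (Suc m)) \<longlonglongrightarrow> a j / \<delta> - b i / \<delta>"
      by (simp add: d_def diff_divide_distrib)
    from tendsto_inverse[OF this ne]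
    have l1: "(\<lambda>m. real (Suc m) / real_of_int (d m i j)) \<longlonglongrightarrow> \<delta> / (a j - b i)"
      by (simp add: diff_divide_distrib[symmetric] inverse_eq_divide)
    have l2: "(\<lambda>m. real_of_int (sgn (d m i j)) / (\<bar>real_of_int (d m i j)\<bar> / real (Suc m) + 2 * real m + 2)) \<longlonglongrightarrow> 0"
    proof (rule tendsto_0_le[OF LIMSEQ_inverse_real_of_nat, where K = 1])
      have "\<bar>real_of_int (sgn (d m i j)) / (\<bar>real_of_int (d m i j)\<bar> / real (Suc m) + 2 * real m + 2)\<bar> \<le> 1 / real (Suc m)" for m
      proof -
        have "\<bar>real_of_int (sgn (d m i j))\<bar> \<le> 1" by (simp add: sgn_if)
        moreover have "real (Suc m) \<le> \<bar>real_of_int (d m i j)\<bar> / real (Suc m) + 2 * real m + 2" by simp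
        ultimately show ?thesis unfolding abs_divide by (intro frac_le) auto
      qed
      then show "\<forall>\<^sub>F m in sequentially. norm (real_of_int (sgn (d m i j)) / (\<bar>real_of_int (d m i j)\<bar> / real (Suc m) + 2 * real m + 2)) \<le> norm (inverse (real (Suc m))) * 1"
        by (intro always_eventually allI) (simp add: inverse_eq_divide)
    qed
    have "(\<lambda>m. v m (d m i j)) \<longlonglongrightarrow> \<delta> / (a j - b i)"
      using tendsto_diff[OF l1 l2] by (simp add: v_def)
    then have "(\<lambda>m. complex_of_real (v m (d m i j)) * W $$ (i, j)) \<longlonglongrightarrow> complex_of_real (\<delta> / (a j - b i)) * W $$ (i, j)"
      by (intro tendsto_intros)
    then show ?thesis using ij by (simp add: X_def L_def)
  qed
  ultimately have "N L \<le> pi / 2 * N W"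
    by (intro ui_norm_limit_le[OF N, of X p q L]) (auto simp: X_def L_def)
  moreover have "mat p q (\<lambda>(i, j). W $$ (i, j) / complex_of_real (a j - b i)) = complex_of_real (1 / \<delta>) \<cdot>\<^sub>m L"
    using \<delta> by (intro eq_matI) (auto simp: L_def)
  ultimately show ?thesis using \<delta> by (simp add: ui_norm_smult[OF N] norm_divide field_simps)
qed

lemma frobenius_norm_mono:
  assumes "dim_row A = dim_row B" "dim_col A = dim_col B"
    "\<And>i j. i < dim_row B \<Longrightarrow> j < dim_col B \<Longrightarrow> cmod (A $$ (i, j)) \<le> k * cmod (B $$ (i, j))" "0 \<le> k"
  shows "frobenius_norm A \<le> k * frobenius_norm B"
proof -
  have "frobenius_norm A \<le> L2_set (\<lambda>ij. k * cmod (B $$ ij)) ({..<dim_row B} \<times> {..<dim_col B})"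
    unfolding frobenius_norm_def assms(1,2) by (rule L2_set_mono) (use assms in auto)
  then show ?thesis using assms(4) by (simp add: frobenius_norm_def L2_set_right_distrib)
qed

subsection \<open>Singular values\<close>

lemma mv_zero: "dim_col A = n \<Longrightarrow> A *\<^sub>v 0\<^sub>v n = 0\<^sub>v (dim_row A)" for A :: "complex mat"
  by (auto intro!: eq_vecI)

lemma poly_char_poly:
  fixes A :: "complex mat"
  assumes "A \<in> carrier_mat n n"
  shows "poly (char_poly A) x = Determinant.det (x \<cdot>\<^sub>m 1\<^sub>m n - A)"
proof -
  have "- (char_matrix A x) = x \<cdot>\<^sub>m 1\<^sub>m n - A"
    using assms by (intro eq_matI) (auto simp: char_matrix_def)
  then show ?thesis using char_poly_matrix[OF assms, of x] by simp
qed

text \<open>Both sides are, up to the factor \<open>x ^ n\<close>, determinants of triangular modifications of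
  \<open>[[x, A], [B, 1]]\<close>.\<close>

lemma char_poly_mult_commute:
  fixes A B :: "complex mat"
  assumes A: "A \<in> carrier_mat n n" and B: "B \<in> carrier_mat n n"
  shows "char_poly (A * B) = char_poly (B * A)"
proof -
  note d = carrier_matD[OF A] carrier_matD[OF B]
  have e: "poly (char_poly (A * B)) x = poly (char_poly (B * A)) x" if x: "x \<noteq> 0" for x
  proof -
    let ?X = "x \<cdot>\<^sub>m 1\<^sub>m n"
    let ?M = "four_block_mat ?X A B (1\<^sub>m n)"
    let ?L = "four_block_mat (1\<^sub>m n) (0\<^sub>m n n) (- B) (1\<^sub>m n)"
    let ?R = "four_block_mat (1\<^sub>m n) (- A) (0\<^sub>m n n) ?X"
    have XA: "?X * A = x \<cdot>\<^sub>m A" "A * ?X = x \<cdot>\<^sub>m A" "B * ?X = x \<cdot>\<^sub>m B" "?X * B = x \<cdot>\<^sub>m B"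
      using mult_smult_assoc_mat[OF one_carrier_mat A, of x] mult_smult_distrib[OF A one_carrier_mat, of x]
        mult_smult_distrib[OF B one_carrier_mat, of x] mult_smult_assoc_mat[OF one_carrier_mat B, of x] A B
      by simp_all
    have z: "B + - B = 0\<^sub>m n n" "- (x \<cdot>\<^sub>m A) + x \<cdot>\<^sub>m A = 0\<^sub>m n n"
      using A B by (auto intro!: eq_matI)
    have s: "?X + - (A * B) = ?X - A * B" "- (B * A) + ?X = ?X - B * A"
      using A B by (auto intro!: eq_matI simp del: index_mult_mat(1))
    have prodL: "?M * ?L = four_block_mat (?X - A * B) A (0\<^sub>m n n) (1\<^sub>m n)"
      using d by (subst four_block_mm) (auto simp: mat_dist z s)
    have prodR: "?M * ?R = four_block_mat ?X (0\<^sub>m n n) B (?X - B * A)"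
      using d by (subst four_block_mm) (auto simp: mat_dist XA z s)
    have cM: "?M \<in> carrier_mat (n + n) (n + n)" "?L \<in> carrier_mat (n + n) (n + n)" "?R \<in> carrier_mat (n + n) (n + n)"
      using A B by auto
    have cs: "?X - A * B \<in> carrier_mat n n" "?X - B * A \<in> carrier_mat n n" "?X \<in> carrier_mat n n"
      using A B by auto
    have "Determinant.det (?M * ?L) = Determinant.det ?M * Determinant.det ?L" by (rule det_mult[OF cM(1,2)])
    moreover have "Determinant.det ?L = 1"
      by (subst det_four_block_mat_upper_right_zero[of _ n _ n]) (use B in auto)
    moreover have "Determinant.det (?M * ?L) = Determinant.det (?X - A * B)"
      unfolding prodL by (subst det_four_block_mat_lower_left_zero[of _ n _ n]) (use A cs in auto)
    moreover have "Determinant.det (?M * ?R) = Determinant.det ?M * Determinant.det ?R" by (rule det_mult[OF cM(1,3)])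
    moreover have "Determinant.det ?R = Determinant.det ?X"
      by (subst det_four_block_mat_lower_left_zero[of _ n _ n]) (use A cs in auto)
    moreover have "Determinant.det (?M * ?R) = Determinant.det ?X * Determinant.det (?X - B * A)"
      unfolding prodR by (subst det_four_block_mat_upper_right_zero[of _ n _ n]) (use B cs in auto)
    moreover have "Determinant.det ?X \<noteq> 0" using x by simp
    ultimately have "Determinant.det (?X - A * B) = Determinant.det (?X - B * A)" using x by simp
    then show ?thesis using A B by (simp add: poly_char_poly[of _ n])
  qed
  \<comment> \<open>The determinants are compared only for \<open>x \<noteq> 0\<close>. The extra
    monomial makes both sides agree at every point, and it cancels between the polynomials.\<close>
  have "poly (char_poly (A * B) * [:0, 1:]) x = poly (char_poly (B * A) * [:0, 1:]) x" for x
    using e[of x] by (cases "x = 0") auto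
  then have "char_poly (A * B) * [:0, 1:] = char_poly (B * A) * [:0, 1:]"
    by (simp only: poly_eq_poly_eq_iff[symmetric] fun_eq_iff) simp
  then show ?thesis by simp
qed

lemma sing_vals_le:
  assumes "dim_row B \<le> dim_col B"
  shows "sing_vals B = image_mset (\<lambda>z. sqrt (Re z)) (proots (char_poly (B * B\<^sup>H)))"
  using assms by (simp add: sing_vals_def)

text \<open>In the square case the definition picks the other Gram matrix, which has the same
  characteristic polynomial.\<close>

lemma sing_vals_ge:
  assumes "dim_col B \<le> dim_row B"
  shows "sing_vals B = image_mset (\<lambda>z. sqrt (Re z)) (proots (char_poly (B\<^sup>H * B)))"
proof (cases "dim_row B = dim_col B")
  case True
  then have "char_poly (B * B\<^sup>H) = char_poly (B\<^sup>H * B)"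
    by (intro char_poly_mult_commute[of _ "dim_row B"]) (auto intro!: carrier_matI)
  then show ?thesis by (simp add: sing_vals_def)
qed (use assms in \<open>simp add: sing_vals_def\<close>)

lemma char_poly_nonzero: "A \<in> carrier_mat n n \<Longrightarrow> char_poly A \<noteq> 0" for A :: "complex mat"
  using degree_monic_char_poly[of A n] by auto

lemma mem_proots_char_poly:
  fixes A :: "complex mat"
  assumes "A \<in> carrier_mat n n"
  shows "z \<in># proots (char_poly A) \<longleftrightarrow> eigenvalue A z"
  using char_poly_nonzero[OF assms] eigenvalue_root_char_poly[OF assms] by simp

lemma sing_vals_unitary:
  assumes P: "unitary_mat m P" and Q: "unitary_mat n Q" and B: "B \<in> carrier_mat m n"
  shows "sing_vals (P * B * Q) = sing_vals B"
proof -
  note d = unitary_matD[OF P] unitary_matD[OF Q] carrier_matD[OF B]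
  have sim: "char_poly (R * A * R\<^sup>H) = char_poly A" if R: "unitary_mat k R" and A: "A \<in> carrier_mat k k" for R A k
  proof (rule char_poly_similar)
    have "similar_mat_wit (R * A * R\<^sup>H) A R (R\<^sup>H)"
      using unitary_matD[OF R] A by (intro similar_mat_witI[of _ _ k]) auto
    then show "similar_mat (R * A * R\<^sup>H) A" by (auto simp: similar_mat_def)
  qed
  show ?thesis
  proof (cases "m \<le> n")
    case True
    have "(P * B * Q) * (P * B * Q)\<^sup>H = P * (B * B\<^sup>H) * P\<^sup>H"
      using d by (simp add: adjoint_mm assoc_mm unitary_cancel[OF Q])
    moreover have "B * B\<^sup>H \<in> carrier_mat m m" using d by (auto intro!: carrier_matI)
    ultimately show ?thesis
      using True d sim[OF P, of "B * B\<^sup>H"] sing_vals_le[of "P * B * Q"] sing_vals_le[of B] by simp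
  next
    case False
    have "(P * B * Q)\<^sup>H * (P * B * Q) = Q\<^sup>H * (B\<^sup>H * B) * (Q\<^sup>H)\<^sup>H"
      using d by (simp add: adjoint_mm assoc_mm unitary_cancel[OF P])
    moreover have "B\<^sup>H * B \<in> carrier_mat n n" using d by (auto intro!: carrier_matI)
    ultimately show ?thesis
      using False d sim[OF unitary_mat_adjoint[OF Q], of "B\<^sup>H * B"] sing_vals_ge[of "P * B * Q"] sing_vals_ge[of B] by simp
  qed
qed

text \<open>Because \<open>A\<close> is square, the side on which the Gram matrix of the whole is
  the smaller one is also the right side for \<open>D\<close>, and that Gram matrix is block
  diagonal.\<close>

lemma sing_vals_block:
  assumes A: "A \<in> carrier_mat r r" and D: "D \<in> carrier_mat p q"
  shows "sing_vals (four_block_mat A (0\<^sub>m r q) (0\<^sub>m p r) D) = sing_vals A + sing_vals D"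
proof -
  let ?B = "four_block_mat A (0\<^sub>m r q) (0\<^sub>m p r) D"
  note d = carrier_matD[OF A] carrier_matD[OF D]
  have cp: "char_poly (four_block_mat X (0\<^sub>m k l) (0\<^sub>m l k) Y) = char_poly X * char_poly Y"
    if "X \<in> carrier_mat k k" "Y \<in> carrier_mat l l" for X Y :: "complex mat" and k l
    using that char_poly_factorized[OF that(1)] char_poly_factorized[OF that(2)]
    by (intro char_poly_0_block[OF refl]) auto
  have pr: "proots (char_poly X * char_poly Y) = proots (char_poly X) + proots (char_poly Y)"
    if "X \<in> carrier_mat k k" "Y \<in> carrier_mat l l" for X Y :: "complex mat" and k l
    using char_poly_nonzero[OF that(1)] char_poly_nonzero[OF that(2)] by (simp add: proots_mult)
  show ?thesis
  proof (cases "p \<le> q")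
    case True
    have "?B * ?B\<^sup>H = four_block_mat (A * A\<^sup>H) (0\<^sub>m r p) (0\<^sub>m p r) (D * D\<^sup>H)"
      using d by (simp add: block_simps mat_dist)
    moreover have c: "A * A\<^sup>H \<in> carrier_mat r r" "D * D\<^sup>H \<in> carrier_mat p p"
      using d by (auto intro!: carrier_matI)
    ultimately have "char_poly (?B * ?B\<^sup>H) = char_poly (A * A\<^sup>H) * char_poly (D * D\<^sup>H)"
      using cp[OF c] by simp
    then show ?thesis
      using True d pr[OF c] sing_vals_le[of ?B] sing_vals_le[of A] sing_vals_le[of D] by simp
  next
    case False
    have "?B\<^sup>H * ?B = four_block_mat (A\<^sup>H * A) (0\<^sub>m r q) (0\<^sub>m q r) (D\<^sup>H * D)"
      using d by (simp add: block_simps mat_dist)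
    moreover have c: "A\<^sup>H * A \<in> carrier_mat r r" "D\<^sup>H * D \<in> carrier_mat q q"
      using d by (auto intro!: carrier_matI)
    ultimately have "char_poly (?B\<^sup>H * ?B) = char_poly (A\<^sup>H * A) * char_poly (D\<^sup>H * D)"
      using cp[OF c] by simp
    then show ?thesis
      using False d pr[OF c] sing_vals_ge[of ?B] sing_vals_ge[of A] sing_vals_ge[of D] by simp
  qed
qed

lemma eigenvalue_unitary_diag:
  assumes P: "unitary_mat n P"
  shows "eigenvalue (P * diag_of n d * P\<^sup>H) z \<longleftrightarrow> (\<exists>i<n. z = d i)"
proof
  note dP = unitary_matD[OF P]
  assume "eigenvalue (P * diag_of n d * P\<^sup>H) z"
  then obtain v where cv: "v \<in> carrier_vec n"
    and v': "v \<noteq> 0\<^sub>v n" "P * diag_of n d * P\<^sup>H *\<^sub>v v = z \<cdot>\<^sub>v v"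
    using dP(1,2) by (auto simp: eigenvalue_def eigenvector_def)
  have v: "dim_vec v = n" "v \<noteq> 0\<^sub>v n" "P * diag_of n d * P\<^sup>H *\<^sub>v v = z \<cdot>\<^sub>v v"
    using cv v' by auto
  let ?y = "P\<^sup>H *\<^sub>v v"
  have "\<exists>i<n. ?y $ i \<noteq> 0"
  proof (rule ccontr)
    assume "\<not> ?thesis"
    then have "?y = 0\<^sub>v n" using dP by (intro eq_vecI) auto
    moreover have "v = P *\<^sub>v ?y" using unitary_mv_cancel(2)[OF P v(1)] by simp
    ultimately have "v = 0\<^sub>v n" using dP(1,2) by (metis mv_zero)
    with v show False by simp
  qed
  then obtain i where i: "i < n" "?y $ i \<noteq> 0" by blast
  have "P\<^sup>H *\<^sub>v (P * diag_of n d * P\<^sup>H *\<^sub>v v) = diag_of n d *\<^sub>v ?y"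
    using dP(1,2) v(1) by (simp add: assoc_mv unitary_mv_cancel[OF P])
  moreover have "P\<^sup>H *\<^sub>v (z \<cdot>\<^sub>v v) = z \<cdot>\<^sub>v ?y" using dP(1,2) v(1) by (simp add: mv_smult)
  ultimately have "diag_of n d *\<^sub>v ?y = z \<cdot>\<^sub>v ?y" using v(3) by simp
  then have "(diag_of n d *\<^sub>v ?y) $ i = (z \<cdot>\<^sub>v ?y) $ i" by simp
  then have "d i * ?y $ i = z * ?y $ i" using i dP(1,2) by (simp del: index_mult_mat_vec)
  then show "\<exists>i<n. z = d i" using i by auto
next
  note dP = unitary_matD[OF P]
  assume "\<exists>i<n. z = d i"
  then obtain i where i: "i < n" "z = d i" by blast
  let ?e = "unit_vec n i :: complex vec"
  let ?v = "P *\<^sub>v ?e"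
  have "diag_of n d *\<^sub>v ?e = d i \<cdot>\<^sub>v ?e" using i by (intro eq_vecI) (auto simp del: index_mult_mat_vec)
  moreover have "P\<^sup>H *\<^sub>v ?v = ?e" by (rule unitary_mv_cancel(1)[OF P]) simp
  ultimately have "P * diag_of n d * P\<^sup>H *\<^sub>v ?v = d i \<cdot>\<^sub>v ?v"
    using dP(1,2) by (simp add: assoc_mv mv_smult)
  moreover have "?v \<noteq> 0\<^sub>v n"
  proof
    assume "?v = 0\<^sub>v n"
    then have "P\<^sup>H *\<^sub>v ?v = 0\<^sub>v n" using dP(1,2) mv_zero[of "P\<^sup>H" n] by simp
    then have "?e = 0\<^sub>v n" using unitary_mv_cancel(1)[OF P, of ?e] by simp
    then have "?e $ i = 0" using i by simp
    then show False using i by simp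
  qed
  ultimately show "eigenvalue (P * diag_of n d * P\<^sup>H) z"
    unfolding eigenvalue_def eigenvector_def using i dP(1,2) by (intro exI[of _ ?v]) (auto intro!: carrier_vecI)
qed

text \<open>Used with \<open>X = B\<close> or \<open>X = B\<^sup>H\<close>, whichever gives the smaller Gram matrix.\<close>

lemma sing_vals_spectral:
  assumes X: "X \<in> carrier_mat n k"
    and sv: "sing_vals B = image_mset (\<lambda>z. sqrt (Re z)) (proots (char_poly (X * X\<^sup>H)))"
  obtains P d where "unitary_mat n P" "\<And>i. i < n \<Longrightarrow> 0 \<le> d i"
    "X * X\<^sup>H = P * diag_of n (\<lambda>i. complex_of_real (d i)) * P\<^sup>H"
    "set_mset (sing_vals B) = (\<lambda>i. sqrt (d i)) ` {..<n}"
    "\<And>x. dim_vec x = n \<Longrightarrow> (vec_norm2 (X\<^sup>H *\<^sub>v x))\<^sup>2 = (\<Sum>i<n. d i * (cmod ((P\<^sup>H *\<^sub>v x) $ i))\<^sup>2)"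
proof -
  note dX = carrier_matD[OF X]
  have "psd_mat n (X * X\<^sup>H)" using psd_gram'[of X] dX by simp
  then obtain P d where P: "unitary_mat n P" "\<And>i. i < n \<Longrightarrow> 0 \<le> d i"
    "X * X\<^sup>H = P * diag_of n (\<lambda>i. complex_of_real (d i)) * P\<^sup>H"
    using psd_spectral by metis
  have c: "X * X\<^sup>H \<in> carrier_mat n n" using dX by (intro carrier_matI) auto
  have "set_mset (sing_vals B) = (\<lambda>z. sqrt (Re z)) ` {z. eigenvalue (X * X\<^sup>H) z}"
    unfolding sv using mem_proots_char_poly[OF c] by auto
  also have "{z. eigenvalue (X * X\<^sup>H) z} = (\<lambda>i. complex_of_real (d i)) ` {..<n}"
    unfolding P(3) eigenvalue_unitary_diag[OF P(1)] by auto
  finally have s: "set_mset (sing_vals B) = (\<lambda>i. sqrt (d i)) ` {..<n}" by (simp add: image_image)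
  have q: "(vec_norm2 (X\<^sup>H *\<^sub>v x))\<^sup>2 = (\<Sum>i<n. d i * (cmod ((P\<^sup>H *\<^sub>v x) $ i))\<^sup>2)" if x: "dim_vec x = n" for x
  proof -
    have "complex_of_real ((vec_norm2 (X\<^sup>H *\<^sub>v x))\<^sup>2) = (X\<^sup>H *\<^sub>v x) \<bullet>c (X\<^sup>H *\<^sub>v x)" by (simp only: cinner_self)
    also have "\<dots> = (X *\<^sub>v (X\<^sup>H *\<^sub>v x)) \<bullet>c x" using x dX by (simp add: cinner_adjoint)
    also have "X *\<^sub>v (X\<^sup>H *\<^sub>v x) = (X * X\<^sup>H) *\<^sub>v x" using x dX by (simp add: assoc_mv)
    also have "\<dots> \<bullet>c x = (\<Sum>i<n. complex_of_real (d i) * of_real ((cmod ((P\<^sup>H *\<^sub>v x) $ i))\<^sup>2))"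
      unfolding P(3) by (rule diag_quad_form[OF P(1) x])
    also have "\<dots> = complex_of_real (\<Sum>i<n. d i * (cmod ((P\<^sup>H *\<^sub>v x) $ i))\<^sup>2)" by simp
    finally show ?thesis by (simp only: of_real_eq_iff)
  qed
  show thesis using that[OF P s q] by blast
qed

text \<open>Translates the indexing of a descending list into order properties of the multiset, the
  form in which extreme singular values are estimated. Nonzero dimensions keep the list
  nonempty.\<close>

lemma sing_val_max_mem:
  assumes "dim_row B \<noteq> 0" "dim_col B \<noteq> 0"
  shows "sing_val_max B \<in># sing_vals B" "\<And>\<mu>. \<mu> \<in># sing_vals B \<Longrightarrow> \<mu> \<le> sing_val_max B"
    "sing_val_min B \<in># sing_vals B" "\<And>\<mu>. \<mu> \<in># sing_vals B \<Longrightarrow> sing_val_min B \<le> \<mu>"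
proof -
  define xs where "xs = sorted_list_of_multiset (sing_vals B)"
  have ms: "mset xs = sing_vals B" by (simp add: xs_def)
  have st: "set xs = set_mset (sing_vals B)" by (simp add: xs_def)
  have len: "length xs = min (dim_row B) (dim_col B)" using ms size_sing_vals[of B] by (metis size_mset)
  then have ne: "xs \<noteq> []" using assms by auto
  have sorted: "sorted xs" by (simp add: xs_def)
  have mx: "sing_val_max B = last xs"
    using ne by (simp add: sing_val_max_def sing_val_def xs_def[symmetric] rev_nth last_conv_nth)
  have "sing_val_min B = rev xs ! (length xs - 1)"
    by (simp only: sing_val_min_def sing_val_def xs_def[symmetric] len)
  also have "\<dots> = last (rev xs)"
    using ne by (metis last_conv_nth length_rev rev_is_Nil_conv)
  finally have mn: "sing_val_min B = hd xs" using ne by (simp add: last_rev)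
  show "sing_val_max B \<in># sing_vals B" "sing_val_min B \<in># sing_vals B"
    unfolding mx mn st[symmetric] using ne by auto
  show "\<mu> \<le> sing_val_max B" "sing_val_min B \<le> \<mu>" if "\<mu> \<in># sing_vals B" for \<mu>
  proof -
    have "\<mu> \<in> set xs" using that st by simp
    then obtain i where i: "i < length xs" "\<mu> = xs ! i" by (auto simp: in_set_conv_nth)
    show "\<mu> \<le> sing_val_max B" unfolding mx i(2) using ne i(1) sorted
      by (simp add: last_conv_nth sorted_nth_mono)
    show "sing_val_min B \<le> \<mu>" unfolding mn i(2) using ne i(1) sorted
      by (simp add: hd_conv_nth sorted_nth_mono)
  qed
qed

lemma sing_vals_nonneg:
  assumes \<mu>: "\<mu> \<in># sing_vals B"
  shows "0 \<le> \<mu>"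
proof -
  have *: "0 \<le> \<mu>"
    if X: "X \<in> carrier_mat n k" and sv: "sing_vals B = image_mset (\<lambda>z. sqrt (Re z)) (proots (char_poly (X * X\<^sup>H)))" for X n k
  proof -
    obtain P d where P: "unitary_mat n P" "\<And>i. i < n \<Longrightarrow> 0 \<le> d i"
      and e: "X * X\<^sup>H = P * diag_of n (\<lambda>i. complex_of_real (d i)) * P\<^sup>H"
      and s: "set_mset (sing_vals B) = (\<lambda>i. sqrt (d i)) ` {..<n}"
      and q: "\<And>x. dim_vec x = n \<Longrightarrow> (vec_norm2 (X\<^sup>H *\<^sub>v x))\<^sup>2 = (\<Sum>i<n. d i * (cmod ((P\<^sup>H *\<^sub>v x) $ i))\<^sup>2)"
      by (rule sing_vals_spectral[OF X sv]) blast
    show ?thesis using \<mu> P(2) unfolding s by auto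
  qed
  show ?thesis
  proof (cases "dim_row B \<le> dim_col B")
    case True
    have "B \<in> carrier_mat (dim_row B) (dim_col B)" by simp
    from *[OF this sing_vals_le[OF True]] show ?thesis .
  next
    case False
    have "B\<^sup>H \<in> carrier_mat (dim_col B) (dim_row B)" by simp
    from *[OF this] sing_vals_ge[of B] False show ?thesis by simp
  qed
qed

text \<open>In an eigenbasis of the Gram matrix the squared length of the image is a sum of squared
  coordinates weighted by squared singular values. The argument runs on the smaller Gram matrix,
  hence on \<open>B\<^sup>H\<close> or \<open>B\<close>, whose spectral norms agree.\<close>

lemma spectral_norm_le_sing_val_max:
  assumes ne: "dim_row B \<noteq> 0" "dim_col B \<noteq> 0"
  shows "spectral_norm B \<le> sing_val_max B"
proof -
  have *: "spectral_norm (X\<^sup>H) \<le> sing_val_max B"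
    if X: "X \<in> carrier_mat n k" and sv: "sing_vals B = image_mset (\<lambda>z. sqrt (Re z)) (proots (char_poly (X * X\<^sup>H)))" for X n k
  proof -
    obtain P d where P: "unitary_mat n P" "\<And>i. i < n \<Longrightarrow> 0 \<le> d i"
      and e: "X * X\<^sup>H = P * diag_of n (\<lambda>i. complex_of_real (d i)) * P\<^sup>H"
      and s: "set_mset (sing_vals B) = (\<lambda>i. sqrt (d i)) ` {..<n}"
      and q: "\<And>x. dim_vec x = n \<Longrightarrow> (vec_norm2 (X\<^sup>H *\<^sub>v x))\<^sup>2 = (\<Sum>i<n. d i * (cmod ((P\<^sup>H *\<^sub>v x) $ i))\<^sup>2)"
      by (rule sing_vals_spectral[OF X sv]) blast
    have m0: "0 \<le> sing_val_max B" by (rule sing_vals_nonneg[OF sing_val_max_mem(1)[OF ne]])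
    show ?thesis
    proof (rule spectral_norm_le[OF m0])
      fix x :: "complex vec" assume "dim_vec x = dim_col (X\<^sup>H)"
      then have x: "dim_vec x = n" using X by simp
      have "d i \<le> (sing_val_max B)\<^sup>2" if "i < n" for i
      proof -
        have "sqrt (d i) \<le> sing_val_max B" using sing_val_max_mem(2)[OF ne] s that by auto
        then have "(sqrt (d i))\<^sup>2 \<le> (sing_val_max B)\<^sup>2" using P(2)[OF that] by (intro power_mono) auto
        then show ?thesis using P(2)[OF that] by simp
      qed
      then have "(vec_norm2 (X\<^sup>H *\<^sub>v x))\<^sup>2 \<le> (\<Sum>i<n. (sing_val_max B)\<^sup>2 * (cmod ((P\<^sup>H *\<^sub>v x) $ i))\<^sup>2)"
        unfolding q[OF x] by (intro sum_mono mult_right_mono) auto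
      also have "\<dots> = (sing_val_max B * vec_norm2 x)\<^sup>2"
        unfolding sum_distrib_left[symmetric] unitary_coords_norm_sq[OF P(1) x] by (simp add: power_mult_distrib)
      finally show "vec_norm2 (X\<^sup>H *\<^sub>v x) \<le> sing_val_max B * vec_norm2 x"
        by (rule power2_le_imp_le) (simp add: m0)
    qed
  qed
  show ?thesis
  proof (cases "dim_row B \<le> dim_col B")
    case True
    have "B \<in> carrier_mat (dim_row B) (dim_col B)" by simp
    from *[OF this sing_vals_le[OF True]] show ?thesis by simp
  next
    case False
    have "B\<^sup>H \<in> carrier_mat (dim_col B) (dim_row B)" by simp
    from *[OF this] sing_vals_ge[of B] False show ?thesis by simp
  qed
qed

text \<open>For a square matrix the eigenvalues of both Gram matrices are the squared singular
  values, so \<open>B\<close> and \<open>B\<^sup>H\<close> are both bounded below; for a rectangular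
  matrix one of the two would have a kernel.\<close>

lemma sing_val_min_lower:
  assumes B: "B \<in> carrier_mat r r" and r: "0 < r" and x: "dim_vec x = r"
  shows "sing_val_min B * vec_norm2 x \<le> vec_norm2 (B *\<^sub>v x)"
    "sing_val_min B * vec_norm2 x \<le> vec_norm2 (B\<^sup>H *\<^sub>v x)"
proof -
  note dB = carrier_matD[OF B]
  have ne: "dim_row B \<noteq> 0" "dim_col B \<noteq> 0" using dB r by auto
  have *: "sing_val_min B * vec_norm2 x \<le> vec_norm2 (X\<^sup>H *\<^sub>v x)"
    if X: "X \<in> carrier_mat r r" and sv: "sing_vals B = image_mset (\<lambda>z. sqrt (Re z)) (proots (char_poly (X * X\<^sup>H)))" for X
  proof -
    obtain P d where P: "unitary_mat r P" "\<And>i. i < r \<Longrightarrow> 0 \<le> d i"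
      and e: "X * X\<^sup>H = P * diag_of r (\<lambda>i. complex_of_real (d i)) * P\<^sup>H"
      and s: "set_mset (sing_vals B) = (\<lambda>i. sqrt (d i)) ` {..<r}"
      and q: "\<And>x. dim_vec x = r \<Longrightarrow> (vec_norm2 (X\<^sup>H *\<^sub>v x))\<^sup>2 = (\<Sum>i<r. d i * (cmod ((P\<^sup>H *\<^sub>v x) $ i))\<^sup>2)"
      by (rule sing_vals_spectral[OF X sv]) blast
    have m0: "0 \<le> sing_val_min B" by (rule sing_vals_nonneg[OF sing_val_max_mem(3)[OF ne]])
    have "(sing_val_min B)\<^sup>2 \<le> d i" if "i < r" for i
    proof -
      have "sing_val_min B \<le> sqrt (d i)" using sing_val_max_mem(4)[OF ne] s that by auto
      then have "(sing_val_min B)\<^sup>2 \<le> (sqrt (d i))\<^sup>2" using m0 by (intro power_mono) auto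
      then show ?thesis using P(2)[OF that] by simp
    qed
    then have "(\<Sum>i<r. (sing_val_min B)\<^sup>2 * (cmod ((P\<^sup>H *\<^sub>v x) $ i))\<^sup>2) \<le> (vec_norm2 (X\<^sup>H *\<^sub>v x))\<^sup>2"
      unfolding q[OF x] by (intro sum_mono mult_right_mono) auto
    then have "(sing_val_min B * vec_norm2 x)\<^sup>2 \<le> (vec_norm2 (X\<^sup>H *\<^sub>v x))\<^sup>2"
      unfolding sum_distrib_left[symmetric] unitary_coords_norm_sq[OF P(1) x] by (simp add: power_mult_distrib)
    then show ?thesis by (rule power2_le_imp_le) simp
  qed
  show "sing_val_min B * vec_norm2 x \<le> vec_norm2 (B\<^sup>H *\<^sub>v x)"
    by (rule *[OF B sing_vals_le]) (use dB in simp)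
  have "B\<^sup>H \<in> carrier_mat r r" using B by simp
  from *[OF this] sing_vals_ge[of B] dB show "sing_val_min B * vec_norm2 x \<le> vec_norm2 (B *\<^sub>v x)" by simp
qed

text \<open>The hypotheses say that \<open>l\<close> is an eigenvalue of \<open>[[0, G], [G\<^sup>H, 0]]\<close> with eigenvector \<open>(u, v)\<close>.\<close>

lemma dilation_eigenvalue_mem:
  fixes l :: real
  assumes G: "G \<in> carrier_mat p q" and u: "dim_vec u = p" and v: "dim_vec v = q"
    and ne: "u \<noteq> 0\<^sub>v p \<or> v \<noteq> 0\<^sub>v q"
    and e1: "G *\<^sub>v v = complex_of_real l \<cdot>\<^sub>v u" and e2: "G\<^sup>H *\<^sub>v u = complex_of_real l \<cdot>\<^sub>v v"
  shows "\<bar>l\<bar> \<in># sing_vals_ext G"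
proof -
  note dG = carrier_matD[OF G]
  have mem: "\<bar>l\<bar> \<in># sing_vals G"
    if X: "X \<in> carrier_mat k n" and sv: "sing_vals G = image_mset (\<lambda>z. sqrt (Re z)) (proots (char_poly (X * X\<^sup>H)))"
      and w: "dim_vec w = k" "w \<noteq> 0\<^sub>v k" and e: "(X * X\<^sup>H) *\<^sub>v w = complex_of_real (l\<^sup>2) \<cdot>\<^sub>v w" for X k n w
  proof -
    have c: "X * X\<^sup>H \<in> carrier_mat k k" using X by auto
    have "eigenvalue (X * X\<^sup>H) (complex_of_real (l\<^sup>2))"
      unfolding eigenvalue_def eigenvector_def using w e X by (intro exI[of _ w]) (auto intro!: carrier_vecI)
    then have "complex_of_real (l\<^sup>2) \<in># proots (char_poly (X * X\<^sup>H))" using mem_proots_char_poly[OF c] by simp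
    then have "sqrt (Re (complex_of_real (l\<^sup>2))) \<in># sing_vals G" unfolding sv set_image_mset by (rule imageI)
    then show ?thesis by simp
  qed
  have gu: "(G * G\<^sup>H) *\<^sub>v u = complex_of_real (l\<^sup>2) \<cdot>\<^sub>v u"
    using dG u v by (simp add: assoc_mv e1 e2 mv_smult smult_smult_assoc power2_eq_square)
  have gv: "(G\<^sup>H * G) *\<^sub>v v = complex_of_real (l\<^sup>2) \<cdot>\<^sub>v v"
    using dG u v by (simp add: assoc_mv e1 e2 mv_smult smult_smult_assoc power2_eq_square)
  have l0: "l = 0" if "x = 0\<^sub>v j" "y \<noteq> 0\<^sub>v k" "A *\<^sub>v x = complex_of_real l \<cdot>\<^sub>v y" "dim_vec y = k" "dim_col A = j" "dim_row A = k"
    for x y :: "complex vec" and A j k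
  proof -
    have "complex_of_real l \<cdot>\<^sub>v y = 0\<^sub>v k" using that(1,3,5,6) by (metis mv_zero)
    then have "cmod (complex_of_real l) * vec_norm2 y = 0" by (metis vec_norm2_smult vec_norm2_zero)
    moreover have "vec_norm2 y \<noteq> 0" using that by simp
    ultimately show ?thesis by simp
  qed
  show ?thesis
  proof (cases "p \<le> q")
    case True
    show ?thesis
    proof (cases "u = 0\<^sub>v p")
      case False
      have "\<bar>l\<bar> \<in># sing_vals G" by (rule mem[OF G sing_vals_le u False gu]) (use dG True in simp)
      then show ?thesis by (simp add: sing_vals_ext_def)
    next
      \<comment> \<open>\<open>u = 0\<close> forces \<open>l = 0\<close>. For \<open>p = q\<close>
        the vector \<open>v\<close> exhibits 0 as a singular value through the other Gram matrix;
        for \<open>p < q\<close> it is one of the added zeros.\<close>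
      case u0: True
      then have v0: "v \<noteq> 0\<^sub>v q" using ne by simp
      have "l = 0" by (rule l0[OF u0 v0 e2 v]) (use dG in simp_all)
      show ?thesis
      proof (cases "p = q")
        case True
        have "G\<^sup>H \<in> carrier_mat q p" using G by simp
        from mem[OF this _ v v0] gv sing_vals_ge[of G] dG True have "\<bar>l\<bar> \<in># sing_vals G" by simp
        then show ?thesis by (simp add: sing_vals_ext_def)
      next
        case False
        then show ?thesis using \<open>l = 0\<close> dG \<open>p \<le> q\<close> by (simp add: sing_vals_ext_def max_def min_def)
      qed
    qed
  next
    case False
    show ?thesis
    proof (cases "v = 0\<^sub>v q")
      case v0: False
      have "G\<^sup>H \<in> carrier_mat q p" using G by simp
      from mem[OF this _ v v0] gv sing_vals_ge[of G] dG False have "\<bar>l\<bar> \<in># sing_vals G" by simp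
      then show ?thesis by (simp add: sing_vals_ext_def)
    next
      case v0: True
      then have u0: "u \<noteq> 0\<^sub>v p" using ne by simp
      have "l = 0" by (rule l0[OF v0 u0 e1 u]) (use dG in simp_all)
      then show ?thesis using dG False by (simp add: sing_vals_ext_def max_def min_def)
    qed
  qed
qed

text \<open>The mutually inverse Hermitian factors cancel in the Gram matrix:
  \<open>B * B\<^sup>H = S * M * M'\<^sup>H * S'\<close> is similar to
  \<open>M * M'\<^sup>H\<close>. Thus \<open>M\<close> and \<open>M'\<close> alone control the
  singular values of \<open>B\<close>, with no loss from the conditioning of \<open>S\<close> and
  \<open>R\<close>, which will be square roots of matrices such as
  \<open>1 + \<Gamma>\<^sup>H * \<Gamma>\<close> and their inverses.\<close>

lemma sing_vals_similar:
  assumes \<mu>: "\<mu> \<in># sing_vals B" and B: "B \<in> carrier_mat p q"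
    and S: "S \<in> carrier_mat p p" "S' \<in> carrier_mat p p" "S\<^sup>H = S" "S'\<^sup>H = S'" "S * S' = 1\<^sub>m p" "S' * S = 1\<^sub>m p"
    and R: "R \<in> carrier_mat q q" "R' \<in> carrier_mat q q" "R\<^sup>H = R" "R'\<^sup>H = R'" "R * R' = 1\<^sub>m q" "R' * R = 1\<^sub>m q"
    and M: "M \<in> carrier_mat p q" "M' \<in> carrier_mat p q" "B = S * M * R" "B = S' * M' * R'"
  shows "(\<exists>w. dim_vec w = p \<and> w \<noteq> 0\<^sub>v p \<and> p \<le> q \<and> M *\<^sub>v (M'\<^sup>H *\<^sub>v w) = complex_of_real (\<mu>\<^sup>2) \<cdot>\<^sub>v w) \<or>
    (\<exists>w. dim_vec w = q \<and> w \<noteq> 0\<^sub>v q \<and> q < p \<and> M'\<^sup>H *\<^sub>v (M *\<^sub>v w) = complex_of_real (\<mu>\<^sup>2) \<cdot>\<^sub>v w)"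
proof -
  note d = carrier_matD[OF B] carrier_matD[OF S(1)] carrier_matD[OF S(2)] carrier_matD[OF R(1)] carrier_matD[OF R(2)]
    carrier_matD[OF M(1)] carrier_matD[OF M(2)]
  have eig: "\<exists>v. dim_vec v = k \<and> v \<noteq> 0\<^sub>v k \<and> (X * X\<^sup>H) *\<^sub>v v = complex_of_real (\<mu>\<^sup>2) \<cdot>\<^sub>v v"
    if X: "X \<in> carrier_mat k n" and sv: "sing_vals B = image_mset (\<lambda>z. sqrt (Re z)) (proots (char_poly (X * X\<^sup>H)))" for X k n
  proof -
    obtain P t where P: "unitary_mat k P" "\<And>i. i < k \<Longrightarrow> 0 \<le> t i"
      and e: "X * X\<^sup>H = P * diag_of k (\<lambda>i. complex_of_real (t i)) * P\<^sup>H"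
      and s: "set_mset (sing_vals B) = (\<lambda>i. sqrt (t i)) ` {..<k}"
      and q: "\<And>x. dim_vec x = k \<Longrightarrow> (vec_norm2 (X\<^sup>H *\<^sub>v x))\<^sup>2 = (\<Sum>i<k. t i * (cmod ((P\<^sup>H *\<^sub>v x) $ i))\<^sup>2)"
      by (rule sing_vals_spectral[OF X sv]) blast
    obtain i where i: "i < k" "\<mu> = sqrt (t i)" using \<mu> s by auto
    have "complex_of_real (\<mu>\<^sup>2) = complex_of_real (t i)" using i P(2) by simp
    then have "eigenvalue (X * X\<^sup>H) (complex_of_real (\<mu>\<^sup>2))"
      unfolding e eigenvalue_unitary_diag[OF P(1)] using i(1) by blast
    moreover have "dim_row (X * X\<^sup>H) = k" using X by simp
    ultimately obtain v where "v \<in> carrier_vec k" "v \<noteq> 0\<^sub>v k" "(X * X\<^sup>H) *\<^sub>v v = complex_of_real (\<mu>\<^sup>2) \<cdot>\<^sub>v v"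
      unfolding eigenvalue_def eigenvector_def by metis
    then show ?thesis using carrier_vecD by blast
  qed
  have nz: "A *\<^sub>v v \<noteq> 0\<^sub>v k" if "A' * A = 1\<^sub>m k" "dim_row A = k" "dim_col A = k" "dim_col A' = k" "dim_vec v = k" "v \<noteq> 0\<^sub>v k"
    for A A' :: "complex mat" and v k
  proof
    assume "A *\<^sub>v v = 0\<^sub>v k"
    then have "A' *\<^sub>v (A *\<^sub>v v) = 0\<^sub>v (dim_row A')" using mv_zero[OF that(4)] by simp
    moreover have "A' *\<^sub>v (A *\<^sub>v v) = (A' * A) *\<^sub>v v" by (rule assoc_mv[symmetric]) (use that in simp_all)
    moreover have "dim_row A' = k" using arg_cong[OF that(1), of dim_row] by simp
    moreover have "v \<in> carrier_vec k" using that(5) by (rule carrier_vecI)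
    ultimately show False using that by simp
  qed
  show ?thesis
  proof (cases "p \<le> q")
    case True
    obtain v where v: "dim_vec v = p" "v \<noteq> 0\<^sub>v p" "(B * B\<^sup>H) *\<^sub>v v = complex_of_real (\<mu>\<^sup>2) \<cdot>\<^sub>v v"
      using eig[OF B sing_vals_le] True d by auto
    have "S' * (B * B\<^sup>H) = (S' * S) * (M * ((R * R') * (M'\<^sup>H * S')))"
    proof -
      have "B * B\<^sup>H = (S * M * R) * (S' * M' * R')\<^sup>H" using M(3,4) by metis
      then show ?thesis using d S(4) R(4) by (simp add: adjoint_mm assoc_mm)
    qed
    then have "S' * (B * B\<^sup>H) = M * (M'\<^sup>H * S')" unfolding S(6) R(5) using d by simp
    then have "S' *\<^sub>v ((B * B\<^sup>H) *\<^sub>v v) = M *\<^sub>v (M'\<^sup>H *\<^sub>v (S' *\<^sub>v v))"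
      using d v(1) by (simp flip: assoc_mv)
    then have "M *\<^sub>v (M'\<^sup>H *\<^sub>v (S' *\<^sub>v v)) = complex_of_real (\<mu>\<^sup>2) \<cdot>\<^sub>v (S' *\<^sub>v v)"
      unfolding v(3) using d v(1) by (simp add: mv_smult)
    moreover have "S' *\<^sub>v v \<noteq> 0\<^sub>v p" by (rule nz[OF S(5)]) (use d v in auto)
    ultimately show ?thesis using True d by (intro disjI1 exI[of _ "S' *\<^sub>v v"]) auto
  next
    case False
    have "B\<^sup>H \<in> carrier_mat q p" using B by simp
    from eig[OF this] sing_vals_ge[of B] d False
    obtain v where v: "dim_vec v = q" "v \<noteq> 0\<^sub>v q" "(B\<^sup>H * B) *\<^sub>v v = complex_of_real (\<mu>\<^sup>2) \<cdot>\<^sub>v v" by auto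
    have "R * (B\<^sup>H * B) = (R * R') * (M'\<^sup>H * ((S' * S) * (M * R)))"
    proof -
      have "B\<^sup>H * B = (S' * M' * R')\<^sup>H * (S * M * R)" using M(3,4) by metis
      then show ?thesis using d S(4) R(4) by (simp add: adjoint_mm assoc_mm)
    qed
    then have "R * (B\<^sup>H * B) = M'\<^sup>H * (M * R)" unfolding S(6) R(5) using d by simp
    then have "R *\<^sub>v ((B\<^sup>H * B) *\<^sub>v v) = M'\<^sup>H *\<^sub>v (M *\<^sub>v (R *\<^sub>v v))"
      using d v(1) by (simp flip: assoc_mv)
    then have "M'\<^sup>H *\<^sub>v (M *\<^sub>v (R *\<^sub>v v)) = complex_of_real (\<mu>\<^sup>2) \<cdot>\<^sub>v (R *\<^sub>v v)"
      unfolding v(3) using d v(1) by (simp add: mv_smult)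
    moreover have "R *\<^sub>v v \<noteq> 0\<^sub>v q" by (rule nz[OF R(6)]) (use d v in auto)
    ultimately show ?thesis using False d by (intro disjI2 exI[of _ "R *\<^sub>v v"]) auto
  qed
qed

text \<open>The squared singular value is an eigenvalue of a product of two matrices of spectral
  norm at most \<open>t\<close>.\<close>

lemma sing_val_max_similar:
  assumes B: "B \<in> carrier_mat p q" "p \<noteq> 0" "q \<noteq> 0"
    and S: "S \<in> carrier_mat p p" "S' \<in> carrier_mat p p" "S\<^sup>H = S" "S'\<^sup>H = S'" "S * S' = 1\<^sub>m p" "S' * S = 1\<^sub>m p"
    and R: "R \<in> carrier_mat q q" "R' \<in> carrier_mat q q" "R\<^sup>H = R" "R'\<^sup>H = R'" "R * R' = 1\<^sub>m q" "R' * R = 1\<^sub>m q"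
    and M: "M \<in> carrier_mat p q" "M' \<in> carrier_mat p q" "B = S * M * R" "B = S' * M' * R'"
    and t: "spectral_norm M \<le> t" "spectral_norm M' \<le> t"
  shows "sing_val_max B \<le> t"
proof -
  let ?\<mu> = "sing_val_max B"
  have \<mu>: "?\<mu> \<in># sing_vals B" using sing_val_max_mem(1)[of B] B by auto
  have t0: "0 \<le> t" using t(1) spectral_norm_nonneg[of M] by linarith
  have *: "?\<mu>\<^sup>2 \<le> t\<^sup>2" if "dim_vec w = k" "w \<noteq> 0\<^sub>v k" "X *\<^sub>v (Y *\<^sub>v w) = complex_of_real (?\<mu>\<^sup>2) \<cdot>\<^sub>v w"
    "dim_col Y = k" "dim_col X = dim_row Y" "spectral_norm X \<le> t" "spectral_norm Y \<le> t" for X Y w k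
  proof -
    have "vec_norm2 w \<noteq> 0" using that by simp
    then have w: "0 < vec_norm2 w" by (metis less_eq_real_def vec_norm2_nonneg)
    have "?\<mu>\<^sup>2 * vec_norm2 w = vec_norm2 (X *\<^sub>v (Y *\<^sub>v w))" unfolding that(3) by (simp del: of_real_power)
    also have "\<dots> \<le> spectral_norm X * vec_norm2 (Y *\<^sub>v w)" using that by (intro spectral_norm_bound) auto
    also have "\<dots> \<le> spectral_norm X * (spectral_norm Y * vec_norm2 w)"
      using that by (intro mult_left_mono spectral_norm_bound) auto
    also have "\<dots> \<le> t * (t * vec_norm2 w)" using that t0 by (intro mult_mono) auto
    finally have "?\<mu>\<^sup>2 * vec_norm2 w \<le> t\<^sup>2 * vec_norm2 w" by (simp add: power2_eq_square mult.assoc)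
    then show ?thesis using w by simp
  qed
  have "?\<mu>\<^sup>2 \<le> t\<^sup>2"
    using sing_vals_similar[OF \<mu> B(1) S R M]
  proof (elim disjE exE conjE)
    fix w assume "dim_vec w = p" "w \<noteq> 0\<^sub>v p" "M *\<^sub>v (M'\<^sup>H *\<^sub>v w) = complex_of_real (?\<mu>\<^sup>2) \<cdot>\<^sub>v w"
    then show ?thesis by (rule *) (use M t in auto)
  next
    fix w assume "dim_vec w = q" "w \<noteq> 0\<^sub>v q" "M'\<^sup>H *\<^sub>v (M *\<^sub>v w) = complex_of_real (?\<mu>\<^sup>2) \<cdot>\<^sub>v w"
    then show ?thesis by (rule *) (use M t in auto)
  qed
  then show ?thesis using t0 by (rule power2_le_imp_le)
qed

text \<open>For \<open>t \<ge> 0\<close> the two lower bounds compose to \<open>t\<^sup>2\<close>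
  and are compared with the eigenvalue of \<open>M * M'\<^sup>H\<close>; for negative
  \<open>t\<close> nonnegativity of singular values suffices.\<close>

lemma sing_val_min_similar:
  assumes B: "B \<in> carrier_mat p p" "p \<noteq> 0"
    and S: "S \<in> carrier_mat p p" "S' \<in> carrier_mat p p" "S\<^sup>H = S" "S'\<^sup>H = S'" "S * S' = 1\<^sub>m p" "S' * S = 1\<^sub>m p"
    and R: "R \<in> carrier_mat p p" "R' \<in> carrier_mat p p" "R\<^sup>H = R" "R'\<^sup>H = R'" "R * R' = 1\<^sub>m p" "R' * R = 1\<^sub>m p"
    and M: "M \<in> carrier_mat p p" "M' \<in> carrier_mat p p" "B = S * M * R" "B = S' * M' * R'"
    and t: "\<And>x. dim_vec x = p \<Longrightarrow> t * vec_norm2 x \<le> vec_norm2 (M *\<^sub>v x)"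
      "\<And>x. dim_vec x = p \<Longrightarrow> t * vec_norm2 x \<le> vec_norm2 (M'\<^sup>H *\<^sub>v x)"
  shows "t \<le> sing_val_min B"
proof (cases "0 \<le> t")
  case t0: True
  let ?\<mu> = "sing_val_min B"
  have \<mu>: "?\<mu> \<in># sing_vals B" using sing_val_max_mem(3)[of B] B by auto
  have \<mu>0: "0 \<le> ?\<mu>" by (rule sing_vals_nonneg[OF \<mu>])
  obtain w where w: "dim_vec w = p" "w \<noteq> 0\<^sub>v p" "M *\<^sub>v (M'\<^sup>H *\<^sub>v w) = complex_of_real (?\<mu>\<^sup>2) \<cdot>\<^sub>v w"
    using sing_vals_similar[OF \<mu> B(1) S R M] by auto
  have "vec_norm2 w \<noteq> 0" using w by simp
  then have wp: "0 < vec_norm2 w" by (metis less_eq_real_def vec_norm2_nonneg)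
  have "t * (t * vec_norm2 w) \<le> t * vec_norm2 (M'\<^sup>H *\<^sub>v w)" using t0 w by (intro mult_left_mono t(2)) auto
  also have "\<dots> \<le> vec_norm2 (M *\<^sub>v (M'\<^sup>H *\<^sub>v w))" using M by (intro t(1)) auto
  also have "\<dots> = ?\<mu>\<^sup>2 * vec_norm2 w" unfolding w(3) by (simp del: of_real_power)
  finally have "t\<^sup>2 * vec_norm2 w \<le> ?\<mu>\<^sup>2 * vec_norm2 w" by (simp add: power2_eq_square mult.assoc)
  then have "t\<^sup>2 \<le> ?\<mu>\<^sup>2" using wp by simp
  then show ?thesis using \<mu>0 by (rule power2_le_imp_le)
next
  case False
  have "sing_val_min B \<in># sing_vals B" using sing_val_max_mem(3)[of B] B by auto
  then have "0 \<le> sing_val_min B" by (rule sing_vals_nonneg)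
  then show ?thesis using False by simp
qed

subsection \<open>Block matrices and Hermitian dilations\<close>

lemma vec_split:
  fixes x :: "complex vec"
  assumes "dim_vec x = k + l"
  obtains u v where "x = u @\<^sub>v v" "dim_vec u = k" "dim_vec v = l"
proof -
  have "x \<in> carrier_vec (k + l)" using assms by (rule carrier_vecI)
  then have "x = vec_first x k @\<^sub>v vec_last x l" by simp
  then show thesis by (rule that) (auto simp: vec_first_def vec_last_def)
qed

lemma vec_norm2_append: "(vec_norm2 (u @\<^sub>v v))\<^sup>2 = (vec_norm2 u)\<^sup>2 + (vec_norm2 v)\<^sup>2"
proof -
  have split: "(\<Sum>i<p + q. f i) = (\<Sum>i<p. f i) + (\<Sum>i<q. f (p + i))" for f :: "nat \<Rightarrow> real" and p q
    by (induction q) (auto simp: add_ac)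
  show ?thesis unfolding vec_norm2_sq by (simp add: split)
qed

lemma four_block_mv:
  fixes A :: "complex mat"
  assumes "A \<in> carrier_mat p k" "B \<in> carrier_mat p l" "C \<in> carrier_mat q k" "D \<in> carrier_mat q l"
    "dim_vec u = k" "dim_vec v = l"
  shows "four_block_mat A B C D *\<^sub>v (u @\<^sub>v v) = (A *\<^sub>v u + B *\<^sub>v v) @\<^sub>v (C *\<^sub>v u + D *\<^sub>v v)"
  by (rule four_block_mat_mult_vec[OF assms(1-4) carrier_vecI[OF assms(5)] carrier_vecI[OF assms(6)]])

lemma zero_mv: "dim_vec x = n \<Longrightarrow> 0\<^sub>m k n *\<^sub>v x = (0\<^sub>v k :: complex vec)"
  by (intro eq_vecI) auto

lemma add_zero_v: "dim_vec x = n \<Longrightarrow> x + 0\<^sub>v n = x" "dim_vec x = n \<Longrightarrow> 0\<^sub>v n + x = x"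
  for x :: "complex vec"
  by (auto intro!: eq_vecI)

lemma spectral_norm_block_diag:
  assumes A: "A \<in> carrier_mat p k" and D: "D \<in> carrier_mat q l"
    and t: "spectral_norm A \<le> t" "spectral_norm D \<le> t"
  shows "spectral_norm (four_block_mat A (0\<^sub>m p l) (0\<^sub>m q k) D) \<le> t"
proof (rule spectral_norm_le)
  note d = carrier_matD[OF A] carrier_matD[OF D]
  show t0: "0 \<le> t" using t(1) spectral_norm_nonneg[of A] by linarith
  fix x :: "complex vec" assume "dim_vec x = dim_col (four_block_mat A (0\<^sub>m p l) (0\<^sub>m q k) D)"
  then have "dim_vec x = k + l" using d by simp
  then obtain u v where x: "x = u @\<^sub>v v" "dim_vec u = k" "dim_vec v = l" by (rule vec_split)
  have "four_block_mat A (0\<^sub>m p l) (0\<^sub>m q k) D *\<^sub>v x = (A *\<^sub>v u) @\<^sub>v (D *\<^sub>v v)"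
    unfolding x(1) using d x(2,3)
    by (subst four_block_mv[OF A zero_carrier_mat zero_carrier_mat D]) (simp_all add: zero_mv add_zero_v)
  then have "(vec_norm2 (four_block_mat A (0\<^sub>m p l) (0\<^sub>m q k) D *\<^sub>v x))\<^sup>2 = (vec_norm2 (A *\<^sub>v u))\<^sup>2 + (vec_norm2 (D *\<^sub>v v))\<^sup>2"
    by (simp only: vec_norm2_append)
  also have "\<dots> \<le> (t * vec_norm2 u)\<^sup>2 + (t * vec_norm2 v)\<^sup>2"
  proof (intro add_mono power_mono)
    show "vec_norm2 (A *\<^sub>v u) \<le> t * vec_norm2 u"
      by (rule order_trans[OF spectral_norm_bound mult_right_mono[OF t(1)]]) (use d x in auto)
    show "vec_norm2 (D *\<^sub>v v) \<le> t * vec_norm2 v"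
      by (rule order_trans[OF spectral_norm_bound mult_right_mono[OF t(2)]]) (use d x in auto)
  qed auto
  also have "\<dots> = (t * vec_norm2 x)\<^sup>2"
    unfolding x(1) power_mult_distrib vec_norm2_append by (simp add: algebra_simps)
  finally show "vec_norm2 (four_block_mat A (0\<^sub>m p l) (0\<^sub>m q k) D *\<^sub>v x) \<le> t * vec_norm2 x"
    by (rule power2_le_imp_le) (simp add: t0)
qed

section \<open>Exchanging blocks by permutation matrices\<close>

definition swap_mat :: "nat \<Rightarrow> nat \<Rightarrow> complex mat" where
  "swap_mat p q = four_block_mat (0\<^sub>m p q) (1\<^sub>m p) (1\<^sub>m q) (0\<^sub>m q p)"

lemma swap_mat_dim [simp]: "dim_row (swap_mat p q) = p + q" "dim_col (swap_mat p q) = q + p"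
  by (simp_all add: swap_mat_def)

lemma unitary_swap_mat: "unitary_mat (p + q) (swap_mat p q)"
proof (rule unitary_matI)
  show "swap_mat p q \<in> carrier_mat (p + q) (p + q)" by (intro carrier_matI) (auto simp: add.commute)
  have "(swap_mat p q)\<^sup>H * swap_mat p q = 1\<^sub>m (q + p)"
    unfolding swap_mat_def by (simp add: block_simps mat_dist)
  then show "(swap_mat p q)\<^sup>H * swap_mat p q = 1\<^sub>m (p + q)" by (simp add: add.commute)
qed

lemma unitary_swap_mat': "unitary_mat (q + p) (swap_mat p q)"
  using unitary_swap_mat[of p q] by (simp add: add.commute)

text \<open>Exchanging block columns is a unitary operation. It lets an off-diagonal right-hand side
  be measured by the norm of a block diagonal matrix.\<close>

lemma ui_norm_offdiag:
  assumes N: "unitarily_invariant_norm N" and C: "C \<in> carrier_mat p l" and D: "D \<in> carrier_mat q k"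
  shows "N (four_block_mat (0\<^sub>m p k) C D (0\<^sub>m q l)) = N (four_block_mat C (0\<^sub>m p k) (0\<^sub>m q l) D)"
proof -
  note d = carrier_matD[OF C] carrier_matD[OF D]
  have "four_block_mat (0\<^sub>m p k) C D (0\<^sub>m q l) = four_block_mat C (0\<^sub>m p k) (0\<^sub>m q l) D * swap_mat l k"
    unfolding swap_mat_def using d by (simp add: block_simps mat_dist)
  then show ?thesis using ui_norm_unitary_right[OF N unitary_swap_mat] d by simp
qed

lemma ui_norm_swap_diag:
  assumes N: "unitarily_invariant_norm N" and C: "C \<in> carrier_mat p l" and D: "D \<in> carrier_mat q k"
  shows "N (four_block_mat D (0\<^sub>m q l) (0\<^sub>m p k) C) = N (four_block_mat C (0\<^sub>m p k) (0\<^sub>m q l) D)"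
proof -
  note d = carrier_matD[OF C] carrier_matD[OF D]
  have "swap_mat q p * four_block_mat C (0\<^sub>m p k) (0\<^sub>m q l) D = four_block_mat (0\<^sub>m q l) D C (0\<^sub>m p k)"
    unfolding swap_mat_def using d by (simp add: block_simps mat_dist)
  then have "N (four_block_mat (0\<^sub>m q l) D C (0\<^sub>m p k)) = N (four_block_mat C (0\<^sub>m p k) (0\<^sub>m q l) D)"
    using ui_norm_unitary_left[OF N unitary_swap_mat'[of p q], of "four_block_mat C (0\<^sub>m p k) (0\<^sub>m q l) D"] d by simp
  then show ?thesis using ui_norm_offdiag[OF N D C] by simp
qed

section \<open>Hermitian dilations and perturbation of their spectra\<close>

definition dilation :: "complex mat \<Rightarrow> complex mat" where
  "dilation G = four_block_mat (0\<^sub>m (dim_row G) (dim_row G)) G (G\<^sup>H) (0\<^sub>m (dim_col G) (dim_col G))"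

lemma dilation_carrier: "G \<in> carrier_mat p q \<Longrightarrow> dilation G \<in> carrier_mat (p + q) (p + q)"
  by (auto simp: dilation_def)

lemma dilation_hermitian: "(dilation G)\<^sup>H = dilation G"
  by (simp add: dilation_def adjoint_four_block)

lemma dilation_add:
  assumes "G \<in> carrier_mat p q" "E \<in> carrier_mat p q"
  shows "dilation (G + E) = dilation G + dilation E"
  using carrier_matD[OF assms(1)] carrier_matD[OF assms(2)]
  by (simp add: dilation_def block_simps mat_dist)

text \<open>Up to an exchange of block columns, the dilation is block diagonal with blocks
  \<open>E\<close> and \<open>E\<^sup>H\<close>, which have the same norm.\<close>

lemma spectral_norm_dilation:
  assumes "E \<in> carrier_mat p q"
  shows "spectral_norm (dilation E) \<le> spectral_norm E"
proof -
  note d = carrier_matD[OF assms]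
  let ?B = "four_block_mat E (0\<^sub>m p p) (0\<^sub>m q q) (E\<^sup>H)"
  have e: "dilation E = ?B * swap_mat q p"
    unfolding swap_mat_def dilation_def using d by (simp add: block_simps mat_dist)
  have "spectral_norm (dilation E) \<le> spectral_norm ?B * spectral_norm (swap_mat q p)"
    unfolding e using d by (intro spectral_norm_mm) simp
  also have "\<dots> \<le> spectral_norm E * 1"
  proof (intro mult_mono)
    show "spectral_norm ?B \<le> spectral_norm E"
      by (rule spectral_norm_block_diag) (use assms in auto)
    show "spectral_norm (swap_mat q p) \<le> 1"
      by (rule spectral_norm_isometry[OF unitary_matD(3)[OF unitary_swap_mat]])
  qed auto
  finally show ?thesis by simp
qed

text \<open>The two halves of an eigenvector satisfy the equations of
  \<open>dilation_eigenvalue_mem\<close>. A rectangular \<open>G\<close> forces extra zero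
  eigenvalues, which is where the extended multiset enters.\<close>

lemma dilation_spectral:
  assumes G: "G \<in> carrier_mat p q"
  obtains P d where "unitary_mat (p + q) P" "dilation G = P * diag_of (p + q) (\<lambda>i. complex_of_real (d i)) * P\<^sup>H"
    "\<And>i. i < p + q \<Longrightarrow> \<bar>d i\<bar> \<in># sing_vals_ext G"
proof -
  note dG = carrier_matD[OF G]
  obtain P d where P: "unitary_mat (p + q) P" and e: "dilation G = P * diag_of (p + q) (\<lambda>i. complex_of_real (d i)) * P\<^sup>H"
    using hermitian_spectral[OF dilation_carrier[OF G] dilation_hermitian] by blast
  have "\<bar>d i\<bar> \<in># sing_vals_ext G" if i: "i < p + q" for i
  proof -
    have "eigenvalue (dilation G) (complex_of_real (d i))" unfolding e eigenvalue_unitary_diag[OF P] using i by blast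
    moreover have "dim_row (dilation G) = p + q" using dilation_carrier[OF G] by simp
    ultimately obtain x where x: "x \<in> carrier_vec (p + q)" "x \<noteq> 0\<^sub>v (p + q)" "dilation G *\<^sub>v x = complex_of_real (d i) \<cdot>\<^sub>v x"
      unfolding eigenvalue_def eigenvector_def by metis
    have "dim_vec x = p + q" using x(1) by simp
    then obtain u v where uv: "x = u @\<^sub>v v" "dim_vec u = p" "dim_vec v = q" by (rule vec_split)
    have "dilation G *\<^sub>v x = (G *\<^sub>v v) @\<^sub>v (G\<^sup>H *\<^sub>v u)"
      unfolding dilation_def uv(1) using dG uv(2,3)
      by (subst four_block_mv[of _ p p _ q _ q]) (simp_all add: zero_mv add_zero_v G)
    then have eq: "(G *\<^sub>v v) @\<^sub>v (G\<^sup>H *\<^sub>v u) = complex_of_real (d i) \<cdot>\<^sub>v (u @\<^sub>v v)" using x(3) uv(1) by simp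
    have e1: "G *\<^sub>v v = complex_of_real (d i) \<cdot>\<^sub>v u"
    proof (rule eq_vecI)
      fix k assume "k < dim_vec (complex_of_real (d i) \<cdot>\<^sub>v u)"
      then have k: "k < p" using uv by simp
      have "((G *\<^sub>v v) @\<^sub>v (G\<^sup>H *\<^sub>v u)) $ k = (complex_of_real (d i) \<cdot>\<^sub>v (u @\<^sub>v v)) $ k" unfolding eq ..
      then show "(G *\<^sub>v v) $ k = (complex_of_real (d i) \<cdot>\<^sub>v u) $ k" using k dG uv(2,3) by (simp del: index_mult_mat_vec)
    qed (use dG uv in simp)
    have e2: "G\<^sup>H *\<^sub>v u = complex_of_real (d i) \<cdot>\<^sub>v v"
    proof (rule eq_vecI)
      fix k assume "k < dim_vec (complex_of_real (d i) \<cdot>\<^sub>v v)"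
      then have k: "k < q" using uv by simp
      have "((G *\<^sub>v v) @\<^sub>v (G\<^sup>H *\<^sub>v u)) $ (p + k) = (complex_of_real (d i) \<cdot>\<^sub>v (u @\<^sub>v v)) $ (p + k)" unfolding eq ..
      then show "(G\<^sup>H *\<^sub>v u) $ k = (complex_of_real (d i) \<cdot>\<^sub>v v) $ k" using k dG uv(2,3) by (simp del: index_mult_mat_vec)
    qed (use dG uv in simp)
    have ne: "u \<noteq> 0\<^sub>v p \<or> v \<noteq> 0\<^sub>v q"
    proof (rule ccontr)
      assume "\<not> ?thesis"
      then have "x = 0\<^sub>v (p + q)" unfolding uv(1) by (intro eq_vecI) auto
      with x(2) show False by simp
    qed
    show ?thesis by (rule dilation_eigenvalue_mem[OF G uv(2,3) ne e1 e2])
  qed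
  then show thesis using that[OF P e] by blast
qed

text \<open>The nearest-eigenvalue form of Weyl's inequality, free of any ordering of eigenvalues.
  If \<open>d i\<close> were farther than the norm of \<open>E\<close> from all eigenvalues of
  \<open>dilation G\<close>, then for an eigenvector \<open>x\<close> the vector
  \<open>d i \<cdot>\<^sub>v x - dilation G *\<^sub>v x\<close>, which is
  \<open>dilation E *\<^sub>v x\<close>, would be longer than the norm of \<open>E\<close>
  permits.\<close>

lemma dilation_perturbed_eigenvalue:
  assumes G: "G \<in> carrier_mat p q" and E: "E \<in> carrier_mat p q"
    and P: "unitary_mat (p + q) P" "dilation (G + E) = P * diag_of (p + q) (\<lambda>i. complex_of_real (d i)) * P\<^sup>H"
    and i: "i < p + q"
  shows "\<exists>l. \<bar>l\<bar> \<in># sing_vals_ext G \<and> \<bar>d i - l\<bar> \<le> spectral_norm E"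
proof (rule ccontr)
  assume neg: "\<not> ?thesis"
  let ?n = "p + q"
  obtain Q a where Q: "unitary_mat ?n Q" "dilation G = Q * diag_of ?n (\<lambda>i. complex_of_real (a i)) * Q\<^sup>H"
    and a: "\<And>i. i < ?n \<Longrightarrow> \<bar>a i\<bar> \<in># sing_vals_ext G"
    using dilation_spectral[OF G] by blast
  note dQ = unitary_matD[OF Q(1)]
  have far: "spectral_norm E < \<bar>d i - a j\<bar>" if "j < ?n" for j using neg a[OF that] by force
  have "eigenvalue (dilation (G + E)) (complex_of_real (d i))" unfolding P(2) eigenvalue_unitary_diag[OF P(1)] using i by blast
  moreover have "dim_row (dilation (G + E)) = ?n" using dilation_carrier[of "G + E" p q] G E by simp
  ultimately obtain x where x: "x \<in> carrier_vec ?n" "x \<noteq> 0\<^sub>v ?n" "dilation (G + E) *\<^sub>v x = complex_of_real (d i) \<cdot>\<^sub>v x"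
    unfolding eigenvalue_def eigenvector_def by metis
  have dx: "dim_vec x = ?n" using x(1) by simp
  have dG: "dim_row (dilation G) = ?n" "dim_col (dilation G) = ?n" "dim_row (dilation E) = ?n" "dim_col (dilation E) = ?n"
    using dilation_carrier[OF G] dilation_carrier[OF E] by auto
  let ?y = "Q\<^sup>H *\<^sub>v x"
  have "dilation G *\<^sub>v x + dilation E *\<^sub>v x = complex_of_real (d i) \<cdot>\<^sub>v x"
    using x(3) dx dG by (simp add: dilation_add[OF G E] add_mv)
  then have s: "(dilation G *\<^sub>v x) $ k + (dilation E *\<^sub>v x) $ k = complex_of_real (d i) * x $ k" if "k < ?n" for k
    using that dx dG by (metis dim_mult_mat_vec index_add_vec(1) index_smult_vec(1))
  have shift: "Q * diag_of ?n (\<lambda>j. complex_of_real (d i - a j)) * Q\<^sup>H *\<^sub>v x = dilation E *\<^sub>v x"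
  proof (rule eq_vecI)
    fix k assume "k < dim_vec (dilation E *\<^sub>v x)"
    then have k: "k < ?n" using dG by simp
    have e2: "(dilation E *\<^sub>v x) $ k = complex_of_real (d i) * x $ k - (dilation G *\<^sub>v x) $ k"
      using s[OF k] by (metis add_diff_cancel_left')
    have D: "diag_of ?n (\<lambda>j. complex_of_real (d i - a j)) = complex_of_real (d i) \<cdot>\<^sub>m 1\<^sub>m ?n + - diag_of ?n (\<lambda>j. complex_of_real (a j))"
      by (intro eq_matI) auto
    have "Q * diag_of ?n (\<lambda>j. complex_of_real (d i - a j)) * Q\<^sup>H = complex_of_real (d i) \<cdot>\<^sub>m 1\<^sub>m ?n + - dilation G"
    proof -
      have Qs: "Q * (complex_of_real (d i) \<cdot>\<^sub>m 1\<^sub>m ?n) = complex_of_real (d i) \<cdot>\<^sub>m Q"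
        using mult_smult_distrib[OF dQ(5) one_carrier_mat, of "complex_of_real (d i)"] dQ by simp
      have "(complex_of_real (d i) \<cdot>\<^sub>m Q) * Q\<^sup>H = complex_of_real (d i) \<cdot>\<^sub>m (Q * Q\<^sup>H)"
        by (rule mult_smult_assoc_mat[of _ ?n ?n _ ?n]) (use dQ(5) in auto)
      then show ?thesis unfolding D Q(2) using dQ(1,2,4) by (simp add: mat_dist Qs assoc_mm)
    qed
    moreover have "((complex_of_real (d i) \<cdot>\<^sub>m 1\<^sub>m ?n + - dilation G) *\<^sub>v x) $ k = complex_of_real (d i) * x $ k - (dilation G *\<^sub>v x) $ k"
    proof -
      have "(complex_of_real (d i) \<cdot>\<^sub>m 1\<^sub>m ?n + - dilation G) *\<^sub>v x = (complex_of_real (d i) \<cdot>\<^sub>m 1\<^sub>m ?n) *\<^sub>v x + (- dilation G) *\<^sub>v x"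
        using dG dx by (intro add_mv) auto
      moreover have "((complex_of_real (d i) \<cdot>\<^sub>m 1\<^sub>m ?n) *\<^sub>v x) $ k = complex_of_real (d i) * x $ k"
        using k x(1) by (simp add: row_smult)
      moreover have "((- dilation G) *\<^sub>v x) $ k = - ((dilation G *\<^sub>v x) $ k)"
        using k dG dx by (simp add: scalar_prod_def sum_negf)
      ultimately show ?thesis using k dG dx by (simp del: index_mult_mat_vec)
    qed
    ultimately show "(Q * diag_of ?n (\<lambda>j. complex_of_real (d i - a j)) * Q\<^sup>H *\<^sub>v x) $ k = (dilation E *\<^sub>v x) $ k"
      using e2 by (simp only:)
  qed (use dQ dG in simp)
  \<comment> \<open>One nonzero coordinate makes the comparison of the two sums strict.\<close>
  have "\<exists>j<?n. ?y $ j \<noteq> 0"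
  proof (rule ccontr)
    assume "\<not> ?thesis"
    then have "(\<Sum>j<?n. (cmod (?y $ j))\<^sup>2) = 0" by simp
    then have "vec_norm2 x = 0" unfolding unitary_coords_norm_sq[OF Q(1) dx] by simp
    then show False using x(2) dx by simp
  qed
  then obtain j where j: "j < ?n" "?y $ j \<noteq> 0" by blast
  have "(\<Sum>j<?n. (spectral_norm E)\<^sup>2 * (cmod (?y $ j))\<^sup>2) < (\<Sum>j<?n. (cmod (complex_of_real (d i - a j)))\<^sup>2 * (cmod (?y $ j))\<^sup>2)"
  proof (rule sum_strict_mono_ex1)
    have sq: "(spectral_norm E)\<^sup>2 < (cmod (complex_of_real (d i - a j)))\<^sup>2" if "j < ?n" for j
      unfolding norm_of_real using far[OF that] by (intro power_strict_mono) auto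
    show "\<forall>j\<in>{..<?n}. (spectral_norm E)\<^sup>2 * (cmod (?y $ j))\<^sup>2 \<le> (cmod (complex_of_real (d i - a j)))\<^sup>2 * (cmod (?y $ j))\<^sup>2"
    proof
      fix j assume "j \<in> {..<?n}"
      then have "(spectral_norm E)\<^sup>2 \<le> (cmod (complex_of_real (d i - a j)))\<^sup>2" by (intro less_imp_le sq) simp
      then show "(spectral_norm E)\<^sup>2 * (cmod (?y $ j))\<^sup>2 \<le> (cmod (complex_of_real (d i - a j)))\<^sup>2 * (cmod (?y $ j))\<^sup>2"
        by (rule mult_right_mono) simp
    qed
    show "\<exists>j\<in>{..<?n}. (spectral_norm E)\<^sup>2 * (cmod (?y $ j))\<^sup>2 < (cmod (complex_of_real (d i - a j)))\<^sup>2 * (cmod (?y $ j))\<^sup>2"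
      using sq[OF j(1)] j by (intro bexI[of _ j] mult_strict_right_mono) (auto simp del: index_mult_mat_vec)
  qed simp
  also have "\<dots> = (vec_norm2 (dilation E *\<^sub>v x))\<^sup>2"
    unfolding shift[symmetric] diag_mv_norm_sq[OF Q(1) dx] ..
  also have "\<dots> \<le> (spectral_norm E * vec_norm2 x)\<^sup>2"
    by (intro power_mono order_trans[OF spectral_norm_bound mult_right_mono[OF spectral_norm_dilation[OF E]]]) (use dx dG in auto)
  also have "\<dots> = (\<Sum>j<?n. (spectral_norm E)\<^sup>2 * (cmod (?y $ j))\<^sup>2)"
    unfolding sum_distrib_left[symmetric] unitary_coords_norm_sq[OF Q(1) dx] by (simp add: power_mult_distrib)
  finally show False by simp
qed

text \<open>Signs cannot reduce the gap, by \<open>\<bar>\<bar>l1\<bar> - \<bar>l2\<bar>\<bar> \<le>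
  \<bar>l1 - l2\<bar>\<close>, and each perturbation costs its spectral norm. \<open>G1\<close> is
  square, so its extended singular values are the plain ones.\<close>

lemma dilation_gap:
  assumes G1: "G1 \<in> carrier_mat r r" and E1: "E1 \<in> carrier_mat r r"
    and G2: "G2 \<in> carrier_mat p q" and E2: "E2 \<in> carrier_mat p q"
    and \<delta>: "\<And>\<mu> \<nu>. \<mu> \<in># sing_vals G1 \<Longrightarrow> \<nu> \<in># sing_vals_ext G2 \<Longrightarrow> \<delta> \<le> \<bar>\<mu> - \<nu>\<bar>"
    and P: "unitary_mat (r + r) P" "dilation (G1 + E1) = P * diag_of (r + r) (\<lambda>i. complex_of_real (a i)) * P\<^sup>H"
    and Q: "unitary_mat (p + q) Q" "dilation (G2 + E2) = Q * diag_of (p + q) (\<lambda>i. complex_of_real (b i)) * Q\<^sup>H"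
    and i: "i < p + q" and j: "j < r + r"
  shows "\<delta> - spectral_norm E1 - spectral_norm E2 \<le> \<bar>a j - b i\<bar>"
proof -
  obtain l1 where l1: "\<bar>l1\<bar> \<in># sing_vals_ext G1" "\<bar>a j - l1\<bar> \<le> spectral_norm E1"
    using dilation_perturbed_eigenvalue[OF G1 E1 P j] by blast
  obtain l2 where l2: "\<bar>l2\<bar> \<in># sing_vals_ext G2" "\<bar>b i - l2\<bar> \<le> spectral_norm E2"
    using dilation_perturbed_eigenvalue[OF G2 E2 Q i] by blast
  have "\<bar>l1\<bar> \<in># sing_vals G1" using l1(1) G1 by (simp add: sing_vals_ext_def)
  then have "\<delta> \<le> \<bar>\<bar>l1\<bar> - \<bar>l2\<bar>\<bar>" using \<delta> l2(1) by blast
  then show ?thesis using l1(2) l2(2) by linarith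
qed

subsection \<open>The Sylvester equation\<close>

text \<open>In the eigenbases the left-hand side multiplies entry \<open>(i, j)\<close> by
  \<open>a j - b i\<close>, which is nonzero. One direction of the equivalence gives existence, the
  other the norm bound.\<close>

lemma diag_sylvester:
  assumes P: "unitary_mat n P" "A = P * diag_of n (\<lambda>j. complex_of_real (a j)) * P\<^sup>H"
    and Q: "unitary_mat k Q" "B = Q * diag_of k (\<lambda>i. complex_of_real (b i)) * Q\<^sup>H"
    and gap: "\<And>i j. i < k \<Longrightarrow> j < n \<Longrightarrow> a j \<noteq> b i"
    and Z: "Z \<in> carrier_mat k n" and W: "W \<in> carrier_mat k n"
  shows "Z * A - B * Z = W \<longleftrightarrow>
    Z = Q * mat k n (\<lambda>(i, j). (Q\<^sup>H * W * P) $$ (i, j) / complex_of_real (a j - b i)) * P\<^sup>H"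
proof -
  note dP = unitary_matD(1,2)[OF P(1)] and dQ = unitary_matD(1,2)[OF Q(1)]
  note dZ = carrier_matD[OF Z] and dW = carrier_matD[OF W]
  let ?A = "diag_of n (\<lambda>j. complex_of_real (a j))" and ?B = "diag_of k (\<lambda>i. complex_of_real (b i))"
  let ?X = "mat k n (\<lambda>(i, j). (Q\<^sup>H * W * P) $$ (i, j) / complex_of_real (a j - b i))"
  let ?Z = "Q\<^sup>H * Z * P"
  have conj_eq: "Y = Y' \<longleftrightarrow> Q\<^sup>H * Y * P = Q\<^sup>H * Y' * P" if "Y \<in> carrier_mat k n" "Y' \<in> carrier_mat k n" for Y Y'
  proof
    have inv: "Q * (Q\<^sup>H * Y * P) * P\<^sup>H = Y" if "Y \<in> carrier_mat k n" for Y
      using dP dQ carrier_matD[OF that] unitary_cancel(2)[OF Q(1), of Y] unitary_cancel_right[OF P(1), of Y]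
      by (simp add: assoc_mm unitary_cancel(2)[OF Q(1)])
    assume "Q\<^sup>H * Y * P = Q\<^sup>H * Y' * P"
    then show "Y = Y'" using inv[OF that(1)] inv[OF that(2)] by metis
  qed simp
  have "Z * A - B * Z \<in> carrier_mat k n" using dZ dP dQ unfolding P(2) Q(2) by (auto intro!: carrier_matI)
  then have "Z * A - B * Z = W \<longleftrightarrow> Q\<^sup>H * (Z * A - B * Z) * P = Q\<^sup>H * W * P" using W by (rule conj_eq)
  also have "Q\<^sup>H * (Z * A - B * Z) * P = ?Z * ?A - ?B * ?Z"
    unfolding P(2) Q(2) using dP dQ dZ
    by (simp add: mat_dist unitary_cancel[OF P(1)] unitary_cancel[OF Q(1)] unitary_matD(3)[OF P(1)])
  also have "?Z * ?A - ?B * ?Z = Q\<^sup>H * W * P \<longleftrightarrow> ?Z = ?X"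
  proof
    assume e: "?Z * ?A - ?B * ?Z = Q\<^sup>H * W * P"
    show "?Z = ?X"
    proof (rule eq_matI)
      fix i j assume "i < dim_row ?X" "j < dim_col ?X"
      then have ij: "i < k" "j < n" by auto
      have "(?Z * ?A - ?B * ?Z) $$ (i, j) = (Q\<^sup>H * W * P) $$ (i, j)" unfolding e ..
      then have "?Z $$ (i, j) * complex_of_real (a j - b i) = (Q\<^sup>H * W * P) $$ (i, j)"
        using ij dP dQ dZ by (simp add: algebra_simps del: index_mult_mat(1))
      then show "?Z $$ (i, j) = ?X $$ (i, j)" using gap[OF ij] ij
        by (simp add: nonzero_eq_divide_eq del: index_mult_mat(1) of_real_diff)
    qed (use dP dQ in auto)
  next
    assume e: "?Z = ?X"
    show "?Z * ?A - ?B * ?Z = Q\<^sup>H * W * P"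
    proof (rule eq_matI)
      fix i j assume "i < dim_row (Q\<^sup>H * W * P)" "j < dim_col (Q\<^sup>H * W * P)"
      then have ij: "i < k" "j < n" using dP dQ by auto
      have "(?Z * ?A - ?B * ?Z) $$ (i, j) = ?Z $$ (i, j) * complex_of_real (a j - b i)"
        using ij dP dQ dZ by (simp add: algebra_simps del: index_mult_mat(1))
      also have "?Z $$ (i, j) = (Q\<^sup>H * W * P) $$ (i, j) / complex_of_real (a j - b i)"
        unfolding e using ij by (simp del: index_mult_mat(1))
      also have "\<dots> * complex_of_real (a j - b i) = (Q\<^sup>H * W * P) $$ (i, j)"
        using gap[OF ij] by (simp del: index_mult_mat(1) of_real_diff)
      finally show "(?Z * ?A - ?B * ?Z) $$ (i, j) = (Q\<^sup>H * W * P) $$ (i, j)" .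
    qed (use dP dQ in auto)
  qed
  also have "?Z = ?X \<longleftrightarrow> Z = Q * ?X * P\<^sup>H"
  proof -
    have "Z = Q * ?X * P\<^sup>H \<longleftrightarrow> ?Z = Q\<^sup>H * (Q * ?X * P\<^sup>H) * P"
      by (rule conj_eq[OF Z]) (use dP dQ in auto)
    also have "Q\<^sup>H * (Q * ?X * P\<^sup>H) * P = ?X"
      using dP dQ by (simp add: assoc_mm unitary_cancel(1)[OF Q(1)] unitary_matD(3)[OF P(1)])
    finally show ?thesis by blast
  qed
  finally show ?thesis .
qed

text \<open>The blocks separate into two systems: \<open>Z1\<close> and \<open>Z4\<close> enter only
  the off-diagonal blocks of the result, \<open>Z2\<close> and \<open>Z3\<close> only the diagonal
  ones. With \<open>Z1 = \<Gamma>\<close> and \<open>Z4 = \<Omega>\<close> the former are the linear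
  part of the pair of equations.\<close>

lemma sylvester_dilation:
  assumes A1: "A1 \<in> carrier_mat r r" and A2: "A2 \<in> carrier_mat p q"
    and Z: "Z1 \<in> carrier_mat p r" "Z2 \<in> carrier_mat p r" "Z3 \<in> carrier_mat q r" "Z4 \<in> carrier_mat q r"
  shows "four_block_mat Z1 Z2 Z3 Z4 * dilation A1 - dilation A2 * four_block_mat Z1 Z2 Z3 Z4 =
    four_block_mat (Z2 * A1\<^sup>H - A2 * Z3) (Z1 * A1 - A2 * Z4) (Z4 * A1\<^sup>H - A2\<^sup>H * Z1) (Z3 * A1 - A2\<^sup>H * Z2)"
  using A1[THEN carrier_matD(1)] A1[THEN carrier_matD(2)] A2[THEN carrier_matD(1)] A2[THEN carrier_matD(2)]
    Z[THEN carrier_matD(1)] Z[THEN carrier_matD(2)]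
  by (simp add: dilation_def block_simps mat_dist)

text \<open>Solve for the full block matrix with an off-diagonal right-hand side and keep the
  diagonal blocks; the other two belong to the separate system.\<close>

lemma sylvester_exists:
  assumes A1: "A1 \<in> carrier_mat r r" and A2: "A2 \<in> carrier_mat p q"
    and P: "unitary_mat (r + r) P" "dilation A1 = P * diag_of (r + r) (\<lambda>i. complex_of_real (a i)) * P\<^sup>H"
    and Q: "unitary_mat (p + q) Q" "dilation A2 = Q * diag_of (p + q) (\<lambda>i. complex_of_real (b i)) * Q\<^sup>H"
    and gap: "\<And>i j. i < p + q \<Longrightarrow> j < r + r \<Longrightarrow> a j \<noteq> b i"
    and C: "C \<in> carrier_mat p r" and D: "D \<in> carrier_mat q r"
  shows "\<exists>\<Gamma> \<Omega>. \<Gamma> \<in> carrier_mat p r \<and> \<Omega> \<in> carrier_mat q r \<and>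
    \<Gamma> * A1 - A2 * \<Omega> = C \<and> \<Omega> * A1\<^sup>H - A2\<^sup>H * \<Gamma> = D"
proof -
  let ?W = "four_block_mat (0\<^sub>m p r) C D (0\<^sub>m q r)"
  define Z where "Z = Q * mat (p + q) (r + r) (\<lambda>(i, j). (Q\<^sup>H * ?W * P) $$ (i, j) / complex_of_real (a j - b i)) * P\<^sup>H"
  have cZ: "Z \<in> carrier_mat (p + q) (r + r)" using unitary_matD(1,2)[OF P(1)] unitary_matD(1,2)[OF Q(1)] by (auto simp: Z_def)
  have cW: "?W \<in> carrier_mat (p + q) (r + r)" using C D by auto
  obtain Z1 Z2 Z3 Z4 where Z: "Z = four_block_mat Z1 Z2 Z3 Z4"
    and c: "Z1 \<in> carrier_mat p r" "Z2 \<in> carrier_mat p r" "Z3 \<in> carrier_mat q r" "Z4 \<in> carrier_mat q r"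
    using four_block_exhaust[OF cZ] by blast
  note cd = c[THEN carrier_matD(1)] c[THEN carrier_matD(2)] carrier_matD[OF A1] carrier_matD[OF A2] carrier_matD[OF C] carrier_matD[OF D]
  have "Z * dilation A1 - dilation A2 * Z = ?W"
    using diag_sylvester[OF P Q gap cZ cW] Z_def by blast
  then have "four_block_mat (Z2 * A1\<^sup>H - A2 * Z3) (Z1 * A1 - A2 * Z4) (Z4 * A1\<^sup>H - A2\<^sup>H * Z1) (Z3 * A1 - A2\<^sup>H * Z2) = ?W"
    unfolding Z sylvester_dilation[OF A1 A2 c] .
  then have "Z1 * A1 - A2 * Z4 = C \<and> Z4 * A1\<^sup>H - A2\<^sup>H * Z1 = D"
    using cd by (subst (asm) four_block_inject_carrier[of _ p r _ r _ q]) (auto intro!: carrier_matI)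
  with c show ?thesis by blast
qed

text \<open>The block diagonal matrix of \<open>\<Gamma>\<close> and \<open>\<Omega>\<close> solves
  the equation with an off-diagonal right-hand side, so up to unitary factors it is the Schur
  multiplier applied to it. Exchanging block columns makes that side block diagonal without changing
  its norm.\<close>

lemma sylvester_bound:
  assumes N: "unitarily_invariant_norm N"
    and A1: "A1 \<in> carrier_mat r r" and A2: "A2 \<in> carrier_mat p q"
    and P: "unitary_mat (r + r) P" "dilation A1 = P * diag_of (r + r) (\<lambda>i. complex_of_real (a i)) * P\<^sup>H"
    and Q: "unitary_mat (p + q) Q" "dilation A2 = Q * diag_of (p + q) (\<lambda>i. complex_of_real (b i)) * Q\<^sup>H"
    and gap: "\<And>i j. i < p + q \<Longrightarrow> j < r + r \<Longrightarrow> a j \<noteq> b i"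
    and mult: "\<And>W. W \<in> carrier_mat (p + q) (r + r) \<Longrightarrow>
      N (mat (p + q) (r + r) (\<lambda>(i, j). W $$ (i, j) / complex_of_real (a j - b i))) \<le> k * N W"
    and c: "\<Gamma> \<in> carrier_mat p r" "\<Omega> \<in> carrier_mat q r"
  shows "N (four_block_mat \<Gamma> (0\<^sub>m p r) (0\<^sub>m q r) \<Omega>) \<le>
    k * N (four_block_mat (\<Gamma> * A1 - A2 * \<Omega>) (0\<^sub>m p r) (0\<^sub>m q r) (\<Omega> * A1\<^sup>H - A2\<^sup>H * \<Gamma>))"
proof -
  let ?C = "\<Gamma> * A1 - A2 * \<Omega>" and ?D = "\<Omega> * A1\<^sup>H - A2\<^sup>H * \<Gamma>"
  let ?Z = "four_block_mat \<Gamma> (0\<^sub>m p r) (0\<^sub>m q r) \<Omega>"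
  let ?W = "four_block_mat (0\<^sub>m p r) ?C ?D (0\<^sub>m q r)"
  note cd = c[THEN carrier_matD(1)] c[THEN carrier_matD(2)] carrier_matD[OF A1] carrier_matD[OF A2]
  have cC: "?C \<in> carrier_mat p r" "?D \<in> carrier_mat q r" using cd by (auto intro!: carrier_matI)
  have cZ: "?Z \<in> carrier_mat (p + q) (r + r)" using c by auto
  have cW: "?W \<in> carrier_mat (p + q) (r + r)" using cC by auto
  have z0: "0\<^sub>m p r - 0\<^sub>m p r = (0\<^sub>m p r :: complex mat)" "0\<^sub>m q r - 0\<^sub>m q r = (0\<^sub>m q r :: complex mat)"
    by (auto intro!: eq_matI)
  have "?Z * dilation A1 - dilation A2 * ?Z = ?W"
    using cd by (simp add: sylvester_dilation[OF A1 A2 c(1) zero_carrier_mat zero_carrier_mat c(2)] mat_dist z0)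
  then have Z: "?Z = Q * mat (p + q) (r + r) (\<lambda>(i, j). (Q\<^sup>H * ?W * P) $$ (i, j) / complex_of_real (a j - b i)) * P\<^sup>H"
    using diag_sylvester[OF P Q gap cZ cW] by blast
  have cX: "Q\<^sup>H * ?W * P \<in> carrier_mat (p + q) (r + r)"
    using unitary_matD(1,2)[OF P(1)] unitary_matD(1,2)[OF Q(1)] by (auto intro!: carrier_matI)
  have "N ?Z = N (mat (p + q) (r + r) (\<lambda>(i, j). (Q\<^sup>H * ?W * P) $$ (i, j) / complex_of_real (a j - b i)))"
    by (subst Z, rule ui_norm_unitary[OF N Q(1) unitary_mat_adjoint[OF P(1)]]) simp
  also have "\<dots> \<le> k * N (Q\<^sup>H * ?W * P)" by (rule mult[OF cX])
  also have "N (Q\<^sup>H * ?W * P) = N ?W" by (rule ui_norm_unitary[OF N unitary_mat_adjoint[OF Q(1)] P(1) cW])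
  also have "N ?W = N (four_block_mat ?C (0\<^sub>m p r) (0\<^sub>m q r) ?D)" by (rule ui_norm_offdiag[OF N cC])
  finally show ?thesis .
qed

text \<open>\<open>H\<close> is invertible and the inverse has spectral norm at most \<open>1 / a\<close>.\<close>

lemma ui_norm_bounded_below:
  assumes N: "unitarily_invariant_norm N" and H: "H \<in> carrier_mat k k" and a: "0 < a"
    and lower: "\<And>x. dim_vec x = k \<Longrightarrow> a * vec_norm2 x \<le> vec_norm2 (H *\<^sub>v x)"
    and Y: "dim_col Y = k"
  shows "a * N Y \<le> N (Y * H)"
proof -
  note dH = carrier_matD[OF H]
  have "Determinant.det H \<noteq> 0"
  proof
    assume "Determinant.det H = 0"
    then obtain v where v: "v \<in> carrier_vec k" "v \<noteq> 0\<^sub>v k" "H *\<^sub>v v = 0\<^sub>v k"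
      using det_0_iff_vec_prod_zero_field[OF H] by blast
    then have dv: "dim_vec v = k" by simp
    have "a * vec_norm2 v \<le> 0" using lower[OF dv] v(3) by simp
    then have "vec_norm2 v \<le> 0" using a by (simp add: mult_le_0_iff)
    then have "vec_norm2 v = 0" by (intro antisym) auto
    then show False using v(2) dv by simp
  qed
  then have "H \<in> Units (ring_mat TYPE(complex) k ())" by (rule det_non_zero_imp_unit[OF H])
  then obtain B where B: "B \<in> carrier_mat k k" "H * B = 1\<^sub>m k"
    by (auto simp: Units_def ring_mat_def)
  note dB = carrier_matD[OF B(1)]
  have sB: "spectral_norm B \<le> 1 / a"
  proof (rule spectral_norm_le)
    fix x :: "complex vec" assume "dim_vec x = dim_col B"
    then have x: "dim_vec x = k" using dB by simp
    have "a * vec_norm2 (B *\<^sub>v x) \<le> vec_norm2 (H *\<^sub>v (B *\<^sub>v x))" using dB by (intro lower) simp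
    also have "H *\<^sub>v (B *\<^sub>v x) = (H * B) *\<^sub>v x" by (rule assoc_mv[symmetric]) (use dB dH x in simp_all)
    also have "\<dots> = x" unfolding B(2) by (rule one_mult_mat_vec[OF carrier_vecI[OF x]])
    finally show "vec_norm2 (B *\<^sub>v x) \<le> 1 / a * vec_norm2 x" using a by (simp add: field_simps)
  qed (use a in simp)
  have "Y = Y * H * B" using Y dH dB by (simp add: assoc_mm B(2))
  then have "N Y = N (Y * H * B)" by simp
  also have "\<dots> \<le> N (Y * H) * spectral_norm B" using Y dH dB by (intro ui_norm_mult_right[OF N]) simp
  also have "\<dots> \<le> N (Y * H) * (1 / a)" using sB ui_norm_nonneg[OF N] by (intro mult_left_mono) auto
  finally show ?thesis using a by (simp add: field_simps)
qed

subsection \<open>Entrywise limits\<close>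

text \<open>The dimensions are part of the predicate so that the rules for products and differences
  chain without side conditions.\<close>

definition mlim :: "nat \<Rightarrow> nat \<Rightarrow> (nat \<Rightarrow> complex mat) \<Rightarrow> complex mat \<Rightarrow> bool" where
  "mlim p q X L \<longleftrightarrow> L \<in> carrier_mat p q \<and> (\<forall>k. X k \<in> carrier_mat p q) \<and>
    (\<forall>i<p. \<forall>j<q. (\<lambda>k. X k $$ (i, j)) \<longlonglongrightarrow> L $$ (i, j))"

lemma mlim_const: "A \<in> carrier_mat p q \<Longrightarrow> mlim p q (\<lambda>k. A) A"
  by (simp add: mlim_def)

lemma mlim_mm:
  assumes X: "mlim p q X A" and Y: "mlim q l Y B"
  shows "mlim p l (\<lambda>k. X k * Y k) (A * B)"
proof -
  have c: "A \<in> carrier_mat p q" "B \<in> carrier_mat q l" "\<And>k. X k \<in> carrier_mat p q" "\<And>k. Y k \<in> carrier_mat q l"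
    using X Y by (auto simp: mlim_def)
  have e: "(U * V) $$ (i, j) = (\<Sum>t<q. U $$ (i, t) * V $$ (t, j))"
    if "U \<in> carrier_mat p q" "V \<in> carrier_mat q l" "i < p" "j < l" for U V :: "complex mat" and i j
    using that by (auto simp: scalar_prod_def lessThan_atLeast0 intro!: sum.cong)
  have "(\<lambda>k. (X k * Y k) $$ (i, j)) \<longlonglongrightarrow> (A * B) $$ (i, j)" if ij: "i < p" "j < l" for i j
  proof -
    have "(\<lambda>k. \<Sum>t<q. X k $$ (i, t) * Y k $$ (t, j)) \<longlonglongrightarrow> (\<Sum>t<q. A $$ (i, t) * B $$ (t, j))"
      using X Y ij by (intro tendsto_sum tendsto_mult) (auto simp: mlim_def)
    then show ?thesis using e[OF c(1,2) ij] e[OF c(3,4) ij] by simp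
  qed
  then show ?thesis unfolding mlim_def
    using mult_carrier_mat[OF c(1,2)] mult_carrier_mat[OF c(3,4)] by blast
qed

lemma mlim_minus:
  assumes X: "mlim p q X A" and Y: "mlim p q Y B"
  shows "mlim p q (\<lambda>k. X k - Y k) (A - B)"
proof -
  have c: "A \<in> carrier_mat p q" "B \<in> carrier_mat p q" "\<And>k. X k \<in> carrier_mat p q" "\<And>k. Y k \<in> carrier_mat p q"
    using X Y by (auto simp: mlim_def)
  have "(\<lambda>k. (X k - Y k) $$ (i, j)) \<longlonglongrightarrow> (A - B) $$ (i, j)" if ij: "i < p" "j < q" for i j
  proof -
    have "(\<lambda>k. X k $$ (i, j) - Y k $$ (i, j)) \<longlonglongrightarrow> A $$ (i, j) - B $$ (i, j)"
      using X Y ij by (intro tendsto_diff) (auto simp: mlim_def)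
    moreover have "(X k - Y k) $$ (i, j) = X k $$ (i, j) - Y k $$ (i, j)" for k
      using ij carrier_matD[OF c(4)[of k]] by simp
    moreover have "(A - B) $$ (i, j) = A $$ (i, j) - B $$ (i, j)" using ij carrier_matD[OF c(2)] by simp
    ultimately show ?thesis by simp
  qed
  then show ?thesis unfolding mlim_def
    using minus_carrier_mat[OF c(2)] minus_carrier_mat[OF c(4)] by blast
qed

lemma mlim_Suc: "mlim p q X A \<Longrightarrow> mlim p q (\<lambda>k. X (Suc k)) A"
  unfolding mlim_def by (auto intro: LIMSEQ_Suc)

lemma mlim_unique:
  assumes A: "mlim p q X A" and B: "mlim p q X B"
  shows "A = B"
proof (rule eq_matI)
  fix i j assume "i < dim_row B" "j < dim_col B"
  then have "i < p" "j < q" using B by (auto simp: mlim_def)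
  then have "(\<lambda>k. X k $$ (i, j)) \<longlonglongrightarrow> A $$ (i, j)" "(\<lambda>k. X k $$ (i, j)) \<longlonglongrightarrow> B $$ (i, j)"
    using A B by (auto simp: mlim_def)
  then show "A $$ (i, j) = B $$ (i, j)" by (rule LIMSEQ_unique)
qed (use A B in \<open>auto simp: mlim_def\<close>)

lemma convergent_geometric:
  fixes f :: "nat \<Rightarrow> complex"
  assumes "\<And>k. norm (f (Suc k) - f k) \<le> c * h ^ k" "0 \<le> h" "h < 1"
  shows "convergent f"
proof -
  have "summable (\<lambda>k. c * h ^ k)" using assms by (intro summable_mult summable_geometric) simp
  then have "summable (\<lambda>k. f (Suc k) - f k)" by (rule summable_comparison_test'[where N = 0]) (use assms in auto)
  then have "convergent (\<lambda>n. \<Sum>k<n. f (Suc k) - f k)" by (simp add: summable_iff_convergent)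
  then have "convergent (\<lambda>n. f n - f 0)" by (simp add: sum_lessThan_telescope)
  then obtain l where "(\<lambda>n. f n - f 0) \<longlonglongrightarrow> l" by (auto simp: convergent_def)
  from tendsto_add[OF this tendsto_const[of "f 0"]] show ?thesis by (auto simp: convergent_def)
qed

subsection \<open>A quadratic matrix equation\<close>

text \<open>An interface that treats both norms on pairs at once: what the iteration uses is
  invariance under sign, the triangle inequality and, for taking limits entrywise, comparison with
  \<open>N\<close> from both sides.\<close>

definition pair_norm :: "(complex mat \<Rightarrow> real) \<Rightarrow> nat \<Rightarrow> nat \<Rightarrow> nat \<Rightarrow> (complex mat \<Rightarrow> complex mat \<Rightarrow> real) \<Rightarrow> bool" where
  "pair_norm N p q r pn \<longleftrightarrow>
    (\<forall>X \<in> carrier_mat p r. \<forall>Y \<in> carrier_mat q r.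
      pn (- X) (- Y) = pn X Y \<and> N X \<le> pn X Y \<and> N Y \<le> pn X Y \<and> pn X Y \<le> N X + N Y \<and>
      (\<forall>X' \<in> carrier_mat p r. \<forall>Y' \<in> carrier_mat q r. pn (X + X') (Y + Y') \<le> pn X Y + pn X' Y'))"

lemma pair_normD:
  assumes "pair_norm N p q r pn" "X \<in> carrier_mat p r" "Y \<in> carrier_mat q r"
  shows "pn (- X) (- Y) = pn X Y" "N X \<le> pn X Y" "N Y \<le> pn X Y" "pn X Y \<le> N X + N Y"
    "X' \<in> carrier_mat p r \<Longrightarrow> Y' \<in> carrier_mat q r \<Longrightarrow> pn (X + X') (Y + Y') \<le> pn X Y + pn X' Y'"
  using assms unfolding pair_norm_def by blast+

lemma pair_norm_minus:
  assumes "pair_norm N p q r pn" "X \<in> carrier_mat p r" "Y \<in> carrier_mat q r" "X' \<in> carrier_mat p r" "Y' \<in> carrier_mat q r"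
  shows "pn (X - X') (Y - Y') \<le> pn X Y + pn X' Y'"
proof -
  have e: "X - X' = X + - X'" "Y - Y' = Y + - Y'" using assms(2-5) by (auto intro!: eq_matI)
  have "- X' \<in> carrier_mat p r" "- Y' \<in> carrier_mat q r" using assms by auto
  then show ?thesis unfolding e using pair_normD(5)[OF assms(1-3), of "- X'" "- Y'"] pair_normD(1)[OF assms(1,4,5)] by simp
qed

text \<open>\<open>\<rho>\<close> is the smaller root of
  \<open>\<epsilon> * x\<^sup>2 - \<tau> * x + g = 0\<close>, written with the conjugate denominator
  so that it also makes sense for \<open>\<epsilon> = 0\<close>; \<open>s\<close> is the square root
  of the discriminant divided by \<open>\<tau>\<^sup>2\<close>. The last identity provides the
  contraction factor \<open>1 - s\<close>.\<close>

lemma quadratic_radius: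
  fixes g \<epsilon> \<tau> :: real
  assumes g: "0 \<le> g" and \<epsilon>: "0 \<le> \<epsilon>" and \<tau>: "0 < \<tau>" and \<kappa>: "\<epsilon> * g / \<tau>\<^sup>2 < 1 / 4"
  defines "s \<equiv> sqrt (1 - 4 * (\<epsilon> * g / \<tau>\<^sup>2))"
  defines "\<rho> \<equiv> 2 * g / (\<tau> * (1 + s))"
  shows "0 < s" "s \<le> 1" "0 \<le> \<rho>" "g + \<epsilon> * \<rho> * \<rho> = \<tau> * \<rho>" "2 * \<epsilon> * \<rho> = \<tau> * (1 - s)"
proof -
  define k where "k = \<epsilon> * g / \<tau>\<^sup>2"
  have k: "0 \<le> k" "k < 1 / 4" using assms by (auto simp: k_def)
  have s: "s = sqrt (1 - 4 * k)" by (simp add: s_def k_def)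
  show s0: "0 < s" and "s \<le> 1" using k by (auto simp: s)
  have s2: "s\<^sup>2 = 1 - 4 * k" using k by (simp add: s)
  have eg: "\<epsilon> * g = k * \<tau>\<^sup>2" using \<tau> by (simp add: k_def)
  show "0 \<le> \<rho>" using g \<tau> s0 by (simp add: \<rho>_def)
  have gr: "g = \<rho> * \<tau> * (1 + s) / 2" using \<tau> s0 by (simp add: \<rho>_def)
  have "2 * \<epsilon> * \<rho> = 4 * (\<epsilon> * g) / (\<tau> * (1 + s))" by (simp add: \<rho>_def)
  also have "\<dots> = (4 * k) * \<tau> / (1 + s)" using \<tau> by (simp add: eg power2_eq_square)
  also have "4 * k = (1 - s) * (1 + s)" using s2 by (simp add: algebra_simps power2_eq_square)
  also have "(1 - s) * (1 + s) * \<tau> / (1 + s) = \<tau> * (1 - s)" using s0 by simp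
  finally show e: "2 * \<epsilon> * \<rho> = \<tau> * (1 - s)" .
  then have "\<epsilon> * \<rho> = \<tau> * (1 - s) / 2" by simp
  then have "g + \<epsilon> * \<rho> * \<rho> = \<rho> * \<tau> * (1 + s) / 2 + \<tau> * (1 - s) / 2 * \<rho>"
    using gr by (simp only:)
  also have "\<dots> = \<tau> * \<rho>" by (simp add: field_simps)
  finally show "g + \<epsilon> * \<rho> * \<rho> = \<tau> * \<rho>" .
qed

text \<open>Each step solves the linear equation with the quadratic term of the previous iterate on
  the right-hand side. The ball of radius \<open>\<rho>\<close> is invariant because
  \<open>g + \<epsilon> * \<rho> * \<rho> = \<tau> * \<rho>\<close>, and consecutive differences
  shrink by \<open>2 * \<epsilon> * \<rho> / \<tau> = 1 - s < 1\<close>.\<close>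

theorem quadratic_sylvester_solution:
  assumes N: "unitarily_invariant_norm N" and pn: "pair_norm N p q r pn"
    and A1: "A1 \<in> carrier_mat r r" and A2: "A2 \<in> carrier_mat p q"
    and B1: "B1 \<in> carrier_mat r q" and B2: "B2 \<in> carrier_mat r p"
    and K: "K1 \<in> carrier_mat p r" "K2 \<in> carrier_mat q r"
    and ex: "\<And>C D. C \<in> carrier_mat p r \<Longrightarrow> D \<in> carrier_mat q r \<Longrightarrow> \<exists>\<Gamma> \<Omega>. \<Gamma> \<in> carrier_mat p r \<and> \<Omega> \<in> carrier_mat q r \<and>
      \<Gamma> * A1 - A2 * \<Omega> = C \<and> \<Omega> * A1\<^sup>H - A2\<^sup>H * \<Gamma> = D"
    and bound: "\<And>\<Gamma> \<Omega>. \<Gamma> \<in> carrier_mat p r \<Longrightarrow> \<Omega> \<in> carrier_mat q r \<Longrightarrow>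
      \<tau> * pn \<Gamma> \<Omega> \<le> pn (\<Gamma> * A1 - A2 * \<Omega>) (\<Omega> * A1\<^sup>H - A2\<^sup>H * \<Gamma>)"
    and quad: "\<And>X Y X' Y'. X \<in> carrier_mat p r \<Longrightarrow> Y \<in> carrier_mat q r \<Longrightarrow> X' \<in> carrier_mat p r \<Longrightarrow> Y' \<in> carrier_mat q r \<Longrightarrow>
      pn (X * B1 * Y') (Y * B2 * X') \<le> \<epsilon> * pn X Y * pn X' Y'"
    and \<tau>: "0 < \<tau>" and \<epsilon>: "0 \<le> \<epsilon>" and \<kappa>: "\<epsilon> * pn K1 K2 / \<tau>\<^sup>2 < 1 / 4"
  shows "\<exists>\<Gamma> \<Omega>. \<Gamma> \<in> carrier_mat p r \<and> \<Omega> \<in> carrier_mat q r \<and>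
    \<Gamma> * A1 - A2 * \<Omega> = K1 - \<Gamma> * B1 * \<Omega> \<and> \<Omega> * A1\<^sup>H - A2\<^sup>H * \<Gamma> = K2 - \<Omega> * B2 * \<Gamma> \<and>
    pn \<Gamma> \<Omega> \<le> 2 * pn K1 K2 / (\<tau> * (1 + sqrt (1 - 4 * (\<epsilon> * pn K1 K2 / \<tau>\<^sup>2))))"
proof -
  define g where "g = pn K1 K2"
  define s where "s = sqrt (1 - 4 * (\<epsilon> * g / \<tau>\<^sup>2))"
  define \<rho> where "\<rho> = 2 * g / (\<tau> * (1 + s))"
  have pn0: "0 \<le> pn X Y" if "X \<in> carrier_mat p r" "Y \<in> carrier_mat q r" for X Y
    using pair_normD(2)[OF pn that] ui_norm_nonneg[OF N, of X] by linarith
  have "0 \<le> g" unfolding g_def by (rule pn0[OF K])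
  note rad = quadratic_radius[OF this \<epsilon> \<tau> \<kappa>[folded g_def], folded s_def, folded \<rho>_def]
  note dA = carrier_matD[OF A1] carrier_matD[OF A2] carrier_matD[OF B1] carrier_matD[OF B2] carrier_matD[OF K(1)] carrier_matD[OF K(2)]
  define ok where "ok C D z \<longleftrightarrow> fst z \<in> carrier_mat p r \<and> snd z \<in> carrier_mat q r \<and>
    fst z * A1 - A2 * snd z = C \<and> snd z * A1\<^sup>H - A2\<^sup>H * fst z = D" for C D z
  \<comment> \<open>Any solution may be chosen: all estimates come from the equations through
    \<open>bound\<close>, not from a formula for the solution operator.\<close>
  define sol where "sol C D = (SOME z. ok C D z)" for C D
  have sol: "ok C D (sol C D)" if "C \<in> carrier_mat p r" "D \<in> carrier_mat q r" for C D
    unfolding sol_def by (rule someI_ex) (use ex[OF that] in \<open>auto simp: ok_def\<close>)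
  define Z where "Z = rec_nat (0\<^sub>m p r, 0\<^sub>m q r) (\<lambda>_ z. sol (K1 - fst z * B1 * snd z) (K2 - snd z * B2 * fst z))"
  define X where "X k = fst (Z k)" for k
  define Y where "Y k = snd (Z k)" for k
  have Z0: "X 0 = 0\<^sub>m p r" "Y 0 = 0\<^sub>m q r" by (simp_all add: X_def Y_def Z_def)
  have ZS: "Z (Suc k) = sol (K1 - X k * B1 * Y k) (K2 - Y k * B2 * X k)" for k
    by (simp add: X_def Y_def Z_def)
  have step: "ok (K1 - X k * B1 * Y k) (K2 - Y k * B2 * X k) (Z (Suc k))" if "X k \<in> carrier_mat p r" "Y k \<in> carrier_mat q r" for k
    unfolding ZS by (rule sol) (use that dA in \<open>auto intro!: carrier_matI\<close>)
  have cXY: "X k \<in> carrier_mat p r \<and> Y k \<in> carrier_mat q r" for k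
  proof (induction k)
    case (Suc k)
    then show ?case using step[of k] by (simp add: ok_def X_def Y_def)
  qed (simp add: Z0)
  then have cX: "X k \<in> carrier_mat p r" and cY: "Y k \<in> carrier_mat q r" for k by auto
  note dX = carrier_matD[OF cX] and dY = carrier_matD[OF cY]
  have eq: "X (Suc k) * A1 - A2 * Y (Suc k) = K1 - X k * B1 * Y k"
    "Y (Suc k) * A1\<^sup>H - A2\<^sup>H * X (Suc k) = K2 - Y k * B2 * X k" for k
    using step[OF cX cY, of k] by (simp_all add: ok_def X_def Y_def)
  have bnd: "pn (X k) (Y k) \<le> \<rho>" for k
  proof (induction k)
    case 0
    have "pn (0\<^sub>m p r) (0\<^sub>m q r) \<le> N (0\<^sub>m p r) + N (0\<^sub>m q r)" by (rule pair_normD(4)[OF pn]) auto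
    then show ?case using rad(3) by (simp add: Z0 ui_norm_zero[OF N])
  next
    case (Suc k)
    have "\<tau> * pn (X (Suc k)) (Y (Suc k)) \<le> pn (K1 - X k * B1 * Y k) (K2 - Y k * B2 * X k)"
      using bound[OF cX cY, of "Suc k" "Suc k"] unfolding eq .
    also have "\<dots> \<le> g + pn (X k * B1 * Y k) (Y k * B2 * X k)"
      unfolding g_def by (rule pair_norm_minus[OF pn K]) (use dA dX dY in \<open>auto intro!: carrier_matI\<close>)
    also have "pn (X k * B1 * Y k) (Y k * B2 * X k) \<le> \<epsilon> * pn (X k) (Y k) * pn (X k) (Y k)"
      by (rule quad[OF cX cY cX cY])
    also have "\<dots> \<le> \<epsilon> * \<rho> * \<rho>" using Suc \<epsilon> rad(3) pn0[OF cX cY, of k k] by (intro mult_mono) auto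
    also have "g + \<epsilon> * \<rho> * \<rho> = \<tau> * \<rho>" by (rule rad(4))
    finally show ?case using \<tau> by simp
  qed
  define d where "d k = pn (X (Suc k) - X k) (Y (Suc k) - Y k)" for k
  have cd: "X (Suc k) - X k \<in> carrier_mat p r" "Y (Suc k) - Y k \<in> carrier_mat q r" for k
    using cX cY by (auto intro!: minus_carrier_mat)
  have dS: "d (Suc k) \<le> (1 - s) * d k" for k
  proof -
    let ?X = "X (Suc k)" and ?Y = "Y (Suc k)" and ?X2 = "X (Suc (Suc k))" and ?Y2 = "Y (Suc (Suc k))"
    have sub4: "(U - V) - (U' - V') = (U - U') - (V - V')"
      if "U \<in> carrier_mat a b" "V \<in> carrier_mat a b" "U' \<in> carrier_mat a b" "V' \<in> carrier_mat a b"
      for U V U' V' :: "complex mat" and a b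
      using that by (intro eq_matI) auto
    have sub3: "(U - V) - (U - V') = - (V - V')"
      if "U \<in> carrier_mat a b" "V \<in> carrier_mat a b" "V' \<in> carrier_mat a b" for U V V' :: "complex mat" and a b
      using that by (intro eq_matI) auto
    have tele: "U - V = (U - W) + (W - V)"
      if "U \<in> carrier_mat a b" "V \<in> carrier_mat a b" "W \<in> carrier_mat a b" for U V W :: "complex mat" and a b
      using that by (intro eq_matI) auto
    have e1: "(?X2 - ?X) * A1 - A2 * (?Y2 - ?Y) = - (?X * B1 * ?Y - X k * B1 * Y k)"
    proof -
      have "(?X2 - ?X) * A1 - A2 * (?Y2 - ?Y) = (?X2 * A1 - ?X * A1) - (A2 * ?Y2 - A2 * ?Y)"
        using dA dX dY by (simp add: minus_mm mm_minus)
      also have "\<dots> = (?X2 * A1 - A2 * ?Y2) - (?X * A1 - A2 * ?Y)"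
        by (rule sub4[symmetric, of _ p r]) (use dA dX dY in \<open>auto intro!: carrier_matI\<close>)
      also have "\<dots> = (K1 - ?X * B1 * ?Y) - (K1 - X k * B1 * Y k)" unfolding eq ..
      also have "\<dots> = - (?X * B1 * ?Y - X k * B1 * Y k)"
        by (rule sub3[of _ p r]) (use dA dX dY in \<open>auto intro!: carrier_matI\<close>)
      finally show ?thesis .
    qed
    have e2: "(?Y2 - ?Y) * A1\<^sup>H - A2\<^sup>H * (?X2 - ?X) = - (?Y * B2 * ?X - Y k * B2 * X k)"
    proof -
      have "(?Y2 - ?Y) * A1\<^sup>H - A2\<^sup>H * (?X2 - ?X) = (?Y2 * A1\<^sup>H - ?Y * A1\<^sup>H) - (A2\<^sup>H * ?X2 - A2\<^sup>H * ?X)"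
        using dA dX dY by (simp add: minus_mm mm_minus)
      also have "\<dots> = (?Y2 * A1\<^sup>H - A2\<^sup>H * ?X2) - (?Y * A1\<^sup>H - A2\<^sup>H * ?X)"
        by (rule sub4[symmetric, of _ q r]) (use dA dX dY in \<open>auto intro!: carrier_matI\<close>)
      also have "\<dots> = (K2 - ?Y * B2 * ?X) - (K2 - Y k * B2 * X k)" unfolding eq ..
      also have "\<dots> = - (?Y * B2 * ?X - Y k * B2 * X k)"
        by (rule sub3[of _ q r]) (use dA dX dY in \<open>auto intro!: carrier_matI\<close>)
      finally show ?thesis .
    qed
    \<comment> \<open>Each summand pairs one increment with one factor from the ball; the two
      together give \<open>2 * \<epsilon> * \<rho>\<close>.\<close>
    have f1: "?X * B1 * ?Y - X k * B1 * Y k = (?X - X k) * B1 * ?Y + X k * B1 * (?Y - Y k)"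
    proof -
      have "?X * B1 * ?Y - X k * B1 * Y k = (?X * B1 * ?Y - X k * B1 * ?Y) + (X k * B1 * ?Y - X k * B1 * Y k)"
        by (rule tele[of _ p r]) (use dA dX dY in \<open>auto intro!: carrier_matI\<close>)
      then show ?thesis using dA dX dY by (simp add: minus_mm mm_minus)
    qed
    have f2: "?Y * B2 * ?X - Y k * B2 * X k = (?Y - Y k) * B2 * ?X + Y k * B2 * (?X - X k)"
    proof -
      have "?Y * B2 * ?X - Y k * B2 * X k = (?Y * B2 * ?X - Y k * B2 * ?X) + (Y k * B2 * ?X - Y k * B2 * X k)"
        by (rule tele[of _ q r]) (use dA dX dY in \<open>auto intro!: carrier_matI\<close>)
      then show ?thesis using dA dX dY by (simp add: minus_mm mm_minus)
    qed
    have c1: "?X * B1 * ?Y - X k * B1 * Y k \<in> carrier_mat p r" "?Y * B2 * ?X - Y k * B2 * X k \<in> carrier_mat q r"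
      using dA dX dY by (auto intro!: carrier_matI)
    have "\<tau> * d (Suc k) \<le> pn (- (?X * B1 * ?Y - X k * B1 * Y k)) (- (?Y * B2 * ?X - Y k * B2 * X k))"
      using bound[OF cd, of "Suc k" "Suc k"] unfolding e1 e2 d_def .
    also have "\<dots> = pn (?X * B1 * ?Y - X k * B1 * Y k) (?Y * B2 * ?X - Y k * B2 * X k)"
      by (rule pair_normD(1)[OF pn c1])
    also have "\<dots> \<le> pn ((?X - X k) * B1 * ?Y) ((?Y - Y k) * B2 * ?X) + pn (X k * B1 * (?Y - Y k)) (Y k * B2 * (?X - X k))"
      unfolding f1 f2 by (rule pair_normD(5)[OF pn]) (use dA dX dY in \<open>auto intro!: carrier_matI\<close>)
    also have "\<dots> \<le> \<epsilon> * d k * pn ?X ?Y + \<epsilon> * pn (X k) (Y k) * d k"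
      unfolding d_def by (intro add_mono quad cX cY cd)
    also have "\<dots> \<le> \<epsilon> * d k * \<rho> + \<epsilon> * \<rho> * d k"
      using bnd \<epsilon> pn0[OF cd] by (intro add_mono mult_left_mono mult_right_mono) (auto simp: d_def)
    also have "\<dots> = (2 * \<epsilon> * \<rho>) * d k" by simp
    also have "\<dots> = \<tau> * ((1 - s) * d k)" unfolding rad(5) by simp
    finally show ?thesis using \<tau> by simp
  qed
  have dk: "d k \<le> d 0 * (1 - s) ^ k" for k
  proof (induction k)
    case (Suc k)
    have "d (Suc k) \<le> (1 - s) * d k" by (rule dS)
    also have "\<dots> \<le> (1 - s) * (d 0 * (1 - s) ^ k)" using Suc rad(2) by (intro mult_left_mono) auto
    finally show ?case by (simp add: mult_ac)
  qed simp
  \<comment> \<open>Entries are dominated by \<open>N\<close>, so the geometric decay of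
    \<open>d k\<close> makes every entry sequence converge.\<close>
  have ent: "cmod (U $$ (i, j)) \<le> N U" if "i < dim_row U" "j < dim_col U" for U i j
    using entry_le_spectral_norm[OF that] spectral_norm_le_ui_norm[OF N, of U] by linarith
  have convX: "convergent (\<lambda>k. X k $$ (i, j))" if "i < p" "j < r" for i j
  proof (rule convergent_geometric)
    fix k
    have "norm (X (Suc k) $$ (i, j) - X k $$ (i, j)) = cmod ((X (Suc k) - X k) $$ (i, j))" using that dX by simp
    also have "\<dots> \<le> N (X (Suc k) - X k)" by (rule ent) (use that dX in auto)
    also have "\<dots> \<le> d k" unfolding d_def by (rule pair_normD(2)[OF pn cd])
    also have "\<dots> \<le> d 0 * (1 - s) ^ k" by (rule dk)
    finally show "norm (X (Suc k) $$ (i, j) - X k $$ (i, j)) \<le> d 0 * (1 - s) ^ k" .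
  qed (use rad in auto)
  have convY: "convergent (\<lambda>k. Y k $$ (i, j))" if "i < q" "j < r" for i j
  proof (rule convergent_geometric)
    fix k
    have "norm (Y (Suc k) $$ (i, j) - Y k $$ (i, j)) = cmod ((Y (Suc k) - Y k) $$ (i, j))" using that dY by simp
    also have "\<dots> \<le> N (Y (Suc k) - Y k)" by (rule ent) (use that dY in auto)
    also have "\<dots> \<le> d k" unfolding d_def by (rule pair_normD(3)[OF pn cd])
    also have "\<dots> \<le> d 0 * (1 - s) ^ k" by (rule dk)
    finally show "norm (Y (Suc k) $$ (i, j) - Y k $$ (i, j)) \<le> d 0 * (1 - s) ^ k" .
  qed (use rad in auto)
  define \<Gamma> where "\<Gamma> = mat p r (\<lambda>(i, j). lim (\<lambda>k. X k $$ (i, j)))"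
  define \<Omega> where "\<Omega> = mat q r (\<lambda>(i, j). lim (\<lambda>k. Y k $$ (i, j)))"
  have limX: "mlim p r X \<Gamma>"
    unfolding mlim_def using cX convX by (auto simp: \<Gamma>_def convergent_LIMSEQ_iff)
  have limY: "mlim q r Y \<Omega>"
    unfolding mlim_def using cY convY by (auto simp: \<Omega>_def convergent_LIMSEQ_iff)
  have c: "\<Gamma> \<in> carrier_mat p r" "\<Omega> \<in> carrier_mat q r" by (auto simp: \<Gamma>_def \<Omega>_def)
  have A1H: "A1\<^sup>H \<in> carrier_mat r r" "A2\<^sup>H \<in> carrier_mat q p" using A1 A2 by auto
  have r1: "\<Gamma> * A1 - A2 * \<Omega> = K1 - \<Gamma> * B1 * \<Omega>"
  proof (rule mlim_unique)
    show "mlim p r (\<lambda>k. X (Suc k) * A1 - A2 * Y (Suc k)) (\<Gamma> * A1 - A2 * \<Omega>)"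
      by (intro mlim_minus mlim_mm[OF mlim_Suc[OF limX] mlim_const[OF A1]] mlim_mm[OF mlim_const[OF A2] mlim_Suc[OF limY]])
    show "mlim p r (\<lambda>k. X (Suc k) * A1 - A2 * Y (Suc k)) (K1 - \<Gamma> * B1 * \<Omega>)"
      unfolding eq by (intro mlim_minus mlim_const[OF K(1)] mlim_mm[OF mlim_mm[OF limX mlim_const[OF B1]] limY])
  qed
  have r2: "\<Omega> * A1\<^sup>H - A2\<^sup>H * \<Gamma> = K2 - \<Omega> * B2 * \<Gamma>"
  proof (rule mlim_unique)
    show "mlim q r (\<lambda>k. Y (Suc k) * A1\<^sup>H - A2\<^sup>H * X (Suc k)) (\<Omega> * A1\<^sup>H - A2\<^sup>H * \<Gamma>)"
      by (intro mlim_minus mlim_mm[OF mlim_Suc[OF limY] mlim_const[OF A1H(1)]] mlim_mm[OF mlim_const[OF A1H(2)] mlim_Suc[OF limX]])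
    show "mlim q r (\<lambda>k. Y (Suc k) * A1\<^sup>H - A2\<^sup>H * X (Suc k)) (K2 - \<Omega> * B2 * \<Gamma>)"
      unfolding eq by (intro mlim_minus mlim_const[OF K(2)] mlim_mm[OF mlim_mm[OF limY mlim_const[OF B2]] limX])
  qed
  \<comment> \<open>Continuity of \<open>pn\<close> is replaced by the triangle inequality together
    with \<open>pn X Y \<le> N X + N Y\<close> for the error.\<close>
  have "pn \<Gamma> \<Omega> \<le> \<rho> + (N (X k - \<Gamma>) + N (Y k - \<Omega>))" for k
  proof -
    have e: "\<Gamma> = X k - (X k - \<Gamma>)" "\<Omega> = Y k - (Y k - \<Omega>)" using cX[of k] cY[of k] c by (auto intro!: eq_matI)
    have cc: "X k - \<Gamma> \<in> carrier_mat p r" "Y k - \<Omega> \<in> carrier_mat q r" using c by (auto intro!: minus_carrier_mat)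
    have "pn \<Gamma> \<Omega> = pn (X k - (X k - \<Gamma>)) (Y k - (Y k - \<Omega>))" using e by simp
    also have "\<dots> \<le> pn (X k) (Y k) + pn (X k - \<Gamma>) (Y k - \<Omega>)" by (rule pair_norm_minus[OF pn cX cY cc])
    also have "\<dots> \<le> \<rho> + (N (X k - \<Gamma>) + N (Y k - \<Omega>))" by (intro add_mono bnd pair_normD(4)[OF pn cc])
    finally show ?thesis .
  qed
  moreover have "(\<lambda>k. \<rho> + (N (X k - \<Gamma>) + N (Y k - \<Omega>))) \<longlonglongrightarrow> \<rho> + (0 + 0)"
    using limX limY by (intro tendsto_intros ui_norm_tendsto_0[OF N]) (auto simp: mlim_def)
  ultimately have "pn \<Gamma> \<Omega> \<le> \<rho>" by (intro tendsto_lowerbound[of _ \<rho> sequentially]) auto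
  then show ?thesis using c r1 r2 unfolding \<rho>_def s_def g_def by blast
qed

subsection \<open>The two norms on pairs\<close>

lemma pair_norm_diag:
  assumes N: "unitarily_invariant_norm N"
  shows "pair_norm N p q r (\<lambda>X Y. N (four_block_mat X (0\<^sub>m p r) (0\<^sub>m q r) Y))"
  unfolding pair_norm_def
proof (intro ballI conjI)
  fix X Y :: "complex mat" assume c: "X \<in> carrier_mat p r" "Y \<in> carrier_mat q r"
  note d = carrier_matD[OF c(1)] carrier_matD[OF c(2)]
  let ?D = "\<lambda>X Y. four_block_mat X (0\<^sub>m p r) (0\<^sub>m q r) Y :: complex mat"
  have lX: "N X \<le> N (?D X Y)" by (rule ui_norm_block_le[OF N]) (use c in auto)
  have lY: "N Y \<le> N (?D X Y)"
    unfolding ui_norm_swap_diag[OF N c(1,2), symmetric] by (rule ui_norm_block_le[OF N]) (use c in auto)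
  show "N X \<le> N (?D X Y)" "N Y \<le> N (?D X Y)" by (fact lX, fact lY)
  have "- ?D X Y = ?D (- X) (- Y)" using d by (simp add: block_simps)
  then show "N (?D (- X) (- Y)) = N (?D X Y)" using ui_norm_uminus[OF N, of "?D X Y"] by simp
  have "?D X Y = ?D X (0\<^sub>m q r) + ?D (0\<^sub>m p r) Y" using d by (simp add: block_simps mat_dist)
  then have "N (?D X Y) \<le> N (?D X (0\<^sub>m q r)) + N (?D (0\<^sub>m p r) Y)"
    using ui_norm_triangle[OF N, of "?D X (0\<^sub>m q r)" "?D (0\<^sub>m p r) Y"] d by simp
  also have "N (?D X (0\<^sub>m q r)) = N X" by (rule ui_norm_pad[OF N c(1)])
  also have "N (?D (0\<^sub>m p r) Y) = N (four_block_mat Y (0\<^sub>m q r) (0\<^sub>m p r) (0\<^sub>m p r))"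
    by (rule ui_norm_swap_diag[OF N zero_carrier_mat c(2), symmetric])
  also have "\<dots> = N Y" by (rule ui_norm_pad[OF N c(2)])
  finally show "N (?D X Y) \<le> N X + N Y" .
  fix X' Y' :: "complex mat" assume c': "X' \<in> carrier_mat p r" "Y' \<in> carrier_mat q r"
  note d' = carrier_matD[OF c'(1)] carrier_matD[OF c'(2)]
  have "?D (X + X') (Y + Y') = ?D X Y + ?D X' Y'" using d d' by (simp add: block_simps mat_dist)
  then show "N (?D (X + X') (Y + Y')) \<le> N (?D X Y) + N (?D X' Y')"
    using ui_norm_triangle[OF N, of "?D X Y" "?D X' Y'"] d d' by simp
qed

lemma pair_norm_max:
  assumes N: "unitarily_invariant_norm N"
  shows "pair_norm N p q r (\<lambda>X Y. max (N X) (N Y))"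
  unfolding pair_norm_def
proof (intro ballI conjI)
  fix X Y :: "complex mat" assume c: "X \<in> carrier_mat p r" "Y \<in> carrier_mat q r"
  show "max (N (- X)) (N (- Y)) = max (N X) (N Y)" by (simp add: ui_norm_uminus[OF N])
  show "N X \<le> max (N X) (N Y)" "N Y \<le> max (N X) (N Y)" by auto
  show "max (N X) (N Y) \<le> N X + N Y" using ui_norm_nonneg[OF N, of X] ui_norm_nonneg[OF N, of Y] by auto
  fix X' Y' :: "complex mat" assume c': "X' \<in> carrier_mat p r" "Y' \<in> carrier_mat q r"
  have "N (X + X') \<le> N X + N X'" "N (Y + Y') \<le> N Y + N Y'"
    using c c' by (auto intro!: ui_norm_triangle[OF N])
  then show "max (N (X + X')) (N (Y + Y')) \<le> max (N X) (N Y) + max (N X') (N Y')" by auto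
qed

text \<open>The mixed products form \<open>diag(X, Y) * diag(B1, B2) * diag(Y', X')\<close>, and
  exchanging blocks gives the last factor the norm of \<open>diag(X', Y')\<close>. The first factor
  is measured in \<open>N\<close> and the others in the spectral norm, which \<open>N\<close>
  dominates.\<close>

lemma quad_bound_diag:
  assumes N: "unitarily_invariant_norm N"
    and B1: "B1 \<in> carrier_mat r q" "spectral_norm B1 \<le> \<epsilon>" and B2: "B2 \<in> carrier_mat r p" "spectral_norm B2 \<le> \<epsilon>"
    and c: "X \<in> carrier_mat p r" "Y \<in> carrier_mat q r" "X' \<in> carrier_mat p r" "Y' \<in> carrier_mat q r"
  shows "N (four_block_mat (X * B1 * Y') (0\<^sub>m p r) (0\<^sub>m q r) (Y * B2 * X')) \<le>
    \<epsilon> * N (four_block_mat X (0\<^sub>m p r) (0\<^sub>m q r) Y) * N (four_block_mat X' (0\<^sub>m p r) (0\<^sub>m q r) Y')"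
proof -
  note d = c[THEN carrier_matD(1)] c[THEN carrier_matD(2)] carrier_matD[OF B1(1)] carrier_matD[OF B2(1)]
  let ?Z = "four_block_mat X (0\<^sub>m p r) (0\<^sub>m q r) Y"
  let ?B = "four_block_mat B1 (0\<^sub>m r p) (0\<^sub>m r q) B2"
  let ?Z' = "four_block_mat Y' (0\<^sub>m q r) (0\<^sub>m p r) X'"
  have "four_block_mat (X * B1 * Y') (0\<^sub>m p r) (0\<^sub>m q r) (Y * B2 * X') = ?Z * (?B * ?Z')"
    using d by (simp add: block_simps mat_dist)
  then have "N (four_block_mat (X * B1 * Y') (0\<^sub>m p r) (0\<^sub>m q r) (Y * B2 * X')) \<le> N ?Z * spectral_norm (?B * ?Z')"
    using ui_norm_mult_right[OF N, of ?Z "?B * ?Z'"] d by simp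
  also have "\<dots> \<le> N ?Z * (\<epsilon> * N ?Z')"
  proof (intro mult_left_mono ui_norm_nonneg[OF N])
    have "spectral_norm (?B * ?Z') \<le> spectral_norm ?B * spectral_norm ?Z'" using d by (intro spectral_norm_mm) simp
    also have "\<dots> \<le> \<epsilon> * N ?Z'"
      using spectral_norm_block_diag[OF B1(1) B2(1) B1(2) B2(2)] spectral_norm_le_ui_norm[OF N, of ?Z']
        spectral_norm_nonneg[of ?B]
      by (intro mult_mono) (auto intro: order_trans[OF spectral_norm_nonneg])
    finally show "spectral_norm (?B * ?Z') \<le> \<epsilon> * N ?Z'" .
  qed
  also have "N ?Z' = N (four_block_mat X' (0\<^sub>m p r) (0\<^sub>m q r) Y')" by (rule ui_norm_swap_diag[OF N c(3,4)])
  finally show ?thesis by (simp add: mult_ac)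
qed

lemma quad_bound_max:
  assumes N: "unitarily_invariant_norm N"
    and B1: "B1 \<in> carrier_mat r q" "spectral_norm B1 \<le> \<epsilon>" and B2: "B2 \<in> carrier_mat r p" "spectral_norm B2 \<le> \<epsilon>"
    and c: "X \<in> carrier_mat p r" "Y \<in> carrier_mat q r" "X' \<in> carrier_mat p r" "Y' \<in> carrier_mat q r"
  shows "max (N (X * B1 * Y')) (N (Y * B2 * X')) \<le> \<epsilon> * max (N X) (N Y) * max (N X') (N Y')"
proof -
  have \<epsilon>: "0 \<le> \<epsilon>" using B1(2) spectral_norm_nonneg[of B1] by linarith
  have *: "N (U * B * V) \<le> \<epsilon> * u * v"
    if "dim_col U = dim_row B" "dim_col B = dim_row V" "spectral_norm B \<le> \<epsilon>" "N U \<le> u" "N V \<le> v" for U B V u v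
  proof -
    have "N (U * B * V) = N (U * (B * V))" using that by (simp add: assoc_mm)
    also have "\<dots> \<le> N U * spectral_norm (B * V)" using that by (intro ui_norm_mult_right[OF N]) simp
    also have "\<dots> \<le> N U * (spectral_norm B * spectral_norm V)"
      using that by (intro mult_left_mono spectral_norm_mm ui_norm_nonneg[OF N]) simp
    also have "\<dots> \<le> u * (\<epsilon> * v)"
      using that \<epsilon> spectral_norm_le_ui_norm[OF N, of V] ui_norm_nonneg[OF N, of U]
      by (intro mult_mono) (auto intro: order_trans[OF ui_norm_nonneg[OF N]])
    finally show ?thesis by (simp add: mult_ac)
  qed
  show ?thesis using c B1 B2 by (intro max.boundedI *) auto
qed

lemma sing_val_min_perturb:
  assumes G: "G \<in> carrier_mat r r" and F: "F \<in> carrier_mat r r" and r: "0 < r" and x: "dim_vec x = r"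
  shows "(sing_val_min G - spectral_norm F) * vec_norm2 x \<le> vec_norm2 ((G + F) *\<^sub>v x)"
    "(sing_val_min G - spectral_norm F) * vec_norm2 x \<le> vec_norm2 ((G + F)\<^sup>H *\<^sub>v x)"
proof -
  note d = carrier_matD[OF G] carrier_matD[OF F]
  have "sing_val_min G * vec_norm2 x - spectral_norm F * vec_norm2 x \<le> vec_norm2 (G *\<^sub>v x) - vec_norm2 (F *\<^sub>v x)"
    by (intro diff_mono sing_val_min_lower(1)[OF G r x] spectral_norm_bound) (use d x in simp)
  also have "\<dots> \<le> vec_norm2 (G *\<^sub>v x + F *\<^sub>v x)" using d by (intro vec_norm2_triangle_minus) simp
  also have "G *\<^sub>v x + F *\<^sub>v x = (G + F) *\<^sub>v x" using d x by (intro add_mv[symmetric]) auto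
  finally show "(sing_val_min G - spectral_norm F) * vec_norm2 x \<le> vec_norm2 ((G + F) *\<^sub>v x)" by (simp add: algebra_simps)
  have "spectral_norm (F\<^sup>H) * vec_norm2 x \<ge> vec_norm2 (F\<^sup>H *\<^sub>v x)" by (rule spectral_norm_bound) (use d x in simp)
  then have "sing_val_min G * vec_norm2 x - spectral_norm F * vec_norm2 x \<le> vec_norm2 (G\<^sup>H *\<^sub>v x) - vec_norm2 (F\<^sup>H *\<^sub>v x)"
    by (intro diff_mono sing_val_min_lower(2)[OF G r x]) simp
  also have "\<dots> \<le> vec_norm2 (G\<^sup>H *\<^sub>v x + F\<^sup>H *\<^sub>v x)" using d by (intro vec_norm2_triangle_minus) simp
  also have "G\<^sup>H *\<^sub>v x + F\<^sup>H *\<^sub>v x = (G + F)\<^sup>H *\<^sub>v x"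
    using d x by (subst add_mv[symmetric]) (auto simp: adjoint_add)
  finally show "(sing_val_min G - spectral_norm F) * vec_norm2 x \<le> vec_norm2 ((G + F)\<^sup>H *\<^sub>v x)" by (simp add: algebra_simps)
qed

text \<open>\<open>A1\<close> is bounded below by \<open>a\<close> and \<open>A2\<close> above by
  \<open>b\<close>, so \<open>\<Gamma> * A1 = C + A2 * \<Omega>\<close> yields
  \<open>a * N \<Gamma> \<le> N C + b * N \<Omega>\<close>, and symmetrically for
  \<open>\<Omega>\<close>. For the maximum take the inequality of the larger norm; for the block
  diagonal norm run the same argument on block matrices, where exchanging \<open>\<Gamma>\<close>
  and \<open>\<Omega>\<close> changes nothing. No Schur multiplier enters, hence the constant
  1.\<close>

lemma separated_bound:
  assumes N: "unitarily_invariant_norm N"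
    and G1: "G1 \<in> carrier_mat r r" and E1: "E1 \<in> carrier_mat r r"
    and G2: "G2 \<in> carrier_mat p q" and E2: "E2 \<in> carrier_mat p q" and pos: "0 < r" "0 < p" "0 < q"
  defines "A1 \<equiv> G1 + E1" and "A2 \<equiv> G2 + E2"
  defines "a \<equiv> sing_val_min G1 - spectral_norm E1" and "b \<equiv> sing_val_max G2 + spectral_norm E2"
  assumes ab: "b < a" and c: "\<Gamma> \<in> carrier_mat p r" "\<Omega> \<in> carrier_mat q r"
  defines "C \<equiv> \<Gamma> * A1 - A2 * \<Omega>" and "D \<equiv> \<Omega> * A1\<^sup>H - A2\<^sup>H * \<Gamma>"
  shows "(a - b) * N (four_block_mat \<Gamma> (0\<^sub>m p r) (0\<^sub>m q r) \<Omega>) \<le> N (four_block_mat C (0\<^sub>m p r) (0\<^sub>m q r) D)"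
    "(a - b) * max (N \<Gamma>) (N \<Omega>) \<le> max (N C) (N D)"
proof -
  have A: "A1 \<in> carrier_mat r r" "A2 \<in> carrier_mat p q" using G1 G2 E1 E2 by (auto simp: A1_def A2_def)
  note d = carrier_matD[OF A(1)] carrier_matD[OF A(2)] c[THEN carrier_matD(1)] c[THEN carrier_matD(2)]
    carrier_matD[OF G1] carrier_matD[OF E1] carrier_matD[OF G2] carrier_matD[OF E2]
  have "spectral_norm A2 \<le> spectral_norm G2 + spectral_norm E2"
    unfolding A2_def using d by (intro spectral_norm_add) auto
  moreover have "spectral_norm G2 \<le> sing_val_max G2" using d pos by (intro spectral_norm_le_sing_val_max) auto
  ultimately have sb: "spectral_norm A2 \<le> b" by (simp add: b_def)
  then have b0: "0 \<le> b" using spectral_norm_nonneg[of A2] by linarith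
  have a0: "0 < a" using ab b0 by simp
  have low1: "a * vec_norm2 x \<le> vec_norm2 (A1 *\<^sub>v x)" if "dim_vec x = r" for x
    unfolding a_def A1_def by (rule sing_val_min_perturb(1)[OF G1 E1 pos(1) that])
  have low2: "a * vec_norm2 x \<le> vec_norm2 (A1\<^sup>H *\<^sub>v x)" if "dim_vec x = r" for x
    unfolding a_def A1_def by (rule sing_val_min_perturb(2)[OF G1 E1 pos(1) that])
  have addback: "(U - V) + V = U" if "dim_row V = dim_row U" "dim_col V = dim_col U" for U V :: "complex mat"
    using that by (intro eq_matI) auto
  have AH: "A1\<^sup>H \<in> carrier_mat r r" using A(1) by simp
  have n1: "a * N \<Gamma> \<le> N C + b * N \<Omega>"
  proof -
    have "a * N \<Gamma> \<le> N (\<Gamma> * A1)" by (rule ui_norm_bounded_below[OF N A(1) a0 low1]) (use d in auto)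
    also have "\<Gamma> * A1 = C + A2 * \<Omega>" unfolding C_def by (rule addback[symmetric]) (use d in auto)
    also have "N \<dots> \<le> N C + N (A2 * \<Omega>)" by (rule ui_norm_triangle[OF N]) (use d in \<open>auto simp: C_def\<close>)
    also have "N (A2 * \<Omega>) \<le> spectral_norm A2 * N \<Omega>" by (rule ui_norm_mult_left[OF N]) (use d in auto)
    also have "\<dots> \<le> b * N \<Omega>" by (rule mult_right_mono[OF sb ui_norm_nonneg[OF N]])
    finally show ?thesis by simp
  qed
  have n2: "a * N \<Omega> \<le> N D + b * N \<Gamma>"
  proof -
    have "a * N \<Omega> \<le> N (\<Omega> * A1\<^sup>H)" by (rule ui_norm_bounded_below[OF N AH a0 low2]) (use d in auto)
    also have "\<Omega> * A1\<^sup>H = D + A2\<^sup>H * \<Gamma>" unfolding D_def by (rule addback[symmetric]) (use d in auto)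
    also have "N \<dots> \<le> N D + N (A2\<^sup>H * \<Gamma>)" by (rule ui_norm_triangle[OF N]) (use d in \<open>auto simp: D_def\<close>)
    also have "N (A2\<^sup>H * \<Gamma>) \<le> spectral_norm (A2\<^sup>H) * N \<Gamma>" by (rule ui_norm_mult_left[OF N]) (use d in auto)
    also have "\<dots> \<le> b * N \<Gamma>" by (rule mult_right_mono[OF _ ui_norm_nonneg[OF N]]) (use sb in simp)
    finally show ?thesis by simp
  qed
  show "(a - b) * max (N \<Gamma>) (N \<Omega>) \<le> max (N C) (N D)"
  proof (cases "N \<Omega> \<le> N \<Gamma>")
    case True
    have "b * N \<Omega> \<le> b * N \<Gamma>" by (rule mult_left_mono[OF True b0])
    then show ?thesis using True n1 by (simp add: max_def algebra_simps)
  next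
    case False
    then have "b * N \<Gamma> \<le> b * N \<Omega>" by (intro mult_left_mono b0) simp
    then show ?thesis using False n2 by (simp add: max_def algebra_simps)
  qed
  let ?Z = "four_block_mat \<Gamma> (0\<^sub>m p r) (0\<^sub>m q r) \<Omega>" and ?Z' = "four_block_mat \<Omega> (0\<^sub>m q r) (0\<^sub>m p r) \<Gamma>"
  let ?H = "four_block_mat A1 (0\<^sub>m r r) (0\<^sub>m r r) (A1\<^sup>H)" and ?W = "four_block_mat C (0\<^sub>m p r) (0\<^sub>m q r) D"
  let ?K = "four_block_mat A2 (0\<^sub>m p p) (0\<^sub>m q q) (A2\<^sup>H)"
  have cH: "?H \<in> carrier_mat (r + r) (r + r)" using A by auto
  have low: "a * vec_norm2 x \<le> vec_norm2 (?H *\<^sub>v x)" if "dim_vec x = r + r" for x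
  proof -
    obtain u v where x: "x = u @\<^sub>v v" "dim_vec u = r" "dim_vec v = r" using \<open>dim_vec x = r + r\<close> by (rule vec_split)
    have "?H *\<^sub>v x = (A1 *\<^sub>v u) @\<^sub>v (A1\<^sup>H *\<^sub>v v)"
      unfolding x(1) using d x(2,3)
      by (subst four_block_mv[OF A(1) zero_carrier_mat zero_carrier_mat AH]) (simp_all add: zero_mv add_zero_v)
    then have e: "(vec_norm2 (?H *\<^sub>v x))\<^sup>2 = (vec_norm2 (A1 *\<^sub>v u))\<^sup>2 + (vec_norm2 (A1\<^sup>H *\<^sub>v v))\<^sup>2"
      by (simp only: vec_norm2_append)
    have "(a * vec_norm2 x)\<^sup>2 = (a * vec_norm2 u)\<^sup>2 + (a * vec_norm2 v)\<^sup>2"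
      unfolding x(1) power_mult_distrib vec_norm2_append by (simp add: algebra_simps)
    also have "\<dots> \<le> (vec_norm2 (A1 *\<^sub>v u))\<^sup>2 + (vec_norm2 (A1\<^sup>H *\<^sub>v v))\<^sup>2"
      by (intro add_mono power_mono low1 low2 x(2,3)) (use a0 in auto)
    finally show ?thesis unfolding e[symmetric] by (rule power2_le_imp_le) simp
  qed
  have "a * N ?Z \<le> N (?Z * ?H)" by (rule ui_norm_bounded_below[OF N cH a0 low]) (use d in auto)
  also have "?Z * ?H = ?W + ?K * ?Z'"
  proof -
    have "?Z * ?H = four_block_mat (\<Gamma> * A1) (0\<^sub>m p r) (0\<^sub>m q r) (\<Omega> * A1\<^sup>H)" using d by (simp add: block_simps mat_dist)
    moreover have "?K * ?Z' = four_block_mat (A2 * \<Omega>) (0\<^sub>m p r) (0\<^sub>m q r) (A2\<^sup>H * \<Gamma>)" using d by (simp add: block_simps mat_dist)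
    moreover have "C + A2 * \<Omega> = \<Gamma> * A1" "D + A2\<^sup>H * \<Gamma> = \<Omega> * A1\<^sup>H"
      unfolding C_def D_def by (rule addback, use d in auto)+
    moreover have "dim_row C = p" "dim_col C = r" "dim_row D = q" "dim_col D = r" using d by (auto simp: C_def D_def)
    ultimately show ?thesis using d by (simp add: block_simps mat_dist)
  qed
  also have "N \<dots> \<le> N ?W + N (?K * ?Z')" by (rule ui_norm_triangle[OF N]) (use d in \<open>auto simp: C_def D_def\<close>)
  also have "N (?K * ?Z') \<le> spectral_norm ?K * N ?Z'" by (rule ui_norm_mult_left[OF N]) (use d in auto)
  also have "\<dots> \<le> b * N ?Z'"
    by (intro mult_right_mono ui_norm_nonneg[OF N] spectral_norm_block_diag[OF A(2)]) (use A sb in auto)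
  also have "N ?Z' = N ?Z" by (rule ui_norm_swap_diag[OF N c])
  finally show "(a - b) * N ?Z \<le> N ?W" by (simp add: algebra_simps)
qed

text \<open>This is where \<open>c\<close> originates: 1 from \<open>separated_bound\<close>, 1 for
  the Frobenius norm because entries are divided by numbers of modulus at least
  \<open>\<delta>'\<close>, and otherwise \<open>pi / 2\<close> from the Schur multiplier, doubled
  for the maximum norm.\<close>

lemma sylvester_pair_bound:
  assumes N: "unitarily_invariant_norm N"
    and G1: "G1 \<in> carrier_mat r r" and E1: "E1 \<in> carrier_mat r r"
    and G2: "G2 \<in> carrier_mat p q" and E2: "E2 \<in> carrier_mat p q" and pos: "0 < r" "0 < p" "0 < q"
    and \<delta>: "\<And>\<mu> \<nu>. \<mu> \<in># sing_vals G1 \<Longrightarrow> \<nu> \<in># sing_vals_ext G2 \<Longrightarrow> \<delta> \<le> \<bar>\<mu> - \<nu>\<bar>"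
    and \<delta>': "\<delta>' = \<delta> - spectral_norm E1 - spectral_norm E2" "0 < \<delta>'"
    and pn_c: "(pn = (\<lambda>X Y. N (four_block_mat X (0\<^sub>m p r) (0\<^sub>m q r) Y)) \<and>
        c = (if sing_val_min G1 > sing_val_max G2 \<or> N = frobenius_norm then 1 else pi / 2)) \<or>
       (pn = (\<lambda>X Y. max (N X) (N Y)) \<and>
        c = (if sing_val_min G1 > sing_val_max G2 then 1 else pi))"
    and cc: "\<Gamma> \<in> carrier_mat p r" "\<Omega> \<in> carrier_mat q r"
  shows "\<delta>' / c * pn \<Gamma> \<Omega> \<le>
    pn (\<Gamma> * (G1 + E1) - (G2 + E2) * \<Omega>) (\<Omega> * (G1 + E1)\<^sup>H - (G2 + E2)\<^sup>H * \<Gamma>)"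
proof -
  let ?A1 = "G1 + E1" and ?A2 = "G2 + E2"
  let ?C = "\<Gamma> * ?A1 - ?A2 * \<Omega>" and ?D = "\<Omega> * ?A1\<^sup>H - ?A2\<^sup>H * \<Gamma>"
  have A: "?A1 \<in> carrier_mat r r" "?A2 \<in> carrier_mat p q" using G1 E1 G2 E2 by auto
  have cC: "?C \<in> carrier_mat p r" "?D \<in> carrier_mat q r"
    using A cc by (auto intro!: carrier_matI)
  obtain P a where P: "unitary_mat (r + r) P" "dilation ?A1 = P * diag_of (r + r) (\<lambda>i. complex_of_real (a i)) * P\<^sup>H"
    using hermitian_spectral[OF dilation_carrier[OF A(1)] dilation_hermitian] by blast
  obtain Q b where Q: "unitary_mat (p + q) Q" "dilation ?A2 = Q * diag_of (p + q) (\<lambda>i. complex_of_real (b i)) * Q\<^sup>H"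
    using hermitian_spectral[OF dilation_carrier[OF A(2)] dilation_hermitian] by blast
  have gap: "\<delta>' \<le> \<bar>a j - b i\<bar>" if "i < p + q" "j < r + r" for i j
    unfolding \<delta>'(1) by (rule dilation_gap[OF G1 E1 G2 E2 \<delta> P Q that])
  have ne: "a j \<noteq> b i" if "i < p + q" "j < r + r" for i j using gap[OF that] \<delta>'(2) by auto
  let ?pn = "\<lambda>X Y. N (four_block_mat X (0\<^sub>m p r) (0\<^sub>m q r) Y)"
  have general: "?pn \<Gamma> \<Omega> \<le> pi / (2 * \<delta>') * ?pn ?C ?D"
  proof (rule sylvester_bound[OF N A P Q ne _ cc])
    fix W :: "complex mat" assume W: "W \<in> carrier_mat (p + q) (r + r)"
    show "N (mat (p + q) (r + r) (\<lambda>(i, j). W $$ (i, j) / complex_of_real (a j - b i))) \<le> pi / (2 * \<delta>') * N W"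
      by (rule ui_norm_schur_multiplier[OF N W \<delta>'(2) gap])
  qed auto
  have frob: "?pn \<Gamma> \<Omega> \<le> 1 / \<delta>' * ?pn ?C ?D" if F: "N = frobenius_norm"
  proof (rule sylvester_bound[OF N A P Q ne _ cc])
    fix W :: "complex mat" assume W: "W \<in> carrier_mat (p + q) (r + r)"
    have "cmod (W $$ (i, j) / complex_of_real (a j - b i)) \<le> 1 / \<delta>' * cmod (W $$ (i, j))" if "i < p + q" "j < r + r" for i j
    proof -
      have "cmod (W $$ (i, j) / complex_of_real (a j - b i)) = cmod (W $$ (i, j)) / \<bar>a j - b i\<bar>"
        by (simp only: norm_divide norm_of_real)
      also have "\<dots> \<le> cmod (W $$ (i, j)) / \<delta>'" using gap[OF that] \<delta>'(2) by (intro divide_left_mono) auto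
      finally show ?thesis by simp
    qed
    then show "N (mat (p + q) (r + r) (\<lambda>(i, j). W $$ (i, j) / complex_of_real (a j - b i))) \<le> 1 / \<delta>' * N W"
      unfolding F using W \<delta>'(2) by (intro frobenius_norm_mono) auto
  qed (auto)
  let ?a = "sing_val_min G1 - spectral_norm E1" and ?b = "sing_val_max G2 + spectral_norm E2"
  have sep: "\<delta>' \<le> ?a - ?b" if "sing_val_min G1 > sing_val_max G2"
  proof -
    have "sing_val_min G1 \<in># sing_vals G1" using sing_val_max_mem(3)[of G1] G1 pos by auto
    moreover have "sing_val_max G2 \<in># sing_vals_ext G2"
      using sing_val_max_mem(1)[of G2] G2 pos by (auto simp: sing_vals_ext_def)
    ultimately have "\<delta> \<le> \<bar>sing_val_min G1 - sing_val_max G2\<bar>" by (rule \<delta>)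
    then show ?thesis using that \<delta>'(1) by simp
  qed
  have sep1: "\<delta>' * ?pn \<Gamma> \<Omega> \<le> ?pn ?C ?D" "\<delta>' * max (N \<Gamma>) (N \<Omega>) \<le> max (N ?C) (N ?D)"
    if s: "sing_val_min G1 > sing_val_max G2"
  proof -
    have ba: "?b < ?a" using sep[OF s] \<delta>'(2) by linarith
    note sb = separated_bound[OF N G1 E1 G2 E2 pos ba cc]
    have "\<delta>' * ?pn \<Gamma> \<Omega> \<le> (?a - ?b) * ?pn \<Gamma> \<Omega>"
      by (rule mult_right_mono[OF sep[OF s] ui_norm_nonneg[OF N]])
    then show "\<delta>' * ?pn \<Gamma> \<Omega> \<le> ?pn ?C ?D" using sb(1) by linarith
    have "\<delta>' * max (N \<Gamma>) (N \<Omega>) \<le> (?a - ?b) * max (N \<Gamma>) (N \<Omega>)"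
      by (rule mult_right_mono[OF sep[OF s]]) (use ui_norm_nonneg[OF N, of \<Gamma>] in auto)
    then show "\<delta>' * max (N \<Gamma>) (N \<Omega>) \<le> max (N ?C) (N ?D)" using sb(2) by linarith
  qed
  show ?thesis
  proof (cases "sing_val_min G1 > sing_val_max G2")
    case True
    then show ?thesis using pn_c sep1[OF True] by auto
  next
    case notsep: False
    from pn_c show ?thesis
    proof
      assume *: "pn = ?pn \<and> c = (if sing_val_min G1 > sing_val_max G2 \<or> N = frobenius_norm then 1 else pi / 2)"
      then have pn: "pn = ?pn" by blast
      show ?thesis
      proof (cases "N = frobenius_norm")
        case True
        then have "c = 1" using * by simp
        then show ?thesis unfolding pn using frob[OF True] \<delta>'(2) by (simp add: field_simps)
      next
        case False
        then have c: "c = pi / 2" using * notsep by simp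
        have "\<delta>' / c * ?pn \<Gamma> \<Omega> \<le> \<delta>' / c * (pi / (2 * \<delta>') * ?pn ?C ?D)"
          by (rule mult_left_mono[OF general]) (use \<delta>'(2) in \<open>simp add: c\<close>)
        also have "\<dots> = ?pn ?C ?D" using \<delta>'(2) by (simp add: c)
        finally show ?thesis unfolding pn .
      qed
    next
      \<comment> \<open>The maximum is at most the block diagonal norm, which in turn is at most the
        sum, hence twice the maximum; so \<open>pi / 2\<close> becomes \<open>pi\<close>.\<close>
      assume *: "pn = (\<lambda>X Y. max (N X) (N Y)) \<and> c = (if sing_val_min G1 > sing_val_max G2 then 1 else pi)"
      then have pn: "pn = (\<lambda>X Y. max (N X) (N Y))" and c: "c = pi" using notsep by auto
      note pd = pair_norm_diag[OF N, of p q r]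
      have "max (N \<Gamma>) (N \<Omega>) \<le> ?pn \<Gamma> \<Omega>" using pair_normD(2,3)[OF pd cc] by simp
      also have "\<dots> \<le> pi / (2 * \<delta>') * ?pn ?C ?D" by (rule general)
      also have "\<dots> \<le> pi / (2 * \<delta>') * (2 * max (N ?C) (N ?D))"
        using pair_normD(4)[OF pd cC] \<delta>'(2) by (intro mult_left_mono) auto
      finally have "\<delta>' / c * max (N \<Gamma>) (N \<Omega>) \<le> \<delta>' / c * (pi / (2 * \<delta>') * (2 * max (N ?C) (N ?D)))"
        by (rule mult_left_mono) (use \<delta>'(2) in \<open>simp add: c\<close>)
      also have "\<dots> = max (N ?C) (N ?D)" using \<delta>'(2) by (simp add: c)
      finally show ?thesis unfolding pn .
    qed
  qed
qed

subsection \<open>Block diagonalization by graph subspaces\<close>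

text \<open>Selecting columns becomes multiplication by an isometry, so that
  \<open>left_cols\<close> and \<open>right_cols\<close> take part in matrix algebra. The second
  block column is empty and only makes the block rules applicable.\<close>

definition incl_left :: "nat \<Rightarrow> nat \<Rightarrow> complex mat" where
  "incl_left r p = four_block_mat (1\<^sub>m r) (0\<^sub>m r 0) (0\<^sub>m p r) (0\<^sub>m p 0)"

definition incl_right :: "nat \<Rightarrow> nat \<Rightarrow> complex mat" where
  "incl_right r p = four_block_mat (0\<^sub>m r p) (0\<^sub>m r 0) (1\<^sub>m p) (0\<^sub>m p 0)"

lemma incl_dim [simp]: "dim_row (incl_left r p) = r + p" "dim_col (incl_left r p) = r"
  "dim_row (incl_right r p) = r + p" "dim_col (incl_right r p) = p"
  by (simp_all add: incl_left_def incl_right_def)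

lemma left_cols_eq:
  assumes "A \<in> carrier_mat k (r + p)"
  shows "left_cols r A = A * incl_left r p" "right_cols r A = A * incl_right r p"
proof -
  note d = carrier_matD[OF assms]
  have L: "incl_left r p = mat (r + p) r (\<lambda>(i, j). if i = j then 1 else 0)"
    by (rule eq_matI) (auto simp: incl_left_def)
  have R: "incl_right r p = mat (r + p) p (\<lambda>(i, j). if i = r + j then 1 else 0)"
    by (rule eq_matI) (auto simp: incl_right_def)
  have idx: "(A * mat (r + p) l (\<lambda>(i, j). if i = f j then 1 else 0)) $$ (i, j) = A $$ (i, f j)"
    if "i < k" "j < l" "f j < r + p" for i j l f
  proof -
    have "(A * mat (r + p) l (\<lambda>(i, j). if i = f j then 1 else 0)) $$ (i, j) = (\<Sum>t = 0..<r + p. A $$ (i, t) * (if t = f j then 1 else 0))"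
      using that d by (auto simp: scalar_prod_def intro!: sum.cong)
    also have "\<dots> = (\<Sum>t = 0..<r + p. if t = f j then A $$ (i, t) else 0)" by (intro sum.cong) auto
    also have "\<dots> = A $$ (i, f j)" using that by simp
    finally show ?thesis .
  qed
  have lenc: "length (cols A) = r + p" using d by simp
  show "left_cols r A = A * incl_left r p"
  proof (rule eq_matI)
    fix i j assume "i < dim_row (A * incl_left r p)" "j < dim_col (A * incl_left r p)"
    then have ij: "i < k" "j < r" using d by auto
    have "left_cols r A $$ (i, j) = A $$ (i, j)"
      using ij d lenc by (simp add: left_cols_def mat_of_cols_index)
    then show "left_cols r A $$ (i, j) = (A * incl_left r p) $$ (i, j)"
      unfolding L using idx[OF ij, of "\<lambda>j. j"] ij by simp
  qed (use d lenc in \<open>auto simp: left_cols_def\<close>)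
  show "right_cols r A = A * incl_right r p"
  proof (rule eq_matI)
    fix i j assume "i < dim_row (A * incl_right r p)" "j < dim_col (A * incl_right r p)"
    then have ij: "i < k" "j < p" using d by auto
    have "right_cols r A $$ (i, j) = A $$ (i, r + j)"
      using ij d lenc by (simp add: right_cols_def mat_of_cols_index)
    then show "right_cols r A $$ (i, j) = (A * incl_right r p) $$ (i, j)"
      unfolding R using idx[OF ij, of "\<lambda>j. r + j"] ij by simp
  qed (use d lenc in \<open>auto simp: right_cols_def\<close>)
qed

lemma incl_left_adjoint_mult:
  "(incl_left r p)\<^sup>H * incl_left r p = 1\<^sub>m r"
  unfolding incl_left_def by (subst adjoint_four_block, simp_all, subst four_block_mm) (auto simp: mat_dist intro!: eq_matI)

lemma block_extract:
  assumes H: "H1 \<in> carrier_mat r r" "H2 \<in> carrier_mat p q"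
  defines "B \<equiv> four_block_mat H1 (0\<^sub>m r q) (0\<^sub>m p r) H2"
  shows "B * incl_left r q = incl_left r p * H1" "B * incl_right r q = incl_right r p * H2"
    "(incl_right r p)\<^sup>H * incl_right r p = 1\<^sub>m p"
proof -
  note d = carrier_matD[OF H(1)] carrier_matD[OF H(2)]
  have p0: "X = four_block_mat X (0\<^sub>m k 0) (0\<^sub>m 0 l) (0\<^sub>m 0 0)" if "X \<in> carrier_mat k l" for X :: "complex mat" and k l
    using that by (intro eq_matI) auto
  show "B * incl_left r q = incl_left r p * H1"
    unfolding B_def incl_left_def by (subst (2) p0[OF H(1)]) (use d in \<open>simp add: block_simps mat_dist\<close>)
  show "B * incl_right r q = incl_right r p * H2"
    unfolding B_def incl_right_def by (subst (2) p0[OF H(2)]) (use d in \<open>simp add: block_simps mat_dist\<close>)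
  show "(incl_right r p)\<^sup>H * incl_right r p = 1\<^sub>m p"
    unfolding incl_right_def by (subst adjoint_four_block, simp_all, subst four_block_mm) (auto simp: mat_dist intro!: eq_matI)
qed

lemma mat_rearrange:
  fixes X :: "complex mat"
  assumes c: "X \<in> carrier_mat a b" "Y \<in> carrier_mat a b" "Z \<in> carrier_mat a b" "W \<in> carrier_mat a b"
    and eq: "X - Y = Z - W"
  shows "Z + Y = X + W" "X - Z = Y - W"
proof -
  have e: "X $$ (i, j) - Y $$ (i, j) = Z $$ (i, j) - W $$ (i, j)" if "i < a" "j < b" for i j
  proof -
    have "(X - Y) $$ (i, j) = (Z - W) $$ (i, j)" unfolding eq ..
    then show ?thesis using that c by simp
  qed
  have "Z $$ (i, j) + Y $$ (i, j) = X $$ (i, j) + W $$ (i, j)" "X $$ (i, j) - Z $$ (i, j) = Y $$ (i, j) - W $$ (i, j)"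
    if "i < a" "j < b" for i j
    using e[OF that] by (simp_all add: algebra_simps)
  then show "Z + Y = X + W" "X - Z = Y - W" using c by (auto intro!: eq_matI)
qed

text \<open>The block columns of the graph frame are orthogonal: its Gram matrix is block diagonal
  with blocks \<open>P\<close> and \<open>P'\<close>, which the inverse square roots
  normalize.\<close>

lemma graph_frame_unitary:
  assumes \<Gamma>: "\<Gamma> \<in> carrier_mat p r"
  defines "P \<equiv> 1\<^sub>m r + \<Gamma>\<^sup>H * \<Gamma>" and "P' \<equiv> 1\<^sub>m p + \<Gamma> * \<Gamma>\<^sup>H"
  shows "unitary_mat (r + p) (four_block_mat (1\<^sub>m r) (- (\<Gamma>\<^sup>H)) \<Gamma> (1\<^sub>m p) *
    four_block_mat (mat_inv_sqrt P) (0\<^sub>m r p) (0\<^sub>m p r) (mat_inv_sqrt P'))"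
    (is "unitary_mat _ (?R * ?D)")
proof (rule unitary_matI)
  note d = carrier_matD[OF \<Gamma>]
  have psd: "psd_mat r (\<Gamma>\<^sup>H * \<Gamma>)" "psd_mat p (\<Gamma> * \<Gamma>\<^sup>H)" using psd_gram[of \<Gamma>] psd_gram'[of \<Gamma>] d by simp_all
  note a = sqrt_one_plus_props[OF psd(1), folded P_def] and b = sqrt_one_plus_props[OF psd(2), folded P'_def]
  note da = psd_dim[OF a(1)] psd_dim[OF a(2)] psd_dim[OF b(1)] psd_dim[OF b(2)]
  have dP: "dim_row P = r" "dim_col P = r" "dim_row P' = p" "dim_col P' = p" using d by (auto simp: P_def P'_def)
  show "?R * ?D \<in> carrier_mat (r + p) (r + p)" using d da by (intro carrier_matI) auto
  have z: "\<Gamma>\<^sup>H + - (\<Gamma>\<^sup>H) = 0\<^sub>m r p" "- (\<Gamma>\<^sup>H) + \<Gamma>\<^sup>H = 0\<^sub>m r p" "- \<Gamma> + \<Gamma> = 0\<^sub>m p r" "\<Gamma> + - \<Gamma> = 0\<^sub>m p r"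
    using \<Gamma> by (auto intro!: eq_matI)
  have sw: "\<Gamma> * \<Gamma>\<^sup>H + 1\<^sub>m p = 1\<^sub>m p + \<Gamma> * \<Gamma>\<^sup>H"
    by (rule comm_add_mat[of _ p p]) (use d in \<open>auto intro!: carrier_matI\<close>)
  have RR: "?R\<^sup>H * ?R = four_block_mat P (0\<^sub>m r p) (0\<^sub>m p r) P'"
    using d by (simp add: block_simps mat_dist z P_def P'_def sw)
  have PP: "mat_inv_sqrt P * (P * mat_inv_sqrt P) = 1\<^sub>m r" "mat_inv_sqrt P' * (P' * mat_inv_sqrt P') = 1\<^sub>m p"
    using a b by simp_all
  have "(?R * ?D)\<^sup>H * (?R * ?D) = ?D\<^sup>H * ((?R\<^sup>H * ?R) * ?D)"
    using d da by (simp add: adjoint_mm assoc_mm)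
  also have "\<dots> = 1\<^sub>m (r + p)"
    unfolding RR using da dP psd_adjoint[OF a(2)] psd_adjoint[OF b(2)] by (simp add: block_simps mat_dist PP)
  finally show "(?R * ?D)\<^sup>H * (?R * ?D) = 1\<^sub>m (r + p)" .
qed

text \<open>The two equations are exactly the vanishing of the off-diagonal blocks of the triple
  product. Bracketing it in both ways expresses the diagonal blocks once with \<open>P\<close>,
  \<open>P'\<close> on the left and once with \<open>Q\<close>, \<open>Q'\<close> on the right; this
  is the source of the two formulas for each transformed block.\<close>

lemma graph_block_diagonal:
  assumes A: "A1 \<in> carrier_mat r r" "E12 \<in> carrier_mat r q" "E21 \<in> carrier_mat p r" "A2 \<in> carrier_mat p q"
    and c: "\<Gamma> \<in> carrier_mat p r" "\<Omega> \<in> carrier_mat q r"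
    and eq1: "\<Gamma> * A1 - A2 * \<Omega> = E21 - \<Gamma> * E12 * \<Omega>"
    and eq2: "\<Omega> * A1\<^sup>H - A2\<^sup>H * \<Gamma> = E12\<^sup>H - \<Omega> * E21\<^sup>H * \<Gamma>"
  defines "P \<equiv> 1\<^sub>m r + \<Gamma>\<^sup>H * \<Gamma>" and "P' \<equiv> 1\<^sub>m p + \<Gamma> * \<Gamma>\<^sup>H"
    and "Q \<equiv> 1\<^sub>m r + \<Omega>\<^sup>H * \<Omega>" and "Q' \<equiv> 1\<^sub>m q + \<Omega> * \<Omega>\<^sup>H"
  obtains "(four_block_mat (1\<^sub>m r) (- (\<Gamma>\<^sup>H)) \<Gamma> (1\<^sub>m p))\<^sup>H * (four_block_mat A1 E12 E21 A2 *
      four_block_mat (1\<^sub>m r) (- (\<Omega>\<^sup>H)) \<Omega> (1\<^sub>m q)) =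
      four_block_mat (P * (A1 + E12 * \<Omega>)) (0\<^sub>m r q) (0\<^sub>m p r) (P' * (A2 - E21 * \<Omega>\<^sup>H))"
    "P * (A1 + E12 * \<Omega>) = (A1 + \<Gamma>\<^sup>H * E21) * Q"
    "P' * (A2 - E21 * \<Omega>\<^sup>H) = (A2 - \<Gamma> * E12) * Q'"
proof -
  note d = A[THEN carrier_matD(1)] A[THEN carrier_matD(2)] c[THEN carrier_matD(1)] c[THEN carrier_matD(2)]
  let ?M = "A1 + E12 * \<Omega>" and ?M' = "A1 + \<Gamma>\<^sup>H * E21" and ?K = "A2 - E21 * \<Omega>\<^sup>H" and ?K' = "A2 - \<Gamma> * E12"
  have cc: "\<Gamma> * A1 \<in> carrier_mat p r" "A2 * \<Omega> \<in> carrier_mat p r" "\<Gamma> * E12 * \<Omega> \<in> carrier_mat p r"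
    using d by (auto intro!: carrier_matI)
  have eq2': "A1 * \<Omega>\<^sup>H - \<Gamma>\<^sup>H * A2 = E12 - \<Gamma>\<^sup>H * (E21 * \<Omega>\<^sup>H)"
    using arg_cong[OF eq2, of mat_adjoint] d by (simp add: mat_dist)
  have cc2: "A1 * \<Omega>\<^sup>H \<in> carrier_mat r q" "\<Gamma>\<^sup>H * A2 \<in> carrier_mat r q" "\<Gamma>\<^sup>H * (E21 * \<Omega>\<^sup>H) \<in> carrier_mat r q"
    using d by (auto intro!: carrier_matI)
  \<comment> \<open>Each equation is rearranged twice, so that an off-diagonal block becomes a
    diagonal one times \<open>\<Gamma>\<close>, \<open>\<Omega>\<close> or an adjoint; the
    cancellation in the block products is then immediate.\<close>
  have i: "E21 + A2 * \<Omega> = \<Gamma> * ?M"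
    using mat_rearrange(1)[OF cc(1,2) A(3) cc(3) eq1] d by (simp add: mat_dist)
  have iv: "\<Gamma> * A1 - E21 = ?K' * \<Omega>"
    using mat_rearrange(2)[OF cc(1,2) A(3) cc(3) eq1] d by (simp add: mat_dist)
  have iii: "E12 + \<Gamma>\<^sup>H * A2 = ?M' * \<Omega>\<^sup>H"
    using mat_rearrange(1)[OF cc2(1,2) A(2) cc2(3) eq2'] d by (simp add: mat_dist)
  have ii: "A1 * \<Omega>\<^sup>H - E12 = \<Gamma>\<^sup>H * ?K"
    using mat_rearrange(2)[OF cc2(1,2) A(2) cc2(3) eq2'] d by (simp add: mat_dist)
  let ?R = "four_block_mat (1\<^sub>m r) (- (\<Gamma>\<^sup>H)) \<Gamma> (1\<^sub>m p)" and ?S = "four_block_mat (1\<^sub>m r) (- (\<Omega>\<^sup>H)) \<Omega> (1\<^sub>m q)"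
  have RA: "?R\<^sup>H * four_block_mat A1 E12 E21 A2 = four_block_mat ?M' (E12 + \<Gamma>\<^sup>H * A2) (E21 - \<Gamma> * A1) ?K'"
  proof -
    have s: "- (\<Gamma> * A1) + E21 = E21 - \<Gamma> * A1" "- (\<Gamma> * E12) + A2 = A2 - \<Gamma> * E12"
      using d by (auto intro!: eq_matI simp del: index_mult_mat(1))
    show ?thesis using d by (simp add: block_simps mat_dist s)
  qed
  have AS: "four_block_mat A1 E12 E21 A2 * ?S = four_block_mat ?M (E12 - A1 * \<Omega>\<^sup>H) (E21 + A2 * \<Omega>) ?K"
  proof -
    have s: "- (A1 * \<Omega>\<^sup>H) + E12 = E12 - A1 * \<Omega>\<^sup>H" "- (E21 * \<Omega>\<^sup>H) + A2 = A2 - E21 * \<Omega>\<^sup>H"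
      using d by (auto intro!: eq_matI simp del: index_mult_mat(1))
    show ?thesis using d by (simp add: block_simps mat_dist s)
  qed
  have neg: "E12 - A1 * \<Omega>\<^sup>H = - (\<Gamma>\<^sup>H * ?K)" "E21 - \<Gamma> * A1 = - (?K' * \<Omega>)"
    unfolding ii[symmetric] iv[symmetric] using d by (auto intro!: eq_matI simp del: index_mult_mat(1))
  have canc: "- X + X = 0\<^sub>m a b" "X + - X = 0\<^sub>m a b" if "X \<in> carrier_mat a b" for X :: "complex mat" and a b
    using that by (auto intro!: eq_matI)
  have dK: "dim_row ?K = p" "dim_col ?K = q" "dim_row ?M = r" "dim_col ?M = r" "dim_row ?K' = p" "dim_col ?K' = q"
    "dim_row ?M' = r" "dim_col ?M' = r" using d by auto
  have left: "?R\<^sup>H * (four_block_mat A1 E12 E21 A2 * ?S) = four_block_mat (P * ?M) (0\<^sub>m r q) (0\<^sub>m p r) (P' * ?K)"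
  proof -
    define M where "M = ?M"
    define K where "K = ?K"
    have dd: "dim_row M = r" "dim_col M = r" "dim_row K = p" "dim_col K = q" using dK by (simp_all add: M_def K_def)
    have z: "- (\<Gamma>\<^sup>H * K) + \<Gamma>\<^sup>H * K = 0\<^sub>m r q" "- (\<Gamma> * M) + \<Gamma> * M = 0\<^sub>m p r"
      using dd d by (auto intro!: canc carrier_matI)
    have sw: "\<Gamma> * (\<Gamma>\<^sup>H * K) + K = K + \<Gamma> * (\<Gamma>\<^sup>H * K)"
      using dd d by (intro comm_add_mat[of _ p q]) (auto intro!: carrier_matI)
    show ?thesis
      unfolding AS neg(1) i M_def[symmetric] K_def[symmetric] P_def P'_def using d dd by (simp add: block_simps mat_dist z sw)
  qed
  have right: "?R\<^sup>H * four_block_mat A1 E12 E21 A2 * ?S = four_block_mat (?M' * Q) (0\<^sub>m r q) (0\<^sub>m p r) (?K' * Q')"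
  proof -
    define M where "M = ?M'"
    define K where "K = ?K'"
    have dd: "dim_row M = r" "dim_col M = r" "dim_row K = p" "dim_col K = q" using dK by (simp_all add: M_def K_def)
    have z: "- (M * \<Omega>\<^sup>H) + M * \<Omega>\<^sup>H = 0\<^sub>m r q" "- (K * \<Omega>) + K * \<Omega> = 0\<^sub>m p r"
      using dd d by (auto intro!: canc carrier_matI)
    have sw: "K * (\<Omega> * \<Omega>\<^sup>H) + K = K + K * (\<Omega> * \<Omega>\<^sup>H)"
      using dd d by (intro comm_add_mat[of _ p q]) (auto intro!: carrier_matI)
    show ?thesis
      unfolding RA iii neg(2) M_def[symmetric] K_def[symmetric] Q_def Q'_def using d dd by (simp add: block_simps mat_dist z sw)
  qed
  have "?R\<^sup>H * (four_block_mat A1 E12 E21 A2 * ?S) = ?R\<^sup>H * four_block_mat A1 E12 E21 A2 * ?S"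
    using d by (intro assoc_mm[symmetric]) auto
  then have "four_block_mat (P * ?M) (0\<^sub>m r q) (0\<^sub>m p r) (P' * ?K) = four_block_mat (?M' * Q) (0\<^sub>m r q) (0\<^sub>m p r) (?K' * Q')"
    unfolding left right .
  then have "P * ?M = ?M' * Q \<and> P' * ?K = ?K' * Q'"
    by (subst (asm) four_block_inject_carrier[of _ r r _ q _ p])
      (use d in \<open>auto simp: P_def P'_def Q_def Q'_def intro!: carrier_matI\<close>)
  then show thesis using that left by blast
qed

text \<open>The first block column of the graph frame minus the first columns of the identity factors as
  \<open>W * \<Gamma>\<close> with \<open>W\<^sup>H * W = f (1 + \<Gamma> * \<Gamma>\<^sup>H)\<close>, where \<open>f (x\<^sup>2) = 2 / (x * (x + 1)) \<le> 1\<close> for \<open>x \<ge> 1\<close>.\<close>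

lemma graph_frame_close:
  assumes N: "unitarily_invariant_norm N" and \<Gamma>: "\<Gamma> \<in> carrier_mat p r"
  defines "R \<equiv> mat_inv_sqrt (1\<^sub>m r + \<Gamma>\<^sup>H * \<Gamma>)"
  shows "N (four_block_mat (R - 1\<^sub>m r) (0\<^sub>m r 0) (\<Gamma> * R) (0\<^sub>m p 0)) \<le> N \<Gamma>"
proof -
  note d = carrier_matD[OF \<Gamma>]
  have psd: "psd_mat r (\<Gamma>\<^sup>H * \<Gamma>)" "psd_mat p (\<Gamma> * \<Gamma>\<^sup>H)" using psd_gram[of \<Gamma>] psd_gram'[of \<Gamma>] d by simp_all
  define S where "S = mat_sqrt (1\<^sub>m r + \<Gamma>\<^sup>H * \<Gamma>)"
  define S' where "S' = mat_sqrt (1\<^sub>m p + \<Gamma> * \<Gamma>\<^sup>H)"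
  define R' where "R' = mat_inv_sqrt (1\<^sub>m p + \<Gamma> * \<Gamma>\<^sup>H)"
  note a = sqrt_one_plus_props[OF psd(1), folded R_def S_def] and b = sqrt_one_plus_props[OF psd(2), folded R'_def S'_def]
  obtain U x where U: "unitary_mat r U" "\<And>i. i < r \<Longrightarrow> 1 \<le> x i"
    and U1: "1\<^sub>m r + \<Gamma>\<^sup>H * \<Gamma> = U * diag_of r (\<lambda>i. complex_of_real ((x i)\<^sup>2)) * U\<^sup>H"
    and US: "S = U * diag_of r (\<lambda>i. complex_of_real (x i)) * U\<^sup>H"
    and UR: "R = U * diag_of r (\<lambda>i. complex_of_real (1 / x i)) * U\<^sup>H"
    unfolding R_def S_def by (rule sqrt_one_plus[OF psd(1)]) blast
  obtain V y where V: "unitary_mat p V" "\<And>i. i < p \<Longrightarrow> 1 \<le> y i"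
    and V1: "1\<^sub>m p + \<Gamma> * \<Gamma>\<^sup>H = V * diag_of p (\<lambda>i. complex_of_real ((y i)\<^sup>2)) * V\<^sup>H"
    and VS: "S' = V * diag_of p (\<lambda>i. complex_of_real (y i)) * V\<^sup>H"
    and VR: "R' = V * diag_of p (\<lambda>i. complex_of_real (1 / y i)) * V\<^sup>H"
    unfolding R'_def S'_def by (rule sqrt_one_plus[OF psd(2)]) blast
  have dUV: "dim_row U = r" "dim_col U = r" "dim_row V = p" "dim_col V = p"
    using unitary_matD(1,2)[OF U(1)] unitary_matD(1,2)[OF V(1)] by auto
  \<comment> \<open>The function \<open>1 / (x * (x + 1))\<close> of \<open>S\<close>: from
    \<open>1 / x - 1 = - (x\<^sup>2 - 1) / (x * (x + 1))\<close> one gets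
    \<open>R - 1 = - F * \<Gamma>\<^sup>H * \<Gamma>\<close>. As \<open>F\<close> inverts
    \<open>S * S + S\<close>, it inherits the intertwining with
    \<open>\<Gamma>\<^sup>H\<close>.\<close>
  define F where "F = U * diag_of r (\<lambda>i. complex_of_real (1 / (x i * (x i + 1)))) * U\<^sup>H"
  define F' where "F' = V * diag_of p (\<lambda>i. complex_of_real (1 / (y i * (y i + 1)))) * V\<^sup>H"
  define L where "L = S * S + S"
  define L' where "L' = S' * S' + S'"
  note dS = psd_dim[OF a(1)] psd_dim[OF a(2)] psd_dim[OF b(1)] psd_dim[OF b(2)]
  have dF: "dim_row F = r" "dim_col F = r" "dim_row F' = p" "dim_col F' = p" using dUV by (auto simp: F_def F'_def)
  have dL: "dim_row L = r" "dim_col L = r" "dim_row L' = p" "dim_col L' = p" using dS by (auto simp: L_def L'_def)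
  have SG: "S * \<Gamma>\<^sup>H = \<Gamma>\<^sup>H * S'"
  proof (rule psd_intertwine[OF a(1) b(1)])
    show "\<Gamma>\<^sup>H \<in> carrier_mat r p" using \<Gamma> by simp
    show "S * S * \<Gamma>\<^sup>H = \<Gamma>\<^sup>H * (S' * S')" unfolding a(3) b(3) using d by (simp add: mat_dist)
  qed
  have LG: "L * \<Gamma>\<^sup>H = \<Gamma>\<^sup>H * L'"
  proof -
    have "S * S * \<Gamma>\<^sup>H = \<Gamma>\<^sup>H * (S' * S')" unfolding a(3) b(3) using d by (simp add: mat_dist)
    then show ?thesis unfolding L_def L'_def using d dS SG by (simp add: add_mm mm_add)
  qed
  have one: "U * diag_of r (\<lambda>i. 1) * U\<^sup>H = 1\<^sub>m r" "V * diag_of p (\<lambda>i. 1) * V\<^sup>H = 1\<^sub>m p"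
    using dUV unitary_matD(4)[OF U(1)] unitary_matD(4)[OF V(1)] by (simp_all add: diag_of_one)
  have addU: "U * diag_of r f * U\<^sup>H + U * diag_of r g * U\<^sup>H = U * diag_of r (\<lambda>i. f i + g i) * U\<^sup>H" for f g
    using dUV by (simp add: mat_dist flip: diag_of_add)
  have addV: "V * diag_of p f * V\<^sup>H + V * diag_of p g * V\<^sup>H = V * diag_of p (\<lambda>i. f i + g i) * V\<^sup>H" for f g
    using dUV by (simp add: mat_dist flip: diag_of_add)
  have FL: "F * L = 1\<^sub>m r"
  proof -
    have "diag_of r (\<lambda>i. complex_of_real (1 / (x i * (x i + 1))) * (complex_of_real (x i) * complex_of_real (x i) + complex_of_real (x i))) = diag_of r (\<lambda>i. 1)"
    proof (rule diag_of_cong)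
      fix i assume "i < r"
      then have "x i \<noteq> 0" "x i + 1 \<noteq> 0" using U(2)[of i] by auto
      moreover have "x i * x i + x i = x i * (x i + 1)" by (simp add: algebra_simps)
      ultimately have "1 / (x i * (x i + 1)) * (x i * x i + x i) = 1" by simp
      then show "complex_of_real (1 / (x i * (x i + 1))) * (complex_of_real (x i) * complex_of_real (x i) + complex_of_real (x i)) = 1"
        by (simp only: of_real_mult[symmetric] of_real_add[symmetric] of_real_1)
    qed
    then show ?thesis unfolding F_def L_def US psd_sqrt_diag[OF U(1)] addU using one by simp
  qed
  have LF': "L' * F' = 1\<^sub>m p"
  proof -
    have "diag_of p (\<lambda>i. (complex_of_real (y i) * complex_of_real (y i) + complex_of_real (y i)) * complex_of_real (1 / (y i * (y i + 1)))) = diag_of p (\<lambda>i. 1)"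
    proof (rule diag_of_cong)
      fix i assume "i < p"
      then have "y i \<noteq> 0" "y i + 1 \<noteq> 0" using V(2)[of i] by auto
      moreover have "y i * y i + y i = y i * (y i + 1)" by (simp add: algebra_simps)
      ultimately have "(y i * y i + y i) * (1 / (y i * (y i + 1))) = 1" by simp
      then show "(complex_of_real (y i) * complex_of_real (y i) + complex_of_real (y i)) * complex_of_real (1 / (y i * (y i + 1))) = 1"
        by (simp only: of_real_mult[symmetric] of_real_add[symmetric] of_real_1)
    qed
    then show ?thesis unfolding F'_def L'_def VS psd_sqrt_diag[OF V(1)] addV using one by simp
  qed
  have FG: "F * \<Gamma>\<^sup>H = \<Gamma>\<^sup>H * F'"
  proof -
    have "F * \<Gamma>\<^sup>H = F * (\<Gamma>\<^sup>H * (L' * F'))" using d dF by (simp add: LF')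
    also have "\<dots> = F * ((L * \<Gamma>\<^sup>H) * F')" unfolding LG using d dF dL by (simp add: assoc_mm)
    also have "\<dots> = (F * L) * (\<Gamma>\<^sup>H * F')" using d dF dL by (simp add: assoc_mm)
    finally show ?thesis unfolding FL using d dF by simp
  qed
  have RG: "R' * \<Gamma> = \<Gamma> * R"
  proof -
    have "S' * \<Gamma> = \<Gamma> * S"
      using arg_cong[OF SG, of mat_adjoint] d dS psd_adjoint[OF a(1)] psd_adjoint[OF b(1)] by (simp add: adjoint_mm)
    then have "R' * (S' * \<Gamma>) * R = R' * (\<Gamma> * S) * R" by simp
    moreover have "R' * (S' * \<Gamma>) * R = (R' * S') * (\<Gamma> * R)" using d dS by (simp add: assoc_mm)
    moreover have "R' * (\<Gamma> * S) * R = (R' * \<Gamma>) * (S * R)" using d dS by (simp add: assoc_mm)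
    ultimately show ?thesis unfolding a(4) b(5) using d dS by simp
  qed
  have FGG: "- (F * (\<Gamma>\<^sup>H * \<Gamma>)) = R - 1\<^sub>m r"
  proof -
    have GG: "\<Gamma>\<^sup>H * \<Gamma> = U * diag_of r (\<lambda>i. complex_of_real ((x i)\<^sup>2 - 1)) * U\<^sup>H"
    proof -
      have "\<Gamma>\<^sup>H * \<Gamma> = (1\<^sub>m r + \<Gamma>\<^sup>H * \<Gamma>) - 1\<^sub>m r" using d by (auto intro!: eq_matI simp del: index_mult_mat(1))
      also have "\<dots> = U * diag_of r (\<lambda>i. complex_of_real ((x i)\<^sup>2)) * U\<^sup>H - U * diag_of r (\<lambda>i. 1) * U\<^sup>H" unfolding U1 one ..
      also have "\<dots> = U * (diag_of r (\<lambda>i. complex_of_real ((x i)\<^sup>2)) - diag_of r (\<lambda>i. 1)) * U\<^sup>H" using dUV by (simp add: mat_dist)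
      also have "diag_of r (\<lambda>i. complex_of_real ((x i)\<^sup>2)) - diag_of r (\<lambda>i. 1) = diag_of r (\<lambda>i. complex_of_real ((x i)\<^sup>2 - 1))"
        by (intro eq_matI) auto
      finally show ?thesis .
    qed
    have "- (F * (\<Gamma>\<^sup>H * \<Gamma>)) = - (U * diag_of r (\<lambda>i. complex_of_real (1 / (x i * (x i + 1))) * complex_of_real ((x i)\<^sup>2 - 1)) * U\<^sup>H)"
      unfolding F_def GG psd_sqrt_diag[OF U(1)] ..
    also have "\<dots> = U * (- diag_of r (\<lambda>i. complex_of_real (1 / (x i * (x i + 1))) * complex_of_real ((x i)\<^sup>2 - 1))) * U\<^sup>H"
      using dUV by (simp add: mat_dist)
    also have "- diag_of r (\<lambda>i. complex_of_real (1 / (x i * (x i + 1))) * complex_of_real ((x i)\<^sup>2 - 1))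
      = diag_of r (\<lambda>i. complex_of_real (1 / x i)) - diag_of r (\<lambda>i. 1)"
    proof (rule eq_matI)
      fix i j assume "i < dim_row (diag_of r (\<lambda>i. complex_of_real (1 / x i)) - diag_of r (\<lambda>i. 1))"
        "j < dim_col (diag_of r (\<lambda>i. complex_of_real (1 / x i)) - diag_of r (\<lambda>i. 1))"
      then have ij: "i < r" "j < r" by auto
      then have "x i \<noteq> 0" "x i + 1 \<noteq> 0" using U(2)[of i] by auto
      moreover have "(x i)\<^sup>2 - 1 = (x i + 1) * (x i - 1)" by (simp add: algebra_simps power2_eq_square)
      ultimately have "- (1 / (x i * (x i + 1)) * ((x i)\<^sup>2 - 1)) = 1 / x i - 1" by (simp add: diff_divide_distrib)
      then have "complex_of_real (- (1 / (x i * (x i + 1)) * ((x i)\<^sup>2 - 1))) = complex_of_real (1 / x i - 1)" by (simp only:)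
      then show "(- diag_of r (\<lambda>i. complex_of_real (1 / (x i * (x i + 1))) * complex_of_real ((x i)\<^sup>2 - 1))) $$ (i, j)
        = (diag_of r (\<lambda>i. complex_of_real (1 / x i)) - diag_of r (\<lambda>i. 1)) $$ (i, j)"
        using ij by (cases "i = j") simp_all
    qed auto
    also have "U * (diag_of r (\<lambda>i. complex_of_real (1 / x i)) - diag_of r (\<lambda>i. 1)) * U\<^sup>H = R - U * diag_of r (\<lambda>i. 1) * U\<^sup>H"
      unfolding UR using dUV by (simp add: mat_dist)
    finally show ?thesis unfolding one .
  qed
  let ?W = "four_block_mat (- (F * \<Gamma>\<^sup>H)) (0\<^sub>m r 0) R' (0\<^sub>m p 0)"
  have pad0: "X = four_block_mat X (0\<^sub>m k 0) (0\<^sub>m 0 l) (0\<^sub>m 0 0)" if "X \<in> carrier_mat k l" for X :: "complex mat" and k l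
    using that by (intro eq_matI) auto
  have K: "four_block_mat (R - 1\<^sub>m r) (0\<^sub>m r 0) (\<Gamma> * R) (0\<^sub>m p 0) = ?W * \<Gamma>"
    by (subst (2) pad0[OF \<Gamma>]) (use d dF dS in \<open>simp add: block_simps mat_dist RG FGG\<close>)
  have WW: "?W\<^sup>H * ?W = V * diag_of p (\<lambda>i. complex_of_real (2 / (y i * (y i + 1)))) * V\<^sup>H"
  proof -
    have FH: "F'\<^sup>H = F'"
      unfolding F'_def using dUV by (simp add: adjoint_mm assoc_mm diag_of_adjoint)
    have "?W\<^sup>H * ?W = four_block_mat ((\<Gamma>\<^sup>H * F')\<^sup>H * (\<Gamma>\<^sup>H * F') + R'\<^sup>H * R') (0\<^sub>m p 0) (0\<^sub>m 0 p) (0\<^sub>m 0 0)"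
      unfolding FG using d dF dS by (simp add: block_simps mat_dist)
    also have "\<dots> = (\<Gamma>\<^sup>H * F')\<^sup>H * (\<Gamma>\<^sup>H * F') + R'\<^sup>H * R'"
      by (rule pad0[symmetric]) (use d dF dS in \<open>auto intro!: carrier_matI\<close>)
    also have "\<dots> = F' * ((\<Gamma> * \<Gamma>\<^sup>H) * F') + R' * R'"
      using d dF dS FH psd_adjoint[OF b(2)] by (simp add: adjoint_mm assoc_mm)
    also have "\<Gamma> * \<Gamma>\<^sup>H = V * diag_of p (\<lambda>i. complex_of_real ((y i)\<^sup>2 - 1)) * V\<^sup>H"
    proof -
      have "\<Gamma> * \<Gamma>\<^sup>H = (1\<^sub>m p + \<Gamma> * \<Gamma>\<^sup>H) - 1\<^sub>m p" using d by (auto intro!: eq_matI simp del: index_mult_mat(1))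
      also have "\<dots> = V * diag_of p (\<lambda>i. complex_of_real ((y i)\<^sup>2)) * V\<^sup>H - V * diag_of p (\<lambda>i. 1) * V\<^sup>H" unfolding V1 one ..
      also have "\<dots> = V * (diag_of p (\<lambda>i. complex_of_real ((y i)\<^sup>2)) - diag_of p (\<lambda>i. 1)) * V\<^sup>H" using dUV by (simp add: mat_dist)
      also have "diag_of p (\<lambda>i. complex_of_real ((y i)\<^sup>2)) - diag_of p (\<lambda>i. 1) = diag_of p (\<lambda>i. complex_of_real ((y i)\<^sup>2 - 1))"
        by (intro eq_matI) auto
      finally show ?thesis .
    qed
    also have "F' * ((V * diag_of p (\<lambda>i. complex_of_real ((y i)\<^sup>2 - 1)) * V\<^sup>H) * F') + R' * R'
      = V * diag_of p (\<lambda>i. complex_of_real (1 / (y i * (y i + 1))) * (complex_of_real ((y i)\<^sup>2 - 1) * complex_of_real (1 / (y i * (y i + 1))))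
        + complex_of_real (1 / y i) * complex_of_real (1 / y i)) * V\<^sup>H"
      unfolding F'_def VR psd_sqrt_diag[OF V(1)] addV ..
    also have "diag_of p (\<lambda>i. complex_of_real (1 / (y i * (y i + 1))) * (complex_of_real ((y i)\<^sup>2 - 1) * complex_of_real (1 / (y i * (y i + 1))))
        + complex_of_real (1 / y i) * complex_of_real (1 / y i)) = diag_of p (\<lambda>i. complex_of_real (2 / (y i * (y i + 1))))"
    proof (rule diag_of_cong)
      fix i assume "i < p"
      then have y: "y i \<noteq> 0" "y i + 1 \<noteq> 0" using V(2)[of i] by auto
      define u where "u = y i"
      have u: "u \<noteq> 0" "u + 1 \<noteq> 0" using y by (simp_all add: u_def)
      have "1 / (u * (u + 1)) * ((u\<^sup>2 - 1) * (1 / (u * (u + 1)))) + 1 / u * (1 / u) = ((u\<^sup>2 - 1) + (u + 1)\<^sup>2) / (u * (u + 1))\<^sup>2"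
      proof -
        have "1 / u * (1 / u) = (u + 1)\<^sup>2 / (u * (u + 1))\<^sup>2" using u by (simp add: power_mult_distrib power2_eq_square)
        then show ?thesis by (simp add: add_divide_distrib power2_eq_square)
      qed
      also have "(u\<^sup>2 - 1) + (u + 1)\<^sup>2 = 2 * (u * (u + 1))" by (simp add: power2_eq_square algebra_simps)
      also have "2 * (u * (u + 1)) / (u * (u + 1))\<^sup>2 = 2 / (u * (u + 1))" using u by (simp add: power2_eq_square)
      finally have "complex_of_real (1 / (u * (u + 1)) * ((u\<^sup>2 - 1) * (1 / (u * (u + 1)))) + 1 / u * (1 / u)) = complex_of_real (2 / (u * (u + 1)))"
        by (simp only:)
      then show "complex_of_real (1 / (y i * (y i + 1))) * (complex_of_real ((y i)\<^sup>2 - 1) * complex_of_real (1 / (y i * (y i + 1))))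
        + complex_of_real (1 / y i) * complex_of_real (1 / y i) = complex_of_real (2 / (y i * (y i + 1)))"
        by (simp only: u_def of_real_mult of_real_add)
    qed
    finally show ?thesis .
  qed
  have "spectral_norm ?W \<le> 1"
  proof (rule spectral_norm_le)
    fix v :: "complex vec" assume "dim_vec v = dim_col ?W"
    then have v: "dim_vec v = p" using dS d by simp
    have dW: "dim_row ?W = r + p" "dim_col ?W = p" using dS dF d by auto
    have "complex_of_real ((vec_norm2 (?W *\<^sub>v v))\<^sup>2) = (?W *\<^sub>v v) \<bullet>c (?W *\<^sub>v v)" by (simp only: cinner_self)
    also have "\<dots> = (?W\<^sup>H *\<^sub>v (?W *\<^sub>v v)) \<bullet>c v" using v dW by (subst (2) cinner_adjoint) simp_all
    also have "?W\<^sup>H *\<^sub>v (?W *\<^sub>v v) = (?W\<^sup>H * ?W) *\<^sub>v v" by (rule assoc_mv[symmetric]) (use v dW in simp_all)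
    also have "\<dots> \<bullet>c v = (\<Sum>i<p. complex_of_real (2 / (y i * (y i + 1))) * of_real ((cmod ((V\<^sup>H *\<^sub>v v) $ i))\<^sup>2))"
      unfolding WW by (rule diag_quad_form[OF V(1) v])
    also have "\<dots> = complex_of_real (\<Sum>i<p. 2 / (y i * (y i + 1)) * (cmod ((V\<^sup>H *\<^sub>v v) $ i))\<^sup>2)" by simp
    finally have "(vec_norm2 (?W *\<^sub>v v))\<^sup>2 = (\<Sum>i<p. 2 / (y i * (y i + 1)) * (cmod ((V\<^sup>H *\<^sub>v v) $ i))\<^sup>2)"
      by (simp only: of_real_eq_iff)
    also have "\<dots> \<le> (\<Sum>i<p. 1 * (cmod ((V\<^sup>H *\<^sub>v v) $ i))\<^sup>2)"
    proof (intro sum_mono mult_right_mono)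
      fix i assume "i \<in> {..<p}"
      then have y: "1 \<le> y i" using V(2) by simp
      have "1 * 2 \<le> y i * (y i + 1)" using y by (intro mult_mono) auto
      then show "2 / (y i * (y i + 1)) \<le> 1" by simp
    qed simp
    also have "\<dots> = (vec_norm2 v)\<^sup>2" using unitary_coords_norm_sq[OF V(1) v] by simp
    finally show "vec_norm2 (?W *\<^sub>v v) \<le> 1 * vec_norm2 v"
      using power2_le_imp_le[OF _ vec_norm2_nonneg] by simp
  qed simp
  moreover have "N (?W * \<Gamma>) \<le> spectral_norm ?W * N \<Gamma>" using d dF dS by (intro ui_norm_mult_left[OF N]) simp
  ultimately show ?thesis unfolding K using ui_norm_nonneg[OF N, of \<Gamma>] mult_right_mono[of "spectral_norm ?W" 1 "N \<Gamma>"] by linarith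
qed

text \<open>Left multiplication by the unitary \<open>U\<close> changes no norm, so the estimate is
  that of \<open>graph_frame_close\<close> for the frame itself.\<close>

lemma graph_frame_cols:
  assumes N: "unitarily_invariant_norm N" and U: "unitary_mat (r + p) U" and \<Gamma>: "\<Gamma> \<in> carrier_mat p r"
  defines "P \<equiv> 1\<^sub>m r + \<Gamma>\<^sup>H * \<Gamma>" and "P' \<equiv> 1\<^sub>m p + \<Gamma> * \<Gamma>\<^sup>H"
  defines "Uc \<equiv> U * four_block_mat (1\<^sub>m r) (- (\<Gamma>\<^sup>H)) \<Gamma> (1\<^sub>m p) *
    four_block_mat (mat_inv_sqrt P) (0\<^sub>m r p) (0\<^sub>m p r) (mat_inv_sqrt P')"
  shows "unitary_mat (r + p) Uc"
    "left_cols r Uc = (left_cols r U + right_cols r U * \<Gamma>) * mat_inv_sqrt P"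
    "N (left_cols r Uc - left_cols r U) \<le> N \<Gamma>"
    "(left_cols r Uc)\<^sup>H * left_cols r Uc = 1\<^sub>m r"
proof -
  note d = carrier_matD[OF \<Gamma>] and dU = unitary_matD[OF U]
  have psd: "psd_mat r (\<Gamma>\<^sup>H * \<Gamma>)" "psd_mat p (\<Gamma> * \<Gamma>\<^sup>H)" using psd_gram[of \<Gamma>] psd_gram'[of \<Gamma>] d by simp_all
  note a = sqrt_one_plus_props[OF psd(1), folded P_def] and b = sqrt_one_plus_props[OF psd(2), folded P'_def]
  define X where "X = mat_inv_sqrt P"
  define X' where "X' = mat_inv_sqrt P'"
  have cX: "X \<in> carrier_mat r r" "X' \<in> carrier_mat p p"
    unfolding X_def X'_def using psd_carrier[OF a(2)] psd_carrier[OF b(2)] by auto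
  note dX = carrier_matD[OF cX(1)] carrier_matD[OF cX(2)]
  let ?R = "four_block_mat (1\<^sub>m r) (- (\<Gamma>\<^sup>H)) \<Gamma> (1\<^sub>m p)" and ?D = "four_block_mat X (0\<^sub>m r p) (0\<^sub>m p r) X'"
  have Uc: "Uc = U * (?R * ?D)" unfolding Uc_def X_def[symmetric] X'_def[symmetric] using d dU(1,2) dX by (simp add: assoc_mm)
  show u: "unitary_mat (r + p) Uc"
    unfolding Uc X_def X'_def P_def P'_def by (rule unitary_mat_mult[OF U graph_frame_unitary[OF \<Gamma>]])
  have L: "left_cols r Uc = Uc * incl_left r p" "left_cols r U = U * incl_left r p" "right_cols r U = U * incl_right r p"
    using left_cols_eq[OF unitary_matD(5)[OF u]] left_cols_eq[OF dU(5)] by auto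
  have pad0: "Y = four_block_mat Y (0\<^sub>m k 0) (0\<^sub>m 0 l) (0\<^sub>m 0 0)" if "Y \<in> carrier_mat k l" for Y :: "complex mat" and k l
    using that by (intro eq_matI) auto
  have DJ: "?D * incl_left r p = incl_left r p * X" by (rule block_extract(1)[OF cX])
  have JX: "incl_left r p * X = four_block_mat X (0\<^sub>m r 0) (0\<^sub>m p r) (0\<^sub>m p 0)"
    unfolding incl_left_def by (subst pad0[OF cX(1)]) (use dX in \<open>simp add: block_simps mat_dist\<close>)
  have RJ: "?R * (incl_left r p * X) = four_block_mat X (0\<^sub>m r 0) (\<Gamma> * X) (0\<^sub>m p 0)"
    unfolding JX using d dX by (simp add: block_simps mat_dist)
  have col: "left_cols r Uc = U * four_block_mat X (0\<^sub>m r 0) (\<Gamma> * X) (0\<^sub>m p 0)"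
  proof -
    have "left_cols r Uc = Uc * incl_left r p" by (rule L(1))
    also have "\<dots> = U * (?R * (?D * incl_left r p))" unfolding Uc using d dU(1,2) dX by (simp add: assoc_mm)
    finally show ?thesis unfolding DJ RJ .
  qed
  have J\<Gamma>: "incl_right r p * \<Gamma> = four_block_mat (0\<^sub>m r r) (0\<^sub>m r 0) \<Gamma> (0\<^sub>m p 0)"
  proof -
    have "incl_right r p * \<Gamma> = incl_right r p * four_block_mat \<Gamma> (0\<^sub>m p 0) (0\<^sub>m 0 r) (0\<^sub>m 0 0)"
      by (rule arg_cong[OF pad0[OF \<Gamma>]])
    then show ?thesis unfolding incl_right_def using d by (simp add: block_simps mat_dist)
  qed
  have "(incl_left r p + incl_right r p * \<Gamma>) * X = four_block_mat X (0\<^sub>m r 0) (\<Gamma> * X) (0\<^sub>m p 0)"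
  proof -
    have "incl_left r p + incl_right r p * \<Gamma> = four_block_mat (1\<^sub>m r) (0\<^sub>m r 0) \<Gamma> (0\<^sub>m p 0)"
      unfolding J\<Gamma> unfolding incl_left_def using d by (simp add: block_simps mat_dist)
    moreover have "four_block_mat (1\<^sub>m r) (0\<^sub>m r 0) \<Gamma> (0\<^sub>m p 0) * X = four_block_mat X (0\<^sub>m r 0) (\<Gamma> * X) (0\<^sub>m p 0)"
      by (subst pad0[OF cX(1)]) (use d dX in \<open>simp add: block_simps mat_dist\<close>)
    ultimately show ?thesis by simp
  qed
  then have "left_cols r Uc = U * ((incl_left r p + incl_right r p * \<Gamma>) * X)" unfolding col by simp
  then show "left_cols r Uc = (left_cols r U + right_cols r U * \<Gamma>) * mat_inv_sqrt P"
    unfolding L(2,3) X_def[symmetric] using d dU(1,2) dX by (simp add: mat_dist)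
  have "left_cols r Uc - left_cols r U = U * (four_block_mat X (0\<^sub>m r 0) (\<Gamma> * X) (0\<^sub>m p 0) - incl_left r p)"
    unfolding col L(2) using d dU(1,2) dX by (simp add: mm_minus)
  also have "four_block_mat X (0\<^sub>m r 0) (\<Gamma> * X) (0\<^sub>m p 0) - incl_left r p = four_block_mat (X - 1\<^sub>m r) (0\<^sub>m r 0) (\<Gamma> * X) (0\<^sub>m p 0)"
  proof -
    have z: "0\<^sub>m r 0 - 0\<^sub>m r 0 = (0\<^sub>m r 0 :: complex mat)" "0\<^sub>m p 0 - 0\<^sub>m p 0 = (0\<^sub>m p 0 :: complex mat)" "\<Gamma> * X - 0\<^sub>m p r = \<Gamma> * X"
      using d dX by (auto intro!: eq_matI simp del: index_mult_mat(1))
    show ?thesis unfolding incl_left_def using d dX by (simp add: block_simps z)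
  qed
  finally have "N (left_cols r Uc - left_cols r U) = N (four_block_mat (X - 1\<^sub>m r) (0\<^sub>m r 0) (\<Gamma> * X) (0\<^sub>m p 0))"
    using ui_norm_unitary_left[OF N U, of "four_block_mat (X - 1\<^sub>m r) (0\<^sub>m r 0) (\<Gamma> * X) (0\<^sub>m p 0)"] d dX by simp
  also have "\<dots> \<le> N \<Gamma>" unfolding X_def P_def by (rule graph_frame_close[OF N \<Gamma>])
  finally show "N (left_cols r Uc - left_cols r U) \<le> N \<Gamma>" .
  have "(Uc * incl_left r p)\<^sup>H * (Uc * incl_left r p) = (incl_left r p)\<^sup>H * (Uc\<^sup>H * (Uc * incl_left r p))"
    using unitary_matD(1,2)[OF u] by (simp add: adjoint_mm assoc_mm)
  then show "(left_cols r Uc)\<^sup>H * left_cols r Uc = 1\<^sub>m r"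
    unfolding L by (simp add: unitary_cancel(1)[OF u] incl_left_adjoint_mult)
qed

text \<open>Inverse square roots on both sides of \<open>P * M = M' * Q\<close> leave
  \<open>mat_sqrt P\<close> on the left in one form and \<open>mat_sqrt Q\<close> on the right in
  the other. The first block columns of the block diagonal form and of its adjoint give the two
  singular subspace relations.\<close>

lemma graph_decomposition:
  assumes U: "unitary_mat (r + p) U" and V: "unitary_mat (r + q) V" and Gt: "Gt \<in> carrier_mat (r + p) (r + q)"
    and A: "A1 \<in> carrier_mat r r" "E12 \<in> carrier_mat r q" "E21 \<in> carrier_mat p r" "A2 \<in> carrier_mat p q"
    and blk: "U\<^sup>H * Gt * V = four_block_mat A1 E12 E21 A2"
    and c: "\<Gamma> \<in> carrier_mat p r" "\<Omega> \<in> carrier_mat q r"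
    and eq1: "\<Gamma> * A1 - A2 * \<Omega> = E21 - \<Gamma> * E12 * \<Omega>"
    and eq2: "\<Omega> * A1\<^sup>H - A2\<^sup>H * \<Gamma> = E12\<^sup>H - \<Omega> * E21\<^sup>H * \<Gamma>"
  defines "P \<equiv> 1\<^sub>m r + \<Gamma>\<^sup>H * \<Gamma>" and "P' \<equiv> 1\<^sub>m p + \<Gamma> * \<Gamma>\<^sup>H"
    and "Q \<equiv> 1\<^sub>m r + \<Omega>\<^sup>H * \<Omega>" and "Q' \<equiv> 1\<^sub>m q + \<Omega> * \<Omega>\<^sup>H"
  defines "Uc \<equiv> U * four_block_mat (1\<^sub>m r) (- (\<Gamma>\<^sup>H)) \<Gamma> (1\<^sub>m p) *
    four_block_mat (mat_inv_sqrt P) (0\<^sub>m r p) (0\<^sub>m p r) (mat_inv_sqrt P')"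
    and "Vc \<equiv> V * four_block_mat (1\<^sub>m r) (- (\<Omega>\<^sup>H)) \<Omega> (1\<^sub>m q) *
    four_block_mat (mat_inv_sqrt Q) (0\<^sub>m r q) (0\<^sub>m q r) (mat_inv_sqrt Q')"
  defines "Gc1 \<equiv> (left_cols r Uc)\<^sup>H * Gt * left_cols r Vc" and "Gc2 \<equiv> (right_cols r Uc)\<^sup>H * Gt * right_cols r Vc"
  assumes u: "unitary_mat (r + p) Uc" and v: "unitary_mat (r + q) Vc"
    and iso: "(left_cols r Uc)\<^sup>H * left_cols r Uc = 1\<^sub>m r" "(left_cols r Vc)\<^sup>H * left_cols r Vc = 1\<^sub>m r"
  shows "Uc\<^sup>H * Gt * Vc = four_block_mat Gc1 (0\<^sub>m r q) (0\<^sub>m p r) Gc2"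
    "sing_vals Gt = sing_vals Gc1 + sing_vals Gc2"
    "Gc1 = mat_sqrt P * (A1 + E12 * \<Omega>) * mat_inv_sqrt Q"
    "Gc1 = mat_inv_sqrt P * (A1 + \<Gamma>\<^sup>H * E21) * mat_sqrt Q"
    "Gc2 = mat_sqrt P' * (A2 - E21 * \<Omega>\<^sup>H) * mat_inv_sqrt Q'"
    "Gc2 = mat_inv_sqrt P' * (A2 - \<Gamma> * E12) * mat_sqrt Q'"
    "singular_subspaces r Gt Gc1 (left_cols r Uc) (left_cols r Vc)"
proof -
  note d = A[THEN carrier_matD(1)] A[THEN carrier_matD(2)] c[THEN carrier_matD(1)] c[THEN carrier_matD(2)] carrier_matD[OF Gt]
  note dU = unitary_matD(1,2)[OF U] unitary_matD(1,2)[OF V] unitary_matD(1,2)[OF u] unitary_matD(1,2)[OF v]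
  have psd: "psd_mat r (\<Gamma>\<^sup>H * \<Gamma>)" "psd_mat p (\<Gamma> * \<Gamma>\<^sup>H)" "psd_mat r (\<Omega>\<^sup>H * \<Omega>)" "psd_mat q (\<Omega> * \<Omega>\<^sup>H)"
    using psd_gram[of \<Gamma>] psd_gram'[of \<Gamma>] psd_gram[of \<Omega>] psd_gram'[of \<Omega>] d by simp_all
  note sP = sqrt_one_plus_props[OF psd(1), folded P_def] and sP' = sqrt_one_plus_props[OF psd(2), folded P'_def]
    and sQ = sqrt_one_plus_props[OF psd(3), folded Q_def] and sQ' = sqrt_one_plus_props[OF psd(4), folded Q'_def]
  note ds = psd_dim[OF sP(1)] psd_dim[OF sP(2)] psd_dim[OF sP'(1)] psd_dim[OF sP'(2)]
    psd_dim[OF sQ(1)] psd_dim[OF sQ(2)] psd_dim[OF sQ'(1)] psd_dim[OF sQ'(2)]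
  have dP: "dim_row P = r" "dim_col P = r" "dim_row P' = p" "dim_col P' = p" "dim_row Q = r" "dim_col Q = r" "dim_row Q' = q" "dim_col Q' = q"
    using d by (auto simp: P_def P'_def Q_def Q'_def)
  let ?R = "four_block_mat (1\<^sub>m r) (- (\<Gamma>\<^sup>H)) \<Gamma> (1\<^sub>m p)" and ?R2 = "four_block_mat (1\<^sub>m r) (- (\<Omega>\<^sup>H)) \<Omega> (1\<^sub>m q)"
  let ?D = "four_block_mat (mat_inv_sqrt P) (0\<^sub>m r p) (0\<^sub>m p r) (mat_inv_sqrt P')"
    and ?D2 = "four_block_mat (mat_inv_sqrt Q) (0\<^sub>m r q) (0\<^sub>m q r) (mat_inv_sqrt Q')"
  let ?M = "A1 + E12 * \<Omega>" and ?K = "A2 - E21 * \<Omega>\<^sup>H" and ?M' = "A1 + \<Gamma>\<^sup>H * E21" and ?K' = "A2 - \<Gamma> * E12"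
  have gb: "?R\<^sup>H * (four_block_mat A1 E12 E21 A2 * ?R2) = four_block_mat (P * ?M) (0\<^sub>m r q) (0\<^sub>m p r) (P' * ?K)"
    and PM: "P * ?M = ?M' * Q" and PK: "P' * ?K = ?K' * Q'"
    by (rule graph_block_diagonal[OF A c eq1 eq2, folded P_def P'_def Q_def Q'_def], blast)+
  define H1 where "H1 = mat_inv_sqrt P * (P * ?M) * mat_inv_sqrt Q"
  define H2 where "H2 = mat_inv_sqrt P' * (P' * ?K) * mat_inv_sqrt Q'"
  have cH: "H1 \<in> carrier_mat r r" "H2 \<in> carrier_mat p q"
    using ds by (auto simp: H1_def H2_def intro!: carrier_matI)
  have "Uc\<^sup>H * Gt * Vc = ?D\<^sup>H * (?R\<^sup>H * ((U\<^sup>H * Gt * V) * ?R2)) * ?D2"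
    unfolding Uc_def Vc_def using d dU ds by (simp add: adjoint_mm assoc_mm)
  also have "\<dots> = four_block_mat H1 (0\<^sub>m r q) (0\<^sub>m p r) H2"
  proof -
    define X where "X = P * ?M"
    define Y where "Y = P' * ?K"
    have dXY: "dim_row X = r" "dim_col X = r" "dim_row Y = p" "dim_col Y = q" using d dP by (auto simp: X_def Y_def)
    show ?thesis
      unfolding blk gb H1_def H2_def X_def[symmetric] Y_def[symmetric]
      using ds dXY psd_adjoint[OF sP(2)] psd_adjoint[OF sP'(2)] by (simp add: block_simps mat_dist)
  qed
  finally have B: "Uc\<^sup>H * Gt * Vc = four_block_mat H1 (0\<^sub>m r q) (0\<^sub>m p r) H2" .
  have L: "left_cols r Uc = Uc * incl_left r p" "right_cols r Uc = Uc * incl_right r p"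
    "left_cols r Vc = Vc * incl_left r q" "right_cols r Vc = Vc * incl_right r q"
    using left_cols_eq[OF unitary_matD(5)[OF u]] left_cols_eq[OF unitary_matD(5)[OF v]] by auto
  note be = block_extract[OF cH]
  have "Gc1 = (incl_left r p)\<^sup>H * ((Uc\<^sup>H * Gt * Vc) * incl_left r q)"
    unfolding Gc1_def L using d dU by (simp add: adjoint_mm assoc_mm)
  also have "\<dots> = (incl_left r p)\<^sup>H * incl_left r p * H1" unfolding B be(1) using cH by (simp add: assoc_mm)
  finally have G1: "Gc1 = H1" using cH by (simp add: incl_left_adjoint_mult)
  have "Gc2 = (incl_right r p)\<^sup>H * ((Uc\<^sup>H * Gt * Vc) * incl_right r q)"
    unfolding Gc2_def L using d dU by (simp add: adjoint_mm assoc_mm)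
  also have "\<dots> = (incl_right r p)\<^sup>H * incl_right r p * H2" unfolding B be(2) using cH by (simp add: assoc_mm)
  finally have G2: "Gc2 = H2" using cH by (simp add: be(3))
  show B': "Uc\<^sup>H * Gt * Vc = four_block_mat Gc1 (0\<^sub>m r q) (0\<^sub>m p r) Gc2" unfolding G1 G2 by (rule B)
  have "sing_vals Gt = sing_vals (Uc\<^sup>H * Gt * Vc)" by (rule sing_vals_unitary[OF unitary_mat_adjoint[OF u] v Gt, symmetric])
  also have "\<dots> = sing_vals Gc1 + sing_vals Gc2" unfolding B G1 G2 by (rule sing_vals_block[OF cH])
  finally show "sing_vals Gt = sing_vals Gc1 + sing_vals Gc2" .
  have dM: "dim_row ?M = r" "dim_col ?M = r" "dim_row ?K = p" "dim_col ?K = q" "dim_row ?M' = r" "dim_col ?M' = r" "dim_row ?K' = p" "dim_col ?K' = q"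
    using d by auto
  have "mat_inv_sqrt P * (P * X) = mat_sqrt P * X" if "dim_row X = r" for X
    using assoc_mm[of "mat_inv_sqrt P" P X] sP(6) ds dP that by simp
  then show "Gc1 = mat_sqrt P * ?M * mat_inv_sqrt Q" unfolding G1 H1_def using dM by simp
  have "mat_inv_sqrt P' * (P' * X) = mat_sqrt P' * X" if "dim_row X = p" for X
    using assoc_mm[of "mat_inv_sqrt P'" P' X] sP'(6) ds dP that by simp
  then show "Gc2 = mat_sqrt P' * ?K * mat_inv_sqrt Q'" unfolding G2 H2_def using dM by simp
  have "mat_inv_sqrt P * (X * Q) * mat_inv_sqrt Q = mat_inv_sqrt P * X * mat_sqrt Q" if "dim_row X = r" "dim_col X = r" for X
  proof -
    have "mat_inv_sqrt P * (X * Q) * mat_inv_sqrt Q = mat_inv_sqrt P * X * (Q * mat_inv_sqrt Q)"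
      using ds dP that by (simp add: assoc_mm)
    then show ?thesis unfolding sQ(7) .
  qed
  then show "Gc1 = mat_inv_sqrt P * ?M' * mat_sqrt Q" unfolding G1 H1_def PM using dM by blast
  have "mat_inv_sqrt P' * (X * Q') * mat_inv_sqrt Q' = mat_inv_sqrt P' * X * mat_sqrt Q'" if "dim_row X = p" "dim_col X = q" for X
  proof -
    have "mat_inv_sqrt P' * (X * Q') * mat_inv_sqrt Q' = mat_inv_sqrt P' * X * (Q' * mat_inv_sqrt Q')"
      using ds dP that by (simp add: assoc_mm)
    then show ?thesis unfolding sQ'(7) .
  qed
  then show "Gc2 = mat_inv_sqrt P' * ?K' * mat_sqrt Q'" unfolding G2 H2_def PK using dM by blast
  let ?B = "four_block_mat H1 (0\<^sub>m r q) (0\<^sub>m p r) H2"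
  have dH: "dim_row H1 = r" "dim_col H1 = r" "dim_row H2 = p" "dim_col H2 = q" using cH by auto
  have GV: "Gt * Vc = Uc * ?B"
    unfolding B[symmetric] using d dU by (simp add: assoc_mm unitary_cancel(2)[OF u])
  have "Gt * (Vc * incl_left r q) = (Gt * Vc) * incl_left r q" using d dU by (simp add: assoc_mm)
  also have "\<dots> = Uc * (?B * incl_left r q)" unfolding GV using dH dU by (simp add: assoc_mm)
  also have "\<dots> = Uc * incl_left r p * H1" unfolding be(1) using dH dU by (simp add: assoc_mm)
  finally have s1: "Gt * left_cols r Vc = left_cols r Uc * Gc1" unfolding L G1 .
  have BH: "?B\<^sup>H = four_block_mat (H1\<^sup>H) (0\<^sub>m r p) (0\<^sub>m q r) (H2\<^sup>H)" using dH by (simp add: adjoint_four_block)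
  have GU: "Gt\<^sup>H * Uc = Vc * ?B\<^sup>H"
  proof -
    have "?B\<^sup>H = Vc\<^sup>H * (Gt\<^sup>H * Uc)" unfolding B[symmetric] using d dU by (simp add: adjoint_mm)
    then show ?thesis using d dU by (simp add: unitary_cancel(2)[OF v])
  qed
  have "Gt\<^sup>H * (Uc * incl_left r p) = (Gt\<^sup>H * Uc) * incl_left r p" using d dU by (simp add: assoc_mm)
  also have "\<dots> = Vc * (?B\<^sup>H * incl_left r p)" unfolding GU using dH dU by (simp add: assoc_mm)
  also have "?B\<^sup>H * incl_left r p = incl_left r q * H1\<^sup>H" unfolding BH by (rule block_extract(1)) (use cH in auto)
  also have "Vc * (incl_left r q * H1\<^sup>H) = Vc * incl_left r q * H1\<^sup>H" using dH dU by (simp add: assoc_mm)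
  finally have s2: "Gt\<^sup>H * left_cols r Uc = left_cols r Vc * Gc1\<^sup>H" unfolding L G1 .
  have "left_cols r Uc \<in> carrier_mat (r + p) r" "left_cols r Vc \<in> carrier_mat (r + q) r"
    unfolding L using dU by (auto intro!: carrier_matI)
  then show "singular_subspaces r Gt Gc1 (left_cols r Uc) (left_cols r Vc)"
    unfolding singular_subspaces_def using s1 s2 iso d cH G1 by auto
qed

section \<open>Bounds for the transformed blocks and combination of the results\<close>

lemma spectral_norm_uminus [simp]: "spectral_norm (- A) = spectral_norm A"
proof -
  have "(- A) *\<^sub>v x = - (A *\<^sub>v x)" if "dim_vec x = dim_col A" for x
    using that by (intro eq_vecI) (auto simp: scalar_prod_def sum_negf)
  then have "vec_norm2 ((- A) *\<^sub>v x) = vec_norm2 (A *\<^sub>v x)" if "x \<in> carrier_vec (dim_col A)" for x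
    using that by simp
  then show ?thesis unfolding spectral_norm_def
    by (intro arg_cong[of _ _ Sup] Collect_cong) (metis index_uminus_mat(3))
qed

text \<open>Free dimensions \<open>p\<close> and \<open>q\<close> stand for \<open>m - r\<close> and
  \<open>n - r\<close>, which keeps subtraction of naturals out of the matrix algebra, and
  \<open>\<delta>\<close> is any lower bound of the gaps.\<close>

lemma perturbation_theorem:
  fixes r p q :: nat
    and G1 G2 E11 E12 E21 E22 :: "complex mat"
    and pnorm :: "complex mat \<Rightarrow> complex mat \<Rightarrow> real"
  assumes pos: "0 < r" "0 < p" "0 < q"
    and Gt: "Gt \<in> carrier_mat (r + p) (r + q)"
    and U: "unitary_mat (r + p) U" and V: "unitary_mat (r + q) V"
    and blocks: "G1 \<in> carrier_mat r r" "G2 \<in> carrier_mat p q" "E11 \<in> carrier_mat r r" "E12 \<in> carrier_mat r q"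
      "E21 \<in> carrier_mat p r" "E22 \<in> carrier_mat p q"
    and Gt_block: "U\<^sup>H * Gt * V = four_block_mat (G1 + E11) E12 E21 (G2 + E22)"
    and \<delta>: "\<And>\<mu> \<nu>. \<mu> \<in># sing_vals G1 \<Longrightarrow> \<nu> \<in># sing_vals_ext G2 \<Longrightarrow> \<delta> \<le> \<bar>\<mu> - \<nu>\<bar>"
    and \<delta>': "\<delta>' = \<delta> - spectral_norm E11 - spectral_norm E22" "0 < \<delta>'"
    and \<epsilon>: "\<epsilon> = max (spectral_norm E12) (spectral_norm E21)"
    and N: "unitarily_invariant_norm N"
    and pnorm_c:
      "(pnorm = (\<lambda>X Y. N (four_block_mat X (0\<^sub>m p r) (0\<^sub>m q r) Y)) \<and>
        c = (if sing_val_min G1 > sing_val_max G2 \<or> N = frobenius_norm then 1 else pi / 2)) \<or>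
       (pnorm = (\<lambda>X Y. max (N X) (N Y)) \<and>
        c = (if sing_val_min G1 > sing_val_max G2 then 1 else pi))"
    and \<kappa>: "\<kappa> = c\<^sup>2 * \<epsilon> / \<delta>'\<^sup>2 * pnorm E21 (E12\<^sup>H)"
    and \<kappa>_less: "\<kappa> < 1 / 4"
  shows "\<exists>\<Gamma> \<Omega>.
    \<Gamma> \<in> carrier_mat p r \<and> \<Omega> \<in> carrier_mat q r \<and>
    \<Gamma> * (G1 + E11) - (G2 + E22) * \<Omega> = E21 - \<Gamma> * E12 * \<Omega> \<and>
    \<Omega> * (G1 + E11)\<^sup>H - (G2 + E22)\<^sup>H * \<Gamma> = E12\<^sup>H - \<Omega> * E21\<^sup>H * \<Gamma> \<and>
    pnorm \<Gamma> \<Omega> \<le> (1 + sqrt (1 - 4 * \<kappa>)) / (1 - 2 * \<kappa> + sqrt (1 - 4 * \<kappa>))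
                   * (c * pnorm E21 (E12\<^sup>H) / \<delta>') \<and>
    (E12 \<noteq> 0\<^sub>m r q \<or> E21 \<noteq> 0\<^sub>m p r \<longrightarrow>
      (1 + sqrt (1 - 4 * \<kappa>)) / (1 - 2 * \<kappa> + sqrt (1 - 4 * \<kappa>))
          * (c * pnorm E21 (E12\<^sup>H) / \<delta>')
        < 2 * (c * pnorm E21 (E12\<^sup>H) / \<delta>')) \<and>
    (let P = 1\<^sub>m r + \<Gamma>\<^sup>H * \<Gamma>;
         P' = 1\<^sub>m p + \<Gamma> * \<Gamma>\<^sup>H;
         Q = 1\<^sub>m r + \<Omega>\<^sup>H * \<Omega>;
         Q' = 1\<^sub>m q + \<Omega> * \<Omega>\<^sup>H;
         Uc = U * four_block_mat (1\<^sub>m r) (- (\<Gamma>\<^sup>H)) \<Gamma> (1\<^sub>m p)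
                * four_block_mat (mat_inv_sqrt P) (0\<^sub>m r p) (0\<^sub>m p r) (mat_inv_sqrt P');
         Vc = V * four_block_mat (1\<^sub>m r) (- (\<Omega>\<^sup>H)) \<Omega> (1\<^sub>m q)
                * four_block_mat (mat_inv_sqrt Q) (0\<^sub>m r q) (0\<^sub>m q r) (mat_inv_sqrt Q');
         Uc1 = left_cols r Uc; Uc2 = right_cols r Uc;
         Vc1 = left_cols r Vc; Vc2 = right_cols r Vc;
         Gc1 = Uc1\<^sup>H * Gt * Vc1;
         Gc2 = Uc2\<^sup>H * Gt * Vc2
     in unitary_mat (r + p) Uc \<and> unitary_mat (r + q) Vc \<and>
        Uc\<^sup>H * Gt * Vc = four_block_mat Gc1 (0\<^sub>m r q) (0\<^sub>m p r) Gc2 \<and>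
        sing_vals Gt = sing_vals Gc1 + sing_vals Gc2 \<and>
        Gc1 = mat_sqrt P * (G1 + E11 + E12 * \<Omega>) * mat_inv_sqrt Q \<and>
        Gc1 = mat_inv_sqrt P * (G1 + E11 + \<Gamma>\<^sup>H * E21) * mat_sqrt Q \<and>
        Gc2 = mat_sqrt P' * (G2 + E22 - E21 * \<Omega>\<^sup>H) * mat_inv_sqrt Q' \<and>
        Gc2 = mat_inv_sqrt P' * (G2 + E22 - \<Gamma> * E12) * mat_sqrt Q' \<and>
        sing_val_min Gc1 \<ge> sing_val_min G1 - spectral_norm E11
          - 2 * c * (\<epsilon> * pnorm E21 (E12\<^sup>H) / \<delta>') \<and>
        sing_val_max Gc2 \<le> sing_val_max G2 + spectral_norm E22
          + 2 * c * (\<epsilon> * pnorm E21 (E12\<^sup>H) / \<delta>') \<and>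
        singular_subspaces r Gt Gc1 Uc1 Vc1 \<and>
        Uc1 = (left_cols r U + right_cols r U * \<Gamma>) * mat_inv_sqrt P \<and>
        Vc1 = (left_cols r V + right_cols r V * \<Omega>) * mat_inv_sqrt Q \<and>
        N (Uc1 - left_cols r U) \<le> N \<Gamma> \<and> N \<Gamma> \<le> pnorm \<Gamma> \<Omega> \<and>
        N (Vc1 - left_cols r V) \<le> N \<Omega> \<and> N \<Omega> \<le> pnorm \<Gamma> \<Omega> \<and>
        pnorm \<Gamma> \<Omega> \<le> 2 * (c * pnorm E21 (E12\<^sup>H) / \<delta>'))"
proof -
  let ?A1 = "G1 + E11" and ?A2 = "G2 + E22"
  have A: "?A1 \<in> carrier_mat r r" "?A2 \<in> carrier_mat p q" using blocks by auto
  note d = carrier_matD[OF blocks(1)] carrier_matD[OF blocks(2)] carrier_matD[OF blocks(3)] carrier_matD[OF blocks(4)]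
    carrier_matD[OF blocks(5)] carrier_matD[OF blocks(6)]
  have EH: "E12\<^sup>H \<in> carrier_mat q r" "E21\<^sup>H \<in> carrier_mat r p" using blocks by auto
  have c: "0 < c" using pnorm_c pi_gt_zero by (elim disjE conjE) (simp_all split: if_splits)
  have pn: "pair_norm N p q r pnorm" using pnorm_c pair_norm_diag[OF N] pair_norm_max[OF N] by auto
  have \<epsilon>0: "0 \<le> \<epsilon>" and \<epsilon>12: "spectral_norm E12 \<le> \<epsilon>" and \<epsilon>21: "spectral_norm E21 \<le> \<epsilon>"
    unfolding \<epsilon> by (auto intro: max.coboundedI1)
  have quad: "pnorm (X * E12 * Y') (Y * E21\<^sup>H * X') \<le> \<epsilon> * pnorm X Y * pnorm X' Y'"
    if "X \<in> carrier_mat p r" "Y \<in> carrier_mat q r" "X' \<in> carrier_mat p r" "Y' \<in> carrier_mat q r" for X Y X' Y'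
  proof -
    have "spectral_norm (E21\<^sup>H) \<le> \<epsilon>" using \<epsilon>21 by simp
    then show ?thesis
      using pnorm_c quad_bound_diag[OF N blocks(4) \<epsilon>12 EH(2) _ that] quad_bound_max[OF N blocks(4) \<epsilon>12 EH(2) _ that] by auto
  qed
  obtain Pa a where Pa: "unitary_mat (r + r) Pa" "dilation ?A1 = Pa * diag_of (r + r) (\<lambda>i. complex_of_real (a i)) * Pa\<^sup>H"
    using hermitian_spectral[OF dilation_carrier[OF A(1)] dilation_hermitian] by blast
  obtain Qb b where Qb: "unitary_mat (p + q) Qb" "dilation ?A2 = Qb * diag_of (p + q) (\<lambda>i. complex_of_real (b i)) * Qb\<^sup>H"
    using hermitian_spectral[OF dilation_carrier[OF A(2)] dilation_hermitian] by blast
  have gap: "a j \<noteq> b i" if "i < p + q" "j < r + r" for i j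
    using dilation_gap[OF blocks(1,3,2,6) \<delta> Pa Qb that] \<delta>' by auto
  define g where "g = pnorm E21 (E12\<^sup>H)"
  define \<tau> where "\<tau> = \<delta>' / c"
  have \<tau>: "0 < \<tau>" using c \<delta>' by (simp add: \<tau>_def)
  \<comment> \<open>With \<open>\<tau>\<close> as the lower bound of the linear part, the smallness
    condition of the iteration is precisely \<open>\<kappa> < 1 / 4\<close>.\<close>
  have \<kappa>': "\<epsilon> * pnorm E21 (E12\<^sup>H) / \<tau>\<^sup>2 = \<kappa>" unfolding \<kappa> \<tau>_def using c by (simp add: power_divide)
  define s where "s = sqrt (1 - 4 * \<kappa>)"
  have g0: "0 \<le> g" unfolding g_def using pair_normD(2)[OF pn blocks(5) EH(1)] ui_norm_nonneg[OF N, of E21] by linarith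
  have s: "0 < s" using \<kappa>_less by (simp add: s_def)
  have ex: "\<exists>\<Gamma> \<Omega>. \<Gamma> \<in> carrier_mat p r \<and> \<Omega> \<in> carrier_mat q r \<and> \<Gamma> * ?A1 - ?A2 * \<Omega> = C \<and> \<Omega> * ?A1\<^sup>H - ?A2\<^sup>H * \<Gamma> = D"
    if "C \<in> carrier_mat p r" "D \<in> carrier_mat q r" for C D
    by (rule sylvester_exists[OF A Pa Qb gap that])
  have bound: "\<tau> * pnorm \<Gamma> \<Omega> \<le> pnorm (\<Gamma> * ?A1 - ?A2 * \<Omega>) (\<Omega> * ?A1\<^sup>H - ?A2\<^sup>H * \<Gamma>)"
    if "\<Gamma> \<in> carrier_mat p r" "\<Omega> \<in> carrier_mat q r" for \<Gamma> \<Omega>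
    unfolding \<tau>_def by (rule sylvester_pair_bound[OF N blocks(1,3,2,6) pos \<delta> \<delta>' pnorm_c that])
  obtain \<Gamma> \<Omega> where sol: "\<Gamma> \<in> carrier_mat p r" "\<Omega> \<in> carrier_mat q r"
    "\<Gamma> * ?A1 - ?A2 * \<Omega> = E21 - \<Gamma> * E12 * \<Omega>" "\<Omega> * ?A1\<^sup>H - ?A2\<^sup>H * \<Gamma> = E12\<^sup>H - \<Omega> * E21\<^sup>H * \<Gamma>"
    and le: "pnorm \<Gamma> \<Omega> \<le> 2 * pnorm E21 (E12\<^sup>H) / (\<tau> * (1 + sqrt (1 - 4 * (\<epsilon> * pnorm E21 (E12\<^sup>H) / \<tau>\<^sup>2))))"
    using quadratic_sylvester_solution[OF N pn A blocks(4) EH(2) blocks(5) EH(1) ex bound quad \<tau> \<epsilon>0] \<kappa>_less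
    unfolding \<kappa>' by blast
  \<comment> \<open>\<open>s\<^sup>2 = 1 - 4 * \<kappa>\<close> turns
    \<open>1 - 2 * \<kappa> + s\<close> into \<open>(1 + s)\<^sup>2 / 2\<close>: the stated factor
    is that of the smaller root in \<open>quadratic_radius\<close>.\<close>
  have factor: "(1 + s) / (1 - 2 * \<kappa> + s) = 2 / (1 + s)"
  proof -
    have "s\<^sup>2 = 1 - 4 * \<kappa>" using \<kappa>_less by (simp add: s_def)
    then have e: "1 - 2 * \<kappa> + s = (1 + s) * (1 + s) / 2" by (simp add: power2_eq_square algebra_simps)
    show ?thesis unfolding e using s by (simp add: divide_simps)
  qed
  have f1: "pnorm \<Gamma> \<Omega> \<le> (1 + sqrt (1 - 4 * \<kappa>)) / (1 - 2 * \<kappa> + sqrt (1 - 4 * \<kappa>)) * (c * pnorm E21 (E12\<^sup>H) / \<delta>')"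
  proof -
    have "2 * g / (\<tau> * (1 + s)) = 2 / (1 + s) * (c * g / \<delta>')" by (simp add: \<tau>_def mult_ac)
    then show ?thesis using le unfolding \<kappa>' unfolding s_def[symmetric] g_def[symmetric] factor by simp
  qed
  \<comment> \<open>If both off-diagonal blocks vanish, the two sides are zero and strictness fails.
    Otherwise \<open>g > 0\<close>, and \<open>s > 0\<close> gives
    \<open>2 / (1 + s) < 2\<close>.\<close>
  have f2: "E12 \<noteq> 0\<^sub>m r q \<or> E21 \<noteq> 0\<^sub>m p r \<longrightarrow>
      (1 + sqrt (1 - 4 * \<kappa>)) / (1 - 2 * \<kappa> + sqrt (1 - 4 * \<kappa>)) * (c * pnorm E21 (E12\<^sup>H) / \<delta>')
        < 2 * (c * pnorm E21 (E12\<^sup>H) / \<delta>')"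
    unfolding s_def[symmetric] g_def[symmetric] factor
  proof
    assume ne: "E12 \<noteq> 0\<^sub>m r q \<or> E21 \<noteq> 0\<^sub>m p r"
    have "g \<noteq> 0"
    proof
      assume "g = 0"
      then have "N E21 \<le> 0" "N (E12\<^sup>H) \<le> 0"
        using pair_normD(2,3)[OF pn blocks(5) EH(1)] by (simp_all add: g_def)
      then have "N E21 = 0" "N (E12\<^sup>H) = 0" using ui_norm_nonneg[OF N] by (auto intro: antisym)
      then have z: "E21 = 0\<^sub>m p r" "E12\<^sup>H = 0\<^sub>m q r" using ui_norm_eq_0[OF N] d by auto
      have "E12 = 0\<^sub>m r q" using arg_cong[OF z(2), of mat_adjoint] by simp
      with z(1) ne show False by simp
    qed
    then have "0 < c * g / \<delta>'" using g0 c \<delta>'(2) by simp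
    moreover have "2 / (1 + s) < 2" using s by (simp add: divide_less_eq)
    ultimately show "2 / (1 + s) * (c * g / \<delta>') < 2 * (c * g / \<delta>')" by (rule mult_strict_right_mono[rotated])
  qed
  have f3: "pnorm \<Gamma> \<Omega> \<le> 2 * (c * pnorm E21 (E12\<^sup>H) / \<delta>')"
  proof -
    have "2 / (1 + s) * (c * g / \<delta>') \<le> 2 * (c * g / \<delta>')"
      using s g0 c \<delta>'(2) by (intro mult_right_mono) (auto simp: divide_le_eq)
    then show ?thesis using f1 unfolding s_def[symmetric] g_def[symmetric] factor by linarith
  qed
  have n\<Gamma>: "N \<Gamma> \<le> pnorm \<Gamma> \<Omega>" and n\<Omega>: "N \<Omega> \<le> pnorm \<Gamma> \<Omega>" using pair_normD(2,3)[OF pn sol(1,2)] by auto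
  let ?P = "1\<^sub>m r + \<Gamma>\<^sup>H * \<Gamma>" and ?P' = "1\<^sub>m p + \<Gamma> * \<Gamma>\<^sup>H" and ?Q = "1\<^sub>m r + \<Omega>\<^sup>H * \<Omega>" and ?Q' = "1\<^sub>m q + \<Omega> * \<Omega>\<^sup>H"
  note uf = graph_frame_cols[OF N U sol(1)] and vf = graph_frame_cols[OF N V sol(2)]
  note gd = graph_decomposition[OF U V Gt A(1) blocks(4,5) A(2) Gt_block sol uf(1) vf(1) uf(4) vf(4)]
  let ?Uc = "U * four_block_mat (1\<^sub>m r) (- (\<Gamma>\<^sup>H)) \<Gamma> (1\<^sub>m p)
                * four_block_mat (mat_inv_sqrt ?P) (0\<^sub>m r p) (0\<^sub>m p r) (mat_inv_sqrt ?P')"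
  let ?Vc = "V * four_block_mat (1\<^sub>m r) (- (\<Omega>\<^sup>H)) \<Omega> (1\<^sub>m q)
                * four_block_mat (mat_inv_sqrt ?Q) (0\<^sub>m r q) (0\<^sub>m q r) (mat_inv_sqrt ?Q')"
  let ?Gc1 = "(left_cols r ?Uc)\<^sup>H * Gt * left_cols r ?Vc" and ?Gc2 = "(right_cols r ?Uc)\<^sup>H * Gt * right_cols r ?Vc"
  note dG = carrier_matD[OF sol(1)] carrier_matD[OF sol(2)]
  have psd: "psd_mat r (\<Gamma>\<^sup>H * \<Gamma>)" "psd_mat p (\<Gamma> * \<Gamma>\<^sup>H)" "psd_mat r (\<Omega>\<^sup>H * \<Omega>)" "psd_mat q (\<Omega> * \<Omega>\<^sup>H)"
    using psd_gram[of \<Gamma>] psd_gram'[of \<Gamma>] psd_gram[of \<Omega>] psd_gram'[of \<Omega>] dG by simp_all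
  note sP = sqrt_one_plus_props[OF psd(1)] and sP' = sqrt_one_plus_props[OF psd(2)]
    and sQ = sqrt_one_plus_props[OF psd(3)] and sQ' = sqrt_one_plus_props[OF psd(4)]
  note cs = psd_carrier[OF sP(1)] psd_carrier[OF sP(2)] psd_adjoint[OF sP(1)] psd_adjoint[OF sP(2)] sP(4,5)
  note cs' = psd_carrier[OF sP'(1)] psd_carrier[OF sP'(2)] psd_adjoint[OF sP'(1)] psd_adjoint[OF sP'(2)] sP'(4,5)
  note ct = psd_carrier[OF sQ(2)] psd_carrier[OF sQ(1)] psd_adjoint[OF sQ(2)] psd_adjoint[OF sQ(1)] sQ(5,4)
  note ct' = psd_carrier[OF sQ'(2)] psd_carrier[OF sQ'(1)] psd_adjoint[OF sQ'(2)] psd_adjoint[OF sQ'(1)] sQ'(5,4)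
  \<comment> \<open>The loss in both singular value bounds: products such as
    \<open>E12 * \<Omega>\<close> have spectral norm at most
    \<open>\<epsilon> * pnorm \<Gamma> \<Omega>\<close>, and the factor 2 is that of the cruder
    bound on the solution.\<close>
  define \<rho> where "\<rho> = 2 * c * (\<epsilon> * pnorm E21 (E12\<^sup>H) / \<delta>')"
  have \<rho>: "\<epsilon> * pnorm \<Gamma> \<Omega> \<le> \<rho>" using mult_left_mono[OF f3 \<epsilon>0] by (simp add: \<rho>_def mult_ac)
  have small: "spectral_norm (X * Y) \<le> \<rho>"
    if "dim_col X = dim_row Y" "spectral_norm X \<le> x" "spectral_norm Y \<le> y" "x * y = \<epsilon> * pnorm \<Gamma> \<Omega>" for X Y x y
  proof -
    have "spectral_norm (X * Y) \<le> spectral_norm X * spectral_norm Y" by (rule spectral_norm_mm[OF that(1)])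
    also have "\<dots> \<le> x * y" using that spectral_norm_nonneg[of X] by (intro mult_mono) (auto intro: order_trans[OF spectral_norm_nonneg])
    finally show ?thesis using that(4) \<rho> by simp
  qed
  have sn: "spectral_norm \<Gamma> \<le> pnorm \<Gamma> \<Omega>" "spectral_norm \<Omega> \<le> pnorm \<Gamma> \<Omega>"
    using n\<Gamma> n\<Omega> spectral_norm_le_ui_norm[OF N, of \<Gamma>] spectral_norm_le_ui_norm[OF N, of \<Omega>] by linarith+
  have sm: "spectral_norm (E12 * \<Omega>) \<le> \<rho>" "spectral_norm (\<Gamma>\<^sup>H * E21) \<le> \<rho>" "spectral_norm (E21 * \<Omega>\<^sup>H) \<le> \<rho>" "spectral_norm (\<Gamma> * E12) \<le> \<rho>"
    by (rule small[OF _ \<epsilon>12 sn(2)] small[OF _ _ \<epsilon>21, of _ "pnorm \<Gamma> \<Omega>"] small[OF _ \<epsilon>21, of _ "pnorm \<Gamma> \<Omega>"] small[OF _ sn(1) \<epsilon>12];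
        use d dG sn in \<open>simp add: mult.commute\<close>)+
  have cM: "?A1 + E12 * \<Omega> \<in> carrier_mat r r" "?A1 + \<Gamma>\<^sup>H * E21 \<in> carrier_mat r r"
    "?A2 - E21 * \<Omega>\<^sup>H \<in> carrier_mat p q" "?A2 - \<Gamma> * E12 \<in> carrier_mat p q"
    using d dG by (auto intro!: carrier_matI)
  have L: "left_cols r ?Uc = ?Uc * incl_left r p" "right_cols r ?Uc = ?Uc * incl_right r p"
    "left_cols r ?Vc = ?Vc * incl_left r q" "right_cols r ?Vc = ?Vc * incl_right r q"
    using left_cols_eq[OF unitary_matD(5)[OF uf(1)]] left_cols_eq[OF unitary_matD(5)[OF vf(1)]] by auto
  have cG: "?Gc1 \<in> carrier_mat r r" "?Gc2 \<in> carrier_mat p q" unfolding L by (auto intro!: carrier_matI)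
  have lower: "(sing_val_min G1 - spectral_norm E11 - \<rho>) * vec_norm2 x \<le> vec_norm2 ((?A1 + F) *\<^sub>v x)"
    "(sing_val_min G1 - spectral_norm E11 - \<rho>) * vec_norm2 x \<le> vec_norm2 ((?A1 + F)\<^sup>H *\<^sub>v x)"
    if F: "F \<in> carrier_mat r r" "spectral_norm F \<le> \<rho>" and x: "dim_vec x = r" for F x
  proof -
    have as: "?A1 + F = G1 + (E11 + F)" using blocks F by (intro assoc_add_mat) auto
    have cF: "E11 + F \<in> carrier_mat r r" using blocks F by auto
    have "spectral_norm (E11 + F) \<le> spectral_norm E11 + \<rho>"
      using spectral_norm_add[of E11 F] F d by simp
    then have "(sing_val_min G1 - spectral_norm E11 - \<rho>) * vec_norm2 x \<le> (sing_val_min G1 - spectral_norm (E11 + F)) * vec_norm2 x"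
      by (intro mult_right_mono) auto
    then show "(sing_val_min G1 - spectral_norm E11 - \<rho>) * vec_norm2 x \<le> vec_norm2 ((?A1 + F) *\<^sub>v x)"
      "(sing_val_min G1 - spectral_norm E11 - \<rho>) * vec_norm2 x \<le> vec_norm2 ((?A1 + F)\<^sup>H *\<^sub>v x)"
      unfolding as using sing_val_min_perturb[OF blocks(1) cF pos(1) x] by linarith+
  qed
  have cF: "E12 * \<Omega> \<in> carrier_mat r r" "\<Gamma>\<^sup>H * E21 \<in> carrier_mat r r" using d dG by (auto intro!: carrier_matI)
  have rne: "r \<noteq> 0" "p \<noteq> 0" "q \<noteq> 0" using pos by auto
  \<comment> \<open>The two formulas for \<open>?Gc1\<close> are the required factorizations with
    mutually inverse square roots; each inner matrix is \<open>G1\<close> perturbed by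
    \<open>E11\<close> and one small product.\<close>
  have minb: "sing_val_min ?Gc1 \<ge> sing_val_min G1 - spectral_norm E11 - \<rho>"
    by (rule sing_val_min_similar[OF cG(1) rne(1) cs ct cM(1,2) gd(3,4)
          lower(1)[OF cF(1) sm(1)] lower(2)[OF cF(2) sm(2)]])
  have upper: "spectral_norm (?A2 - F) \<le> sing_val_max G2 + spectral_norm E22 + \<rho>"
    if F: "F \<in> carrier_mat p q" "spectral_norm F \<le> \<rho>" for F
  proof -
    have "?A2 - F = ?A2 + - F" using blocks F by (intro eq_matI) auto
    then have "spectral_norm (?A2 - F) \<le> spectral_norm ?A2 + spectral_norm F"
      using spectral_norm_add[of ?A2 "- F"] F d by simp
    also have "spectral_norm ?A2 \<le> spectral_norm G2 + spectral_norm E22" using d by (intro spectral_norm_add) auto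
    also have "spectral_norm G2 \<le> sing_val_max G2" using d pos by (intro spectral_norm_le_sing_val_max) auto
    finally show ?thesis using F(2) by linarith
  qed
  have cF2: "E21 * \<Omega>\<^sup>H \<in> carrier_mat p q" "\<Gamma> * E12 \<in> carrier_mat p q" using d dG by (auto intro!: carrier_matI)
  have maxb: "sing_val_max ?Gc2 \<le> sing_val_max G2 + spectral_norm E22 + \<rho>"
    by (rule sing_val_max_similar[OF cG(2) rne(2,3) cs' ct' cM(3,4) gd(5,6)
          upper[OF cF2(1) sm(3)] upper[OF cF2(2) sm(4)]])
  show ?thesis
    unfolding Let_def \<rho>_def[symmetric]
    by (intro exI[of _ \<Gamma>] exI[of _ \<Omega>] conjI; fact)
qed

text \<open>The strict estimate carries the condition that \<open>E12\<close> or \<open>E21\<close>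
  is nonzero, since otherwise both of its sides are 0. The minimum \<open>\<delta>\<close> is taken
  over a finite set of differences and is therefore a lower bound in the sense of
  \<open>perturbation_theorem\<close>.\<close>

theorem theorem3p1:
  fixes m n r :: nat
    and G E Gt U V U1 U2 V1 V2 G1 G2 E11 E12 E21 E22 :: "complex mat"
    and N :: "complex mat \<Rightarrow> real"
    and pnorm :: "complex mat \<Rightarrow> complex mat \<Rightarrow> real"
    and c \<delta> \<delta>' \<epsilon> \<kappa> :: real
  assumes r: "1 \<le> r" "r < min m n"
    and G: "G \<in> carrier_mat m n" and E: "E \<in> carrier_mat m n" and Gt: "Gt = G + E"
    and U: "unitary_mat m U" "U1 = left_cols r U" "U2 = right_cols r U"
    and V: "unitary_mat n V" "V1 = left_cols r V" "V2 = right_cols r V"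
    and blocks:
      "G1 \<in> carrier_mat r r" "G2 \<in> carrier_mat (m - r) (n - r)"
      "E11 \<in> carrier_mat r r" "E12 \<in> carrier_mat r (n - r)"
      "E21 \<in> carrier_mat (m - r) r" "E22 \<in> carrier_mat (m - r) (n - r)"
    and G_block: "U\<^sup>H * G * V = four_block_mat G1 (0\<^sub>m r (n - r)) (0\<^sub>m (m - r) r) G2"
    and Gt_block: "U\<^sup>H * Gt * V = four_block_mat (G1 + E11) E12 E21 (G2 + E22)"
    and \<delta>: "\<delta> = Min {\<bar>\<mu> - \<nu>\<bar> | \<mu> \<nu>. \<mu> \<in># sing_vals G1 \<and> \<nu> \<in># sing_vals_ext G2}"
    and \<delta>': "\<delta>' = \<delta> - spectral_norm E11 - spectral_norm E22"
    and \<epsilon>: "\<epsilon> = max (spectral_norm E12) (spectral_norm E21)"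
    and N: "unitarily_invariant_norm N"
    and pnorm_c:
      "(pnorm = (\<lambda>X Y. N (four_block_mat X (0\<^sub>m (m - r) r) (0\<^sub>m (n - r) r) Y)) \<and>
        c = (if sing_val_min G1 > sing_val_max G2 \<or> N = frobenius_norm then 1 else pi / 2)) \<or>
       (pnorm = (\<lambda>X Y. max (N X) (N Y)) \<and>
        c = (if sing_val_min G1 > sing_val_max G2 then 1 else pi))"
    and \<delta>'_pos: "\<delta>' > 0"
    and \<kappa>: "\<kappa> = c\<^sup>2 * \<epsilon> / \<delta>'\<^sup>2 * pnorm E21 (E12\<^sup>H)"
    and \<kappa>_less: "\<kappa> < 1 / 4"
  shows "\<exists>\<Gamma> \<Omega>.
    \<Gamma> \<in> carrier_mat (m - r) r \<and> \<Omega> \<in> carrier_mat (n - r) r \<and>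
    \<Gamma> * (G1 + E11) - (G2 + E22) * \<Omega> = E21 - \<Gamma> * E12 * \<Omega> \<and>
    \<Omega> * (G1 + E11)\<^sup>H - (G2 + E22)\<^sup>H * \<Gamma> = E12\<^sup>H - \<Omega> * E21\<^sup>H * \<Gamma> \<and>
    pnorm \<Gamma> \<Omega> \<le> (1 + sqrt (1 - 4 * \<kappa>)) / (1 - 2 * \<kappa> + sqrt (1 - 4 * \<kappa>))
                   * (c * pnorm E21 (E12\<^sup>H) / \<delta>') \<and>
    (E12 \<noteq> 0\<^sub>m r (n - r) \<or> E21 \<noteq> 0\<^sub>m (m - r) r \<longrightarrow>
      (1 + sqrt (1 - 4 * \<kappa>)) / (1 - 2 * \<kappa> + sqrt (1 - 4 * \<kappa>))
          * (c * pnorm E21 (E12\<^sup>H) / \<delta>')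
        < 2 * (c * pnorm E21 (E12\<^sup>H) / \<delta>')) \<and>
    (let P = 1\<^sub>m r + \<Gamma>\<^sup>H * \<Gamma>;
         P' = 1\<^sub>m (m - r) + \<Gamma> * \<Gamma>\<^sup>H;
         Q = 1\<^sub>m r + \<Omega>\<^sup>H * \<Omega>;
         Q' = 1\<^sub>m (n - r) + \<Omega> * \<Omega>\<^sup>H;
         Uc = U * four_block_mat (1\<^sub>m r) (- (\<Gamma>\<^sup>H)) \<Gamma> (1\<^sub>m (m - r))
                * four_block_mat (mat_inv_sqrt P) (0\<^sub>m r (m - r)) (0\<^sub>m (m - r) r) (mat_inv_sqrt P');
         Vc = V * four_block_mat (1\<^sub>m r) (- (\<Omega>\<^sup>H)) \<Omega> (1\<^sub>m (n - r))
                * four_block_mat (mat_inv_sqrt Q) (0\<^sub>m r (n - r)) (0\<^sub>m (n - r) r) (mat_inv_sqrt Q');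
         Uc1 = left_cols r Uc; Uc2 = right_cols r Uc;
         Vc1 = left_cols r Vc; Vc2 = right_cols r Vc;
         Gc1 = Uc1\<^sup>H * Gt * Vc1;
         Gc2 = Uc2\<^sup>H * Gt * Vc2
     in unitary_mat m Uc \<and> unitary_mat n Vc \<and>
        Uc\<^sup>H * Gt * Vc = four_block_mat Gc1 (0\<^sub>m r (n - r)) (0\<^sub>m (m - r) r) Gc2 \<and>
        sing_vals Gt = sing_vals Gc1 + sing_vals Gc2 \<and>
        Gc1 = mat_sqrt P * (G1 + E11 + E12 * \<Omega>) * mat_inv_sqrt Q \<and>
        Gc1 = mat_inv_sqrt P * (G1 + E11 + \<Gamma>\<^sup>H * E21) * mat_sqrt Q \<and>
        Gc2 = mat_sqrt P' * (G2 + E22 - E21 * \<Omega>\<^sup>H) * mat_inv_sqrt Q' \<and>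
        Gc2 = mat_inv_sqrt P' * (G2 + E22 - \<Gamma> * E12) * mat_sqrt Q' \<and>
        sing_val_min Gc1 \<ge> sing_val_min G1 - spectral_norm E11
          - 2 * c * (\<epsilon> * pnorm E21 (E12\<^sup>H) / \<delta>') \<and>
        sing_val_max Gc2 \<le> sing_val_max G2 + spectral_norm E22
          + 2 * c * (\<epsilon> * pnorm E21 (E12\<^sup>H) / \<delta>') \<and>
        singular_subspaces r Gt Gc1 Uc1 Vc1 \<and>
        Uc1 = (U1 + U2 * \<Gamma>) * mat_inv_sqrt P \<and>
        Vc1 = (V1 + V2 * \<Omega>) * mat_inv_sqrt Q \<and>
        N (Uc1 - U1) \<le> N \<Gamma> \<and> N \<Gamma> \<le> pnorm \<Gamma> \<Omega> \<and>
        N (Vc1 - V1) \<le> N \<Omega> \<and> N \<Omega> \<le> pnorm \<Gamma> \<Omega> \<and>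
        pnorm \<Gamma> \<Omega> \<le> 2 * (c * pnorm E21 (E12\<^sup>H) / \<delta>'))"
proof -
  have e: "r + (m - r) = m" "r + (n - r) = n" using r by auto
  have Gt': "Gt \<in> carrier_mat (r + (m - r)) (r + (n - r))" unfolding e Gt using G E by simp
  have gap: "\<delta> \<le> \<bar>\<mu> - \<nu>\<bar>" if "\<mu> \<in># sing_vals G1" "\<nu> \<in># sing_vals_ext G2" for \<mu> \<nu>
  proof -
    have "{\<bar>\<mu> - \<nu>\<bar> | \<mu> \<nu>. \<mu> \<in># sing_vals G1 \<and> \<nu> \<in># sing_vals_ext G2}
      = (\<lambda>(\<mu>, \<nu>). \<bar>\<mu> - \<nu>\<bar>) ` (set_mset (sing_vals G1) \<times> set_mset (sing_vals_ext G2))" by auto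
    then have "finite {\<bar>\<mu> - \<nu>\<bar> | \<mu> \<nu>. \<mu> \<in># sing_vals G1 \<and> \<nu> \<in># sing_vals_ext G2}" by simp
    then show ?thesis unfolding \<delta> by (rule Min_le) (use that in blast)
  qed
  have U': "unitary_mat (r + (m - r)) U" and V': "unitary_mat (r + (n - r)) V" using U(1) V(1) by (simp_all only: e)
  have pos: "0 < r" "0 < m - r" "0 < n - r" using r by auto
  show ?thesis
    using perturbation_theorem[OF pos Gt' U' V' blocks Gt_block gap \<delta>' \<delta>'_pos \<epsilon> N pnorm_c \<kappa> \<kappa>_less]
    unfolding e U(2,3) V(2,3) .
qed

end
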